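(* Let $m\in\mathbb{N}$. Assume that (i) $f_o\in W^{m,\infty}(0,1)$; (ii) $X_1,X_2,\ldots,X_n$ are independent and identically distributed with a probability density function $w$ with respect to Lebesgue measure on $(0,1)$; (iii) there are positive constants $w_1,w_2$ with $w_1\le w(t)\le w_2$ for all $t\in[0,1]$; (iv) with $D=Y-f_o(X)$, $\sup_{x\in[0,1]}\mathbb{E}[\,|D|^{\kappa}\mid X=x\,]<\infty$ for some $\kappa>2$. Let $2<\lambda<\min(\kappa,4)$. Then for every $\gamma>0$ the smoothing spline estimator $f^{nh}$ of order $m$ satisfies, almost surely, $$\limsup_{n\to\infty}\ \sup_{h\in\mathcal{G}_n(\gamma)}\ \frac{\|f^{nh}-f_o\|_\infty}{\sqrt{h^{2m}+(nh)^{-1}\{\log(1/h)\vee\log\log n\}}}<\infty .$$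
   Context: $(X_1,Y_1),(X_2,Y_2),\ldots$ is a random sample (i.i.d. copies) of the bivariate random variable $(X,Y)$ with $X\in[0,1]$ almost surely; it is assumed that $f_o(x)=\mathbb{E}[Y\mid X=x]$ exists. Sobolev spaces: $W^{m,p}(0,1)=\{f\in C^{m-1}[0,1]: f^{(m-1)}\text{ absolutely continuous},\ f^{(m)}\in L^p(0,1)\}$. The smoothing spline estimator $f^{nh}$ is the minimizer over $f\in W^{m,2}(0,1)$ of $\frac1n\sum_{i=1}^n|f(X_i)-Y_i|^2+h^{2m}\|f^{(m)}\|^2$, where $\|\cdot\|$ is the $L^2(0,1)$ norm; for $n\ge m$ it is almost surely unique. $\|\cdot\|_\infty$ is the $L^\infty(0,1)$ norm, and $a\vee b=\max(a,b)$. For $\gamma>0$, $\mathcal{G}_n(\gamma)=\big[\gamma\,(n^{-1}\log n)^{1-2/\lambda},\ \tfrac12\big]$, where $\lambda$ is any fixed number with $2<\lambda<\min(\kappa,4)$. *)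

theory Defs
  imports "HOL-Probability.Probability"
begin

definition abs_cont_on :: "real \<Rightarrow> real \<Rightarrow> (real \<Rightarrow> real) \<Rightarrow> bool" where
  "abs_cont_on a b f \<longleftrightarrow>
     (\<forall>\<epsilon>>0. \<exists>\<delta>>0. \<forall>(N::nat) u v.
        (\<forall>i<N. a \<le> u i \<and> u i \<le> v i \<and> v i \<le> b) \<longrightarrow>
        disjoint_family_on (\<lambda>i. {u i<..<v i}) {..<N} \<longrightarrow>
        (\<Sum>i<N. v i - u i) < \<delta> \<longrightarrow>
        (\<Sum>i<N. \<bar>f (v i) - f (u i)\<bar>) < \<epsilon>)"

text \<open>Derivatives are taken within \<open>[0,1]\<close>, hence one-sided at the endpoints; values of
  functions outside \<open>[0,1]\<close> never matter.  Where the derivative does not exist (a null set, for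
  the last derivative of a Sobolev function) the value is an unspecified constant.\<close>

primrec nderiv :: "nat \<Rightarrow> (real \<Rightarrow> real) \<Rightarrow> real \<Rightarrow> real" where
  "nderiv 0 f = f"
| "nderiv (Suc k) f = (\<lambda>x. vector_derivative (nderiv k f) (at x within {0..1}))"

definition Ck_01 :: "nat \<Rightarrow> (real \<Rightarrow> real) \<Rightarrow> bool" where
  "Ck_01 k f \<longleftrightarrow> (\<forall>j<k. nderiv j f differentiable_on {0..1}) \<and> continuous_on {0..1} (nderiv k f)"

definition Linf_norm :: "(real \<Rightarrow> real) \<Rightarrow> ereal" where
  "Linf_norm g = esssup (lebesgue_on {0<..<1}) (\<lambda>x. ereal \<bar>g x\<bar>)"

definition L2_norm :: "(real \<Rightarrow> real) \<Rightarrow> real" where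
  "L2_norm g = sqrt (\<integral>x. (g x)\<^sup>2 \<partial>(lebesgue_on {0<..<1}))"

definition Lp_01 :: "ereal \<Rightarrow> (real \<Rightarrow> real) \<Rightarrow> bool" where
  "Lp_01 p g \<longleftrightarrow> g \<in> borel_measurable (lebesgue_on {0<..<1}) \<and>
     (if p = \<infinity> then Linf_norm g < \<infinity>
      else integrable (lebesgue_on {0<..<1}) (\<lambda>x. \<bar>g x\<bar> powr real_of_ereal p))"

definition sobolev :: "nat \<Rightarrow> ereal \<Rightarrow> (real \<Rightarrow> real) set" where
  "sobolev m p = {f. Ck_01 (m - 1) f \<and> abs_cont_on 0 1 (nderiv (m - 1) f) \<and> Lp_01 p (nderiv m f)}"

definition spline_objective ::
  "nat \<Rightarrow> nat \<Rightarrow> real \<Rightarrow> (nat \<Rightarrow> real) \<Rightarrow> (nat \<Rightarrow> real) \<Rightarrow> (real \<Rightarrow> real) \<Rightarrow> real" where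
  "spline_objective m n h x y f =
     1 / real n * (\<Sum>i=1..n. \<bar>f (x i) - y i\<bar>\<^sup>2) + h ^ (2 * m) * (L2_norm (nderiv m f))\<^sup>2"

definition is_smoothing_spline ::
  "nat \<Rightarrow> nat \<Rightarrow> real \<Rightarrow> (nat \<Rightarrow> real) \<Rightarrow> (nat \<Rightarrow> real) \<Rightarrow> (real \<Rightarrow> real) \<Rightarrow> bool" where
  "is_smoothing_spline m n h x y f \<longleftrightarrow>
     f \<in> sobolev m 2 \<and>
     (\<forall>g\<in>sobolev m 2. spline_objective m n h x y f \<le> spline_objective m n h x y g)"

definition iid_copies :: "'a measure \<Rightarrow> (nat \<Rightarrow> 'a \<Rightarrow> real \<times> real) \<Rightarrow> ('a \<Rightarrow> real \<times> real) \<Rightarrow> bool" where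
  "iid_copies M Zs Z \<longleftrightarrow>
     prob_space.indep_vars M (\<lambda>_. borel) Zs {1..} \<and>
     Z \<in> borel_measurable M \<and>
     (\<forall>i\<ge>1. distr M borel (Zs i) = distr M borel Z)"

text \<open>\<open>g x = E[Z | X = x]\<close>, i.e. \<open>g\<close> is a Borel version of the factorised conditional expectation.
  Integrability is explicit since the library's conditional expectation is total.\<close>

definition is_cond_exp_given ::
  "'a measure \<Rightarrow> ('a \<Rightarrow> real) \<Rightarrow> ('a \<Rightarrow> real) \<Rightarrow> (real \<Rightarrow> real) \<Rightarrow> bool" where
  "is_cond_exp_given M X Z g \<longleftrightarrow>
     X \<in> borel_measurable M \<and> integrable M Z \<and> g \<in> borel_measurable borel \<and>
     (AE \<omega> in M. real_cond_exp M (vimage_algebra (space M) X borel) Z \<omega> = g (X \<omega>))"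

definition bandwidths :: "real \<Rightarrow> real \<Rightarrow> nat \<Rightarrow> real set" where
  "bandwidths lam \<gamma> n = {\<gamma> * (ln (real n) / real n) powr (1 - 2 / lam) .. 1 / 2}"

end

(* Testing the Euler-Lagrange identity of the spline against f - f_o multiplied by a sech bump of
   width proportional to h around a point t localizes the energy of f - f_o near t.  Because all
   derivatives of sech are bounded by multiples of sech, interpolation inequalities with this weight
   absorb the commutator terms, provided every dyadic cell of length comparable to h contains its
   share of design points.  Hence |f(t) - f_o(t)|^2 is bounded by h^(2m) plus the largest squared
   oscillation, over dyadic cells of length comparable to h, of the partial sums of the noise.

   Uniformity in h is then a statement about countably many dyadic cells: on each cell and for each
   block of sample sizes between powers of two, Doob's inequality for the average of cosh of the
   (truncated) partial sums gives an exponential tail bound.  The level-j exponent 1 + j + log log n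
   makes the exceptional events summable over the 2^j cells of each level and over the blocks, and
   kappa > lambda makes the truncation harmless at all bandwidths in question. *)

theory Submission
  imports Defs
begin

section \<open>Absolutely continuous functions\<close>

text \<open>Summation by parts on a cell lets the noise enter only through its cell total and the
  mean square of its running sums. The truncation level 2^(k rho) for sample sizes near 2^k faces
  two opposed demands. It must eventually exceed all marks, which by kappa moments asks for rho >
  1/kappa; and the truncated marks, scaled for Bernstein's bound, must stay below 1 on every cell of
  length at least n^-(1 - 2/lambda), which asks for rho < 1/lambda. The design is treated by the
  same fluctuation theorem with all marks equal to 1, on cells finer by a fixed factor, which makes
  the difference between sampled and integrated squares small against the energy. Sobolev functions
  are given by absolute continuity and pointwise derivatives; hence the fundamental theorem for
  absolutely continuous functions comes first, and afterwards mainly its integral form is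
  used.\<close>

lemma sum_disjoint_lengths_le:
  fixes u v :: "'i \<Rightarrow> real"
  assumes "finite I" and "\<And>i. i \<in> I \<Longrightarrow> a \<le> u i \<and> u i \<le> v i \<and> v i \<le> b"
    and "disjoint_family_on (\<lambda>i. {u i<..<v i}) I" and "a \<le> b"
  shows "(\<Sum>i\<in>I. v i - u i) \<le> b - a"
proof -
  have "(\<Sum>i\<in>I. v i - u i) = (\<Sum>i\<in>I. measure lborel {u i<..<v i})"
    using assms(2) by (intro sum.cong) auto
  also have "\<dots> = measure lborel (\<Union>i\<in>I. {u i<..<v i})"
    using assms by (intro measure_finite_Union[symmetric]) auto
  also have "\<dots> \<le> measure lborel {a..b}"
  proof (intro measure_mono_fmeasurable)
    show "(\<Union>i\<in>I. {u i<..<v i}) \<subseteq> {a..b}" using assms(2) by fastforce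
    show "(\<Union>i\<in>I. {u i<..<v i}) \<in> sets lborel" using assms(1) by auto
    show "{a..b} \<in> fmeasurable lborel" by (auto intro!: fmeasurableI simp: emeasure_lborel_Icc_eq)
  qed
  finally show ?thesis using assms(4) by simp
qed

lemma abs_cont_onE:
  assumes "abs_cont_on a b F" "\<epsilon> > 0"
  obtains \<delta> where "\<delta> > 0"
    "\<And>(N::nat) u v. \<forall>i<N. a \<le> u i \<and> u i \<le> v i \<and> v i \<le> b \<Longrightarrow>
       disjoint_family_on (\<lambda>i. {u i<..<v i}) {..<N} \<Longrightarrow> (\<Sum>i<N. v i - u i) < \<delta> \<Longrightarrow>
       (\<Sum>i<N. \<bar>F (v i) - F (u i)\<bar>) < \<epsilon>"
proof -
  obtain \<delta> where d: "\<delta> > 0" "\<forall>(N::nat) u v.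
        (\<forall>i<N. a \<le> u i \<and> u i \<le> v i \<and> v i \<le> b) \<longrightarrow>
        disjoint_family_on (\<lambda>i. {u i<..<v i}) {..<N} \<longrightarrow>
        (\<Sum>i<N. v i - u i) < \<delta> \<longrightarrow>
        (\<Sum>i<N. \<bar>F (v i) - F (u i)\<bar>) < \<epsilon>"
    using assms(1)[unfolded abs_cont_on_def, rule_format, OF assms(2)] by (elim exE conjE)
  show ?thesis by (rule that[OF d(1)]) (rule d(2)[rule_format], auto)
qed

text \<open>Absolute continuity is tested below on families indexed by dyadic cells and by pairs
  (interval, subinterval). Enumerating the index set reduces these to the families over
  \<open>{..<N}\<close> of the definition.\<close>

lemma abs_cont_on_finite_family:
  assumes "abs_cont_on a b F" "\<epsilon> > 0"
  shows "\<exists>\<delta>>0. \<forall>(I::'i set) u v. finite I \<longrightarrow> (\<forall>i\<in>I. a \<le> u i \<and> u i \<le> v i \<and> v i \<le> b) \<longrightarrow>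
       disjoint_family_on (\<lambda>i. {u i<..<v i}) I \<longrightarrow> (\<Sum>i\<in>I. v i - u i) < \<delta> \<longrightarrow>
       (\<Sum>i\<in>I. \<bar>F (v i) - F (u i)\<bar>) < \<epsilon>"
proof -
  obtain \<delta> where d: "\<delta> > 0" and
    *: "\<And>(N::nat) u v. \<lbrakk>\<forall>i<N. a \<le> u i \<and> u i \<le> v i \<and> v i \<le> b; 
        disjoint_family_on (\<lambda>i. {u i<..<v i}) {..<N}; (\<Sum>i<N. v i - u i) < \<delta>\<rbrakk> \<Longrightarrow> 
        (\<Sum>i<N. \<bar>F (v i) - F (u i)\<bar>) < \<epsilon>"
    by (rule abs_cont_onE[OF assms]) blast
  show ?thesis
  proof (intro exI[of _ \<delta>] conjI allI impI)
    show "\<delta> > 0" by fact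
    fix I :: "'i set" and u v
    assume I: "finite I" "\<forall>i\<in>I. a \<le> u i \<and> u i \<le> v i \<and> v i \<le> b"
       "disjoint_family_on (\<lambda>i. {u i<..<v i}) I" "(\<Sum>i\<in>I. v i - u i) < \<delta>"
    obtain h where h: "bij_betw h {..<card I} I"
      using ex_bij_betw_nat_finite[OF I(1)] by (auto simp: atLeast0LessThan)
    have s: "(\<Sum>i<card I. g (h i)) = sum g I" for g :: "'i \<Rightarrow> real"
      by (rule sum.reindex_bij_betw[OF h])
    have "(\<Sum>i<card I. \<bar>F ((v \<circ> h) i) - F ((u \<circ> h) i)\<bar>) < \<epsilon>"
    proof (rule *)
      show "\<forall>i<card I. a \<le> (u \<circ> h) i \<and> (u \<circ> h) i \<le> (v \<circ> h) i \<and> (v \<circ> h) i \<le> b"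
        using I(2) h by (auto simp: bij_betw_def)
      show "disjoint_family_on (\<lambda>i. {(u \<circ> h) i<..<(v \<circ> h) i}) {..<card I}"
        using I(3) h unfolding disjoint_family_on_def bij_betw_def inj_on_def o_def
        by (metis imageI)
      show "(\<Sum>i<card I. (v \<circ> h) i - (u \<circ> h) i) < \<delta>"
        using I(4) s[of "\<lambda>i. v i - u i"] by simp
    qed
    then show "(\<Sum>i\<in>I. \<bar>F (v i) - F (u i)\<bar>) < \<epsilon>"
      using s[of "\<lambda>i. \<bar>F (v i) - F (u i)\<bar>"] by simp
  qed
qed

text \<open>The supremum of this set is the total variation of \<open>F\<close>. Families of
  disjoint intervals take the place of partitions because absolute continuity speaks about such
  families; degenerate intervals are allowed, so clipping never leaves the class.\<close>

definition variation_sums :: "(real \<Rightarrow> real) \<Rightarrow> real \<Rightarrow> real \<Rightarrow> real set" where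
  "variation_sums F a b = {s. \<exists>(N::nat) u v. (\<forall>i<N. a \<le> u i \<and> u i \<le> v i \<and> v i \<le> b) \<and>
     disjoint_family_on (\<lambda>i. {u i<..<v i}) {..<N} \<and> s = (\<Sum>i<N. \<bar>F (v i) - F (u i)\<bar>)}"

lemma variation_sumsI:
  fixes N :: nat
  assumes "\<forall>i<N. a \<le> u i \<and> u i \<le> v i \<and> v i \<le> b" "disjoint_family_on (\<lambda>i. {u i<..<v i}) {..<N}"
  shows "(\<Sum>i<N. \<bar>F (v i) - F (u i)\<bar>) \<in> variation_sums F a b"
  unfolding variation_sums_def using assms by (intro CollectI exI[of _ N] exI[of _ u] exI[of _ v] conjI) auto

lemma zero_in_variation_sums: "0 \<in> variation_sums F a b"
  unfolding variation_sums_def by (force intro!: exI[of _ 0] simp: disjoint_family_on_def)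

text \<open>Clipping every interval at \<open>x\<close> from above and from below gives the two
  families. Only an interval straddling \<open>x\<close> is really cut, and there the triangle
  inequality is used; the others degenerate on one side.\<close>

lemma variation_sums_split:
  assumes "s \<in> variation_sums F a b" "a \<le> x" "x \<le> b"
  obtains s1 s2 where "s1 \<in> variation_sums F a x" "s2 \<in> variation_sums F x b" "s \<le> s1 + s2"
proof -
  obtain N :: nat and u v where N: "\<forall>i<N. a \<le> u i \<and> u i \<le> v i \<and> v i \<le> b"
     "disjoint_family_on (\<lambda>i. {u i<..<v i}) {..<N}" "s = (\<Sum>i<N. \<bar>F (v i) - F (u i)\<bar>)"
    using assms(1) unfolding variation_sums_def by auto
  define s1 where "s1 = (\<Sum>i<N. \<bar>F (min (v i) x) - F (min (u i) x)\<bar>)"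
  define s2 where "s2 = (\<Sum>i<N. \<bar>F (max (v i) x) - F (max (u i) x)\<bar>)"
  show ?thesis
  proof
    have sub: "{min (u i) x<..<min (v i) x} \<subseteq> {u i<..<v i}" 
              "{max (u i) x<..<max (v i) x} \<subseteq> {u i<..<v i}" for i by auto
    have "disjoint_family_on (\<lambda>i. {min (u i) x<..<min (v i) x}) {..<N}"
         "disjoint_family_on (\<lambda>i. {max (u i) x<..<max (v i) x}) {..<N}"
      using N(2) sub unfolding disjoint_family_on_def by blast+
    moreover have "\<forall>i<N. a \<le> min (u i) x \<and> min (u i) x \<le> min (v i) x \<and> min (v i) x \<le> x"
      "\<forall>i<N. x \<le> max (u i) x \<and> max (u i) x \<le> max (v i) x \<and> max (v i) x \<le> b"
      using N(1) assms(2,3) by (auto simp: min_def max_def)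
    ultimately show "s1 \<in> variation_sums F a x" "s2 \<in> variation_sums F x b"
      unfolding s1_def s2_def by (intro variation_sumsI; simp)+
    have "\<bar>F (v i) - F (u i)\<bar> \<le> \<bar>F (min (v i) x) - F (min (u i) x)\<bar> + \<bar>F (max (v i) x) - F (max (u i) x)\<bar>" if "i < N" for i
      using N(1) that by (auto simp: min_def max_def)
    then show "s \<le> s1 + s2"
      unfolding N(3) s1_def s2_def sum.distrib[symmetric] by (intro sum_mono) auto
  qed
qed

lemma variation_sums_append:
  assumes "s \<in> variation_sums F a x" "a \<le> x" "x \<le> y"
  shows "s + \<bar>F y - F x\<bar> \<in> variation_sums F a y"
proof -
  obtain N :: nat and u v where N: "\<forall>i<N. a \<le> u i \<and> u i \<le> v i \<and> v i \<le> x"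
     "disjoint_family_on (\<lambda>i. {u i<..<v i}) {..<N}" "s = (\<Sum>i<N. \<bar>F (v i) - F (u i)\<bar>)"
    using assms(1) unfolding variation_sums_def by auto
  let ?u = "u(N := x)" and ?v = "v(N := y)"
  have 1: "\<forall>i<Suc N. a \<le> ?u i \<and> ?u i \<le> ?v i \<and> ?v i \<le> y"
    using N(1) assms(2,3) by (auto simp: less_Suc_eq intro: order_trans)
  have dj: "{u i<..<v i} \<inter> {x<..<y} = {}" if "i < N" for i using N(1) that by fastforce
  have 2: "disjoint_family_on (\<lambda>i. {?u i<..<?v i}) {..<Suc N}"
    unfolding disjoint_family_on_def
  proof (intro ballI impI)
    fix i j assume "i \<in> {..<Suc N}" "j \<in> {..<Suc N}" "i \<noteq> j"
    then consider "i < N" "j < N" | "i = N" "j < N" | "i < N" "j = N" by (auto simp: less_Suc_eq)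
    then show "{?u i<..<?v i} \<inter> {?u j<..<?v j} = {}"
    proof cases
      case 1 then show ?thesis using N(2) \<open>i \<noteq> j\<close> unfolding disjoint_family_on_def by auto
    next
      case 2 then show ?thesis using dj[of j] by (simp add: Int_commute)
    next
      case 3 then show ?thesis using dj[of i] by simp
    qed
  qed
  have 3: "s + \<bar>F y - F x\<bar> = (\<Sum>i<Suc N. \<bar>F (?v i) - F (?u i)\<bar>)"
    using N(3) by simp
  show ?thesis unfolding 3 by (rule variation_sumsI[OF 1 2])
qed

text \<open>With \<delta> belonging to \<epsilon> = 1, every interval shorter than \<delta> carries
  variation at most 1. Finitely many such intervals fill [0,1], and variation is subadditive under
  cutting.\<close>

lemma abs_cont_on_variation_bounded:
  assumes "abs_cont_on 0 1 F"
  shows "\<exists>B. \<forall>s \<in> variation_sums F 0 1. s \<le> B"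
proof -
  obtain \<delta> where d: "\<delta> > 0" and
    *: "\<And>(N::nat) u v. \<lbrakk>\<forall>i<N. 0 \<le> u i \<and> u i \<le> v i \<and> v i \<le> 1; 
        disjoint_family_on (\<lambda>i. {u i<..<v i}) {..<N}; (\<Sum>i<N. v i - u i) < \<delta>\<rbrakk> \<Longrightarrow> 
        (\<Sum>i<N. \<bar>F (v i) - F (u i)\<bar>) < 1"
    by (rule abs_cont_onE[OF assms zero_less_one]) blast
  have short: "s \<le> 1" if s: "s \<in> variation_sums F x y" and xy: "0 \<le> x" "x \<le> y" "y \<le> 1" "y - x < \<delta>" for s x y
  proof -
    obtain N :: nat and u v where N: "\<forall>i<N. x \<le> u i \<and> u i \<le> v i \<and> v i \<le> y"
     "disjoint_family_on (\<lambda>i. {u i<..<v i}) {..<N}" "s = (\<Sum>i<N. \<bar>F (v i) - F (u i)\<bar>)"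
      using s unfolding variation_sums_def by auto
    have "(\<Sum>i<N. v i - u i) \<le> y - x"
      using N xy by (intro sum_disjoint_lengths_le) auto
    then have "(\<Sum>i<N. \<bar>F (v i) - F (u i)\<bar>) < 1"
      using N xy by (intro *) (force intro: order_trans)+
    then show ?thesis using N(3) by simp
  qed
  obtain n :: nat where n: "1 / \<delta> < real n" using reals_Archimedean2 by blast
  have n0: "real n > 0" using n d by (meson divide_pos_pos less_trans zero_less_one)
  have step: "1 / real n < \<delta>" using n d n0 by (simp add: field_simps)
  have "\<forall>s \<in> variation_sums F 0 (real k / real n). s \<le> 1 + real k" if "k \<le> n" for k
    using that
  proof (induction k)
    case 0
    show ?case using short[of _ 0 0] d by simp
  next
    case (Suc k)
    show ?case
    proof
      fix s assume "s \<in> variation_sums F 0 (real (Suc k) / real n)"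
      moreover have le: "real k / real n \<le> real (Suc k) / real n" using n0 by (simp add: divide_right_mono)
      moreover have "0 \<le> real k / real n" by simp
      ultimately obtain s1 s2 where s: "s1 \<in> variation_sums F 0 (real k / real n)"
         "s2 \<in> variation_sums F (real k / real n) (real (Suc k) / real n)" "s \<le> s1 + s2"
        using variation_sums_split[of s F 0 "real (Suc k) / real n" "real k / real n"] by metis
      have "s2 \<le> 1"
      proof (rule short[OF s(2)])
        show "real (Suc k) / real n \<le> 1" using Suc(2) n0 by (simp add: field_simps)
        show "real (Suc k) / real n - real k / real n < \<delta>"
          using step by (simp add: diff_divide_distrib[symmetric])
      qed (use le in auto)
      moreover have "s1 \<le> 1 + real k" using s(1) Suc by simp
      ultimately show "s \<le> 1 + real (Suc k)" using s(3) by simp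
    qed
  qed
  from this[of n] n0 have "\<forall>s \<in> variation_sums F 0 1. s \<le> 1 + real n" by simp
  then show ?thesis by blast
qed

text \<open>\<open>P\<close> is the variation of \<open>F\<close> over [0,x]. For its absolute
  continuity, each interval of a short family is refined by a family that almost attains the
  variation there; all refinements together form one short family for \<open>F\<close>.\<close>

lemma abs_cont_on_mono_decomposition:
  assumes "abs_cont_on 0 1 F"
  obtains P where "abs_cont_on 0 1 P" "mono_on {0..1} P"
    "\<And>x y. 0 \<le> x \<Longrightarrow> x \<le> y \<Longrightarrow> y \<le> 1 \<Longrightarrow> \<bar>F y - F x\<bar> \<le> P y - P x"
proof -
  obtain B where B: "\<forall>s \<in> variation_sums F 0 1. s \<le> B"
    using abs_cont_on_variation_bounded[OF assms] by blast
  define P where "P x = Sup (variation_sums F 0 x)" for x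
  have sub: "variation_sums F 0 x \<subseteq> variation_sums F 0 1" if "x \<le> 1" for x
  proof
    fix s assume "s \<in> variation_sums F 0 x"
    then obtain N :: nat and u v where N: "\<forall>i<N. 0 \<le> u i \<and> u i \<le> v i \<and> v i \<le> x"
     "disjoint_family_on (\<lambda>i. {u i<..<v i}) {..<N}" "s = (\<Sum>i<N. \<bar>F (v i) - F (u i)\<bar>)"
      unfolding variation_sums_def by auto
    have "\<forall>i<N. 0 \<le> u i \<and> u i \<le> v i \<and> v i \<le> 1" using N(1) that by fastforce
    then show "s \<in> variation_sums F 0 1" unfolding N(3) by (rule variation_sumsI[OF _ N(2)])
  qed
  have bdd: "bdd_above (variation_sums F 0 x)" if "x \<le> 1" for x
    using B sub[OF that] by (intro bdd_aboveI[of _ B]) auto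
  have up: "s \<le> P x" if "s \<in> variation_sums F 0 x" "x \<le> 1" for s x
    unfolding P_def using that bdd by (intro cSup_upper) auto
  have inc: "\<bar>F y - F x\<bar> \<le> P y - P x" if "0 \<le> x" "x \<le> y" "y \<le> 1" for x y
  proof -
    have "P x \<le> P y - \<bar>F y - F x\<bar>"
      unfolding P_def[of x]
    proof (rule cSup_least)
      show "variation_sums F 0 x \<noteq> {}" using zero_in_variation_sums by blast
      fix s assume "s \<in> variation_sums F 0 x"
      then have "s + \<bar>F y - F x\<bar> \<le> P y" using that by (intro up variation_sums_append) auto
      then show "s \<le> P y - \<bar>F y - F x\<bar>" by simp
    qed
    then show ?thesis by simp
  qed
  have near: "\<exists>s \<in> variation_sums F x y. P y - P x < s + e" if xy: "0 \<le> x" "x \<le> y" "y \<le> 1" and e0: "e > 0" for x y e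
  proof -
    have "variation_sums F 0 y \<noteq> {}" using zero_in_variation_sums by blast
    then obtain s where s: "s \<in> variation_sums F 0 y" "P y - e < s"
      using less_cSupE[of "P y - e" "variation_sums F 0 y"] e0 unfolding P_def by auto
    obtain s1 s2 where s12: "s1 \<in> variation_sums F 0 x" "s2 \<in> variation_sums F x y" "s \<le> s1 + s2"
      using variation_sums_split[OF s(1) xy(1,2)] by metis
    have "s1 \<le> P x" using up s12 xy by auto
    then show ?thesis using s12 s by (intro bexI[of _ s2]) auto
  qed
  have ac: "abs_cont_on 0 1 P"
    unfolding abs_cont_on_def
  proof (intro allI impI)
    fix e :: real assume e: "e > 0"
    obtain d where d: "d > 0" and
      D: "\<forall>(I::(nat\<times>nat) set) u v. finite I \<longrightarrow> (\<forall>i\<in>I. 0 \<le> u i \<and> u i \<le> v i \<and> v i \<le> 1) \<longrightarrow>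
       disjoint_family_on (\<lambda>i. {u i<..<v i}) I \<longrightarrow> (\<Sum>i\<in>I. v i - u i) < d \<longrightarrow>
       (\<Sum>i\<in>I. \<bar>F (v i) - F (u i)\<bar>) < e/2"
      using abs_cont_on_finite_family[OF assms half_gt_zero[OF e], where 'i="nat\<times>nat"] by (elim exE conjE) rule
    show "\<exists>d>0. \<forall>(N::nat) u v.
             (\<forall>i<N. 0 \<le> u i \<and> u i \<le> v i \<and> v i \<le> 1) \<longrightarrow>
             disjoint_family_on (\<lambda>i. {u i<..<v i}) {..<N} \<longrightarrow>
             (\<Sum>i<N. v i - u i) < d \<longrightarrow> (\<Sum>i<N. \<bar>P (v i) - P (u i)\<bar>) < e"
    proof (intro exI[of _ d] conjI allI impI)
      fix N :: nat and u v
      assume N: "\<forall>i<N. 0 \<le> u i \<and> u i \<le> v i \<and> v i \<le> 1"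
        "disjoint_family_on (\<lambda>i. {u i<..<v i}) {..<N}" "(\<Sum>i<N. v i - u i) < d"
      \<comment> \<open>The \<open>N\<close> errors made by choosing almost optimal refinements add
        up to at most \<open>e / 2\<close>; the other half of \<open>e\<close> is the variation of
        \<open>F\<close> over the joint family.\<close>
      define e' where "e' = e / (2 * (real N + 1))"
      have e': "e' > 0" using e unfolding e'_def by (intro divide_pos_pos) auto
      have "\<forall>i<N. \<exists>s \<in> variation_sums F (u i) (v i). P (v i) - P (u i) < s + e'"
        using N(1) near e' by blast
      define Q where "Q i z \<longleftrightarrow> (\<forall>k<fst z. u i \<le> fst (snd z) k \<and> fst (snd z) k \<le> snd (snd z) k \<and> snd (snd z) k \<le> v i) \<and>
          disjoint_family_on (\<lambda>k. {fst (snd z) k<..<snd (snd z) k}) {..<fst z} \<and> 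
          P (v i) - P (u i) < (\<Sum>k<fst z. \<bar>F (snd (snd z) k) - F (fst (snd z) k)\<bar>) + e'"
        for i and z :: "nat \<times> (nat \<Rightarrow> real) \<times> (nat \<Rightarrow> real)"
      have "\<exists>z. Q i z" if iN: "i < N" for i
      proof -
        obtain s where s: "s \<in> variation_sums F (u i) (v i)" "P (v i) - P (u i) < s + e'"
          using \<open>\<forall>i<N. \<exists>s \<in> variation_sums F (u i) (v i). P (v i) - P (u i) < s + e'\<close> iN by blast
        from s(1) obtain n p q where n: "\<forall>k<(n::nat). u i \<le> p k \<and> p k \<le> q k \<and> q k \<le> v i"
          "disjoint_family_on (\<lambda>k. {p k<..<q k}) {..<n}" "s = (\<Sum>k<n. \<bar>F (q k) - F (p k)\<bar>)"
          unfolding variation_sums_def by auto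
        show ?thesis by (rule exI[of _ "(n, p, q)"]) (use n s(2) in \<open>simp add: Q_def\<close>)
      qed
      then obtain z where z: "\<And>i. i < N \<Longrightarrow> Q i (z i)" by metis
      define n p q where "n i = fst (z i)" and "p i = fst (snd (z i))" and "q i = snd (snd (z i))" for i
      have n: "\<And>i k. i < N \<Longrightarrow> k < n i \<Longrightarrow> u i \<le> p i k \<and> p i k \<le> q i k \<and> q i k \<le> v i"
        "\<And>i. i < N \<Longrightarrow> disjoint_family_on (\<lambda>k. {p i k<..<q i k}) {..<n i}"
        "\<And>i. i < N \<Longrightarrow> P (v i) - P (u i) < (\<Sum>k<n i. \<bar>F (q i k) - F (p i k)\<bar>) + e'"
        using z unfolding Q_def n_def p_def q_def by blast+
      let ?I = "SIGMA i:{..<N}. {..<n i}"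
      have "(\<Sum>z\<in>?I. \<bar>F (q (fst z) (snd z)) - F (p (fst z) (snd z))\<bar>) < e/2"
      proof (rule D[rule_format])
        show "finite ?I" by auto
        show "0 \<le> p (fst z) (snd z) \<and> p (fst z) (snd z) \<le> q (fst z) (snd z) \<and> q (fst z) (snd z) \<le> 1" if "z \<in> ?I" for z
          using that n(1)[of "fst z" "snd z"] N(1) by (auto intro: order_trans)
        have sub: "{p i k<..<q i k} \<subseteq> {u i<..<v i}" if "i < N" "k < n i" for i k
          using n(1)[OF that] by auto
        show "disjoint_family_on (\<lambda>z. {p (fst z) (snd z)<..<q (fst z) (snd z)}) ?I"
          unfolding disjoint_family_on_def
        proof (intro ballI impI)
          fix z z' assume z: "z \<in> ?I" "z' \<in> ?I" "z \<noteq> z'"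
          show "{p (fst z) (snd z)<..<q (fst z) (snd z)} \<inter> {p (fst z') (snd z')<..<q (fst z') (snd z')} = {}"
          proof (cases "fst z = fst z'")
            case True
            then have "snd z \<noteq> snd z'" using z(3) by (simp add: prod_eq_iff)
            then show ?thesis using n(2)[of "fst z"] z True unfolding disjoint_family_on_def by auto
          next
            case False
            then have "{u (fst z)<..<v (fst z)} \<inter> {u (fst z')<..<v (fst z')} = {}"
              using N(2) z unfolding disjoint_family_on_def by auto
            moreover have "fst z < N" "snd z < n (fst z)" "fst z' < N" "snd z' < n (fst z')" using z by auto
            ultimately show ?thesis using sub[of "fst z" "snd z"] sub[of "fst z'" "snd z'"] by blast
          qed
        qed
        have "(\<Sum>z\<in>?I. q (fst z) (snd z) - p (fst z) (snd z)) = (\<Sum>i<N. \<Sum>k<n i. q i k - p i k)"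
          by (subst sum.Sigma) (auto simp: case_prod_unfold)
        also have "\<dots> \<le> (\<Sum>i<N. v i - u i)"
          using n(1,2) N(1) by (intro sum_mono sum_disjoint_lengths_le) auto
        finally show "(\<Sum>z\<in>?I. q (fst z) (snd z) - p (fst z) (snd z)) < d" using N(3) by linarith
      qed
      moreover have "(\<Sum>z\<in>?I. \<bar>F (q (fst z) (snd z)) - F (p (fst z) (snd z))\<bar>) = (\<Sum>i<N. \<Sum>k<n i. \<bar>F (q i k) - F (p i k)\<bar>)"
        by (subst sum.Sigma) (auto simp: case_prod_unfold)
      moreover have "(\<Sum>i<N. \<bar>P (v i) - P (u i)\<bar>) \<le> (\<Sum>i<N. (\<Sum>k<n i. \<bar>F (q i k) - F (p i k)\<bar>) + e')"
      proof (intro sum_mono)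
        fix i assume "i \<in> {..<N}"
        then show "\<bar>P (v i) - P (u i)\<bar> \<le> (\<Sum>k<n i. \<bar>F (q i k) - F (p i k)\<bar>) + e'"
          using n(3)[of i] inc[of "u i" "v i"] N(1) by fastforce
      qed
      moreover have "(\<Sum>i<N. e') \<le> e/2"
        using e unfolding e'_def by (simp add: field_simps)
      ultimately show "(\<Sum>i<N. \<bar>P (v i) - P (u i)\<bar>) < e" by (simp add: sum.distrib)
    qed fact
  qed
  show ?thesis
    using that[OF ac _ inc] inc by (force intro!: mono_onI)
qed

lemma abs_cont_on_continuous:
  assumes "abs_cont_on 0 1 P"
  shows "continuous_on {0..1} P"
  unfolding continuous_on_iff
proof (intro ballI allI impI)
  fix x e :: real assume x: "x \<in> {0..1}" and e: "e > 0"
  obtain d where d: "d > 0" and D: "\<And>(N::nat) u v. \<forall>i<N. 0 \<le> u i \<and> u i \<le> v i \<and> v i \<le> 1 \<Longrightarrow>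
       disjoint_family_on (\<lambda>i. {u i<..<v i}) {..<N} \<Longrightarrow> (\<Sum>i<N. v i - u i) < d \<Longrightarrow>
       (\<Sum>i<N. \<bar>P (v i) - P (u i)\<bar>) < e"
    by (rule abs_cont_onE[OF assms e]) blast
  have *: "\<bar>P q - P p\<bar> < e" if "0 \<le> p" "p \<le> q" "q \<le> 1" "q - p < d" for p q
    using D[of 1 "\<lambda>_. p" "\<lambda>_. q"] that by (simp add: disjoint_family_on_def)
  show "\<exists>d>0. \<forall>x'\<in>{0..1}. dist x' x < d \<longrightarrow> dist (P x') (P x) < e"
  proof (intro exI[of _ d] conjI ballI impI)
    fix y assume y: "y \<in> {0..1::real}" "dist y x < d"
    show "dist (P y) (P x) < e"
    proof (cases "x \<le> y")
      case True then show ?thesis using *[of x y] x y by (simp add: dist_real_def)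
    next
      case False then show ?thesis using *[of y x] x y by (simp add: dist_real_def)
    qed
  qed fact
qed

text \<open>The Stieltjes measure of \<open>P\<close> vanishes on Lebesgue null sets, and its
  Radon-Nikodym density is the wanted function. A null set lies in an open set of length below
  \<delta>; the part of it in (0,1] is an increasing union of finite unions of dyadic cells, and
  absolute continuity bounds the measure of each of these by \<epsilon>.\<close>

lemma mono_abs_cont_density:
  assumes ac: "abs_cont_on 0 1 P" and mono: "mono_on {0..1} P"
  shows "\<exists>g. g \<in> borel_measurable borel \<and> (\<forall>x. 0 \<le> g x) \<and>
     (\<forall>x\<in>{0..1}. (g has_integral (P x - P 0)) {0..x})"
proof -
  \<comment> \<open>Constant extension of \<open>P\<close> beyond [0,1]: a Stieltjes measure needs
    an increasing right-continuous function on the whole line.\<close>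
  define H where "H x = P (max 0 (min 1 x))" for x
  have HP: "H x = P x" if "0 \<le> x" "x \<le> 1" for x using that unfolding H_def by (simp add: max_def min_def)
  have monoH: "H x \<le> H y" if "x \<le> y" for x y
    unfolding H_def using that by (intro mono_onD[OF mono]) auto
  have contH: "continuous_on UNIV H"
    unfolding H_def by (intro continuous_on_compose2[OF abs_cont_on_continuous[OF ac]] continuous_intros) auto
  have rcont: "continuous (at_right a) H" for a
    using contH by (simp add: continuous_on_eq_continuous_at continuous_at_imp_continuous_at_within)
  define \<mu> where "\<mu> = interval_measure H"
  have [measurable_cong, simp]: "sets \<mu> = sets borel" and [simp]: "space \<mu> = UNIV" unfolding \<mu>_def by auto
  have Ioc: "emeasure \<mu> {a<..b} = ennreal (H b - H a)" if "a \<le> b" for a b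
    unfolding \<mu>_def using that monoH rcont by (rule emeasure_interval_measure_Ioc)
  define \<nu> where "\<nu> = density \<mu> (indicator {0<..1})"
  have \<nu>: "emeasure \<nu> A = emeasure \<mu> ({0<..1} \<inter> A)" if "A \<in> sets borel" for A
    unfolding \<nu>_def using that by (subst emeasure_density) (auto simp: nn_integral_indicator[symmetric] indicator_inter_arith intro!: nn_integral_cong)
  have sets\<nu>[simp]: "sets \<nu> = sets borel" unfolding \<nu>_def by simp
  \<comment> \<open>At each level the half-open cells partition (0,1], and every cell splits into
    two cells of the next level, which makes the sets \<open>W k\<close> below increase.\<close>
  define C where "C k i = {real i / 2^k<..real (Suc i) / 2^k}" for k i :: nat
  have C_borel[measurable]: "C k i \<in> sets borel" for k i unfolding C_def by simp
  have C_split: "C k i = C (Suc k) (2*i) \<union> C (Suc k) (Suc (2*i))" for k i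
    unfolding C_def by (auto simp: field_simps)
  have C_disj: "disjoint_family (C k)" for k
  proof -
    have "C k i \<inter> C k j = {}" if "i < j" for i j
    proof -
      have "real (Suc i) / 2^k \<le> real j / 2^k" using that by (intro divide_right_mono) auto
      then show ?thesis unfolding C_def by auto
    qed
    then show ?thesis unfolding disjoint_family_on_def by (metis Int_commute linorder_neqE_nat)
  qed
  have C_le: "real (Suc i) \<le> 2^k" if "i < 2^k" for i k
    using that by (metis Suc_leI of_nat_le_iff of_nat_numeral of_nat_power)
  have C_sub01: "C k i \<subseteq> {0<..1}" if "i < 2^k" for k i
  proof -
    have "real (Suc i) \<le> 2^k" using C_le that .
    then have "real (Suc i) / 2^k \<le> 1" by simp
    moreover have "0 \<le> real i / 2^k" by simp
    ultimately show ?thesis unfolding C_def by (intro subsetI, simp only: greaterThanAtMost_iff, linarith)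
  qed
  have C_cover: "\<exists>i<2^k. x \<in> C k i" if "x \<in> {0<..1}" for x k
  proof -
    define c where "c = \<lceil>x * 2^k\<rceil>"
    have c: "of_int c - 1 < x * 2^k" "x * 2^k \<le> of_int c" unfolding c_def by linarith+
    have "0 < x * 2^k" using that by simp
    then have c1: "c \<ge> 1" using c by linarith
    have "x * 2^k \<le> 2^k" using that by simp
    then have c2: "c \<le> 2^k" unfolding c_def by (simp add: ceiling_le_iff)
    define i where "i = nat (c - 1)"
    have i: "real i = of_int c - 1" unfolding i_def using c1 by simp
    have "int i < 2^k" using c1 c2 unfolding i_def by simp
    then have "i < 2^k" by (metis of_nat_less_iff of_nat_numeral of_nat_power)
    moreover have "x \<in> C k i" unfolding C_def using c i by (simp add: field_simps)
    ultimately show ?thesis by blast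
  qed
  have null: "emeasure \<nu> N = 0" if N: "N \<in> null_sets lborel" for N
  proof -
    have "emeasure \<nu> N \<le> 0 + ennreal \<epsilon>" if \<epsilon>: "\<epsilon> > 0" for \<epsilon>
    proof -
      obtain \<delta> where \<delta>: "\<delta> > 0" and D: "\<forall>(I::nat set) u v. finite I \<longrightarrow> (\<forall>i\<in>I. 0 \<le> u i \<and> u i \<le> v i \<and> v i \<le> 1) \<longrightarrow>
         disjoint_family_on (\<lambda>i. {u i<..<v i}) I \<longrightarrow> (\<Sum>i\<in>I. v i - u i) < \<delta> \<longrightarrow>
         (\<Sum>i\<in>I. \<bar>P (v i) - P (u i)\<bar>) < \<epsilon>"
        using abs_cont_on_finite_family[OF ac \<epsilon>, where 'i=nat] by (elim exE conjE) rule
      obtain U where U: "open U" "N \<subseteq> U" "emeasure lborel (U - N) < ennreal \<delta>"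
      proof -
        have "N \<in> sets borel" using null_setsD2[OF N] by simp
        then show ?thesis using outer_regular_lborel[of N \<delta>] \<delta> that by metis
      qed
      have [measurable]: "U \<in> sets borel" "N \<in> sets borel" using U N by (auto dest: null_setsD2)
      have Ud: "emeasure lborel U < ennreal \<delta>"
        using U N emeasure_Diff_null_set[of N lborel U] by simp
      define I where "I k = {i. i < 2^k \<and> C k i \<subseteq> U}" for k
      have fI: "finite (I k)" for k unfolding I_def by simp
      define W where "W k = (\<Union>i\<in>I k. C k i)" for k
      have W_borel[measurable]: "W k \<in> sets borel" for k unfolding W_def using fI by auto
      have incW: "incseq W"
      proof (intro incseq_SucI subsetI)
        fix k x assume "x \<in> W k"
        then obtain i where i: "i \<in> I k" "x \<in> C k i" unfolding W_def by auto
        then have "2*i \<in> I (Suc k)" "Suc (2*i) \<in> I (Suc k)"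
          using C_split[of k i] unfolding I_def by auto
        then show "x \<in> W (Suc k)" using i C_split[of k i] unfolding W_def by auto
      qed
      have UW: "U \<inter> {0<..1} = (\<Union>k. W k)"
      proof (intro equalityI subsetI)
        fix x assume x: "x \<in> U \<inter> {0<..1}"
        then obtain r where r: "r > 0" "ball x r \<subseteq> U" using U(1) open_contains_ball by blast
        obtain k where k: "(1/2::real)^k < r" using real_arch_pow_inv[of r "1/2"] r by auto
        obtain i where i: "i < 2^k" "x \<in> C k i" using C_cover x by blast
        have "C k i \<subseteq> ball x r"
        proof
          fix y assume "y \<in> C k i"
          then have "\<bar>x - y\<bar> < 1/2^k" using i(2) unfolding C_def by (auto simp: add_divide_distrib abs_less_iff)
          then show "y \<in> ball x r" using k by (simp add: dist_real_def power_divide)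
        qed
        then show "x \<in> (\<Union>k. W k)" using i r unfolding W_def I_def by auto
      next
        fix x assume "x \<in> (\<Union>k. W k)"
        then show "x \<in> U \<inter> {0<..1}" using C_sub01 unfolding W_def I_def by blast
      qed
      have W_small: "emeasure \<mu> (W k) \<le> ennreal \<epsilon>" for k
      proof -
        have "(\<Sum>i\<in>I k. \<bar>P (real (Suc i) / 2^k) - P (real i / 2^k)\<bar>) < \<epsilon>"
        proof (rule D[rule_format])
          show "finite (I k)" by (rule fI)
          show "0 \<le> real i / 2^k \<and> real i / 2^k \<le> real (Suc i) / 2^k \<and> real (Suc i) / 2^k \<le> 1" if "i \<in> I k" for i
          proof -
            have "real (Suc i) \<le> 2^k" using C_le that unfolding I_def by blast
            then have "real (Suc i) / 2^k \<le> 1" by simp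
            moreover have "real i / 2^k \<le> real (Suc i) / 2^k" by (intro divide_right_mono) auto
            moreover have "0 \<le> real i / 2^k" by simp
            ultimately show ?thesis by blast
          qed
          show "disjoint_family_on (\<lambda>i. {real i / 2^k<..<real (Suc i) / 2^k}) (I k)"
            using C_disj[of k] unfolding C_def disjoint_family_on_def by fastforce
          have "ennreal (\<Sum>i\<in>I k. real (Suc i) / 2^k - real i / 2^k) = (\<Sum>i\<in>I k. emeasure lborel (C k i))"
            unfolding C_def by (subst sum_ennreal[symmetric]) (auto simp: divide_right_mono)
          also have "\<dots> = emeasure lborel (W k)"
            unfolding W_def using fI C_disj by (intro sum_emeasure) (auto simp: disjoint_family_on_def)
          also have "\<dots> \<le> emeasure lborel U" unfolding W_def I_def by (intro emeasure_mono) auto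
          also have "\<dots> < ennreal \<delta>" by (rule Ud)
          finally show "(\<Sum>i\<in>I k. real (Suc i) / 2^k - real i / 2^k) < \<delta>"
            by (subst (asm) ennreal_less_iff) (auto intro!: sum_nonneg divide_right_mono)
        qed
        moreover have "emeasure \<mu> (W k) = (\<Sum>i\<in>I k. emeasure \<mu> (C k i))"
          unfolding W_def using fI C_disj by (intro sum_emeasure[symmetric]) (auto simp: disjoint_family_on_def)
        moreover have "\<dots> = (\<Sum>i\<in>I k. ennreal \<bar>P (real (Suc i) / 2^k) - P (real i / 2^k)\<bar>)"
        proof (rule sum.cong[OF refl])
          fix i assume i: "i \<in> I k"
          have "real (Suc i) \<le> 2^k" using C_le i unfolding I_def by blast
          then have a1: "real (Suc i) / 2^k \<le> 1" by simp
          have a3: "real i / 2^k \<le> real (Suc i) / 2^k" by (intro divide_right_mono) auto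
          note a = a1 order_trans[OF a3 a1] a3
          have "emeasure \<mu> (C k i) = ennreal (H (real (Suc i) / 2^k) - H (real i / 2^k))"
            unfolding C_def by (rule Ioc[OF a(3)])
          also have "\<dots> = ennreal \<bar>P (real (Suc i) / 2^k) - P (real i / 2^k)\<bar>"
            using monoH[OF a(3)] HP[OF _ a(1)] HP[OF _ a(2)] by (simp del: of_nat_Suc)
          finally show "emeasure \<mu> (C k i) = ennreal \<bar>P (real (Suc i) / 2^k) - P (real i / 2^k)\<bar>" .
        qed
        ultimately show ?thesis by (simp add: sum_ennreal ennreal_leI less_imp_le del: of_nat_Suc)
      qed
      have "emeasure \<nu> N \<le> emeasure \<nu> U" using U(2) by (intro emeasure_mono) auto
      also have "\<dots> = emeasure \<mu> (\<Union>k. W k)" using UW \<nu> by (simp add: Int_commute)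
      also have "\<dots> = (SUP k. emeasure \<mu> (W k))" using incW by (intro SUP_emeasure_incseq[symmetric]) auto
      also have "\<dots> \<le> ennreal \<epsilon>" using W_small by (intro SUP_least) auto
      finally show ?thesis by simp
    qed
    then have "emeasure \<nu> N \<le> 0" by (rule ennreal_le_epsilon)
    then show ?thesis by simp
  qed
  have ac\<nu>: "absolutely_continuous lborel \<nu>"
    unfolding absolutely_continuous_def
  proof
    fix N :: "real set" assume N: "N \<in> null_sets lborel"
    show "N \<in> null_sets \<nu>" using null_setsD2[OF N] by (intro null_setsI null[OF N]) simp
  qed
  have "\<exists>f\<in>borel_measurable lborel. density lborel f = \<nu>"
    by (rule sigma_finite_measure.Radon_Nikodym[OF sigma_finite_lborel ac\<nu>]) simp
  then obtain f where f[measurable]: "f \<in> borel_measurable borel" and dens: "density lborel f = \<nu>"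
    by (elim bexE) simp
  have f_int: "(\<integral>\<^sup>+x. f x * indicator {0<..y} x \<partial>lborel) = ennreal (P y - P 0)" if "y \<in> {0..1}" for y
  proof -
    have "(\<integral>\<^sup>+x. f x * indicator {0<..y} x \<partial>lborel) = emeasure \<nu> {0<..y}"
      unfolding dens[symmetric] by (subst emeasure_density) auto
    also have "\<dots> = emeasure \<mu> {0<..y}" using that by (subst \<nu>) (auto intro!: arg_cong[where f="emeasure \<mu>"])
    also have "\<dots> = ennreal (P y - P 0)" using that by (subst Ioc) (auto simp: H_def)
    finally show ?thesis .
  qed
  \<comment> \<open>The density takes values in \<open>ennreal\<close>. Its integral over (0,1] is
    finite, so replacing infinite values through \<open>enn2real\<close> changes it there on a null
    set only.\<close>
  have fin: "AE x in lborel. f x * indicator {0<..1} x \<noteq> \<infinity>"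
    using f_int[of 1] by (intro nn_integral_noteq_infinite) auto
  define g where "g x = enn2real (f x)" for x
  have g[measurable]: "g \<in> borel_measurable borel" unfolding g_def by measurable
  have "(g has_integral (P y - P 0)) {0..y}" if y: "y \<in> {0..1}" for y
  proof -
    have "(\<integral>\<^sup>+x. ennreal (g x * indicator {0<..y} x) \<partial>lborel) = (\<integral>\<^sup>+x. f x * indicator {0<..y} x \<partial>lborel)"
    proof (intro nn_integral_cong_AE)
      show "AE x in lborel. ennreal (g x * indicator {0<..y} x) = f x * indicator {0<..y} x"
        using fin by eventually_elim (use y in \<open>auto simp: g_def indicator_def top.not_eq_extremum\<close>)
    qed
    then have *: "(\<integral>\<^sup>+x. ennreal (g x * indicator {0<..y} x) \<partial>lborel) = ennreal (P y - P 0)"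
      using f_int[OF y] by simp
    have "0 \<le> P y - P 0" using mono_onD[OF mono, of 0 y] y by auto
    then have "((\<lambda>x. g x * indicator {0<..y} x) has_integral (P y - P 0)) UNIV"
      using * by (intro nn_integral_has_integral) (auto simp: g_def)
    then have "((\<lambda>x. if x \<in> {0<..y} then g x else 0) has_integral (P y - P 0)) UNIV"
      by (rule has_integral_eq[rotated]) (auto simp: indicator_def)
    then have "(g has_integral (P y - P 0)) {0<..y}" using has_integral_restrict_UNIV by blast
    then show ?thesis
      by (rule has_integral_spike_set_eq[THEN iffD1, rotated 2]) (auto intro: negligible_subset[of "{0}"])
  qed
  then show ?thesis using g by (intro exI[of _ g]) (auto simp: g_def)
qed

lemma abs_cont_on_diff:
  assumes "abs_cont_on a b F" "abs_cont_on a b G"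
  shows "abs_cont_on a b (\<lambda>x. F x - G x)"
  unfolding abs_cont_on_def
proof (intro allI impI)
  fix e :: real assume e: "e > 0"
  obtain d1 where d1: "d1 > 0" and D1: "\<And>(N::nat) u v. \<forall>i<N. a \<le> u i \<and> u i \<le> v i \<and> v i \<le> b \<Longrightarrow>
       disjoint_family_on (\<lambda>i. {u i<..<v i}) {..<N} \<Longrightarrow> (\<Sum>i<N. v i - u i) < d1 \<Longrightarrow>
       (\<Sum>i<N. \<bar>F (v i) - F (u i)\<bar>) < e/2"
    by (rule abs_cont_onE[OF assms(1) half_gt_zero[OF e]]) blast
  obtain d2 where d2: "d2 > 0" and D2: "\<And>(N::nat) u v. \<forall>i<N. a \<le> u i \<and> u i \<le> v i \<and> v i \<le> b \<Longrightarrow>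
       disjoint_family_on (\<lambda>i. {u i<..<v i}) {..<N} \<Longrightarrow> (\<Sum>i<N. v i - u i) < d2 \<Longrightarrow>
       (\<Sum>i<N. \<bar>G (v i) - G (u i)\<bar>) < e/2"
    by (rule abs_cont_onE[OF assms(2) half_gt_zero[OF e]]) blast
  show "\<exists>d>0. \<forall>(N::nat) u v. (\<forall>i<N. a \<le> u i \<and> u i \<le> v i \<and> v i \<le> b) \<longrightarrow>
      disjoint_family_on (\<lambda>i. {u i<..<v i}) {..<N} \<longrightarrow> (\<Sum>i<N. v i - u i) < d \<longrightarrow>
      (\<Sum>i<N. \<bar>F (v i) - G (v i) - (F (u i) - G (u i))\<bar>) < e"
  proof (intro exI[of _ "min d1 d2"] conjI allI impI)
    fix N :: nat and u v
    assume N: "\<forall>i<N. a \<le> u i \<and> u i \<le> v i \<and> v i \<le> b" "disjoint_family_on (\<lambda>i. {u i<..<v i}) {..<N}"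
      "(\<Sum>i<N. v i - u i) < min d1 d2"
    have "(\<Sum>i<N. \<bar>F (v i) - G (v i) - (F (u i) - G (u i))\<bar>) \<le> (\<Sum>i<N. \<bar>F (v i) - F (u i)\<bar>) + (\<Sum>i<N. \<bar>G (v i) - G (u i)\<bar>)"
      unfolding sum.distrib[symmetric] by (intro sum_mono) auto
    then show "(\<Sum>i<N. \<bar>F (v i) - G (v i) - (F (u i) - G (u i))\<bar>) < e"
      using D1[OF N(1,2)] D2[OF N(1,2)] N(3) by fastforce
  qed (use d1 d2 in auto)
qed

text \<open>\<open>F\<close> is the difference of \<open>P\<close> and \<open>P - F\<close>, both
  increasing and absolutely continuous, so the monotone case applies twice.\<close>

theorem abs_cont_on_has_integral:
  assumes "abs_cont_on 0 1 F"
  obtains g where "g \<in> borel_measurable borel" "g absolutely_integrable_on {0..1}"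
    "\<And>x. x \<in> {0..1} \<Longrightarrow> (g has_integral (F x - F 0)) {0..x}"
proof -
  obtain P where P: "abs_cont_on 0 1 P" "mono_on {0..1} P"
    "\<And>x y. 0 \<le> x \<Longrightarrow> x \<le> y \<Longrightarrow> y \<le> 1 \<Longrightarrow> \<bar>F y - F x\<bar> \<le> P y - P x"
    using abs_cont_on_mono_decomposition[OF assms] by metis
  obtain g1 where g1: "g1 \<in> borel_measurable borel" "\<forall>x. 0 \<le> g1 x"
     "\<forall>x\<in>{0..1}. (g1 has_integral (P x - P 0)) {0..x}"
    using mono_abs_cont_density[OF P(1,2)] by metis
  have "mono_on {0..1} (\<lambda>x. P x - F x)" using P(3) by (fastforce intro!: mono_onI)
  then obtain g2 where g2: "g2 \<in> borel_measurable borel" "\<forall>x. 0 \<le> g2 x"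
     "\<forall>x\<in>{0..1}. (g2 has_integral ((P x - F x) - (P 0 - F 0))) {0..x}"
    using mono_abs_cont_density[OF abs_cont_on_diff[OF P(1) assms]] by metis
  show ?thesis
  proof (rule that[of "\<lambda>x. g1 x - g2 x"])
    show "(\<lambda>x. g1 x - g2 x) \<in> borel_measurable borel" using g1 g2 by measurable
    have "g1 absolutely_integrable_on {0..1}" "g2 absolutely_integrable_on {0..1}"
      using g1 g2 by (auto intro!: nonnegative_absolutely_integrable_1 has_integral_integrable)
    then show "(\<lambda>x. g1 x - g2 x) absolutely_integrable_on {0..1}" by (rule set_integral_diff)
    show "((\<lambda>x. g1 x - g2 x) has_integral (F x - F 0)) {0..x}" if "x \<in> {0..1}" for x
      using has_integral_diff[OF g1(3)[rule_format, OF that] g2(3)[rule_format, OF that]] by simp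
  qed
qed

section \<open>Almost everywhere differentiation of indefinite integrals\<close>

lemma right_lebesgue_points:
  fixes f :: "real \<Rightarrow> real"
  assumes "\<And>a b. f integrable_on {a..b}"
  shows "\<exists>N. negligible N \<and> (\<forall>x e. x \<notin> N \<longrightarrow> 0 < e \<longrightarrow>
    (\<exists>d>0. \<forall>h. 0 < h \<and> h < d \<longrightarrow> \<bar>integral {x..x + h} f / h - f x\<bar> < e))"
proof (rule integrable_ccontinuous_explicit[of f])
  show "f integrable_on cbox a b" for a b using assms by simp
  fix N :: "real set"
  assume N: "negligible N" "\<And>x e. \<lbrakk>x \<notin> N; 0 < e\<rbrakk> \<Longrightarrow>
      \<exists>d>0. \<forall>h. 0 < h \<and> h < d \<longrightarrow> norm(integral (cbox x (x + h *\<^sub>R One)) f /\<^sub>R h ^ DIM(real) - f x) < e"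
  show ?thesis
  proof (intro exI[of _ N] conjI allI impI)
    fix x e :: real assume "x \<notin> N" "0 < e"
    from N(2)[OF this] show "\<exists>d>0. \<forall>h. 0 < h \<and> h < d \<longrightarrow> \<bar>integral {x..x + h} f / h - f x\<bar> < e"
      by (simp add: divide_inverse mult.commute)
  qed fact
qed

text \<open>At almost every point the averages of the integrand over shrinking intervals to the
  right converge to its value. Reflection at 0 gives the same for intervals to the left, and the two
  together are the convergence of the difference quotients.\<close>

lemma indefinite_integral_deriv_ae:
  fixes g G :: "real \<Rightarrow> real"
  assumes int: "g integrable_on {0..1}"
    and G: "\<And>x. x \<in> {0..1} \<Longrightarrow> G x = G 0 + integral {0..x} g"
  shows "\<exists>N. negligible N \<and> (\<forall>x\<in>{0<..<1} - N. (G has_real_derivative g x) (at x))"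
proof -
  \<comment> \<open>Extension by 0 makes the integrand integrable on every interval, as the
    differentiation theorem and the reflection require.\<close>
  define f where "f x = (if x \<in> {0..1} then g x else 0)" for x
  have "f integrable_on UNIV" unfolding f_def using int integrable_restrict_UNIV by blast
  then have fi: "f integrable_on cbox a b" for a b using integrable_on_subcbox by blast
  have fi': "(\<lambda>x. f (-x)) integrable_on cbox a b" for a b
    using fi[of "-b" "-a"] Henstock_Kurzweil_Integration.integrable_reflect_real[where f=f and a="-b" and b="-a"] by simp
  obtain N1 where N1: "negligible N1" "\<forall>x e. x \<notin> N1 \<longrightarrow> 0 < e \<longrightarrow>
      (\<exists>d>0. \<forall>h. 0 < h \<and> h < d \<longrightarrow> \<bar>integral {x..x + h} f / h - f x\<bar> < e)"
    using right_lebesgue_points[of f] fi by auto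
  obtain N2 where N2: "negligible N2" "\<forall>x e. x \<notin> N2 \<longrightarrow> 0 < e \<longrightarrow>
      (\<exists>d>0. \<forall>h. 0 < h \<and> h < d \<longrightarrow> \<bar>integral {x..x + h} (\<lambda>x. f (-x)) / h - f (-x)\<bar> < e)"
    using right_lebesgue_points[of "\<lambda>x. f (-x)"] fi' by auto
  have "negligible (uminus ` N2)" using N2(1) by (intro negligible_differentiable_image_negligible) (auto intro!: differentiable_on_minus)
  then have neg: "negligible (N1 \<union> uminus ` N2)" using N1(1) by simp
  have Gd: "G y - G x = integral {x..y} f" if "0 \<le> x" "x \<le> y" "y \<le> 1" for x y
  proof -
    have "integral {0..x} g + integral {x..y} g = integral {0..y} g"
      using that by (intro Henstock_Kurzweil_Integration.integral_combine integrable_on_subinterval[OF int]) auto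
    moreover have "integral {x..y} f = integral {x..y} g"
      using that by (intro integral_cong) (auto simp: f_def)
    ultimately show ?thesis using G[of x] G[of y] that by simp
  qed
  have "(G has_real_derivative g x) (at x)" if x: "x \<in> {0<..<1} - (N1 \<union> uminus ` N2)" for x
    unfolding DERIV_def
  proof (rule LIM_I)
    fix e :: real assume e: "e > 0"
    have x2: "- x \<notin> N2" using x by force
    obtain d1 where d1: "d1 > 0" "\<forall>h. 0 < h \<and> h < d1 \<longrightarrow> \<bar>integral {x..x + h} f / h - f x\<bar> < e"
      using N1(2) x e by blast
    obtain d2 where d2: "d2 > 0" "\<forall>h. 0 < h \<and> h < d2 \<longrightarrow> \<bar>integral {-x..-x + h} (\<lambda>x. f (-x)) / h - f (- (- x))\<bar> < e"
      using N2(2) x2 e by blast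
    define d where "d = Min {d1, d2, x, 1 - x}"
    have d: "d > 0" "d \<le> d1" "d \<le> d2" "d \<le> x" "d \<le> 1 - x" using d1 d2 x unfolding d_def by auto
    show "\<exists>s>0. \<forall>h::real. h \<noteq> 0 \<and> norm (h - 0) < s \<longrightarrow> norm ((G (x + h) - G x) / h - g x) < e"
    proof (intro exI[of _ d] conjI allI impI)
      fix h :: real assume h: "h \<noteq> 0 \<and> norm (h - 0) < d"
      have fx: "f x = g x" using x by (simp add: f_def)
      show "norm ((G (x + h) - G x) / h - g x) < e"
      proof (cases "h > 0")
        case True
        then have "G (x + h) - G x = integral {x..x+h} f" using h d x by (intro Gd) auto
        then show ?thesis using d1(2)[rule_format, of h] True h d fx by simp
      next
        case False
        then have h0: "h < 0" using h by auto
        have "G x - G (x + h) = integral {x + h..x} f" using h d h0 x by (intro Gd) auto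
        also have "\<dots> = integral {-x..-x + -h} (\<lambda>x. f (-x))"
          using Henstock_Kurzweil_Integration.integral_reflect_real[of x "x+h" f] by simp
        finally have "(G (x + h) - G x) / h = integral {-x..-x + -h} (\<lambda>x. f (-x)) / (-h)"
          using h0 by (simp add: field_simps)
        then show ?thesis using d2(2)[rule_format, of "-h"] h0 h d fx by simp
      qed
    qed fact
  qed
  then show ?thesis using neg by blast
qed

section \<open>Sobolev functions and their derivative sequences\<close>

text \<open>Square integrability in the gauge sense. Measurability is a separate clause because
  integrability of the square says nothing about the sign of \<open>f\<close>.\<close>

definition L2_01 :: "(real \<Rightarrow> real) \<Rightarrow> bool" where
  "L2_01 f \<longleftrightarrow> f \<in> borel_measurable (lebesgue_on {0..1}) \<and> (\<lambda>x. (f x)\<^sup>2) integrable_on {0..1}"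

lemma L2_01_prod_integrable:
  assumes "L2_01 f" "L2_01 g"
  shows "(\<lambda>x. f x * g x) integrable_on {0..1}"
proof (rule measurable_bounded_by_integrable_imp_integrable_real)
  show "(\<lambda>x. f x * g x) \<in> borel_measurable (lebesgue_on {0..1})"
    using assms unfolding L2_01_def by (intro borel_measurable_times) auto
  show "(\<lambda>x. (f x)\<^sup>2 + (g x)\<^sup>2) integrable_on {0..1}"
    using assms unfolding L2_01_def by (intro integrable_add) auto
  show "\<bar>f x * g x\<bar> \<le> (f x)\<^sup>2 + (g x)\<^sup>2" for x
  proof -
    have "0 \<le> (\<bar>f x\<bar> - \<bar>g x\<bar>)\<^sup>2" by simp
    then have "2 * (\<bar>f x\<bar> * \<bar>g x\<bar>) \<le> (f x)\<^sup>2 + (g x)\<^sup>2" by (simp add: power2_diff)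
    moreover have "0 \<le> \<bar>f x\<bar> * \<bar>g x\<bar>" by simp
    ultimately show ?thesis unfolding abs_mult by linarith
  qed
qed simp

lemma L2_01_continuous:
  assumes "continuous_on {0..1} f"
  shows "L2_01 f"
  unfolding L2_01_def
proof
  show "f \<in> borel_measurable (lebesgue_on {0..1})"
    by (rule integrable_imp_measurable) (rule integrable_continuous_real[OF assms])
  show "(\<lambda>x. (f x)\<^sup>2) integrable_on {0..1}"
    by (intro integrable_continuous_real continuous_intros assms)
qed

lemma L2_01_integrable: "L2_01 f \<Longrightarrow> f integrable_on {0..1}"
  using L2_01_prod_integrable[of f "\<lambda>_. 1"] L2_01_continuous[of "\<lambda>_. 1"] by simp

lemma L2_01_add:
  assumes "L2_01 f" "L2_01 g"
  shows "L2_01 (\<lambda>x. f x + g x)"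
  unfolding L2_01_def
proof
  show "(\<lambda>x. f x + g x) \<in> borel_measurable (lebesgue_on {0..1})"
    using assms unfolding L2_01_def by (intro borel_measurable_add) auto
  have "(\<lambda>x. ((f x)\<^sup>2 + (g x)\<^sup>2) + 2 * (f x * g x)) integrable_on {0..1}"
    using assms L2_01_prod_integrable[OF assms] unfolding L2_01_def by (intro integrable_add integrable_on_mult_right) auto
  then show "(\<lambda>x. (f x + g x)\<^sup>2) integrable_on {0..1}"
    by (simp add: power2_sum algebra_simps)
qed

lemma L2_01_cont_mult:
  assumes "continuous_on {0..1} p" "L2_01 f"
  shows "L2_01 (\<lambda>x. p x * f x)"
  unfolding L2_01_def
proof
  have pm: "p \<in> borel_measurable (lebesgue_on {0..1})" using L2_01_continuous[OF assms(1)] unfolding L2_01_def by simp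
  show m: "(\<lambda>x. p x * f x) \<in> borel_measurable (lebesgue_on {0..1})"
    using assms pm unfolding L2_01_def by (intro borel_measurable_times) auto
  obtain B where B: "\<forall>x\<in>{0..1}. \<bar>p x\<bar> \<le> B"
    using compact_continuous_image[OF assms(1) compact_Icc, THEN compact_imp_bounded] unfolding bounded_iff by auto
  show "(\<lambda>x. (p x * f x)\<^sup>2) integrable_on {0..1}"
  proof (rule measurable_bounded_by_integrable_imp_integrable_real)
    show "(\<lambda>x. (p x * f x)\<^sup>2) \<in> borel_measurable (lebesgue_on {0..1})" using m by (rule borel_measurable_power)
    show "(\<lambda>x. B\<^sup>2 * (f x)\<^sup>2) integrable_on {0..1}" using assms(2) unfolding L2_01_def by (intro integrable_on_mult_right) auto
    show "\<bar>(p x * f x)\<^sup>2\<bar> \<le> B\<^sup>2 * (f x)\<^sup>2" if "x \<in> {0..1}" for x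
    proof -
      have "(p x)\<^sup>2 \<le> B\<^sup>2" using B[rule_format, OF that] abs_le_square_iff[of "p x" B] by fastforce
      then show ?thesis by (simp add: power_mult_distrib mult_right_mono)
    qed
  qed simp
qed

lemma L2_01_cmult: "L2_01 f \<Longrightarrow> L2_01 (\<lambda>x. c * f x)"
  by (rule L2_01_cont_mult) auto

lemma L2_01_diff:
  assumes "L2_01 f" "L2_01 g"
  shows "L2_01 (\<lambda>x. f x - g x)"
  using L2_01_add[OF assms(1) L2_01_cmult[OF assms(2), of "-1"]] by simp

lemma L2_01_abs: "L2_01 f \<Longrightarrow> L2_01 (\<lambda>x. \<bar>f x\<bar>)"
  unfolding L2_01_def by (auto intro: borel_measurable_abs)

lemma integrable_on_sub01:
  fixes f :: "real \<Rightarrow> real"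
  shows "f integrable_on {0..1} \<Longrightarrow> 0 \<le> a \<Longrightarrow> b \<le> 1 \<Longrightarrow> f integrable_on {a..b}"
  by (rule integrable_subinterval_real[of f 0 1]) auto

text \<open>A function together with its derivatives up to order \<open>m\<close>, tied by integral
  identities instead of pointwise derivatives. Thus \<open>d m\<close> matters only up to null sets,
  and linear combinations and products with smooth functions stay in the class. Entries beyond
  \<open>m\<close> are arbitrary.\<close>

definition sobolev_jet :: "nat \<Rightarrow> (nat \<Rightarrow> real \<Rightarrow> real) \<Rightarrow> bool" where
  "sobolev_jet m d \<longleftrightarrow> (\<forall>j<m. continuous_on {0..1} (d j)) \<and> L2_01 (d m) \<and>
     (\<forall>j<m. \<forall>x y. 0 \<le> x \<longrightarrow> x \<le> y \<longrightarrow> y \<le> 1 \<longrightarrow> (d (Suc j) has_integral (d j y - d j x)) {x..y})"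

lemma sobolev_jet_L2: "sobolev_jet m d \<Longrightarrow> j \<le> m \<Longrightarrow> L2_01 (d j)"
  unfolding sobolev_jet_def using L2_01_continuous[of "d j"] by (metis nat_less_le)

lemma sobolev_jet_continuous: "sobolev_jet m d \<Longrightarrow> j < m \<Longrightarrow> continuous_on {0..1} (d j)"
  unfolding sobolev_jet_def by auto

lemma sobolev_jet_ftc:
  "sobolev_jet m d \<Longrightarrow> j < m \<Longrightarrow> 0 \<le> x \<Longrightarrow> x \<le> y \<Longrightarrow> y \<le> 1 \<Longrightarrow> (d (Suc j) has_integral (d j y - d j x)) {x..y}"
  unfolding sobolev_jet_def by auto

lemma sobolev_jet_lincomb:
  assumes "sobolev_jet m d" "sobolev_jet m e"
  shows "sobolev_jet m (\<lambda>j x. d j x + s * e j x)"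
  unfolding sobolev_jet_def
proof (intro conjI allI impI)
  show "continuous_on {0..1} (\<lambda>x. d j x + s * e j x)" if "j < m" for j
    using sobolev_jet_continuous[OF assms(1) that] sobolev_jet_continuous[OF assms(2) that] by (intro continuous_intros)
  show "L2_01 (\<lambda>x. d m x + s * e m x)"
    using assms by (intro L2_01_add L2_01_cmult sobolev_jet_L2[of m]) auto
  show "((\<lambda>x. d (Suc j) x + s * e (Suc j) x) has_integral (d j y + s * e j y - (d j x + s * e j x))) {x..y}"
    if "j < m" "0 \<le> x" "x \<le> y" "y \<le> 1" for j x y
    using has_integral_add[OF sobolev_jet_ftc[OF assms(1) that] has_integral_mult_right[OF sobolev_jet_ftc[OF assms(2) that], of s]]
    by (simp add: algebra_simps)
qed

lemma sobolev_jet_shift: "sobolev_jet (Suc m) d \<Longrightarrow> sobolev_jet m (\<lambda>j. d (Suc j))"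
  unfolding sobolev_jet_def by auto

text \<open>Only the top order is delicate. The derivative of order \<open>m - 1\<close> is the
  integral of some \<open>g\<close>; almost everywhere it is differentiable with derivative
  \<open>g\<close>, so \<open>nderiv m f\<close> may replace \<open>g\<close> in integrals despite
  its unspecified values elsewhere.\<close>

lemma sobolev_imp_jet:
  assumes f: "f \<in> sobolev m 2" and m: "m \<ge> 1"
  shows "sobolev_jet m (\<lambda>j. nderiv j f)"
proof -
  define F where "F = nderiv (m - 1) f"
  have Sm: "Suc (m - 1) = m" using m by simp
  have ck: "Ck_01 (m - 1) f" and ac: "abs_cont_on 0 1 F" and lp: "Lp_01 2 (nderiv m f)"
    using f unfolding sobolev_def F_def by auto
  have diff: "nderiv j f differentiable_on {0..1}" if "j < m - 1" for j
    using ck that unfolding Ck_01_def by auto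
  have cont: "continuous_on {0..1} (nderiv j f)" if "j < m" for j
  proof (cases "j = m - 1")
    case True then show ?thesis using ck unfolding Ck_01_def by simp
  next
    case False then show ?thesis using that by (intro differentiable_imp_continuous_on diff) auto
  qed
  obtain g where g: "g absolutely_integrable_on {0..1}" "\<And>x. x \<in> {0..1} \<Longrightarrow> (g has_integral (F x - F 0)) {0..x}"
    by (rule abs_cont_on_has_integral[OF ac]) (rule that)
  have gi: "g integrable_on {0..1}" using g(1) set_lebesgue_integral_eq_integral(1) by blast
  have "F x = F 0 + integral {0..x} g" if "x \<in> {0..1}" for x
    using integral_unique[OF g(2)[OF that]] by simp
  from indefinite_integral_deriv_ae[OF gi this] obtain N where N: "negligible N"
      "\<forall>x\<in>{0<..<1} - N. (F has_real_derivative g x) (at x)" by blast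
  have neg: "negligible (N \<union> {0, 1})" using N(1) by simp
  have eq: "nderiv m f x = g x" if "x \<in> {0..1} - (N \<union> {0,1})" for x
  proof -
    have x: "x \<in> {0<..<1} - N" using that by auto
    then have "(F has_vector_derivative g x) (at x)"
      using N(2) has_real_derivative_iff_has_vector_derivative by blast
    then have "vector_derivative F (at x within {0..1}) = g x"
      using x by (intro vector_derivative_at_within_ivl) auto
    moreover have "nderiv m f = nderiv (Suc (m - 1)) f" using Sm by simp
    ultimately show ?thesis unfolding F_def by simp
  qed
  have top: "(nderiv m f has_integral (F y - F x)) {x..y}" if "0 \<le> x" "x \<le> y" "y \<le> 1" for x y
  proof (rule has_integral_spike[OF neg])
    show "nderiv m f t = g t" if "t \<in> {x..y} - (N \<union> {0,1})" for t
    proof (rule eq)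
      have "{x..y} \<subseteq> {0..1}" using \<open>0 \<le> x\<close> \<open>y \<le> 1\<close> by auto
      then show "t \<in> {0..1} - (N \<union> {0,1})" using that by blast
    qed
    have "integral {0..x} g + integral {x..y} g = integral {0..y} g"
      using that gi by (intro Henstock_Kurzweil_Integration.integral_combine integrable_on_sub01[OF gi]) auto
    then have "integral {x..y} g = F y - F x"
      using integral_unique[OF g(2)[of x]] integral_unique[OF g(2)[of y]] that by simp
    moreover have "g integrable_on {x..y}" using that by (intro integrable_on_sub01[OF gi]) auto
    ultimately show "(g has_integral F y - F x) {x..y}" by (metis integrable_integral)
  qed
  have "integrable (lebesgue_on {0<..<1}) (\<lambda>x. \<bar>nderiv m f x\<bar> powr 2)"
    using lp unfolding Lp_01_def by (simp split: if_splits)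
  then have "integrable (lebesgue_on {0<..<1}) (\<lambda>x. (nderiv m f x)\<^sup>2)"
    by (simp add: powr_numeral)
  then have "(\<lambda>x. (nderiv m f x)\<^sup>2) integrable_on {0<..<1}"
    by (rule integrable_on_lebesgue_on) simp
  then have sq: "(\<lambda>x. (nderiv m f x)\<^sup>2) integrable_on {0..1}"
    by (simp add: integrable_on_Icc_iff_Ioo)
  have meas: "nderiv m f \<in> borel_measurable (lebesgue_on {0..1})"
    using top[of 0 1] by (intro integrable_imp_measurable) (auto simp: integrable_on_def)
  show ?thesis
    unfolding sobolev_jet_def
  proof (intro conjI allI impI)
    show "L2_01 (nderiv m f)" using sq meas unfolding L2_01_def by blast
    fix j and x y :: real assume j: "j < m" and xy: "0 \<le> x" "x \<le> y" "y \<le> 1"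
    show "(nderiv (Suc j) f has_integral (nderiv j f y - nderiv j f x)) {x..y}"
    proof (cases "j = m - 1")
      case True
      then show ?thesis using top[OF xy] Sm F_def by simp
    next
      case False
      then have j': "j < m - 1" using j by simp
      show ?thesis
      proof (rule fundamental_theorem_of_calculus)
        show "(nderiv j f has_vector_derivative nderiv (Suc j) f t) (at t within {x..y})" if "t \<in> {x..y}" for t
        proof (rule has_vector_derivative_within_subset)
          have "nderiv j f differentiable (at t within {0..1})"
            using diff[OF j'] that xy unfolding differentiable_on_def by auto
          then show "(nderiv j f has_vector_derivative nderiv (Suc j) f t) (at t within {0..1})"
            by (simp add: vector_derivative_works)
          show "{x..y} \<subseteq> {0..1}" using xy by auto
        qed
      qed (rule xy)
    qed
  qed (use cont in auto)
qed

lemma sobolev_infinity: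
  assumes "f \<in> sobolev m \<infinity>"
  shows "f \<in> sobolev m 2"
    and "\<exists>B N. negligible N \<and> (\<forall>x\<in>{0..1} - N. \<bar>nderiv m f x\<bar> \<le> B)"
proof -
  have m: "nderiv m f \<in> borel_measurable (lebesgue_on {0<..<1})" and fin: "Linf_norm (nderiv m f) < \<infinity>"
    using assms unfolding sobolev_def Lp_01_def by auto
  obtain B :: real where B: "Linf_norm (nderiv m f) \<le> ereal B"
    using fin by (cases "Linf_norm (nderiv m f)") auto
  have "AE x in lebesgue_on {0<..<1}. ereal \<bar>nderiv m f x\<bar> \<le> Linf_norm (nderiv m f)"
    unfolding Linf_norm_def by (rule esssup_AE)
  then have ae: "AE x in lebesgue_on {0<..<1}. \<bar>nderiv m f x\<bar> \<le> B"
    by eventually_elim (use B order_trans ereal_less_eq(3) in blast)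
  have "integrable (lebesgue_on {0<..<1}) (\<lambda>x. \<bar>nderiv m f x\<bar> powr 2)"
  proof (rule Bochner_Integration.integrable_bound[where f="\<lambda>_. B\<^sup>2"])
    have "finite_measure (lebesgue_on {0<..<1::real})"
      by (rule finite_measure_lebesgue_on) simp
    then show "integrable (lebesgue_on {0<..<1::real}) (\<lambda>_. B\<^sup>2)"
      by (rule finite_measure.integrable_const)
    show "(\<lambda>x. \<bar>nderiv m f x\<bar> powr 2) \<in> borel_measurable (lebesgue_on {0<..<1})" using m by measurable
    show "AE x in lebesgue_on {0<..<1}. norm (\<bar>nderiv m f x\<bar> powr 2) \<le> norm (B\<^sup>2)"
      using ae
    proof eventually_elim
      case (elim x)
      then have "\<bar>nderiv m f x\<bar> \<le> \<bar>B\<bar>" by simp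
      then show ?case by (simp add: powr_numeral abs_le_square_iff)
    qed
  qed
  then show "f \<in> sobolev m 2"
    using assms m unfolding sobolev_def Lp_01_def by auto
  have "AE x in lebesgue. x \<in> {0<..<1} \<longrightarrow> \<bar>nderiv m f x\<bar> \<le> B"
    using ae by (subst (asm) AE_restrict_space_iff) auto
  then obtain N where N: "N \<in> null_sets lebesgue" "{x. \<not> (x \<in> {0<..<1} \<longrightarrow> \<bar>nderiv m f x\<bar> \<le> B)} \<subseteq> N"
    by (auto simp: eventually_ae_filter)
  then have "negligible (N \<union> {0,1})" by (simp add: negligible_iff_null_sets)
  moreover have "\<bar>nderiv m f x\<bar> \<le> B" if x: "x \<in> {0..1} - (N \<union> {0,1})" for x
  proof (rule ccontr)
    assume "\<not> \<bar>nderiv m f x\<bar> \<le> B"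
    then have "x \<in> {x. \<not> (x \<in> {0<..<1} \<longrightarrow> \<bar>nderiv m f x\<bar> \<le> B)}" using x by auto
    then show False using N(2) x by blast
  qed
  ultimately show "\<exists>B N. negligible N \<and> (\<forall>x\<in>{0..1} - N. \<bar>nderiv m f x\<bar> \<le> B)" by blast
qed


section \<open>From derivative sequences back to Sobolev functions\<close>

lemma sum_disjoint_integrals_le:
  fixes f :: "real \<Rightarrow> real" and N :: nat
  assumes "f integrable_on {0..1}" "\<And>x. 0 \<le> f x"
    and uv: "\<forall>i<N. 0 \<le> u i \<and> u i \<le> v i \<and> v i \<le> 1" and dj: "disjoint_family_on (\<lambda>i. {u i<..<v i}) {..<N}"
  shows "(\<Sum>i<N. integral {u i..v i} f) \<le> integral {0..1} f"
proof -
  let ?g = "\<lambda>i x. if x \<in> {u i<..<v i} then f x else 0"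
  have fi: "f integrable_on {u i<..<v i}" if "i < N" for i
    using integrable_on_sub01[OF assms(1)] uv that by (simp add: integrable_on_Icc_iff_Ioo[symmetric])
  have gi: "?g i integrable_on {0..1}" if "i < N" for i
  proof -
    have "{u i<..<v i} \<subseteq> {0..1}" using uv that by fastforce
    then have "{0..1} \<inter> {u i<..<v i} = {u i<..<v i}" by blast
    then show ?thesis using fi[OF that] integrable_restrict_Int[of "{u i<..<v i}" f "{0..1}"] by (simp add: Int_commute)
  qed
  have ge: "integral {u i..v i} f = integral {0..1} (?g i)" if "i < N" for i
  proof -
    have "{u i<..<v i} \<subseteq> {0..1}" using uv that by fastforce
    then have "{u i<..<v i} \<inter> {0..1} = {u i<..<v i}" by blast
    then show ?thesis using integral_restrict_Int[of "{0..1}" "{u i<..<v i}" f] by (simp add: integral_open_interval_real Int_commute)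
  qed
  have "(\<Sum>i<N. integral {u i..v i} f) = integral {0..1} (\<lambda>x. \<Sum>i<N. ?g i x)"
    using gi ge by (subst Henstock_Kurzweil_Integration.integral_sum) auto
  also have "\<dots> \<le> integral {0..1} f"
  proof (rule integral_le)
    show "(\<lambda>x. \<Sum>i<N. ?g i x) integrable_on {0..1}" using gi by (intro integrable_sum) auto
    fix x :: real
    show "(\<Sum>i<N. ?g i x) \<le> f x"
    proof (cases "\<exists>i<N. x \<in> {u i<..<v i}")
      case True
      then obtain k where k: "k < N" "x \<in> {u k<..<v k}" by blast
      have "?g i x = (if i = k then f x else 0)" if "i < N" for i
      proof (cases "i = k")
        case False
        then have "{u i<..<v i} \<inter> {u k<..<v k} = {}" using dj k(1) \<open>i < N\<close> unfolding disjoint_family_on_def by simp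
        then have "x \<notin> {u i<..<v i}" using k(2) by blast
        then show ?thesis using False by (auto simp del: greaterThanLessThan_iff)
      qed (use k in simp)
      then have "(\<Sum>i<N. ?g i x) = (\<Sum>i<N. if i = k then f x else 0)" by (intro sum.cong) auto
      then show ?thesis using k by simp
    next
      case False
      then have "(\<Sum>i<N. ?g i x) = 0" by (intro sum.neutral) auto
      then show ?thesis using assms(2) by simp
    qed
  qed (rule assms(1))
  finally show ?thesis .
qed

text \<open>Young's inequality under the integral. The free parameter \<open>s\<close> keeps both
  terms additive over families of intervals.\<close>

lemma abs_integral_le_square:
  assumes v: "L2_01 v" and ab: "0 \<le> a" "a \<le> b" "b \<le> 1" and s: "s > 0"
  shows "\<bar>integral {a..b} v\<bar> \<le> s / 2 * integral {a..b} (\<lambda>x. (v x)\<^sup>2) + (b - a) / (2 * s)"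
proof -
  have v2: "(\<lambda>x. (v x)\<^sup>2) integrable_on {a..b}" and v1: "v integrable_on {a..b}"
    using v L2_01_integrable[OF v] ab unfolding L2_01_def by (auto dest: integrable_on_sub01[where a=a and b=b])
  have "norm (integral {a..b} v) \<le> integral {a..b} (\<lambda>x. s / 2 * (v x)\<^sup>2 + 1 / (2 * s))"
  proof (rule integral_norm_bound_integral)
    show "v integrable_on {a..b}" by (rule v1)
    show "(\<lambda>x. s / 2 * (v x)\<^sup>2 + 1 / (2 * s)) integrable_on {a..b}"
      using v2 by (intro integrable_add integrable_on_mult_right) auto
    show "norm (v x) \<le> s / 2 * (v x)\<^sup>2 + 1 / (2 * s)" for x
    proof -
      have "0 \<le> (s * \<bar>v x\<bar> - 1)\<^sup>2 / (2 * s)" using s by simp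
      also have "\<dots> = s / 2 * (v x)\<^sup>2 + 1 / (2 * s) - \<bar>v x\<bar>"
        using s by (simp add: power2_diff power_mult_distrib field_simps power2_eq_square)
      finally show ?thesis by simp
    qed
  qed
  also have "\<dots> = s / 2 * integral {a..b} (\<lambda>x. (v x)\<^sup>2) + (b - a) / (2 * s)"
    using v2 ab by (subst Henstock_Kurzweil_Integration.integral_add) (auto intro: integrable_on_mult_right)
  finally show ?thesis by simp
qed

lemma indefinite_L2_integral_abs_cont:
  assumes v: "L2_01 v" and F: "\<And>x y. 0 \<le> x \<Longrightarrow> x \<le> y \<Longrightarrow> y \<le> 1 \<Longrightarrow> F y - F x = integral {x..y} v"
  shows "abs_cont_on 0 1 F"
  unfolding abs_cont_on_def
proof (intro allI impI)
  fix e :: real assume e: "e > 0"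
  define A where "A = integral {0..1} (\<lambda>x. (v x)\<^sup>2)"
  have A: "A \<ge> 0" unfolding A_def by (intro Henstock_Kurzweil_Integration.integral_nonneg) (use v in \<open>auto simp: L2_01_def\<close>)
  \<comment> \<open>This \<open>s\<close> keeps the square-integral part below \<open>e / 2\<close>
    for every disjoint family; the length part then dictates the threshold
    \<open>s * e\<close>.\<close>
  define s where "s = e / (A + 1)"
  have s: "s > 0" unfolding s_def using e A by simp
  show "\<exists>d>0. \<forall>(N::nat) u v. (\<forall>i<N. 0 \<le> u i \<and> u i \<le> v i \<and> v i \<le> 1) \<longrightarrow>
      disjoint_family_on (\<lambda>i. {u i<..<v i}) {..<N} \<longrightarrow> (\<Sum>i<N. v i - u i) < d \<longrightarrow>
      (\<Sum>i<N. \<bar>F (v i) - F (u i)\<bar>) < e"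
  proof (intro exI[of _ "s * e"] conjI allI impI)
    show "s * e > 0" using s e by simp
    fix N :: nat and p q
    assume N: "\<forall>i<N. 0 \<le> p i \<and> p i \<le> q i \<and> q i \<le> (1::real)"
      "disjoint_family_on (\<lambda>i. {p i<..<q i}) {..<N}" "(\<Sum>i<N. q i - p i) < s * e"
    have "(\<Sum>i<N. \<bar>F (q i) - F (p i)\<bar>) \<le> (\<Sum>i<N. s / 2 * integral {p i..q i} (\<lambda>x. (v x)\<^sup>2) + (q i - p i) / (2 * s))"
      using N(1) F abs_integral_le_square[OF v _ _ _ s] by (intro sum_mono) auto
    also have "\<dots> = s / 2 * (\<Sum>i<N. integral {p i..q i} (\<lambda>x. (v x)\<^sup>2)) + (\<Sum>i<N. q i - p i) / (2 * s)"
      by (simp add: sum.distrib sum_distrib_left sum_divide_distrib)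
    also have "\<dots> < s / 2 * A + (s * e) / (2 * s)"
    proof (intro add_le_less_mono)
      show "s / 2 * (\<Sum>i<N. integral {p i..q i} (\<lambda>x. (v x)\<^sup>2)) \<le> s / 2 * A"
        unfolding A_def using s v N(1,2) by (intro mult_left_mono sum_disjoint_integrals_le) (auto simp: L2_01_def)
      show "(\<Sum>i<N. q i - p i) / (2 * s) < (s * e) / (2 * s)" using N(3) s by (intro divide_strict_right_mono) auto
    qed
    also have "\<dots> \<le> e / 2 + e / 2"
    proof (intro add_mono)
      have "e * A \<le> e * (A + 1)" using e by simp
      then show "s / 2 * A \<le> e / 2" unfolding s_def using A e by (simp add: field_simps)
    qed (use s in auto)
    finally show "(\<Sum>i<N. \<bar>F (q i) - F (p i)\<bar>) < e" by simp
  qed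
qed

text \<open>The converse of \<open>sobolev_imp_jet\<close>: it makes perturbations built from
  derivative sequences admissible competitors and computes their penalty. Below order
  \<open>m\<close> the derivatives exist everywhere by continuity; at order \<open>m\<close> only
  almost everywhere, which the integral does not see.\<close>

lemma jet_imp_sobolev:
  assumes d: "sobolev_jet m d" and m: "m \<ge> 1" and f: "\<And>x. x \<in> {0..1} \<Longrightarrow> f x = d 0 x"
  shows "f \<in> sobolev m 2" and "(L2_norm (nderiv m f))\<^sup>2 = integral {0..1} (\<lambda>x. (d m x)\<^sup>2)"
proof -
  have Sm: "Suc (m - 1) = m" using m by simp
  have vd: "(d j has_vector_derivative d (Suc j) x) (at x within {0..1})" if "Suc j < m" "x \<in> {0..1}" for j x
  proof (rule has_vector_derivative_transform[OF that(2)])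
    have c: "continuous_on {0..1} (d (Suc j))" using sobolev_jet_continuous[OF d that(1)] .
    show "((\<lambda>t. d j 0 + integral {0..t} (d (Suc j))) has_vector_derivative d (Suc j) x) (at x within {0..1})"
      using has_vector_derivative_add[OF has_vector_derivative_const integral_has_vector_derivative[OF c that(2)], of "d j 0"] by simp
    show "d j t = d j 0 + integral {0..t} (d (Suc j))" if "t \<in> {0..1}" for t
      using integral_unique[OF sobolev_jet_ftc[OF d, of j 0 t]] \<open>Suc j < m\<close> that by simp
  qed
  have eq: "\<forall>x\<in>{0..1}. nderiv j f x = d j x" if "j < m" for j
    using that
  proof (induction j)
    case 0 then show ?case using f by simp
  next
    case (Suc j)
    show ?case
    proof
      fix x :: real assume x: "x \<in> {0..1}"
      have "(nderiv j f has_vector_derivative d (Suc j) x) (at x within {0..1})"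
        using Suc by (intro has_vector_derivative_transform[OF x _ vd[OF Suc.prems x]]) auto
      then show "nderiv (Suc j) f x = d (Suc j) x"
        using vector_derivative_within_cbox[of 0 1 x "nderiv j f"] x by simp
    qed
  qed
  have diff: "nderiv j f differentiable_on {0..1}" if "j < m - 1" for j
    unfolding differentiable_on_def
  proof
    fix x :: real assume x: "x \<in> {0..1}"
    have "(nderiv j f has_vector_derivative d (Suc j) x) (at x within {0..1})"
      using eq[of j] that by (intro has_vector_derivative_transform[OF x _ vd[OF _ x]]) auto
    then show "nderiv j f differentiable (at x within {0..1})"
      using has_vector_derivative_def differentiable_def by blast
  qed
  have cont: "continuous_on {0..1} (nderiv (m-1) f)"
    by (rule continuous_on_eq[OF sobolev_jet_continuous[OF d, of "m-1"]]) (use eq[of "m-1"] m in auto)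
  have dm: "L2_01 (d m)" using sobolev_jet_L2[OF d] by simp
  have ftc: "nderiv (m-1) f y - nderiv (m-1) f x = integral {x..y} (d m)" if "0 \<le> x" "x \<le> y" "y \<le> 1" for x y
    using integral_unique[OF sobolev_jet_ftc[OF d, of "m-1" x y]] that eq[of "m-1"] m by simp
  have ac: "abs_cont_on 0 1 (nderiv (m-1) f)"
    by (rule indefinite_L2_integral_abs_cont[OF dm ftc])
  have "nderiv (m-1) f x = nderiv (m-1) f 0 + integral {0..x} (d m)" if "x \<in> {0..1}" for x
    using ftc[of 0 x] that by simp
  from indefinite_integral_deriv_ae[OF L2_01_integrable[OF dm] this] obtain N where N: "negligible N"
      "\<forall>x\<in>{0<..<1} - N. (nderiv (m-1) f has_real_derivative d m x) (at x)" by blast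
  have eqm: "nderiv m f x = d m x" if x: "x \<in> {0<..<1} - N" for x
  proof -
    have "(nderiv (m-1) f has_vector_derivative d m x) (at x)"
      using N(2) x has_real_derivative_iff_has_vector_derivative by blast
    then have "vector_derivative (nderiv (m-1) f) (at x within {0..1}) = d m x"
      using x by (intro vector_derivative_at_within_ivl) auto
    moreover have "nderiv m f = nderiv (Suc (m - 1)) f" using Sm by simp
    ultimately show ?thesis by simp
  qed
  have i0: "d m integrable_on {0<..<1}" "(\<lambda>x. (d m x)\<^sup>2) integrable_on {0<..<1}"
    using L2_01_integrable[OF dm] dm unfolding L2_01_def by (auto simp: integrable_on_Icc_iff_Ioo)
  have i1: "nderiv m f integrable_on {0<..<1}"
    by (rule integrable_spike[OF i0(1) N(1)]) (use eqm in auto)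
  have i2: "(\<lambda>x. (nderiv m f x)\<^sup>2) integrable_on {0<..<1}"
    by (rule integrable_spike[OF i0(2) N(1)]) (use eqm in auto)
  have int2: "integrable (lebesgue_on {0<..<1}) (\<lambda>x. (nderiv m f x)\<^sup>2)"
    using nonnegative_absolutely_integrable_1[OF i2] by (simp add: absolutely_integrable_on_def set_integrable_def integrable_restrict_space)
  then have "integrable (lebesgue_on {0<..<1}) (\<lambda>x. \<bar>nderiv m f x\<bar> powr 2)"
    by (simp add: powr_numeral)
  then have lp: "Lp_01 2 (nderiv m f)"
    unfolding Lp_01_def using integrable_imp_measurable[OF i1] by simp
  show "f \<in> sobolev m 2"
    unfolding sobolev_def Ck_01_def using diff cont ac lp by auto
  have "integral\<^sup>L (lebesgue_on {0<..<1}) (\<lambda>x. (nderiv m f x)\<^sup>2) = integral {0<..<1} (\<lambda>x. (nderiv m f x)\<^sup>2)"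
    by (rule lebesgue_integral_eq_integral[OF int2]) simp
  also have "\<dots> = integral {0<..<1} (\<lambda>x. (d m x)\<^sup>2)"
    by (rule integral_spike[OF N(1)]) (use eqm in auto)
  also have "\<dots> = integral {0..1} (\<lambda>x. (d m x)\<^sup>2)" by (rule integral_open_interval_real[symmetric])
  finally have *: "integral\<^sup>L (lebesgue_on {0<..<1}) (\<lambda>x. (nderiv m f x)\<^sup>2) = integral {0..1} (\<lambda>x. (d m x)\<^sup>2)" .
  have "0 \<le> integral\<^sup>L (lebesgue_on {0<..<1}) (\<lambda>x. (nderiv m f x)\<^sup>2)"
    by (rule Bochner_Integration.integral_nonneg) simp
  then show "(L2_norm (nderiv m f))\<^sup>2 = integral {0..1} (\<lambda>x. (d m x)\<^sup>2)"
    unfolding L2_norm_def using * by simp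
qed


text \<open>Over n equal pieces of [x,y] the bounds sum to \<open>C * (y - x) / n\<close> times the
  telescoping increment of \<open>V\<close>, which tends to 0. It serves to identify two functions
  that agree locally to second order.\<close>

lemma increments_zero_of_quadratic_bound:
  fixes F V :: "real \<Rightarrow> real"
  assumes bound: "\<And>a b. x \<le> a \<Longrightarrow> a \<le> b \<Longrightarrow> b \<le> y \<Longrightarrow> \<bar>F b - F a\<bar> \<le> C * (b - a) * (V b - V a)"
    and xy: "x \<le> y"
  shows "F y = F x"
proof -
  have le: "\<bar>F y - F x\<bar> \<le> (C * (y - x) * (V y - V x)) / real (Suc N)" for N
  proof -
    define n where "n = Suc N"
    define t where "t i = x + real i / real n * (y - x)" for i
    have n: "real n > 0" unfolding n_def by simp
    have t0: "t 0 = x" "t n = y" unfolding t_def using n by auto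
    have inc: "t (Suc i) - t i = (y - x) / real n" for i unfolding t_def using n by (simp add: field_simps)
    have tm: "t i \<le> t (Suc i)" for i using inc[of i] xy n by (simp add: algebra_simps)
    have tx: "x \<le> t i" for i unfolding t_def using xy by simp
    have ty: "t i \<le> y" if "i \<le> n" for i
    proof -
      have "real i / real n * (y - x) \<le> 1 * (y - x)" using that n xy by (intro mult_right_mono) auto
      then show ?thesis unfolding t_def by simp
    qed
    have "F y - F x = (\<Sum>i<n. F (t (Suc i)) - F (t i))"
      using sum_lessThan_telescope[of "\<lambda>i. F (t i)" n] t0 by simp
    then have "\<bar>F y - F x\<bar> \<le> (\<Sum>i<n. \<bar>F (t (Suc i)) - F (t i)\<bar>)" by (metis sum_abs)
    also have "\<dots> \<le> (\<Sum>i<n. C * ((y - x) / real n) * (V (t (Suc i)) - V (t i)))"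
    proof (intro sum_mono)
      fix i assume "i \<in> {..<n}"
      then show "\<bar>F (t (Suc i)) - F (t i)\<bar> \<le> C * ((y - x) / real n) * (V (t (Suc i)) - V (t i))"
        using bound[OF tx tm ty[of "Suc i"]] inc[of i] by simp
    qed
    also have "\<dots> = C * ((y - x) / real n) * (\<Sum>i<n. V (t (Suc i)) - V (t i))" by (simp add: sum_distrib_left)
    also have "(\<Sum>i<n. V (t (Suc i)) - V (t i)) = V y - V x"
      using sum_lessThan_telescope[of "\<lambda>i. V (t i)" n] t0 by simp
    finally show ?thesis unfolding n_def by simp
  qed
  have "(\<lambda>N. (C * (y - x) * (V y - V x)) / real (Suc N)) \<longlonglongrightarrow> 0"
    using LIMSEQ_inverse_real_of_nat[THEN tendsto_mult_right_zero] by (simp add: divide_inverse)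
  then have "\<bar>F y - F x\<bar> \<le> 0" by (rule LIMSEQ_le_const) (use le in auto)
  then show ?thesis by simp
qed

text \<open>\<open>u\<close> is only absolutely continuous, so the classical product rule does not
  apply. \<open>F\<close> is the product minus the candidate primitive; its increment is at most a
  constant times the length of the interval times the variation \<open>V\<close> of \<open>u\<close>
  on it, hence \<open>F\<close> is constant.\<close>

lemma has_integral_mult_C1_deriv:
  fixes p p' u v :: "real \<Rightarrow> real"
  assumes p: "\<And>t. t \<in> {0..1} \<Longrightarrow> (p has_real_derivative p' t) (at t)" and p': "continuous_on {0..1} p'"
    and v: "L2_01 v" and u: "\<And>s t. 0 \<le> s \<Longrightarrow> s \<le> t \<Longrightarrow> t \<le> 1 \<Longrightarrow> (v has_integral (u t - u s)) {s..t}"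
    and uc: "continuous_on {0..1} u"
    and xy: "0 \<le> x" "x \<le> y" "y \<le> 1"
  shows "((\<lambda>s. p' s * u s + p s * v s) has_integral (p y * u y - p x * u x)) {x..y}"
proof -
  have pc: "continuous_on {0..1} p"
    using p by (intro continuous_at_imp_continuous_on ballI DERIV_isCont) auto
  have w2: "L2_01 (\<lambda>s. p' s * u s + p s * v s)"
    by (intro L2_01_add L2_01_cont_mult L2_01_continuous p' pc uc v)
  define w where "w s = p' s * u s + p s * v s" for s
  have wi: "w integrable_on {0..1}" unfolding w_def using L2_01_integrable[OF w2] .
  have vi: "v integrable_on {0..1}" and avi: "(\<lambda>s. \<bar>v s\<bar>) integrable_on {0..1}"
    using L2_01_integrable[OF v] L2_01_integrable[OF L2_01_abs[OF v]] by auto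
  obtain K0 where K0: "\<forall>s\<in>{0..1}. \<bar>p' s\<bar> \<le> K0"
    using compact_continuous_image[OF p' compact_Icc, THEN compact_imp_bounded] unfolding bounded_iff by auto
  define K where "K = \<bar>K0\<bar>"
  have K: "\<And>s. s \<in> {0..1} \<Longrightarrow> \<bar>p' s\<bar> \<le> K" "K \<ge> 0" unfolding K_def using K0 by fastforce+
  define V where "V t = integral {0..t} (\<lambda>s. \<bar>v s\<bar>)" for t
  define F where "F t = p t * u t - integral {0..t} w" for t
  have diffV: "V b - V a = integral {a..b} (\<lambda>s. \<bar>v s\<bar>)" if "0 \<le> a" "a \<le> b" "b \<le> 1" for a b
  proof -
    have "integral {0..a} (\<lambda>s. \<bar>v s\<bar>) + integral {a..b} (\<lambda>s. \<bar>v s\<bar>) = integral {0..b} (\<lambda>s. \<bar>v s\<bar>)"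
      using that by (intro Henstock_Kurzweil_Integration.integral_combine integrable_on_sub01[OF avi]) auto
    then show ?thesis unfolding V_def by simp
  qed
  have diffw: "integral {0..b} w - integral {0..a} w = integral {a..b} w" if "0 \<le> a" "a \<le> b" "b \<le> 1" for a b
  proof -
    have "integral {0..a} w + integral {a..b} w = integral {0..b} w"
      using that by (intro Henstock_Kurzweil_Integration.integral_combine integrable_on_sub01[OF wi]) auto
    then show ?thesis by simp
  qed
  have ud: "\<bar>u t - u s\<bar> \<le> V b - V a" if "0 \<le> a" "a \<le> s" "s \<le> t" "t \<le> b" "b \<le> 1" for a b s t
  proof -
    have "norm (integral {s..t} v) \<le> integral {s..t} (\<lambda>s. \<bar>v s\<bar>)"
      using that by (intro integral_norm_bound_integral integrable_on_sub01[OF vi] integrable_on_sub01[OF avi]) auto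
    also have "\<dots> \<le> integral {a..b} (\<lambda>s. \<bar>v s\<bar>)"
      using that by (intro integral_subset_le integrable_on_sub01[OF avi]) auto
    finally show ?thesis using integral_unique[OF u[of s t]] diffV[of a b] that by simp
  qed
  have pd: "\<bar>p t - p s\<bar> \<le> K * (t - s)" if "0 \<le> s" "s \<le> t" "t \<le> 1" for s t
  proof (cases "s = t")
    case False
    have "\<exists>z. s < z \<and> z < t \<and> p t - p s = (t - s) * p' z"
      using False that by (intro MVT2 p) auto
    then obtain z where z: "z > s" "z < t" "p t - p s = (t - s) * p' z" by blast
    have "\<bar>p' z\<bar> \<le> K" using K(1)[of z] z that by simp
    then show ?thesis using z that by (simp add: abs_mult mult.commute mult_left_mono)
  qed (use K in auto)
  have p'i: "(p' has_integral (p b - p a)) {a..b}" if "0 \<le> a" "a \<le> b" "b \<le> 1" for a b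
  proof (rule fundamental_theorem_of_calculus)
    fix t assume t: "t \<in> {a..b}"
    have "(p has_vector_derivative p' t) (at t)"
      using p[of t] t that by (simp add: has_real_derivative_iff_has_vector_derivative)
    then show "(p has_vector_derivative p' t) (at t within {a..b})" by (rule has_vector_derivative_at_within)
  qed (use that in auto)
  have "F y = F x"
  proof (rule increments_zero_of_quadratic_bound[where C="2*K" and V=V and x=x and y=y])
    fix a b assume ab: "x \<le> a" "a \<le> b" "b \<le> y"
    have ab01: "0 \<le> a" "b \<le> 1" using ab xy by auto
    have wab: "w integrable_on {a..b}" using ab01 by (intro integrable_on_sub01[OF wi])
    \<comment> \<open>Freezing \<open>u\<close> at the right end and \<open>p\<close> at the left
      end makes the product formula for increments exact; the error against \<open>w\<close>
      integrates to a product of two increments.\<close>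
    have "((\<lambda>s. p' s * u b + p a * v s) has_integral ((p b - p a) * u b + p a * (u b - u a))) {a..b}"
      by (intro has_integral_add has_integral_mult_left has_integral_mult_right p'i u ab ab01)
    from has_integral_diff[OF this integrable_integral[OF wab]]
    have R: "((\<lambda>s. (p' s * u b + p a * v s) - w s) has_integral (F b - F a)) {a..b}"
      using diffw[OF ab01(1) ab(2) ab01(2)] unfolding F_def by (simp add: algebra_simps)
    have B: "((\<lambda>s. K * (V b - V a) + K * (b - a) * \<bar>v s\<bar>) has_integral
        (K * (V b - V a) * (b - a) + K * (b - a) * (V b - V a))) {a..b}"
    proof (intro has_integral_add has_integral_mult_right)
      show "((\<lambda>s. K * (V b - V a)) has_integral K * (V b - V a) * (b - a)) {a..b}"
        using has_integral_const_real[of "K * (V b - V a)" a b] ab by (simp add: mult.commute)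
      show "((\<lambda>s. \<bar>v s\<bar>) has_integral V b - V a) {a..b}"
        using integrable_integral[OF integrable_on_sub01[OF avi ab01]] diffV[OF ab01(1) ab(2) ab01(2)] by simp
    qed
    have "norm (F b - F a) \<le> K * (V b - V a) * (b - a) + K * (b - a) * (V b - V a)"
      unfolding integral_unique[OF R, symmetric] integral_unique[OF B, symmetric]
    proof (rule integral_norm_bound_integral)
      fix s assume s: "s \<in> {a..b}"
      have "(p' s * u b + p a * v s) - w s = p' s * (u b - u s) + (p a - p s) * v s"
        unfolding w_def by (simp add: algebra_simps)
      moreover have "\<bar>p' s * (u b - u s)\<bar> \<le> K * (V b - V a)"
        unfolding abs_mult using K s ab01 ud[of a s b b] by (intro mult_mono) auto
      moreover have "\<bar>(p a - p s) * v s\<bar> \<le> K * (b - a) * \<bar>v s\<bar>"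
      proof -
        have "\<bar>p a - p s\<bar> \<le> K * (s - a)" using pd[of a s] s ab01 by (simp add: abs_minus_commute)
        also have "\<dots> \<le> K * (b - a)" using s K by (intro mult_left_mono) auto
        finally show ?thesis unfolding abs_mult by (intro mult_right_mono) auto
      qed
      ultimately show "norm ((p' s * u b + p a * v s) - w s) \<le> K * (V b - V a) + K * (b - a) * \<bar>v s\<bar>"
        by simp
    qed (use R B in \<open>auto simp: integrable_on_def\<close>)
    then show "\<bar>F b - F a\<bar> \<le> 2 * K * (b - a) * (V b - V a)" by (simp add: algebra_simps)
  qed (rule xy)
  then have "p y * u y - p x * u x = integral {x..y} w"
    unfolding F_def using diffw[OF xy] by simp
  moreover have "w integrable_on {x..y}" using xy by (intro integrable_on_sub01[OF wi])
  ultimately show ?thesis unfolding w_def by (metis (no_types, lifting) integrable_integral)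
qed

text \<open>The \<open>k\<close>-th derivative of the product of two functions given by their sequences of derivatives;
  the recursion replaces the binomial sum.\<close>

primrec leibniz :: "nat \<Rightarrow> (nat \<Rightarrow> real \<Rightarrow> real) \<Rightarrow> (nat \<Rightarrow> real \<Rightarrow> real) \<Rightarrow> real \<Rightarrow> real" where
  "leibniz 0 p d = (\<lambda>x. p 0 x * d 0 x)"
| "leibniz (Suc k) p d = (\<lambda>x. leibniz k (\<lambda>i. p (Suc i)) d x + leibniz k p (\<lambda>i. d (Suc i)) x)"

lemma leibniz_L2:
  assumes "\<And>i. continuous_on {0..1} (p i)" "\<And>j. j \<le> k \<Longrightarrow> L2_01 (d j)"
  shows "L2_01 (leibniz k p d)"
  using assms
proof (induction k arbitrary: p d)
  case 0 then show ?case by (auto intro: L2_01_cont_mult)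
next
  case (Suc k)
  show ?case unfolding leibniz.simps by (intro L2_01_add Suc) auto
qed

text \<open>Both summands of the recursion are again of order \<open>k\<close>, for the shifted
  \<open>p\<close> or the shifted \<open>d\<close>. A shifted \<open>d\<close> has one derivative
  less, so \<open>m\<close> varies in the induction along with \<open>k\<close>.\<close>

lemma leibniz_ftc:
  assumes "\<And>i t. (p i has_real_derivative p (Suc i) t) (at t)" "sobolev_jet m d" "k < m"
    "0 \<le> x" "x \<le> y" "y \<le> 1"
  shows "continuous_on {0..1} (leibniz k p d)"
    and "(leibniz (Suc k) p d has_integral (leibniz k p d y - leibniz k p d x)) {x..y}"
proof -
  have pc: "continuous_on {0..1} (p i)" if "\<And>i t. (p i has_real_derivative p (Suc i) t) (at t)" for p :: "nat \<Rightarrow> real \<Rightarrow> real" and i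
    using that by (meson DERIV_isCont continuous_at_imp_continuous_on)
  have "continuous_on {0..1} (leibniz k p d) \<and> (leibniz (Suc k) p d has_integral (leibniz k p d y - leibniz k p d x)) {x..y}"
    using assms(1-3)
  proof (induction k arbitrary: p d m)
    case 0
    have c: "continuous_on {0..1} (d 0)" using 0 by (intro sobolev_jet_continuous)
    have "((\<lambda>s. p 1 s * d 0 s + p 0 s * d 1 s) has_integral (p 0 y * d 0 y - p 0 x * d 0 x)) {x..y}"
    proof (rule has_integral_mult_C1_deriv)
      show "continuous_on {0..1} (p 1)" by (rule pc[of p, OF 0(1)])
      show "L2_01 (d 1)" using 0 by (intro sobolev_jet_L2[of m]) auto
      show "(d 1 has_integral d 0 t - d 0 s) {s..t}" if "0 \<le> s" "s \<le> t" "t \<le> 1" for s t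
        using sobolev_jet_ftc[OF 0(2,3) that] by simp
    qed (use 0(1)[of 0] c assms in auto)
    then show ?case using c pc[of p 0, OF 0(1)] by (auto intro: continuous_on_mult)
  next
    case (Suc k)
    obtain m' where m': "m = Suc m'" using Suc.prems(3) by (cases m) auto
    have A: "continuous_on {0..1} (leibniz k (\<lambda>i. p (Suc i)) d) \<and>
       (leibniz (Suc k) (\<lambda>i. p (Suc i)) d has_integral (leibniz k (\<lambda>i. p (Suc i)) d y - leibniz k (\<lambda>i. p (Suc i)) d x)) {x..y}"
      using Suc.prems by (intro Suc.IH[of _ m]) auto
    have B: "continuous_on {0..1} (leibniz k p (\<lambda>i. d (Suc i))) \<and>
       (leibniz (Suc k) p (\<lambda>i. d (Suc i)) has_integral (leibniz k p (\<lambda>i. d (Suc i)) y - leibniz k p (\<lambda>i. d (Suc i)) x)) {x..y}"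
      using Suc.prems m' by (intro Suc.IH[of _ m'] sobolev_jet_shift) auto
    show ?case
    proof
      show "continuous_on {0..1} (leibniz (Suc k) p d)"
        using A B by (auto intro: continuous_on_add)
      show "(leibniz (Suc (Suc k)) p d has_integral (leibniz (Suc k) p d y - leibniz (Suc k) p d x)) {x..y}"
        unfolding leibniz.simps(2)[of "Suc k" p d] leibniz.simps(2)[of k p d]
        using has_integral_add[OF conjunct2[OF A] conjunct2[OF B]] by (simp add: algebra_simps)
    qed
  qed
  then show "continuous_on {0..1} (leibniz k p d)"
    and "(leibniz (Suc k) p d has_integral (leibniz k p d y - leibniz k p d x)) {x..y}" by auto
qed

lemma sobolev_jet_leibniz:
  assumes "\<And>i t. (p i has_real_derivative p (Suc i) t) (at t)" "sobolev_jet m d"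
  shows "sobolev_jet m (\<lambda>k. leibniz k p d)"
  unfolding sobolev_jet_def
proof (intro conjI allI impI)
  show "continuous_on {0..1} (leibniz j p d)" if "j < m" for j
    using leibniz_ftc(1)[of p m d j 0 0, OF assms(1) assms(2) that] by simp
  have "continuous_on {0..1} (p i)" for i
    using assms(1) by (meson DERIV_isCont continuous_at_imp_continuous_on)
  then show "L2_01 (leibniz m p d)" using assms(2) by (intro leibniz_L2) (auto intro: sobolev_jet_L2)
  show "(leibniz (Suc j) p d has_integral leibniz j p d y - leibniz j p d x) {x..y}"
    if "j < m" "0 \<le> x" "x \<le> y" "y \<le> 1" for j x y
    using leibniz_ftc(2)[of p m d j x y, OF assms(1) assms(2) that] .
qed

text \<open>Each use of the recursion doubles the number of terms, hence \<open>2 ^ k\<close>;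
  shifting \<open>p\<close> turns the constant \<open>P\<close> into \<open>P * q\<close>.\<close>

lemma abs_leibniz_le:
  assumes "\<And>i. i \<le> k \<Longrightarrow> \<bar>p i x\<bar> \<le> P * q ^ i" "0 \<le> P" "0 \<le> q"
  shows "\<bar>leibniz k p d x\<bar> \<le> P * 2 ^ k * (\<Sum>j\<le>k. q ^ (k - j) * \<bar>d j x\<bar>)"
  using assms
proof (induction k arbitrary: p d P)
  case 0 then show ?case using 0(1)[of 0] by (simp add: abs_mult mult_right_mono)
next
  case (Suc k)
  have A: "\<bar>leibniz k (\<lambda>i. p (Suc i)) d x\<bar> \<le> P * q * 2 ^ k * (\<Sum>j\<le>k. q ^ (k - j) * \<bar>d j x\<bar>)"
    using Suc.prems(1)[of "Suc _"] Suc.prems(2,3) by (intro Suc.IH) (auto simp: algebra_simps)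
  have B: "\<bar>leibniz k p (\<lambda>i. d (Suc i)) x\<bar> \<le> P * 2 ^ k * (\<Sum>j\<le>k. q ^ (k - j) * \<bar>d (Suc j) x\<bar>)"
    using Suc.prems by (intro Suc.IH) auto
  have c1: "q * (\<Sum>j\<le>k. q ^ (k - j) * \<bar>d j x\<bar>) \<le> (\<Sum>j\<le>Suc k. q ^ (Suc k - j) * \<bar>d j x\<bar>)"
    by (simp add: sum_distrib_left Suc_diff_le mult.assoc)
  have c2: "(\<Sum>j\<le>k. q ^ (k - j) * \<bar>d (Suc j) x\<bar>) \<le> (\<Sum>j\<le>Suc k. q ^ (Suc k - j) * \<bar>d j x\<bar>)"
    using Suc.prems(3) by (subst sum.atMost_Suc_shift) (simp add: mult_nonneg_nonneg)
  have "\<bar>leibniz (Suc k) p d x\<bar> \<le> P * 2 ^ k * (q * (\<Sum>j\<le>k. q ^ (k - j) * \<bar>d j x\<bar>)) + P * 2 ^ k * (\<Sum>j\<le>k. q ^ (k - j) * \<bar>d (Suc j) x\<bar>)"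
    using A B by (simp add: algebra_simps)
  also have "\<dots> \<le> P * 2 ^ k * (\<Sum>j\<le>Suc k. q ^ (Suc k - j) * \<bar>d j x\<bar>) + P * 2 ^ k * (\<Sum>j\<le>Suc k. q ^ (Suc k - j) * \<bar>d j x\<bar>)"
    using Suc.prems(2) by (intro add_mono mult_left_mono c1 c2) auto
  finally show ?case by (simp add: algebra_simps)
qed

text \<open>Without the term in which no derivative falls on \<open>p\<close>, every term carries at
  least one factor \<open>q\<close>. In the application \<open>q\<close> is
  \<open>c / \<delta>\<close> with \<open>c\<close> small, which makes the commutator
  absorbable.\<close>

lemma abs_leibniz_diff_le:
  assumes "\<And>i. i \<le> k \<Longrightarrow> \<bar>p i x\<bar> \<le> P * q ^ i" "0 \<le> P" "0 \<le> q"
  shows "\<bar>leibniz k p d x - p 0 x * d k x\<bar> \<le> P * 2 ^ k * (\<Sum>j<k. q ^ (k - j) * \<bar>d j x\<bar>)"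
  using assms
proof (induction k arbitrary: p d P)
  case 0 then show ?case by simp
next
  case (Suc k)
  have A: "\<bar>leibniz k (\<lambda>i. p (Suc i)) d x\<bar> \<le> P * q * 2 ^ k * (\<Sum>j\<le>k. q ^ (k - j) * \<bar>d j x\<bar>)"
    using Suc.prems(1)[of "Suc _"] Suc.prems(2,3) by (intro abs_leibniz_le) (auto simp: algebra_simps)
  have B: "\<bar>leibniz k p (\<lambda>i. d (Suc i)) x - p 0 x * d (Suc k) x\<bar> \<le> P * 2 ^ k * (\<Sum>j<k. q ^ (k - j) * \<bar>d (Suc j) x\<bar>)"
    using Suc.prems by (intro Suc.IH) auto
  have c1: "q * (\<Sum>j\<le>k. q ^ (k - j) * \<bar>d j x\<bar>) = (\<Sum>j<Suc k. q ^ (Suc k - j) * \<bar>d j x\<bar>)"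
    unfolding lessThan_Suc_atMost by (simp add: sum_distrib_left Suc_diff_le mult.assoc)
  have c2: "(\<Sum>j<k. q ^ (k - j) * \<bar>d (Suc j) x\<bar>) \<le> (\<Sum>j<Suc k. q ^ (Suc k - j) * \<bar>d j x\<bar>)"
    using Suc.prems(3) by (subst sum.lessThan_Suc_shift) (simp add: mult_nonneg_nonneg)
  have "\<bar>leibniz (Suc k) p d x - p 0 x * d (Suc k) x\<bar> \<le> P * 2 ^ k * (q * (\<Sum>j\<le>k. q ^ (k - j) * \<bar>d j x\<bar>)) + P * 2 ^ k * (\<Sum>j<k. q ^ (k - j) * \<bar>d (Suc j) x\<bar>)"
    using A B by (simp add: algebra_simps)
  also have "\<dots> \<le> P * 2 ^ k * (\<Sum>j<Suc k. q ^ (Suc k - j) * \<bar>d j x\<bar>) + P * 2 ^ k * (\<Sum>j<Suc k. q ^ (Suc k - j) * \<bar>d j x\<bar>)"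
    unfolding c1 using Suc.prems(2) by (intro add_mono mult_left_mono c2 order_refl) auto
  finally show ?case by (simp add: algebra_simps)
qed

section \<open>Weighted interpolation inequalities\<close>

lemma sum_integral_pieces:
  fixes f :: "real \<Rightarrow> real"
  assumes f: "f integrable_on {0..1}" and N: "N > 0"
  shows "(\<Sum>k<N. integral {real k / real N..real (Suc k) / real N} f) = integral {0..1} f"
proof -
  have "(\<Sum>k<j. integral {real k / real N..real (Suc k) / real N} f) = integral {0..real j / real N} f" if "j \<le> N" for j
    using that
  proof (induction j)
    case (Suc j)
    have "real (Suc j) / real N \<le> 1" using Suc.prems N by simp
    then have "integral {0..real j / real N} f + integral {real j / real N..real (Suc j) / real N} f = integral {0..real (Suc j) / real N} f"
      by (intro Henstock_Kurzweil_Integration.integral_combine integrable_on_sub01[OF f] divide_right_mono) auto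
    then show ?case using Suc by simp
  qed simp
  from this[of N] show ?thesis using N by simp
qed

lemma piece_bounds:
  assumes "k < N"
  shows "0 \<le> real k / real N" "real k / real N < real (Suc k) / real N" "real (Suc k) / real N \<le> 1"
    "real (Suc k) / real N - real k / real N = 1 / real N"
  using assms by (auto simp: divide_strict_right_mono diff_divide_distrib[symmetric])

text \<open>Cauchy-Schwarz, obtained from the nonnegative integral of
  \<open>(v t - I / L)\<^sup>2\<close>; enlarging [x,y] to [a,b] only increases the right
  side.\<close>

lemma square_integral_le:
  assumes v: "L2_01 v" and ab: "0 \<le> a" "a \<le> x" "x \<le> y" "y \<le> b" "b \<le> 1"
  shows "(integral {x..y} v)\<^sup>2 \<le> (b - a) * integral {a..b} (\<lambda>t. (v t)\<^sup>2)"
proof -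
  have v2: "(\<lambda>t. (v t)\<^sup>2) integrable_on {0..1}" using v unfolding L2_01_def by simp
  have v1: "v integrable_on {0..1}" by (rule L2_01_integrable[OF v])
  define A where "A = integral {x..y} (\<lambda>t. (v t)\<^sup>2)"
  define I where "I = integral {x..y} v"
  have A: "A \<le> integral {a..b} (\<lambda>t. (v t)\<^sup>2)" "0 \<le> A"
    unfolding A_def using ab by (auto intro!: integral_subset_le integrable_on_sub01[OF v2] Henstock_Kurzweil_Integration.integral_nonneg)
  have "I\<^sup>2 \<le> (y - x) * A"
  proof (cases "x = y")
    case True then show ?thesis by (simp add: I_def)
  next
    case False
    define L where "L = y - x"
    have L: "L > 0" using False ab unfolding L_def by simp
    have i: "(v has_integral I) {x..y}" "((\<lambda>t. (v t)\<^sup>2) has_integral A) {x..y}"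
      unfolding I_def A_def using ab by (auto intro!: integrable_integral integrable_on_sub01[OF v2] integrable_on_sub01[OF v1])
    have c: "((\<lambda>t. (I / L)\<^sup>2) has_integral L * (I / L)\<^sup>2) {x..y}"
      using has_integral_const_real[of "(I/L)\<^sup>2" x y] ab unfolding L_def by simp
    have "((\<lambda>t. ((v t)\<^sup>2 - (2 * (I / L)) * v t) + (I / L)\<^sup>2) has_integral ((A - (2 * (I / L)) * I) + L * (I / L)\<^sup>2)) {x..y}"
      by (intro has_integral_add has_integral_diff has_integral_mult_right i c)
    then have "((\<lambda>t. (v t - I / L)\<^sup>2) has_integral ((A - (2 * (I / L)) * I) + L * (I / L)\<^sup>2)) {x..y}"
      by (simp add: power2_diff algebra_simps)
    then have "0 \<le> (A - (2 * (I / L)) * I) + L * (I / L)\<^sup>2"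
      by (rule has_integral_nonneg) simp
    also have "\<dots> = A - I\<^sup>2 / L" using L by (simp add: power2_eq_square field_simps)
    finally have "I\<^sup>2 / L \<le> A" by simp
    then show ?thesis using L unfolding L_def[symmetric] by (simp add: field_simps)
  qed
  also have "\<dots> \<le> (b - a) * integral {a..b} (\<lambda>t. (v t)\<^sup>2)"
    using A ab by (intro mult_mono) auto
  finally show ?thesis unfolding I_def .
qed

section \<open>Sup bounds and interpolation on a single interval\<close>

lemma exists_square_le_mean:
  fixes u :: "real \<Rightarrow> real"
  assumes "continuous_on {a..b} u" "a < b"
  shows "\<exists>z\<in>{a..b}. (u z)\<^sup>2 * (b - a) \<le> integral {a..b} (\<lambda>x. (u x)\<^sup>2)"
proof -
  have c: "continuous_on {a..b} (\<lambda>x. (u x)\<^sup>2)" by (intro continuous_intros assms)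
  obtain z where z: "z \<in> {a..b}" "\<forall>y\<in>{a..b}. (u z)\<^sup>2 \<le> (u y)\<^sup>2"
    using continuous_attains_inf[OF compact_Icc _ c] assms(2) by fastforce
  have "integral {a..b} (\<lambda>_. (u z)\<^sup>2) \<le> integral {a..b} (\<lambda>x. (u x)\<^sup>2)"
    using z by (intro integral_le integrable_continuous_real c) auto
  then show ?thesis using z assms(2) by (intro bexI[of _ z]) (auto simp: mult.commute)
qed

lemma square_sum_le: "((p::real) + q)\<^sup>2 \<le> 2 * p\<^sup>2 + 2 * q\<^sup>2"
proof -
  have "0 \<le> (p - q)\<^sup>2" by simp
  then show ?thesis by (simp add: power2_sum power2_diff)
qed

lemma jet_square_diff:
  assumes d: "sobolev_jet m d" and j: "j < m" and ab: "0 \<le> a" "b \<le> 1" and xy: "x \<in> {a..b}" "y \<in> {a..b}"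
  shows "(d j x - d j y)\<^sup>2 \<le> (b - a) * integral {a..b} (\<lambda>t. (d (Suc j) t)\<^sup>2)"
proof -
  have L: "L2_01 (d (Suc j))" using d j by (intro sobolev_jet_L2) auto
  have *: "(d j x - d j y)\<^sup>2 \<le> (b - a) * integral {a..b} (\<lambda>t. (d (Suc j) t)\<^sup>2)"
    if "x \<le> y" "x \<in> {a..b}" "y \<in> {a..b}" for x y
  proof -
    have "d j y - d j x = integral {x..y} (d (Suc j))"
      using integral_unique[OF sobolev_jet_ftc[OF d j, of x y]] that ab by auto
    then have "(d j x - d j y)\<^sup>2 = (integral {x..y} (d (Suc j)))\<^sup>2" by (metis power2_commute)
    then show ?thesis using square_integral_le[OF L, of a x y b] that ab by simp
  qed
  show ?thesis using *[of x y] *[of y x] xy by (cases "x \<le> y") (auto simp: power2_commute)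
qed

lemma jet_square_transfer:
  assumes "sobolev_jet m d" "j < m" "0 \<le> a" "b \<le> 1" "x \<in> {a..b}" "y \<in> {a..b}"
  shows "(d j x)\<^sup>2 \<le> 2 * (d j y)\<^sup>2 + 2 * (b - a) * integral {a..b} (\<lambda>t. (d (Suc j) t)\<^sup>2)"
  using square_sum_le[of "d j y" "d j x - d j y"] jet_square_diff[OF assms] by (simp add: algebra_simps)

text \<open>Some point of the interval has a square not above the mean square; Cauchy-Schwarz for
  the increment carries this to every point.\<close>

lemma jet_sup_le:
  assumes d: "sobolev_jet m d" and j: "j < m" and ab: "0 \<le> a" "a < b" "b \<le> 1" and x: "x \<in> {a..b}"
  shows "(d j x)\<^sup>2 \<le> 2 / (b - a) * integral {a..b} (\<lambda>t. (d j t)\<^sup>2) + 2 * (b - a) * integral {a..b} (\<lambda>t. (d (Suc j) t)\<^sup>2)"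
proof -
  have "continuous_on {a..b} (d j)"
    by (rule continuous_on_subset[OF sobolev_jet_continuous[OF d j]]) (use ab in auto)
  from exists_square_le_mean[OF this ab(2)] obtain z where z: "z \<in> {a..b}"
    "(d j z)\<^sup>2 * (b - a) \<le> integral {a..b} (\<lambda>t. (d j t)\<^sup>2)" by blast
  have "(d j z)\<^sup>2 \<le> integral {a..b} (\<lambda>t. (d j t)\<^sup>2) / (b - a)"
    using z(2) ab by (simp add: field_simps)
  then show ?thesis using jet_square_transfer[OF d j ab(1,3) x z(1)] by simp
qed

text \<open>Each outer third contains a point where the square of \<open>d j\<close> is at most
  \<open>3 * U / l\<close>. These points are at least \<open>l / 3\<close> apart, so the mean value
  theorem yields a point in between with a small derivative, its square being at most
  \<open>108 * U / l ^ 3\<close>, where 108 = 9 * 12. Carrying this to all points doubles it to 216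
  and adds the second-derivative term.\<close>

lemma jet_second_order_interpolation:
  assumes d: "sobolev_jet m d" and j: "Suc j < m" and ab: "0 \<le> a" "a < b" "b \<le> 1"
  shows "(b - a)\<^sup>2 * integral {a..b} (\<lambda>t. (d (Suc j) t)\<^sup>2) \<le>
    216 * integral {a..b} (\<lambda>t. (d j t)\<^sup>2) + 2 * (b - a) ^ 4 * integral {a..b} (\<lambda>t. (d (Suc (Suc j)) t)\<^sup>2)"
proof -
  define l where "l = b - a"
  have l: "l > 0" unfolding l_def using ab by simp
  define U where "U = integral {a..b} (\<lambda>t. (d j t)\<^sup>2)"
  define W where "W = integral {a..b} (\<lambda>t. (d (Suc (Suc j)) t)\<^sup>2)"
  have cont: "continuous_on {a..b} (d j)" "continuous_on {a..b} (d (Suc j))"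
    using j ab by (auto intro!: continuous_on_subset[OF sobolev_jet_continuous[OF d]])
  have sub: "\<exists>z\<in>{p..q}. (d j z)\<^sup>2 \<le> 3 * U / l" if pq: "a \<le> p" "q \<le> b" "q - p = l / 3" for p q
  proof -
    have "continuous_on {p..q} (d j)" by (rule continuous_on_subset[OF cont(1)]) (use pq in auto)
    moreover have "p < q" using pq l by linarith
    ultimately obtain z where z: "z \<in> {p..q}" "(d j z)\<^sup>2 * (q - p) \<le> integral {p..q} (\<lambda>t. (d j t)\<^sup>2)"
      using exists_square_le_mean by blast
    have "integral {p..q} (\<lambda>t. (d j t)\<^sup>2) \<le> U" unfolding U_def
    proof (rule integral_subset_le)
      show "{p..q} \<subseteq> {a..b}" using pq by auto
      then show "(\<lambda>t. (d j t)\<^sup>2) integrable_on {p..q}"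
        by (intro integrable_continuous_real continuous_intros continuous_on_subset[OF cont(1)])
      show "(\<lambda>t. (d j t)\<^sup>2) integrable_on {a..b}"
        by (intro integrable_continuous_real continuous_intros cont(1))
    qed auto
    then have "(d j z)\<^sup>2 * (l / 3) \<le> U" using z(2) pq(3) by simp
    then have "(d j z)\<^sup>2 \<le> 3 * U / l" using l by (simp add: field_simps)
    then show ?thesis using z(1) by blast
  qed
  have third: "a + l / 3 \<le> b" "a \<le> b - l / 3" using l l_def by linarith+
  obtain x1 where x1: "x1 \<in> {a..a + l/3}" "(d j x1)\<^sup>2 \<le> 3 * U / l" using sub[of a "a + l/3"] l third by auto
  obtain x2 where x2: "x2 \<in> {b - l/3..b}" "(d j x2)\<^sup>2 \<le> 3 * U / l" using sub[of "b - l/3" b] l third by auto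
  have x12: "x2 - x1 \<ge> l / 3" 
  proof -
    have "x1 \<le> a + l / 3" "b - l / 3 \<le> x2" using x1(1) x2(1) by auto
    then show ?thesis using l_def by linarith
  qed
  have der: "(d j has_real_derivative d (Suc j) x) (at x)" if "x \<in> {a<..<b}" for x
  proof -
    have x01: "x \<in> {0<..<1}" using that ab by auto
    have c: "continuous_on {0..1} (d (Suc j))" using j by (intro sobolev_jet_continuous[OF d])
    have "((\<lambda>t. d j 0 + integral {0..t} (d (Suc j))) has_vector_derivative d (Suc j) x) (at x within {0..1})"
      using has_vector_derivative_add[OF has_vector_derivative_const integral_has_vector_derivative[OF c], of x "d j 0"] x01 by simp
    then have "(d j has_vector_derivative d (Suc j) x) (at x within {0..1})"
    proof (rule has_vector_derivative_transform[rotated 2])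
      show "d j t = d j 0 + integral {0..t} (d (Suc j))" if "t \<in> {0..1}" for t
        using integral_unique[OF sobolev_jet_ftc[OF d, of j 0 t]] j that by simp
    qed (use x01 in auto)
    then have "(d j has_vector_derivative d (Suc j) x) (at x)"
      using x01 by (simp add: at_within_Icc_at)
    then show ?thesis by (simp add: has_real_derivative_iff_has_vector_derivative)
  qed
  have xx: "x1 < x2" using x12 l by linarith
  have "\<exists>z. x1 < z \<and> z < x2 \<and> d j x2 - d j x1 = (x2 - x1) * d (Suc j) z"
  proof -
    have "\<exists>l z. x1 < z \<and> z < x2 \<and> (d j has_real_derivative l) (at z) \<and> d j x2 - d j x1 = (x2 - x1) * l"
    proof (rule MVT[OF xx])
      show "continuous_on {x1..x2} (d j)" by (rule continuous_on_subset[OF cont(1)]) (use x1 x2 in auto)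
      show "d j differentiable at x" if "x1 < x" "x < x2" for x
        using der[of x] that x1 x2 unfolding real_differentiable_def by auto
    qed
    then obtain l z where lz: "x1 < z" "z < x2" "(d j has_real_derivative l) (at z)" "d j x2 - d j x1 = (x2 - x1) * l" by blast
    then have "l = d (Suc j) z" using der[of z] x1 x2 by (intro DERIV_unique[OF lz(3)]) auto
    then show ?thesis using lz by blast
  qed
  then obtain z where z: "x1 < z" "z < x2" "d j x2 - d j x1 = (x2 - x1) * d (Suc j) z" by blast
  have z_le: "(d (Suc j) z)\<^sup>2 \<le> 108 * U / l ^ 3"
  proof -
    have "(l / 3)\<^sup>2 * (d (Suc j) z)\<^sup>2 \<le> (x2 - x1)\<^sup>2 * (d (Suc j) z)\<^sup>2"
      using x12 l by (intro mult_right_mono power_mono) auto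
    also have "\<dots> = (d j x2 - d j x1)\<^sup>2" using z(3) by (simp add: power_mult_distrib)
    also have "\<dots> \<le> 2 * (d j x2)\<^sup>2 + 2 * (d j x1)\<^sup>2" using square_sum_le[of "d j x2" "- d j x1"] by simp
    also have "\<dots> \<le> 12 * U / l" using x1(2) x2(2) by simp
    finally have "l\<^sup>2 * (d (Suc j) z)\<^sup>2 \<le> 108 * U / l" by (simp add: power_divide)
    then show ?thesis using l by (simp add: field_simps power2_eq_square power3_eq_cube)
  qed
  have pt: "(d (Suc j) x)\<^sup>2 \<le> 216 * U / l ^ 3 + 2 * l * W" if "x \<in> {a..b}" for x
    using jet_square_transfer[OF d j ab(1,3) that, of z] z_le z(1,2) x1 x2 unfolding W_def l_def by auto
  have "integral {a..b} (\<lambda>t. (d (Suc j) t)\<^sup>2) \<le> integral {a..b} (\<lambda>_. 216 * U / l ^ 3 + 2 * l * W)"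
    using pt by (intro integral_le integrable_continuous_real continuous_intros cont(2)) auto
  also have "\<dots> = l * (216 * U / l ^ 3 + 2 * l * W)" using ab unfolding l_def by simp
  finally have "l\<^sup>2 * integral {a..b} (\<lambda>t. (d (Suc j) t)\<^sup>2) \<le> l\<^sup>2 * (l * (216 * U / l ^ 3 + 2 * l * W))"
    by (intro mult_left_mono) auto
  also have "\<dots> = 216 * U + 2 * l ^ 4 * W" using l by (simp add: field_simps power2_eq_square power3_eq_cube power4_eq_xxxx)
  finally show ?thesis unfolding U_def W_def l_def .
qed

text \<open>On an interval of length at most \<delta> such a weight is constant up to a factor 3, so
  unweighted estimates on cells become weighted ones. The 3 is e rounded up: sech changes by at most
  a factor e when its argument moves by 1.\<close>

definition slow_weight :: "real \<Rightarrow> (real \<Rightarrow> real) \<Rightarrow> bool" where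
  "slow_weight \<delta> \<phi> \<longleftrightarrow> continuous_on {0..1} \<phi> \<and> (\<forall>x\<in>{0..1}. 0 \<le> \<phi> x) \<and>
     (\<forall>x\<in>{0..1}. \<forall>y\<in>{0..1}. \<bar>x - y\<bar> \<le> \<delta> \<longrightarrow> \<phi> x \<le> 3 * \<phi> y)"

lemma slow_weightD:
  assumes "slow_weight \<delta> \<phi>"
  shows "continuous_on {0..1} \<phi>" and "x \<in> {0..1} \<Longrightarrow> 0 \<le> \<phi> x"
    and "x \<in> {0..1} \<Longrightarrow> y \<in> {0..1} \<Longrightarrow> \<bar>x - y\<bar> \<le> \<delta> \<Longrightarrow> \<phi> x \<le> 3 * \<phi> y"
  using assms unfolding slow_weight_def by blast+

lemma weighted_square_integrable:
  assumes "slow_weight \<delta> \<phi>" "L2_01 u"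
  shows "(\<lambda>x. \<phi> x * (u x)\<^sup>2) integrable_on {0..1}"
  using L2_01_prod_integrable[OF L2_01_cont_mult[OF slow_weightD(1)[OF assms(1)] assms(2)] assms(2)]
  by (simp add: power2_eq_square mult.assoc)

lemma weighted_square_integral_nonneg:
  assumes "slow_weight \<delta> \<phi>" "L2_01 u" "0 \<le> a" "b \<le> 1"
  shows "0 \<le> integral {a..b} (\<lambda>x. \<phi> x * (u x)\<^sup>2)"
proof (rule Henstock_Kurzweil_Integration.integral_nonneg)
  show "(\<lambda>x. \<phi> x * (u x)\<^sup>2) integrable_on {a..b}"
    by (rule integrable_on_sub01[OF weighted_square_integrable[OF assms(1,2)] assms(3,4)])
  show "0 \<le> \<phi> x * (u x)\<^sup>2" if "x \<in> {a..b}" for x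
    using slow_weightD(2)[OF assms(1), of x] that assms(3,4) by simp
qed

lemma slow_weight_integral_bounds:
  assumes \<phi>: "slow_weight \<delta> \<phi>" and u: "L2_01 u" and ab: "0 \<le> a" "a \<le> b" "b \<le> 1" "b - a \<le> \<delta>" and c: "c \<in> {a..b}"
  shows "integral {a..b} (\<lambda>x. \<phi> x * (u x)\<^sup>2) \<le> 3 * \<phi> c * integral {a..b} (\<lambda>x. (u x)\<^sup>2)"
    and "\<phi> c * integral {a..b} (\<lambda>x. (u x)\<^sup>2) \<le> 3 * integral {a..b} (\<lambda>x. \<phi> x * (u x)\<^sup>2)"
proof -
  have u2: "(\<lambda>x. (u x)\<^sup>2) integrable_on {a..b}"
    using u unfolding L2_01_def by (intro integrable_on_sub01[OF conjunct2 ab(1,3)])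
  have pu: "(\<lambda>x. \<phi> x * (u x)\<^sup>2) integrable_on {a..b}" by (rule integrable_on_sub01[OF weighted_square_integrable[OF \<phi> u] ab(1,3)])
  have 1: "\<phi> x \<le> 3 * \<phi> c" "\<phi> c \<le> 3 * \<phi> x" if "x \<in> {a..b}" for x
    using that c ab by (auto intro!: slow_weightD(3)[OF \<phi>])
  have "integral {a..b} (\<lambda>x. \<phi> x * (u x)\<^sup>2) \<le> integral {a..b} (\<lambda>x. 3 * \<phi> c * (u x)\<^sup>2)"
    using 1 u2 pu by (intro integral_le integrable_on_mult_right mult_right_mono) auto
  then show "integral {a..b} (\<lambda>x. \<phi> x * (u x)\<^sup>2) \<le> 3 * \<phi> c * integral {a..b} (\<lambda>x. (u x)\<^sup>2)" by simp
  have "integral {a..b} (\<lambda>x. \<phi> c * (u x)\<^sup>2) \<le> integral {a..b} (\<lambda>x. 3 * (\<phi> x * (u x)\<^sup>2))"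
    using mult_right_mono[OF 1(2), of _ "(u _)\<^sup>2"] by (intro integral_le integrable_on_mult_right u2 pu) (auto simp: algebra_simps)
  then show "\<phi> c * integral {a..b} (\<lambda>x. (u x)\<^sup>2) \<le> 3 * integral {a..b} (\<lambda>x. \<phi> x * (u x)\<^sup>2)" by simp
qed

text \<open>The unweighted inequality is summed over the cells. Freezing the weight costs a factor 3
  and releasing it another, hence 1944 = 9 * 216. Cells may be much shorter than \<delta>, which
  supplies the free parameter of the interpolation.\<close>

lemma weighted_second_order_interpolation:
  assumes d: "sobolev_jet m d" and j: "Suc j < m" and \<phi>: "slow_weight \<delta> \<phi>" and N: "N > 0" "1 / real N \<le> \<delta>"
  shows "(1 / real N)\<^sup>2 * integral {0..1} (\<lambda>t. \<phi> t * (d (Suc j) t)\<^sup>2) \<le>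
    1944 * (integral {0..1} (\<lambda>t. \<phi> t * (d j t)\<^sup>2) + (1 / real N) ^ 4 * integral {0..1} (\<lambda>t. \<phi> t * (d (Suc (Suc j)) t)\<^sup>2))"
proof -
  have L: "L2_01 (d j)" "L2_01 (d (Suc j))" "L2_01 (d (Suc (Suc j)))" using j by (auto intro: sobolev_jet_L2[OF d])
  let ?I = "\<lambda>k i. integral {real k / real N..real (Suc k) / real N} (\<lambda>t. \<phi> t * (d i t)\<^sup>2)"
  have piece: "(1 / real N)\<^sup>2 * ?I k (Suc j) \<le> 1944 * ?I k j + 1944 * (1 / real N) ^ 4 * ?I k (Suc (Suc j))" if k: "k < N" for k
  proof -
    define a b where "a = real k / real N" and "b = real (Suc k) / real N"
    have ab: "0 \<le> a" "a < b" "b \<le> 1" "b - a = 1 / real N" "b - a \<le> \<delta>" "a \<in> {a..b}"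
      using piece_bounds[OF k] N(2) unfolding a_def b_def by auto
    have ab': "a \<le> b" using ab by simp
    have pa: "0 \<le> \<phi> a" using ab by (intro slow_weightD(2)[OF \<phi>]) auto
    note W = slow_weight_integral_bounds[OF \<phi> _ ab(1) ab' ab(3,5,6)]
    let ?J = "\<lambda>i. integral {a..b} (\<lambda>t. (d i t)\<^sup>2)"
    have "(1 / real N)\<^sup>2 * integral {a..b} (\<lambda>t. \<phi> t * (d (Suc j) t)\<^sup>2) \<le> (1 / real N)\<^sup>2 * (3 * \<phi> a * ?J (Suc j))"
      by (intro mult_left_mono W L) auto
    also have "\<dots> = 3 * \<phi> a * ((1 / real N)\<^sup>2 * ?J (Suc j))" by simp
    also have "\<dots> \<le> 3 * \<phi> a * (216 * ?J j + 2 * (1 / real N) ^ 4 * ?J (Suc (Suc j)))"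
      using jet_second_order_interpolation[OF d j ab(1-3)] pa unfolding ab(4) by (intro mult_left_mono) auto
    also have "\<dots> = 648 * (\<phi> a * ?J j) + 6 * (1 / real N) ^ 4 * (\<phi> a * ?J (Suc (Suc j)))" by (simp add: algebra_simps)
    also have "\<dots> \<le> 648 * (3 * integral {a..b} (\<lambda>t. \<phi> t * (d j t)\<^sup>2)) + 6 * (1 / real N) ^ 4 * (3 * integral {a..b} (\<lambda>t. \<phi> t * (d (Suc (Suc j)) t)\<^sup>2))"
      by (intro add_mono mult_left_mono W L) auto
    also have "\<dots> \<le> 1944 * integral {a..b} (\<lambda>t. \<phi> t * (d j t)\<^sup>2) + 1944 * (1 / real N) ^ 4 * integral {a..b} (\<lambda>t. \<phi> t * (d (Suc (Suc j)) t)\<^sup>2)"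
    proof -
      have "0 \<le> integral {a..b} (\<lambda>t. \<phi> t * (d (Suc (Suc j)) t)\<^sup>2)"
        by (rule weighted_square_integral_nonneg[OF \<phi> L(3) ab(1,3)])
      then have "0 \<le> (1 / real N) ^ 4 * integral {a..b} (\<lambda>t. \<phi> t * (d (Suc (Suc j)) t)\<^sup>2)" by simp
      then show ?thesis by linarith
    qed
    finally show ?thesis unfolding a_def b_def .
  qed
  have S: "(\<Sum>k<N. ?I k i) = integral {0..1} (\<lambda>t. \<phi> t * (d i t)\<^sup>2)" if "L2_01 (d i)" for i
    by (rule sum_integral_pieces[OF weighted_square_integrable[OF \<phi> that] N(1)])
  have "(\<Sum>k<N. (1 / real N)\<^sup>2 * ?I k (Suc j)) \<le> (\<Sum>k<N. 1944 * ?I k j + 1944 * (1 / real N) ^ 4 * ?I k (Suc (Suc j)))"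
    using piece by (intro sum_mono) auto
  then show ?thesis
    unfolding sum.distrib sum_distrib_left[symmetric] S[OF L(1)] S[OF L(2)] S[OF L(3)] by (simp add: algebra_simps)
qed

text \<open>In the application \<open>A j\<close> is the weighted square integral of the j-th
  derivative scaled by \<open>\<delta> ^ (2 * j)\<close>, and \<open>i\<close> refines the cells by
  \<open>2 ^ i\<close>. Inserting the bound for \<open>A k\<close> with a small coefficient \<theta>
  into the three-term inequality puts only a fraction of \<open>A (Suc k)\<close> on the right,
  which the left side absorbs.\<close>

lemma interpolation_chain:
  assumes K: "K \<ge> (0::real)"
  shows "\<forall>\<eta>>0. \<exists>C\<ge>0. \<forall>m (A::nat \<Rightarrow> real). (\<forall>j. 0 \<le> A j) \<longrightarrow>
     (\<forall>j i. Suc (Suc j) \<le> m \<longrightarrow> A (Suc j) \<le> K * (4 ^ i * A j + A (Suc (Suc j)) / 4 ^ i)) \<longrightarrow> Suc k \<le> m \<longrightarrow>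
     A k \<le> C * A 0 + \<eta> * A (Suc k)"
proof (induction k)
  case 0
  show ?case by (intro allI impI exI[of _ 1]) auto
next
  case (Suc k)
  show ?case
  proof (intro allI impI)
    fix \<eta> :: real assume \<eta>: "\<eta> > 0"
    \<comment> \<open>First \<open>i\<close> brings the coefficient of
      \<open>A (Suc (Suc k))\<close> to at most \<eta> / 2, then \<theta> that of
      \<open>A (Suc k)\<close> to at most 1/2; moving this half to the left doubles the
      rest.\<close>
    obtain i where i: "2 * K / \<eta> < 4 ^ i" using real_arch_pow[of 4 "2 * K / \<eta>"] by auto
    define \<theta> where "\<theta> = 1 / (2 * (K + 1) * 4 ^ i)"
    have \<theta>: "\<theta> > 0" unfolding \<theta>_def using K by simp
    from Suc \<theta> obtain C where C: "C \<ge> 0" "\<forall>m (A::nat \<Rightarrow> real). (\<forall>j. 0 \<le> A j) \<longrightarrow>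
     (\<forall>j i. Suc (Suc j) \<le> m \<longrightarrow> A (Suc j) \<le> K * (4 ^ i * A j + A (Suc (Suc j)) / 4 ^ i)) \<longrightarrow> Suc k \<le> m \<longrightarrow>
     A k \<le> C * A 0 + \<theta> * A (Suc k)" by blast
    show "\<exists>C\<ge>0. \<forall>m (A::nat \<Rightarrow> real). (\<forall>j. 0 \<le> A j) \<longrightarrow>
     (\<forall>j i. Suc (Suc j) \<le> m \<longrightarrow> A (Suc j) \<le> K * (4 ^ i * A j + A (Suc (Suc j)) / 4 ^ i)) \<longrightarrow> Suc (Suc k) \<le> m \<longrightarrow>
     A (Suc k) \<le> C * A 0 + \<eta> * A (Suc (Suc k))"
    proof (intro exI[of _ "2 * K * 4 ^ i * C"] conjI allI impI)
      show "0 \<le> 2 * K * 4 ^ i * C" using K C by simp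
      fix m and A :: "nat \<Rightarrow> real"
      assume A: "\<forall>j. 0 \<le> A j" "\<forall>j i. Suc (Suc j) \<le> m \<longrightarrow> A (Suc j) \<le> K * (4 ^ i * A j + A (Suc (Suc j)) / 4 ^ i)" "Suc (Suc k) \<le> m"
      have a: "A k \<le> C * A 0 + \<theta> * A (Suc k)" using C(2)[rule_format, of A m] A by simp
      have "A (Suc k) \<le> K * (4 ^ i * A k + A (Suc (Suc k)) / 4 ^ i)" using A(2,3) by blast
      also have "\<dots> \<le> K * (4 ^ i * (C * A 0 + \<theta> * A (Suc k)) + A (Suc (Suc k)) / 4 ^ i)"
        using a K by (intro mult_left_mono add_mono) auto
      also have "\<dots> = K * 4 ^ i * C * A 0 + (K * 4 ^ i * \<theta>) * A (Suc k) + K / 4 ^ i * A (Suc (Suc k))"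
        by (simp add: algebra_simps)
      also have "\<dots> \<le> K * 4 ^ i * C * A 0 + 1/2 * A (Suc k) + \<eta> / 2 * A (Suc (Suc k))"
      proof (intro add_mono mult_right_mono order_refl)
        have "K * 4 ^ i * \<theta> = K / (2 * (K + 1))" unfolding \<theta>_def by simp
        also have "\<dots> \<le> 1/2" using K by (simp add: field_simps)
        finally show "K * 4 ^ i * \<theta> \<le> 1/2" .
        show "K / 4 ^ i \<le> \<eta> / 2" using i \<eta> by (simp add: field_simps)
      qed (use A(1) C(1) K in auto)
      finally show "A (Suc k) \<le> 2 * K * 4 ^ i * C * A 0 + \<eta> * A (Suc (Suc k))" by simp
    qed
  qed
qed

text \<open>With coefficient 1 at \<open>A (Suc k)\<close> the two-term inequalities chain from
  \<open>j\<close> up to \<open>m\<close>, and the coefficients of \<open>A 0\<close> add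
  up.\<close>

lemma interpolation_sequence:
  assumes K: "K \<ge> (0::real)"
  shows "\<exists>C\<ge>0. \<forall>A::nat \<Rightarrow> real. (\<forall>j. 0 \<le> A j) \<longrightarrow>
     (\<forall>j i. Suc (Suc j) \<le> m \<longrightarrow> A (Suc j) \<le> K * (4 ^ i * A j + A (Suc (Suc j)) / 4 ^ i)) \<longrightarrow>
     (\<forall>j\<le>m. A j \<le> C * (A 0 + A m))"
proof -
  define Q where "Q k C \<longleftrightarrow> (\<forall>m (A::nat \<Rightarrow> real). (\<forall>j. 0 \<le> A j) \<longrightarrow>
     (\<forall>j i. Suc (Suc j) \<le> m \<longrightarrow> A (Suc j) \<le> K * (4 ^ i * A j + A (Suc (Suc j)) / 4 ^ i)) \<longrightarrow> Suc k \<le> m \<longrightarrow>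
     A k \<le> C * A 0 + 1 * A (Suc k))" for k C
  have "\<exists>C. C \<ge> 0 \<and> Q k C" for k
    using interpolation_chain[OF K, of k, rule_format, of 1] unfolding Q_def by simp
  then obtain c where cQ: "\<And>k. c k \<ge> 0 \<and> Q k (c k)" by metis
  then have c: "\<And>k. c k \<ge> 0" by blast
  have cA: "A k \<le> c k * A 0 + 1 * A (Suc k)"
    if "\<forall>j. 0 \<le> A j" "\<forall>j i. Suc (Suc j) \<le> m \<longrightarrow> A (Suc j) \<le> K * (4 ^ i * A j + A (Suc (Suc j)) / 4 ^ i)" "Suc k \<le> m"
    for k m and A :: "nat \<Rightarrow> real"
    using cQ[of k] that unfolding Q_def by blast
  define C where "C = 1 + (\<Sum>k<m. c k)"
  have C1: "C \<ge> 1" unfolding C_def using c by (simp add: sum_nonneg)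
  show ?thesis
  proof (intro exI[of _ C] conjI allI impI)
    show "0 \<le> C" using C1 by simp
    fix A :: "nat \<Rightarrow> real" and j
    assume A: "\<forall>j. 0 \<le> A j" "\<forall>j i. Suc (Suc j) \<le> m \<longrightarrow> A (Suc j) \<le> K * (4 ^ i * A j + A (Suc (Suc j)) / 4 ^ i)" and j: "j \<le> m"
    have "A j \<le> (\<Sum>k\<in>{j..<m}. c k) * A 0 + A m"
      using j
    proof (induction j rule: inc_induct)
      case (step n)
      have "A n \<le> c n * A 0 + 1 * A (Suc n)" using step by (intro cA[OF A]) auto
      also have "\<dots> \<le> c n * A 0 + ((\<Sum>k\<in>{Suc n..<m}. c k) * A 0 + A m)" using step by simp
      also have "\<dots> = (\<Sum>k\<in>{n..<m}. c k) * A 0 + A m"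
        using step by (subst (2) sum.atLeast_Suc_lessThan) (auto simp: algebra_simps)
      finally show ?case .
    qed simp
    also have "\<dots> \<le> C * A 0 + C * A m"
    proof (intro add_mono mult_right_mono)
      have "(\<Sum>k\<in>{j..<m}. c k) \<le> (\<Sum>k<m. c k)" by (rule sum_mono2) (use c in auto)
      then show "(\<Sum>k\<in>{j..<m}. c k) \<le> C" unfolding C_def by simp
      show "A m \<le> C * A m" using C1 A(1) mult_right_mono[of 1 C "A m"] by simp
    qed (use A in auto)
    finally show "A j \<le> C * (A 0 + A m)" by (simp add: algebra_simps)
  qed
qed

lemma weighted_interpolation:
  "\<exists>C\<ge>0. \<forall>d \<phi> J. sobolev_jet m d \<longrightarrow> slow_weight (1 / 2 ^ J) \<phi> \<longrightarrow>
     (\<forall>j\<le>m. (1 / 2 ^ J) ^ (2 * j) * integral {0..1} (\<lambda>t. \<phi> t * (d j t)\<^sup>2) \<le>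
       C * (integral {0..1} (\<lambda>t. \<phi> t * (d 0 t)\<^sup>2) + (1 / 2 ^ J) ^ (2 * m) * integral {0..1} (\<lambda>t. \<phi> t * (d m t)\<^sup>2)))"
proof -
  obtain C where C: "C \<ge> 0" "\<forall>A::nat \<Rightarrow> real. (\<forall>j. 0 \<le> A j) \<longrightarrow>
     (\<forall>j i. Suc (Suc j) \<le> m \<longrightarrow> A (Suc j) \<le> 1944 * (4 ^ i * A j + A (Suc (Suc j)) / 4 ^ i)) \<longrightarrow>
     (\<forall>j\<le>m. A j \<le> C * (A 0 + A m))"
    using interpolation_sequence[of 1944 m] by auto
  show ?thesis
  proof (intro exI[of _ C] conjI allI impI)
    fix d :: "nat \<Rightarrow> real \<Rightarrow> real" and \<phi> and J j :: nat
    assume d: "sobolev_jet m d" and \<phi>: "slow_weight (1 / 2 ^ J) \<phi>" and j: "j \<le> m"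
    define \<delta> :: real where "\<delta> = 1 / 2 ^ J"
    have \<delta>: "\<delta> > 0" unfolding \<delta>_def by simp
    define a where "a j = integral {0..1} (\<lambda>t. \<phi> t * (d j t)\<^sup>2)" for j
    \<comment> \<open>Set to 0 beyond \<open>m\<close>, where a derivative sequence is
      unconstrained.\<close>
    define A where "A j = (if j \<le> m then \<delta> ^ (2 * j) * a j else 0)" for j
    have a0: "0 \<le> a j" if "j \<le> m" for j unfolding a_def
      by (rule weighted_square_integral_nonneg[OF \<phi> sobolev_jet_L2[OF d that]]) auto
    have "A (Suc j) \<le> 1944 * (4 ^ i * A j + A (Suc (Suc j)) / 4 ^ i)" if j: "Suc (Suc j) \<le> m" for j i
    proof -
      \<comment> \<open>Cells shorter than \<delta> by the factor \<open>2 ^ i\<close>; after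
        scaling by \<open>4 ^ i * \<delta> ^ (2 * j)\<close> the inequality takes the three-term
        form.\<close>
      define N :: nat where "N = 2 ^ (J + i)"
      have N: "N > 0" "1 / real N = \<delta> / 2 ^ i" unfolding N_def \<delta>_def by (auto simp: power_add)
      have Nl: "1 / real N \<le> \<delta>" unfolding N(2) using \<delta> by (simp add: field_simps mult_left_mono)
      have "(\<delta> / 2 ^ i)\<^sup>2 * a (Suc j) \<le> 1944 * (a j + (\<delta> / 2 ^ i) ^ 4 * a (Suc (Suc j)))"
        using weighted_second_order_interpolation[OF d _ \<phi> N(1), of j] Nl j unfolding a_def N(2) \<delta>_def[symmetric] by simp
      then have "4 ^ i * \<delta> ^ (2 * j) * ((\<delta> / 2 ^ i)\<^sup>2 * a (Suc j)) \<le> 4 ^ i * \<delta> ^ (2 * j) * (1944 * (a j + (\<delta> / 2 ^ i) ^ 4 * a (Suc (Suc j))))"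
        using \<delta> by (intro mult_left_mono) auto
      moreover have "4 ^ i * \<delta> ^ (2 * j) * ((\<delta> / 2 ^ i)\<^sup>2 * a (Suc j)) = A (Suc j)"
      proof -
        have "((2::real) ^ i)\<^sup>2 = 4 ^ i" by (simp add: power_mult[symmetric] mult.commute power2_eq_square power_mult_distrib[symmetric])
        then show ?thesis using j unfolding A_def by (simp add: power_divide field_simps power2_eq_square)
      qed
      moreover have "4 ^ i * \<delta> ^ (2 * j) * (1944 * (a j + (\<delta> / 2 ^ i) ^ 4 * a (Suc (Suc j)))) = 1944 * (4 ^ i * A j + A (Suc (Suc j)) / 4 ^ i)"
      proof -
        have "((2::real) ^ i) ^ 4 = 4 ^ i * 4 ^ i" by (simp add: power4_eq_xxxx power_mult_distrib[symmetric] mult.assoc)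
        then show ?thesis using j unfolding A_def by (simp add: power_divide field_simps power4_eq_xxxx)
      qed
      ultimately show ?thesis by simp
    qed
    moreover have "\<forall>j. 0 \<le> A j" unfolding A_def using a0 \<delta> by simp
    ultimately have "A j \<le> C * (A 0 + A m)" using C(2) j by blast
    then show "(1 / 2 ^ J) ^ (2 * j) * integral {0..1} (\<lambda>t. \<phi> t * (d j t)\<^sup>2) \<le>
       C * (integral {0..1} (\<lambda>t. \<phi> t * (d 0 t)\<^sup>2) + (1 / 2 ^ J) ^ (2 * m) * integral {0..1} (\<lambda>t. \<phi> t * (d m t)\<^sup>2))"
      using j unfolding A_def a_def \<delta>_def by simp
  qed (rule C(1))
qed

section \<open>Mark sums over cells\<close>

text \<open>The half-open cells partition (0,1] and miss 0, which is why design points are required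
  to be positive below.\<close>

lemma sum_indicator_pieces:
  fixes y :: real
  assumes "0 < x" "x \<le> 1" "N > 0"
  shows "(\<Sum>k<N. if real k / real N < x \<and> x \<le> real (Suc k) / real N then y else 0) = y"
proof -
  have "(\<Sum>k<j. if real k / real N < x \<and> x \<le> real (Suc k) / real N then y else 0) = (if x \<le> real j / real N then y else 0)" for j
  proof (induction j)
    case (Suc j)
    have "real j / real N \<le> real (Suc j) / real N" by (intro divide_right_mono) auto
    then show ?case using Suc by auto
  qed (use assms in auto)
  from this[of N] show ?thesis using assms by simp
qed

lemma L2_01_bounded_borel:
  assumes "f \<in> borel_measurable borel" "\<And>x. \<bar>f x\<bar> \<le> B"
  shows "L2_01 f"
  unfolding L2_01_def
proof
  show m: "f \<in> borel_measurable (lebesgue_on {0..1})"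
    using assms(1) by (intro measurable_restrict_space1 measurable_completion) simp
  show "(\<lambda>x. (f x)\<^sup>2) integrable_on {0..1}"
  proof (rule measurable_bounded_by_integrable_imp_integrable_real)
    show "(\<lambda>x. (f x)\<^sup>2) \<in> borel_measurable (lebesgue_on {0..1})" using m by (rule borel_measurable_power)
    show "(\<lambda>_. B\<^sup>2) integrable_on {0..1::real}" by (rule integrable_const_ivl)
    show "\<bar>(f x)\<^sup>2\<bar> \<le> B\<^sup>2" for x
    proof -
      have "\<bar>f x\<bar> \<le> \<bar>B\<bar>" using assms(2)[of x] by simp
      then show ?thesis by (simp add: abs_le_square_iff)
    qed
  qed simp
qed

text \<open>With marks 1 this counts the design points in (a,t]; with residuals as marks it is the
  running noise sum, started afresh in each cell.\<close>

definition mark_sum :: "(nat \<Rightarrow> real) \<Rightarrow> (nat \<Rightarrow> real) \<Rightarrow> nat \<Rightarrow> real \<Rightarrow> real \<Rightarrow> real" where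
  "mark_sum x D n a t = (\<Sum>i=1..n. if a < x i \<and> x i \<le> t then D i else 0)"

lemma mark_sum_L2: "L2_01 (\<lambda>t. mark_sum x D n a t)"
proof (rule L2_01_bounded_borel)
  show "(\<lambda>t. mark_sum x D n a t) \<in> borel_measurable borel"
    unfolding mark_sum_def by measurable
  show "\<bar>mark_sum x D n a t\<bar> \<le> (\<Sum>i=1..n. \<bar>D i\<bar>)" for t
    unfolding mark_sum_def by (rule order_trans[OF sum_abs]) (auto intro!: sum_mono)
qed

text \<open>A mark at \<open>x i\<close> contributes \<open>D i\<close> times the integral of
  \<open>G 1\<close> from \<open>x i\<close> to \<open>b\<close>. The noise tested against
  \<open>G\<close> is thereby expressed by the total over the cell and the running sums inside
  it.\<close>

lemma mark_sum_by_parts: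
  assumes G: "sobolev_jet m G" "0 < m" and ab: "0 \<le> a" "a \<le> b" "b \<le> 1"
  shows "((\<lambda>t. G 1 t * mark_sum x D n a t) has_integral
     (G 0 b * mark_sum x D n a b - (\<Sum>i=1..n. if a < x i \<and> x i \<le> b then D i * G 0 (x i) else 0))) {a..b}"
proof -
  have one: "((\<lambda>t. G 1 t * (if a < x i \<and> x i \<le> t then D i else 0)) has_integral
      (if a < x i \<and> x i \<le> b then D i * (G 0 b - G 0 (x i)) else 0)) {a..b}" for i
  proof (cases "a < x i \<and> x i \<le> b")
    case True
    have "(G 1 has_integral (G 0 b - G 0 (x i))) {x i..b}"
      using sobolev_jet_ftc[OF G, of "x i" b] True ab by simp
    then have "((\<lambda>t. D i * G 1 t) has_integral D i * (G 0 b - G 0 (x i))) {x i..b}"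
      by (rule has_integral_mult_right)
    then have "((\<lambda>t. if t \<in> {x i..b} then D i * G 1 t else 0) has_integral D i * (G 0 b - G 0 (x i))) {a..b}"
      using True by (subst has_integral_restrict) auto
    then have "((\<lambda>t. G 1 t * (if a < x i \<and> x i \<le> t then D i else 0)) has_integral D i * (G 0 b - G 0 (x i))) {a..b}"
      by (rule has_integral_eq[rotated]) (use True in auto)
    then show ?thesis using True by simp
  next
    case False
    show ?thesis
      unfolding if_not_P[OF False] by (rule has_integral_is_0) (use False in auto)
  qed
  have "((\<lambda>t. \<Sum>i=1..n. G 1 t * (if a < x i \<and> x i \<le> t then D i else 0)) has_integral
      (\<Sum>i=1..n. if a < x i \<and> x i \<le> b then D i * (G 0 b - G 0 (x i)) else 0)) {a..b}"
    by (intro has_integral_sum one) auto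
  moreover have "(\<Sum>i=1..n. if a < x i \<and> x i \<le> b then D i * (G 0 b - G 0 (x i)) else 0) =
     G 0 b * mark_sum x D n a b - (\<Sum>i=1..n. if a < x i \<and> x i \<le> b then D i * G 0 (x i) else 0)"
    unfolding mark_sum_def sum_distrib_left sum_subtractf[symmetric]
    by (intro sum.cong) (auto simp: algebra_simps)
  ultimately show ?thesis unfolding mark_sum_def sum_distrib_left by simp
qed

lemma weighted_young: "0 < \<nu> \<Longrightarrow> p * q \<le> \<nu> * p\<^sup>2 + q\<^sup>2 / (4 * \<nu>)" for p q \<nu> :: real
proof -
  assume \<nu>: "0 < \<nu>"
  have "0 \<le> (2 * \<nu> * p - q)\<^sup>2 / (4 * \<nu>)" using \<nu> by simp
  also have "\<dots> = \<nu> * p\<^sup>2 + q\<^sup>2 / (4 * \<nu>) - p * q" using \<nu> by (simp add: power2_diff power_mult_distrib field_simps power2_eq_square)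
  finally show ?thesis by simp
qed

text \<open>On every cell, summation by parts leaves an endpoint term and an integral of
  \<open>G 1\<close> against the running sum. Young's inequality with a small \<nu> splits both into
  energy of \<open>d\<close>, to be absorbed later, and oscillation \<open>R\<close>. The 7 is 6
  from the endpoint (2 from the sup bound, 3 from the weight) plus 1 from the integral.\<close>

lemma noise_bound:
  fixes x D :: "nat \<Rightarrow> real" and N n :: nat
  assumes d: "sobolev_jet m d" and m: "0 < m" and G: "sobolev_jet m G"
    and N: "N > 0" "\<delta> = 1 / real N" and n: "n > 0" and \<phi>: "slow_weight \<delta> \<phi>"
    and G0: "\<And>t. t \<in> {0..1} \<Longrightarrow> \<bar>G 0 t\<bar> \<le> \<phi> t * \<bar>d 0 t\<bar>"
    and G1: "\<And>t. t \<in> {0..1} \<Longrightarrow> \<bar>G 1 t\<bar> \<le> \<phi> t * (\<bar>d 1 t\<bar> + A / \<delta> * \<bar>d 0 t\<bar>)"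
    and S: "integral {0..1} \<phi> \<le> S * \<delta>" and A: "A \<ge> 0"
    and x: "\<And>i. i \<in> {1..n} \<Longrightarrow> 0 < x i \<and> x i \<le> 1"
    and R1: "\<And>k. k < N \<Longrightarrow> (mark_sum x D n (real k / real N) (real (Suc k) / real N))\<^sup>2 \<le> R * (real n)\<^sup>2"
    and R2: "\<And>k. k < N \<Longrightarrow> integral {real k / real N..real (Suc k) / real N} (\<lambda>t. (mark_sum x D n (real k / real N) t)\<^sup>2) \<le> \<delta> * R * (real n)\<^sup>2"
    and \<nu>: "\<nu> > 0" and R: "R \<ge> 0"
  shows "1 / real n * (\<Sum>i=1..n. D i * G 0 (x i)) \<le>
    7 * \<nu> * (integral {0..1} (\<lambda>t. \<phi> t * (d 0 t)\<^sup>2) + \<delta>\<^sup>2 * integral {0..1} (\<lambda>t. \<phi> t * (d 1 t)\<^sup>2)) + 3 * S * (1 + A\<^sup>2) * R / (\<nu> * \<delta>)"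
proof -
  have \<delta>: "\<delta> > 0" using N by simp
  have L0: "L2_01 (d 0)" and L1: "L2_01 (d 1)" and LG1: "L2_01 (G 1)" using m by (auto intro: sobolev_jet_L2[OF d] sobolev_jet_L2[OF G])
  have Lc: "L2_01 (\<lambda>_. 1)" by (intro L2_01_continuous continuous_intros)
  let ?a = "\<lambda>k. real k / real N" and ?b = "\<lambda>k. real (Suc k) / real N"
  let ?I = "\<lambda>k f. integral {?a k..?b k} f"
  let ?E = "\<lambda>t. \<phi> t * (d 0 t)\<^sup>2 + \<delta>\<^sup>2 * (\<phi> t * (d 1 t)\<^sup>2)"
  have Ei: "?E integrable_on {0..1}"
    by (intro integrable_add integrable_on_mult_right weighted_square_integrable[OF \<phi>] L0 L1)
  have \<phi>i: "\<phi> integrable_on {0..1}" by (intro integrable_continuous_real slow_weightD(1)[OF \<phi>])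
  \<comment> \<open>Collects the oscillation terms: the endpoint gives \<open>1 / 4\<close> and the
    integral \<open>3 / 4 * (1 + A\<^sup>2)\<close>, together at most \<open>1 + A\<^sup>2\<close>.
    The 3 comes from replacing \<open>\<phi> b * \<delta>\<close> by the integral of \<phi> over the
    cell.\<close>
  define K where "K = 3 * (1 + A\<^sup>2) * R / (\<nu> * \<delta>\<^sup>2)"
  have piece: "1 / real n * (\<Sum>i=1..n. if ?a k < x i \<and> x i \<le> ?b k then D i * G 0 (x i) else 0) \<le> 7 * \<nu> * ?I k ?E + K * ?I k \<phi>"
    if k: "k < N" for k
  proof -
    define a b where "a = ?a k" and "b = ?b k"
    have ab: "0 \<le> a" "a < b" "b \<le> 1" "b - a = \<delta>" "b - a \<le> \<delta>" "b \<in> {a..b}"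
      using piece_bounds[OF k] N unfolding a_def b_def by auto
    have ab': "a \<le> b" and b01: "b \<in> {0..1}" using ab by auto
    note W = slow_weight_integral_bounds[OF \<phi> _ ab(1) ab' ab(3,5,6)]
    have pb: "0 \<le> \<phi> b" by (rule slow_weightD(2)[OF \<phi> b01])
    define \<tau> where "\<tau> t = mark_sum x D n a t / real n" for t
    have L\<tau>: "L2_01 \<tau>" unfolding \<tau>_def using L2_01_cmult[OF mark_sum_L2, of "1 / real n" x D n a] by simp
    have n2: "(real n)\<^sup>2 > 0" using n by simp
    have T1: "(\<tau> b)\<^sup>2 \<le> R"
      using R1[OF k] n2 unfolding \<tau>_def a_def b_def by (simp add: power_divide divide_le_eq)
    have T2: "integral {a..b} (\<lambda>t. (\<tau> t)\<^sup>2) \<le> \<delta> * R"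
    proof -
      have "integral {a..b} (\<lambda>t. (\<tau> t)\<^sup>2) = integral {a..b} (\<lambda>t. (mark_sum x D n a t)\<^sup>2) / (real n)\<^sup>2"
        unfolding \<tau>_def power_divide by simp
      then show ?thesis using R2[OF k] n2 unfolding a_def b_def by (simp add: divide_le_eq)
    qed
    have E0: "0 \<le> integral {a..b} (\<lambda>t. \<phi> t * (d 0 t)\<^sup>2)" and E1: "0 \<le> integral {a..b} (\<lambda>t. \<phi> t * (d 1 t)\<^sup>2)"
      by (rule weighted_square_integral_nonneg[OF \<phi> _ ab(1,3)], rule L0)
         (rule weighted_square_integral_nonneg[OF \<phi> _ ab(1,3)], rule L1)
    have wi: "(\<lambda>t. \<phi> t * (d 0 t)\<^sup>2) integrable_on {a..b}" "(\<lambda>t. \<phi> t * (d 1 t)\<^sup>2) integrable_on {a..b}" "(\<lambda>t. \<phi> t * (\<tau> t)\<^sup>2) integrable_on {a..b}"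
      by (intro integrable_on_sub01[OF _ ab(1,3)] weighted_square_integrable[OF \<phi>] L0 L1 L\<tau>)+
    have IE: "integral {a..b} ?E = integral {a..b} (\<lambda>t. \<phi> t * (d 0 t)\<^sup>2) + \<delta>\<^sup>2 * integral {a..b} (\<lambda>t. \<phi> t * (d 1 t)\<^sup>2)"
      using wi by (subst Henstock_Kurzweil_Integration.integral_add) (auto intro: integrable_on_mult_right)
    have \<phi>b: "\<phi> b * \<delta> \<le> 3 * integral {a..b} \<phi>"
      using W(2)[OF Lc] ab by simp
    have P1: "G 0 b * \<tau> b \<le> 6 * \<nu> * integral {a..b} ?E + \<phi> b * R / (4 * \<nu> * \<delta>)"
    proof -
      have "G 0 b * \<tau> b \<le> \<bar>G 0 b\<bar> * \<bar>\<tau> b\<bar>" by (metis abs_ge_self abs_mult)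
      also have "\<dots> \<le> (\<phi> b * \<bar>d 0 b\<bar>) * \<bar>\<tau> b\<bar>" using G0[OF b01] by (intro mult_right_mono) auto
      also have "\<dots> = \<phi> b * (\<bar>d 0 b\<bar> * \<bar>\<tau> b\<bar>)" by simp
      \<comment> \<open>Young's parameter is \<open>\<nu> * \<delta>\<close> because the sup bound
        for \<open>d 0\<close> on a cell returns a factor \<open>1 / \<delta>\<close>.\<close>
      also have "\<dots> \<le> \<phi> b * (\<nu> * \<delta> * \<bar>d 0 b\<bar>\<^sup>2 + \<bar>\<tau> b\<bar>\<^sup>2 / (4 * (\<nu> * \<delta>)))"
        using \<nu> \<delta> pb by (intro mult_left_mono weighted_young) auto
      also have "\<dots> = \<nu> * \<delta> * (\<phi> b * (d 0 b)\<^sup>2) + \<phi> b * (\<tau> b)\<^sup>2 / (4 * \<nu> * \<delta>)" by (simp add: algebra_simps)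
      also have "\<dots> \<le> \<nu> * \<delta> * (\<phi> b * (2 / \<delta> * integral {a..b} (\<lambda>t. (d 0 t)\<^sup>2) + 2 * \<delta> * integral {a..b} (\<lambda>t. (d 1 t)\<^sup>2))) + \<phi> b * R / (4 * \<nu> * \<delta>)"
        using jet_sup_le[OF d m ab(1-3,6)] T1 \<nu> \<delta> pb unfolding ab(4)
        by (intro add_mono mult_left_mono divide_right_mono) auto
      also have "\<nu> * \<delta> * (\<phi> b * (2 / \<delta> * integral {a..b} (\<lambda>t. (d 0 t)\<^sup>2) + 2 * \<delta> * integral {a..b} (\<lambda>t. (d 1 t)\<^sup>2))) =
          2 * \<nu> * (\<phi> b * integral {a..b} (\<lambda>t. (d 0 t)\<^sup>2)) + 2 * \<nu> * \<delta>\<^sup>2 * (\<phi> b * integral {a..b} (\<lambda>t. (d 1 t)\<^sup>2))"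
        using \<delta> by (simp add: field_simps power2_eq_square)
      also have "\<dots> \<le> 2 * \<nu> * (3 * integral {a..b} (\<lambda>t. \<phi> t * (d 0 t)\<^sup>2)) + 2 * \<nu> * \<delta>\<^sup>2 * (3 * integral {a..b} (\<lambda>t. \<phi> t * (d 1 t)\<^sup>2))"
        using \<nu> by (intro add_mono mult_left_mono W L0 L1) auto
      also have "\<dots> = 6 * \<nu> * integral {a..b} ?E" unfolding IE by (simp add: algebra_simps)
      finally show ?thesis by simp
    qed
    have P2: "- integral {a..b} (\<lambda>t. G 1 t * \<tau> t) \<le> \<nu> * integral {a..b} ?E + (1 + A\<^sup>2) / (4 * \<nu> * \<delta>\<^sup>2) * (3 * \<phi> b * (\<delta> * R))"
    proof -
      have "norm (integral {a..b} (\<lambda>t. G 1 t * \<tau> t)) \<le> integral {a..b} (\<lambda>t. \<nu> * ?E t + (1 + A\<^sup>2) / (4 * \<nu> * \<delta>\<^sup>2) * (\<phi> t * (\<tau> t)\<^sup>2))"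
      proof (rule integral_norm_bound_integral)
        show "(\<lambda>t. G 1 t * \<tau> t) integrable_on {a..b}"
          by (rule integrable_on_sub01[OF L2_01_prod_integrable[OF LG1 L\<tau>] ab(1,3)])
        show "(\<lambda>t. \<nu> * ?E t + (1 + A\<^sup>2) / (4 * \<nu> * \<delta>\<^sup>2) * (\<phi> t * (\<tau> t)\<^sup>2)) integrable_on {a..b}"
          by (intro integrable_add integrable_on_mult_right wi)
        fix t assume "t \<in> {a..b}"
        then have t: "t \<in> {0..1}" using ab by auto
        have pt: "0 \<le> \<phi> t" by (rule slow_weightD(2)[OF \<phi> t])
        have "norm (G 1 t * \<tau> t) \<le> (\<phi> t * (\<bar>d 1 t\<bar> + A / \<delta> * \<bar>d 0 t\<bar>)) * \<bar>\<tau> t\<bar>"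
          using G1[OF t] by (simp add: abs_mult mult_right_mono)
        also have "\<dots> = \<phi> t * ((\<delta> * \<bar>d 1 t\<bar>) * (\<bar>\<tau> t\<bar> / \<delta>) + \<bar>d 0 t\<bar> * (A * \<bar>\<tau> t\<bar> / \<delta>))"
          using \<delta> by (simp add: field_simps)
        also have "\<dots> \<le> \<phi> t * ((\<nu> * (\<delta> * \<bar>d 1 t\<bar>)\<^sup>2 + (\<bar>\<tau> t\<bar> / \<delta>)\<^sup>2 / (4 * \<nu>)) + (\<nu> * \<bar>d 0 t\<bar>\<^sup>2 + (A * \<bar>\<tau> t\<bar> / \<delta>)\<^sup>2 / (4 * \<nu>)))"
          using pt \<nu> by (intro mult_left_mono add_mono weighted_young) auto
        also have "\<dots> = \<nu> * ?E t + (1 + A\<^sup>2) / (4 * \<nu> * \<delta>\<^sup>2) * (\<phi> t * (\<tau> t)\<^sup>2)"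
          using \<delta> \<nu> by (simp add: power_mult_distrib power_divide field_simps)
        finally show "norm (G 1 t * \<tau> t) \<le> \<nu> * ?E t + (1 + A\<^sup>2) / (4 * \<nu> * \<delta>\<^sup>2) * (\<phi> t * (\<tau> t)\<^sup>2)" .
      qed
      also have "\<dots> = \<nu> * integral {a..b} ?E + (1 + A\<^sup>2) / (4 * \<nu> * \<delta>\<^sup>2) * integral {a..b} (\<lambda>t. \<phi> t * (\<tau> t)\<^sup>2)"
        by (subst Henstock_Kurzweil_Integration.integral_add)
          (intro integrable_add integrable_on_mult_right wi, intro integrable_on_mult_right wi,
            simp only: Henstock_Kurzweil_Integration.integral_mult_right)
      also have "\<dots> \<le> \<nu> * integral {a..b} ?E + (1 + A\<^sup>2) / (4 * \<nu> * \<delta>\<^sup>2) * (3 * \<phi> b * (\<delta> * R))"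
      proof (intro add_left_mono mult_left_mono)
        have "integral {a..b} (\<lambda>t. \<phi> t * (\<tau> t)\<^sup>2) \<le> 3 * \<phi> b * integral {a..b} (\<lambda>t. (\<tau> t)\<^sup>2)" by (rule W(1)[OF L\<tau>])
        also have "\<dots> \<le> 3 * \<phi> b * (\<delta> * R)" using T2 pb by (intro mult_left_mono) auto
        finally show "integral {a..b} (\<lambda>t. \<phi> t * (\<tau> t)\<^sup>2) \<le> 3 * \<phi> b * (\<delta> * R)" .
      qed (use \<nu> in auto)
      finally show ?thesis by simp
    qed
    have ibp: "1 / real n * (\<Sum>i=1..n. if a < x i \<and> x i \<le> b then D i * G 0 (x i) else 0) = G 0 b * \<tau> b - integral {a..b} (\<lambda>t. G 1 t * \<tau> t)"
    proof -
      have "integral {a..b} (\<lambda>t. G 1 t * \<tau> t) = integral {a..b} (\<lambda>t. G 1 t * mark_sum x D n a t) / real n"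
        unfolding \<tau>_def by simp
      then show ?thesis using integral_unique[OF mark_sum_by_parts[OF G m ab(1) ab' ab(3), of x D n]] n unfolding \<tau>_def
        by (simp add: field_simps)
    qed
    have "\<phi> b * R / (4 * \<nu> * \<delta>) + (1 + A\<^sup>2) / (4 * \<nu> * \<delta>\<^sup>2) * (3 * \<phi> b * (\<delta> * R)) = (\<phi> b * \<delta>) * ((1 / 4 + 3 / 4 * (1 + A\<^sup>2)) * R / (\<nu> * \<delta>\<^sup>2))"
      using \<delta> \<nu> by (simp add: field_simps power2_eq_square)
    also have "\<dots> \<le> (3 * integral {a..b} \<phi>) * ((1 + A\<^sup>2) * R / (\<nu> * \<delta>\<^sup>2))"
    proof (rule mult_mono[OF \<phi>b])
      have "(1 / 4 + 3 / 4 * (1 + A\<^sup>2)) \<le> 1 + A\<^sup>2" using zero_le_power2[of A] by (simp add: field_simps)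
      then show "(1 / 4 + 3 / 4 * (1 + A\<^sup>2)) * R / (\<nu> * \<delta>\<^sup>2) \<le> (1 + A\<^sup>2) * R / (\<nu> * \<delta>\<^sup>2)"
        using R \<nu> by (intro divide_right_mono mult_right_mono) auto
      have "0 \<le> \<phi> b * \<delta>" using pb \<delta> by simp
      then show "0 \<le> 3 * integral {a..b} \<phi>" using \<phi>b by linarith
      show "0 \<le> (1 / 4 + 3 / 4 * (1 + A\<^sup>2)) * R / (\<nu> * \<delta>\<^sup>2)" using R \<nu> by simp
    qed
    also have "\<dots> = K * integral {a..b} \<phi>" unfolding K_def by simp
    finally show ?thesis using ibp P1 P2 unfolding a_def b_def by (simp add: algebra_simps)
  qed
  have "(\<Sum>i=1..n. D i * G 0 (x i)) = (\<Sum>i=1..n. \<Sum>k<N. if ?a k < x i \<and> x i \<le> ?b k then D i * G 0 (x i) else 0)"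
  proof (intro sum.cong refl)
    fix i assume i: "i \<in> {1..n}"
    show "D i * G 0 (x i) = (\<Sum>k<N. if ?a k < x i \<and> x i \<le> ?b k then D i * G 0 (x i) else 0)"
      using sum_indicator_pieces[of "x i" N "D i * G 0 (x i)"] x[OF i] N by simp
  qed
  also have "\<dots> = (\<Sum>k<N. \<Sum>i=1..n. if ?a k < x i \<and> x i \<le> ?b k then D i * G 0 (x i) else 0)" by (rule sum.swap)
  finally have "1 / real n * (\<Sum>i=1..n. D i * G 0 (x i)) = (\<Sum>k<N. 1 / real n * (\<Sum>i=1..n. if ?a k < x i \<and> x i \<le> ?b k then D i * G 0 (x i) else 0))"
    by (simp add: sum_distrib_left)
  also have "\<dots> \<le> (\<Sum>k<N. 7 * \<nu> * ?I k ?E + K * ?I k \<phi>)" using piece by (intro sum_mono) auto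
  also have "\<dots> = 7 * \<nu> * integral {0..1} ?E + K * integral {0..1} \<phi>"
    unfolding sum.distrib sum_distrib_left[symmetric] sum_integral_pieces[OF Ei N(1)] sum_integral_pieces[OF \<phi>i N(1)] ..
  also have "\<dots> \<le> 7 * \<nu> * integral {0..1} ?E + K * (S * \<delta>)"
    using S R \<nu> unfolding K_def by (intro add_left_mono mult_left_mono) auto
  also have "integral {0..1} ?E = integral {0..1} (\<lambda>t. \<phi> t * (d 0 t)\<^sup>2) + \<delta>\<^sup>2 * integral {0..1} (\<lambda>t. \<phi> t * (d 1 t)\<^sup>2)"
    using weighted_square_integrable[OF \<phi> L0] weighted_square_integrable[OF \<phi> L1]
    by (subst Henstock_Kurzweil_Integration.integral_add) (auto intro: integrable_on_mult_right)
  also have "K * (S * \<delta>) = 3 * S * (1 + A\<^sup>2) * R / (\<nu> * \<delta>)" unfolding K_def using \<delta> \<nu> by (simp add: field_simps power2_eq_square)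
  finally show ?thesis .
qed

text \<open>On a cell every sampled square is at least half the mean square minus a gradient term,
  and there are at least \<open>c0 * n / N\<close> samples. The 18 is 2 * 3 * 3: the halving and two
  weight comparisons. The gradient term carries the squared cell length and is made small by
  refining the cells.\<close>

lemma design_bound:
  fixes x :: "nat \<Rightarrow> real" and N n :: nat
  assumes d: "sobolev_jet m d" and m: "0 < m" and N: "N > 0" "1 / real N \<le> \<delta>" and n: "n > 0" and \<phi>: "slow_weight \<delta> \<phi>"
    and x: "\<And>i. i \<in> {1..n} \<Longrightarrow> 0 < x i \<and> x i \<le> 1" and c0: "c0 \<ge> 0"
    and cnt: "\<And>k. k < N \<Longrightarrow> mark_sum x (\<lambda>_. 1) n (real k / real N) (real (Suc k) / real N) \<ge> c0 * real n / real N"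
  shows "c0 / 18 * integral {0..1} (\<lambda>t. \<phi> t * (d 0 t)\<^sup>2) - c0 * (1 / real N)\<^sup>2 * integral {0..1} (\<lambda>t. \<phi> t * (d 1 t)\<^sup>2)
     \<le> 1 / real n * (\<Sum>i=1..n. \<phi> (x i) * (d 0 (x i))\<^sup>2)"
proof -
  have L0: "L2_01 (d 0)" and L1: "L2_01 (d 1)" using m by (auto intro: sobolev_jet_L2[OF d])
  let ?a = "\<lambda>k. real k / real N" and ?b = "\<lambda>k. real (Suc k) / real N"
  let ?I = "\<lambda>k j. integral {?a k..?b k} (\<lambda>t. \<phi> t * (d j t)\<^sup>2)"
  let ?f = "\<lambda>i. \<phi> (x i) * (d 0 (x i))\<^sup>2"
  have piece: "c0 / 18 * ?I k 0 - c0 * (1 / real N)\<^sup>2 * ?I k 1 \<le> 1 / real n * (\<Sum>i=1..n. if ?a k < x i \<and> x i \<le> ?b k then ?f i else 0)"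
    if k: "k < N" for k
  proof -
    define l where "l = 1 / real N"
    have l: "l > 0" unfolding l_def using N by simp
    define a b where "a = ?a k" and "b = ?b k"
    have ab: "0 \<le> a" "a < b" "b \<le> 1" "b - a = l" "b - a \<le> \<delta>" "a \<in> {a..b}"
      using piece_bounds[OF k] N unfolding a_def b_def l_def by auto
    have ab': "a \<le> b" and a01: "a \<in> {0..1}" using ab by auto
    note W = slow_weight_integral_bounds[OF \<phi> _ ab(1) ab' ab(3,5,6)]
    have pa: "0 \<le> \<phi> a" by (rule slow_weightD(2)[OF \<phi> a01])
    define U where "U = integral {a..b} (\<lambda>t. (d 0 t)\<^sup>2)"
    define V where "V = integral {a..b} (\<lambda>t. (d 1 t)\<^sup>2)"
    have u2: "(\<lambda>x. (d 0 x)\<^sup>2) integrable_on {a..b}"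
      using L0 unfolding L2_01_def by (intro integrable_on_sub01[OF conjunct2 ab(1,3)])
    \<comment> \<open>Cut off at 0, since this lower bound is multiplied by a lower bound for the
      number of points.\<close>
    define \<mu> where "\<mu> = max 0 (U / (2 * l) - l * V)"
    have pt: "\<mu> \<le> (d 0 y)\<^sup>2" if y: "y \<in> {a..b}" for y
    proof -
      have "U \<le> integral {a..b} (\<lambda>_. 2 * (d 0 y)\<^sup>2 + 2 * l * V)"
        unfolding U_def using jet_square_transfer[OF d m ab(1,3) _ y] u2 unfolding V_def ab(4)
        by (intro integral_le) auto
      also have "\<dots> = l * (2 * (d 0 y)\<^sup>2 + 2 * l * V)" using ab by simp
      finally have "U / (2 * l) \<le> (d 0 y)\<^sup>2 + l * V" using l by (simp add: field_simps)
      then show ?thesis unfolding \<mu>_def by simp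
    qed
    have "\<phi> a / 3 * \<mu> * (c0 * real n * l) \<le> \<phi> a / 3 * \<mu> * mark_sum x (\<lambda>_. 1) n a b"
      using cnt[OF k] pa unfolding a_def b_def l_def \<mu>_def by (intro mult_left_mono) auto
    also have "\<dots> = (\<Sum>i=1..n. if a < x i \<and> x i \<le> b then \<phi> a / 3 * \<mu> else 0)"
      unfolding mark_sum_def sum_distrib_left by (intro sum.cong) auto
    also have "\<dots> \<le> (\<Sum>i=1..n. if a < x i \<and> x i \<le> b then ?f i else 0)"
    proof (rule sum_mono)
      fix i
      have "\<phi> a / 3 * \<mu> \<le> ?f i" if i: "a < x i" "x i \<le> b"
      proof (rule mult_mono)
        have "\<phi> a \<le> 3 * \<phi> (x i)" using i ab by (intro slow_weightD(3)[OF \<phi>]) auto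
        then show "\<phi> a / 3 \<le> \<phi> (x i)" by simp
        show "\<mu> \<le> (d 0 (x i))\<^sup>2" using i by (intro pt) auto
        show "0 \<le> \<phi> (x i)" using i ab by (intro slow_weightD(2)[OF \<phi>]) auto
      qed (simp add: \<mu>_def)
      then show "(if a < x i \<and> x i \<le> b then \<phi> a / 3 * \<mu> else 0) \<le> (if a < x i \<and> x i \<le> b then ?f i else 0)" by auto
    qed
    finally have *: "\<phi> a / 3 * \<mu> * (c0 * l) \<le> 1 / real n * (\<Sum>i=1..n. if a < x i \<and> x i \<le> b then ?f i else 0)"
      using n by (simp add: field_simps)
    have "c0 / 18 * integral {a..b} (\<lambda>t. \<phi> t * (d 0 t)\<^sup>2) - c0 * l\<^sup>2 * integral {a..b} (\<lambda>t. \<phi> t * (d 1 t)\<^sup>2) \<le>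
       c0 / 18 * (3 * \<phi> a * U) - c0 * l\<^sup>2 * (\<phi> a * V / 3)"
      unfolding U_def V_def
    proof (rule diff_mono)
      show "c0 / 18 * integral {a..b} (\<lambda>t. \<phi> t * (d 0 t)\<^sup>2) \<le> c0 / 18 * (3 * \<phi> a * integral {a..b} (\<lambda>t. (d 0 t)\<^sup>2))"
        using c0 W(1)[OF L0] by (intro mult_left_mono) auto
      have "\<phi> a * integral {a..b} (\<lambda>t. (d 1 t)\<^sup>2) / 3 \<le> integral {a..b} (\<lambda>t. \<phi> t * (d 1 t)\<^sup>2)" using W(2)[OF L1] by simp
      then show "c0 * l\<^sup>2 * (\<phi> a * integral {a..b} (\<lambda>t. (d 1 t)\<^sup>2) / 3) \<le> c0 * l\<^sup>2 * integral {a..b} (\<lambda>t. \<phi> t * (d 1 t)\<^sup>2)"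
        using c0 by (intro mult_left_mono) auto
    qed
    also have "\<dots> = \<phi> a / 3 * (U / (2 * l) - l * V) * (c0 * l)" using l by (simp add: field_simps power2_eq_square)
    also have "\<dots> \<le> \<phi> a / 3 * \<mu> * (c0 * l)"
      using pa c0 l unfolding \<mu>_def by (intro mult_left_mono mult_right_mono) auto
    also note *
    finally show ?thesis unfolding a_def b_def l_def .
  qed
  have "(\<Sum>i=1..n. ?f i) = (\<Sum>i=1..n. \<Sum>k<N. if ?a k < x i \<and> x i \<le> ?b k then ?f i else 0)"
  proof (intro sum.cong refl)
    fix i assume i: "i \<in> {1..n}"
    show "?f i = (\<Sum>k<N. if ?a k < x i \<and> x i \<le> ?b k then ?f i else 0)"
      using sum_indicator_pieces[of "x i" N "?f i"] x[OF i] N by simp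
  qed
  also have "\<dots> = (\<Sum>k<N. \<Sum>i=1..n. if ?a k < x i \<and> x i \<le> ?b k then ?f i else 0)" by (rule sum.swap)
  finally have "1 / real n * (\<Sum>i=1..n. ?f i) = (\<Sum>k<N. 1 / real n * (\<Sum>i=1..n. if ?a k < x i \<and> x i \<le> ?b k then ?f i else 0))"
    by (simp add: sum_distrib_left)
  moreover have "(\<Sum>k<N. c0 / 18 * ?I k 0 - c0 * (1 / real N)\<^sup>2 * ?I k 1) \<le> (\<Sum>k<N. 1 / real n * (\<Sum>i=1..n. if ?a k < x i \<and> x i \<le> ?b k then ?f i else 0))"
    using piece by (intro sum_mono) auto
  moreover have "(\<Sum>k<N. c0 / 18 * ?I k 0 - c0 * (1 / real N)\<^sup>2 * ?I k 1) =
      c0 / 18 * integral {0..1} (\<lambda>t. \<phi> t * (d 0 t)\<^sup>2) - c0 * (1 / real N)\<^sup>2 * integral {0..1} (\<lambda>t. \<phi> t * (d 1 t)\<^sup>2)"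
    unfolding sum_subtractf sum_distrib_left[symmetric]
      sum_integral_pieces[OF weighted_square_integrable[OF \<phi> L0] N(1)] sum_integral_pieces[OF weighted_square_integrable[OF \<phi> L1] N(1)] ..
  ultimately show ?thesis by simp
qed

section \<open>A maximal inequality for mark sums\<close>

lemma exp_le_quadratic:
  fixes u :: real
  assumes "\<bar>u\<bar> \<le> 1"
  shows "exp u \<le> 1 + u + u\<^sup>2"
proof (cases "u \<ge> 0")
  case True then show ?thesis using exp_bound[of u] assms by simp
next
  case False
  define v where "v = - u"
  have v: "0 \<le> v" "v \<le> 1" using False assms unfolding v_def by auto
  have q: "1 + v + v\<^sup>2 / 2 \<le> exp v" using exp_lower_Taylor_quadratic[OF v(1)] by simp
  have p: "1 + v + v\<^sup>2 / 2 > 0" using v by (simp add: add_pos_nonneg)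
  have "exp u = 1 / exp v" unfolding v_def by (simp add: exp_minus inverse_eq_divide)
  also have "\<dots> \<le> 1 / (1 + v + v\<^sup>2 / 2)" using q p by (intro divide_left_mono) auto
  also have "\<dots> \<le> 1 - v + v\<^sup>2"
  proof -
    have "(1 - v + v\<^sup>2) * (1 + v + v\<^sup>2 / 2) = 1 + (v\<^sup>2 + v ^ 3 + v ^ 4) / 2"
      by (simp add: field_simps power2_eq_square power3_eq_cube power4_eq_xxxx)
    then have "1 \<le> (1 - v + v\<^sup>2) * (1 + v + v\<^sup>2 / 2)" using v by simp
    then show ?thesis using p by (simp add: divide_le_eq)
  qed
  finally show ?thesis unfolding v_def by simp
qed

text \<open>For \<bar>u\<bar> > 2a the exponent \<bar>u\<bar> - a exceeds \<bar>u\<bar> / 2, whose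
  exponential dominates \<open>u\<^sup>2 / 8\<close>. Consequently, if an average of
  \<open>cosh u\<close> is at most \<open>exp a\<close>, the average of the squares is at most
  \<open>4 * a\<^sup>2 + 16\<close>.\<close>

lemma square_le_cosh:
  fixes u a :: real
  assumes "0 \<le> a"
  shows "u\<^sup>2 \<le> 4 * a\<^sup>2 + 16 * exp (- a) * cosh u"
proof (cases "\<bar>u\<bar> \<le> 2 * a")
  case True
  then have "u\<^sup>2 \<le> (2 * a)\<^sup>2" using abs_le_square_iff[of u "2 * a"] assms by simp
  moreover have "(2 * a)\<^sup>2 = 4 * a\<^sup>2" by (simp add: power_mult_distrib)
  moreover have "0 \<le> 16 * exp (- a) * cosh u" by simp
  ultimately show ?thesis by linarith
next
  case False
  define v where "v = \<bar>u\<bar> / 2"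
  have v: "0 \<le> v" "a \<le> v" using False unfolding v_def by auto
  have "v\<^sup>2 / 2 \<le> exp v" using exp_lower_Taylor_quadratic[OF v(1)] v by simp
  then have "u\<^sup>2 \<le> 8 * exp v" unfolding v_def by (simp add: power_divide)
  also have "\<dots> \<le> 8 * exp (\<bar>u\<bar> - a)" using v unfolding v_def by simp
  also have "\<dots> = 16 * exp (- a) * (exp \<bar>u\<bar> / 2)" by (simp add: exp_diff exp_minus field_simps)
  also have "\<dots> \<le> 16 * exp (- a) * cosh u"
  proof (intro mult_left_mono)
    have "exp \<bar>u\<bar> / 2 \<le> cosh \<bar>u\<bar>" unfolding cosh_def by simp
    then show "exp \<bar>u\<bar> / 2 \<le> cosh u" by (simp add: cosh_real_abs)
  qed simp
  finally show ?thesis using zero_le_power2[of a] by linarith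
qed

context prob_space
begin

text \<open>Taking expectations in 1 + u \<le> exp u \<le> 1 + u + u^2 removes the linear term. The
  lower bound makes exponentials of partial sums a submartingale; the upper one is Bernstein's
  estimate.\<close>

lemma exp_moment_bounds:
  fixes X :: "'a \<Rightarrow> real"
  assumes [measurable]: "X \<in> borel_measurable M" and b: "\<And>\<omega>. \<bar>X \<omega>\<bar> \<le> b" "\<bar>s\<bar> * b \<le> 1"
    and mean: "expectation X = 0" and var: "expectation (\<lambda>\<omega>. (X \<omega>)\<^sup>2) \<le> \<sigma>"
  shows "1 \<le> expectation (\<lambda>\<omega>. exp (s * X \<omega>))" and "expectation (\<lambda>\<omega>. exp (s * X \<omega>)) \<le> exp (s\<^sup>2 * \<sigma>)"
    and "integrable M (\<lambda>\<omega>. exp (s * X \<omega>))"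
proof -
  have sX: "\<bar>s * X \<omega>\<bar> \<le> 1" for \<omega>
  proof -
    have "\<bar>s * X \<omega>\<bar> \<le> \<bar>s\<bar> * b" unfolding abs_mult using b by (intro mult_left_mono) auto
    then show ?thesis using b by simp
  qed
  have iX: "integrable M X" by (rule integrable_const_bound[where B=b]) (use b in auto)
  have iX2: "integrable M (\<lambda>\<omega>. (X \<omega>)\<^sup>2)"
  proof (rule integrable_const_bound[where B="b\<^sup>2"])
    have "(X \<omega>)\<^sup>2 \<le> b\<^sup>2" for \<omega>
    proof -
      have "\<bar>X \<omega>\<bar> \<le> \<bar>b\<bar>" using b(1)[of \<omega>] by simp
      then show ?thesis by (simp add: abs_le_square_iff)
    qed
    then show "AE \<omega> in M. norm ((X \<omega>)\<^sup>2) \<le> b\<^sup>2" by simp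
  qed simp
  show iE: "integrable M (\<lambda>\<omega>. exp (s * X \<omega>))"
  proof (rule integrable_const_bound[where B="exp 1"])
    show "AE \<omega> in M. norm (exp (s * X \<omega>)) \<le> exp 1" using sX by (auto simp: abs_le_iff)
  qed simp
  have "expectation (\<lambda>\<omega>. 1 + s * X \<omega>) \<le> expectation (\<lambda>\<omega>. exp (s * X \<omega>))"
    by (rule integral_mono) (use iX iE in \<open>auto intro: exp_ge_add_one_self\<close>)
  moreover have "expectation (\<lambda>\<omega>. 1 + s * X \<omega>) = 1"
    using iX mean by (simp add: prob_space)
  ultimately show "1 \<le> expectation (\<lambda>\<omega>. exp (s * X \<omega>))" by simp
  have "expectation (\<lambda>\<omega>. exp (s * X \<omega>)) \<le> expectation (\<lambda>\<omega>. 1 + s * X \<omega> + s\<^sup>2 * (X \<omega>)\<^sup>2)"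
    by (rule integral_mono) (use iX iX2 iE exp_le_quadratic[OF sX] in \<open>auto simp: power_mult_distrib\<close>)
  also have "\<dots> = 1 + s\<^sup>2 * expectation (\<lambda>\<omega>. (X \<omega>)\<^sup>2)"
    using iX iX2 mean by (simp add: prob_space)
  also have "\<dots> \<le> 1 + s\<^sup>2 * \<sigma>" using var by (intro add_left_mono mult_left_mono) auto
  also have "\<dots> \<le> exp (s\<^sup>2 * \<sigma>)" by (rule exp_ge_add_one_self)
  finally show "expectation (\<lambda>\<omega>. exp (s * X \<omega>)) \<le> exp (s\<^sup>2 * \<sigma>)" .
qed

text \<open>Independence of the first \<open>n\<close> observations from the next one; it takes the
  place of conditioning on the past in the submartingale argument.\<close>

lemma expectation_mult_next:
  fixes Z :: "nat \<Rightarrow> 'a \<Rightarrow> 'z" and g :: "'z \<Rightarrow> real" and f :: "(nat \<Rightarrow> 'z) \<Rightarrow> real"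
  assumes ind: "indep_vars (\<lambda>_. S) Z {1..}" and f: "f \<in> borel_measurable (PiM {1..n} (\<lambda>_. S))" and g: "g \<in> borel_measurable S"
    and fi: "integrable M (\<lambda>\<omega>. f (\<lambda>i\<in>{1..n}. Z i \<omega>))" and gi: "integrable M (\<lambda>\<omega>. g (Z (Suc n) \<omega>))"
  shows "expectation (\<lambda>\<omega>. f (\<lambda>i\<in>{1..n}. Z i \<omega>) * g (Z (Suc n) \<omega>)) = expectation (\<lambda>\<omega>. f (\<lambda>i\<in>{1..n}. Z i \<omega>)) * expectation (\<lambda>\<omega>. g (Z (Suc n) \<omega>))"
    and "integrable M (\<lambda>\<omega>. f (\<lambda>i\<in>{1..n}. Z i \<omega>) * g (Z (Suc n) \<omega>))"
proof -
  have "indep_var (PiM {1..n} (\<lambda>_. S)) (\<lambda>\<omega>. restrict (\<lambda>i. Z i \<omega>) {1..n}) (PiM {Suc n} (\<lambda>_. S)) (\<lambda>\<omega>. restrict (\<lambda>i. Z i \<omega>) {Suc n})"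
    by (rule indep_var_restrict[OF ind]) auto
  then have "indep_var borel (f \<circ> (\<lambda>\<omega>. restrict (\<lambda>i. Z i \<omega>) {1..n})) borel ((\<lambda>z. g (z (Suc n))) \<circ> (\<lambda>\<omega>. restrict (\<lambda>i. Z i \<omega>) {Suc n}))"
  proof (rule indep_var_compose[OF _ f])
    show "(\<lambda>z. g (z (Suc n))) \<in> borel_measurable (PiM {Suc n} (\<lambda>_. S))" using g by measurable
  qed
  then have iv: "indep_var borel (\<lambda>\<omega>. f (\<lambda>i\<in>{1..n}. Z i \<omega>)) borel (\<lambda>\<omega>. g (Z (Suc n) \<omega>))"
    by (simp add: o_def)
  show "expectation (\<lambda>\<omega>. f (\<lambda>i\<in>{1..n}. Z i \<omega>) * g (Z (Suc n) \<omega>)) = expectation (\<lambda>\<omega>. f (\<lambda>i\<in>{1..n}. Z i \<omega>)) * expectation (\<lambda>\<omega>. g (Z (Suc n) \<omega>))"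
    and "integrable M (\<lambda>\<omega>. f (\<lambda>i\<in>{1..n}. Z i \<omega>) * g (Z (Suc n) \<omega>))"
    by (rule indep_var_lebesgue_integral[OF iv fi gi], rule indep_var_integrable[OF iv fi gi])
qed

text \<open>Doob's maximal inequality for the submartingale \<open>n \<mapsto> \<integral>cosh (\<theta> \<Sum>i\<le>n. \<zeta> x (Z i)) \<partial>\<mu>\<close>, combined
  with Bernstein's bound for its last term.\<close>

lemma cosh_average_maximal_inequality:
  fixes Z :: "nat \<Rightarrow> 'a \<Rightarrow> 'z" and \<mu> :: "'x measure" and \<zeta> :: "'x \<Rightarrow> 'z \<Rightarrow> real"
  assumes ind: "indep_vars (\<lambda>_. S) Z {1..}" and \<mu>: "prob_space \<mu>"
    and \<zeta>[measurable]: "case_prod \<zeta> \<in> borel_measurable (\<mu> \<Otimes>\<^sub>M S)"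
    and bd: "\<And>x z. \<bar>\<zeta> x z\<bar> \<le> b" and mean: "\<And>x i. i \<ge> 1 \<Longrightarrow> x \<in> space \<mu> \<Longrightarrow> expectation (\<lambda>\<omega>. \<zeta> x (Z i \<omega>)) = 0"
    and var: "\<And>x i. i \<ge> 1 \<Longrightarrow> x \<in> space \<mu> \<Longrightarrow> expectation (\<lambda>\<omega>. (\<zeta> x (Z i \<omega>))\<^sup>2) \<le> \<sigma>"
    and \<theta>: "0 \<le> \<theta>" "\<theta> * b \<le> 1"
  shows "ennreal K * emeasure M {\<omega>\<in>space M. \<exists>k\<le>n. ennreal K \<le> (\<integral>\<^sup>+x. ennreal (cosh (\<theta> * (\<Sum>i=1..k. \<zeta> x (Z i \<omega>)))) \<partial>\<mu>)}
    \<le> ennreal (exp (real n * (\<theta>\<^sup>2 * \<sigma>)))"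
proof -
  interpret \<mu>: prob_space \<mu> by fact
  interpret pair_sigma_finite \<mu> M ..
  have Z[measurable]: "Z i \<in> measurable M S" if "i \<ge> 1" for i
    using ind that unfolding indep_vars_def by auto
  have \<zeta>x: "\<zeta> x \<in> borel_measurable S" if "x \<in> space \<mu>" for x
    using measurable_compose[OF measurable_Pair1'[OF that] \<zeta>] by simp
  define \<Phi> where "\<Phi> k z = (\<integral>\<^sup>+x. ennreal (cosh (\<theta> * (\<Sum>i=1..k. \<zeta> x (z i)))) \<partial>\<mu>)" for k and z :: "nat \<Rightarrow> 'z"
  have \<Phi>m: "\<Phi> k \<in> borel_measurable (PiM {1..n} (\<lambda>_. S))" if "k \<le> n" for k n
  proof -
    have [measurable]: "(\<lambda>(z, x). \<zeta> x (z i)) \<in> borel_measurable (PiM {1..n} (\<lambda>_. S) \<Otimes>\<^sub>M \<mu>)" if "i \<in> {1..n}" for i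
    proof -
      have "(\<lambda>p. (snd p, fst p i)) \<in> measurable (PiM {1..n} (\<lambda>_. S) \<Otimes>\<^sub>M \<mu>) (\<mu> \<Otimes>\<^sub>M S)"
        by (intro measurable_Pair measurable_snd measurable_compose[OF measurable_fst measurable_component_singleton[OF that]])
      from measurable_compose[OF this \<zeta>] show ?thesis by (simp add: case_prod_beta)
    qed
    show ?thesis unfolding \<Phi>_def
    proof (rule \<mu>.borel_measurable_nn_integral)
      have "(\<lambda>p. ennreal (cosh (\<theta> * (\<Sum>i=1..k. (case p of (z, x) \<Rightarrow> \<zeta> x (z i)))))) \<in> borel_measurable (PiM {1..n} (\<lambda>_. S) \<Otimes>\<^sub>M \<mu>)"
      proof (intro measurable_compose[OF _ measurable_ennreal] )
        have "(\<lambda>p. \<Sum>i=1..k. (case p of (z, x) \<Rightarrow> \<zeta> x (z i))) \<in> borel_measurable (PiM {1..n} (\<lambda>_. S) \<Otimes>\<^sub>M \<mu>)"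
          using that by (intro borel_measurable_sum) auto
        then show "(\<lambda>p. cosh (\<theta> * (\<Sum>i=1..k. (case p of (z, x) \<Rightarrow> \<zeta> x (z i))))) \<in> borel_measurable (PiM {1..n} (\<lambda>_. S) \<Otimes>\<^sub>M \<mu>)"
          unfolding cosh_def by measurable
      qed
      then show "(\<lambda>(z, x). ennreal (cosh (\<theta> * (\<Sum>i=1..k. \<zeta> x (z i))))) \<in> borel_measurable (PiM {1..n} (\<lambda>_. S) \<Otimes>\<^sub>M \<mu>)"
        by (simp add: case_prod_beta)
    qed
  qed
  \<comment> \<open>The event that the level \<open>K\<close> has been reached by time
    \<open>n\<close>, written as a condition on the vector of the first \<open>n\<close>
    observations so that independence of the next one applies.\<close>
  define B where "B n z \<longleftrightarrow> (\<exists>k\<le>n. ennreal K \<le> \<Phi> k z)" for n and z :: "nat \<Rightarrow> 'z"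
  have Bm: "(\<lambda>z. indicator {z. B n z} z :: real) \<in> borel_measurable (PiM {1..n} (\<lambda>_. S))" for n
  proof -
    have "{z \<in> space (PiM {1..n} (\<lambda>_. S)). B n z} = (\<Union>k\<in>{..n}. {z \<in> space (PiM {1..n} (\<lambda>_. S)). ennreal K \<le> \<Phi> k z})"
      unfolding B_def by auto
    also have "\<dots> \<in> sets (PiM {1..n} (\<lambda>_. S))"
    proof (intro sets.finite_UN)
      fix k assume "k \<in> {..n}"
      then have "k \<le> n" by simp
      from borel_measurable_le[OF borel_measurable_const \<Phi>m[OF this]]
      show "{z \<in> space (PiM {1..n} (\<lambda>_. S)). ennreal K \<le> \<Phi> k z} \<in> sets (PiM {1..n} (\<lambda>_. S))" .
    qed simp
    finally show ?thesis by (subst borel_measurable_indicator_iff) (simp add: Collect_conj_eq[symmetric] Int_def conj_commute)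
  qed
  define R where "R n \<omega> = (\<lambda>i\<in>{1..n}. Z i \<omega>)" for n \<omega>
  have Rm[measurable]: "R n \<in> measurable M (PiM {1..n} (\<lambda>_. S))" for n
    unfolding R_def[abs_def] by (rule measurable_restrict) auto
  have sumR: "(\<Sum>i=1..k. \<zeta> x (R n \<omega> i)) = (\<Sum>i=1..k. \<zeta> x (Z i \<omega>))" if "k \<le> n" for k n x \<omega>
    using that by (intro sum.cong) (auto simp: R_def)
  define U where "U k x \<omega> = \<theta> * (\<Sum>i=1..k. \<zeta> x (Z i \<omega>))" for k x \<omega>
  define F where "F k \<omega> = (\<integral>\<^sup>+x. ennreal (cosh (U k x \<omega>)) \<partial>\<mu>)" for k \<omega>
  have \<Phi>R: "\<Phi> k (R n \<omega>) = F k \<omega>" if "k \<le> n" for k n \<omega>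
    unfolding \<Phi>_def F_def U_def using sumR[OF that] by simp
  define I where "I n \<omega> = (indicator {z. B n z} (R n \<omega>) :: real)" for n \<omega>
  have Ieq: "I n \<omega> = (if \<exists>k\<le>n. ennreal K \<le> F k \<omega> then 1 else 0)" for n \<omega>
    unfolding I_def B_def using \<Phi>R by (auto simp: indicator_def)
  have Im[measurable]: "I n \<in> borel_measurable M" for n
    unfolding I_def[abs_def] using measurable_compose[OF Rm Bm] by simp
  have I01: "0 \<le> I n \<omega>" "I n \<omega> \<le> 1" for n \<omega> unfolding Ieq by auto
  have Fm[measurable]: "F k \<in> borel_measurable M" for k
    using measurable_compose[OF Rm \<Phi>m[of k k]] \<Phi>R[of k k] by simp
  have Zx: "(\<lambda>\<omega>. \<zeta> x (Z i \<omega>)) \<in> borel_measurable M" if "x \<in> space \<mu>" "i \<ge> 1" for x i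
    using measurable_compose[OF Z[OF that(2)] \<zeta>x[OF that(1)]] .
  have Um: "U k x \<in> borel_measurable M" if "x \<in> space \<mu>" for k x
    unfolding U_def[abs_def] using Zx[OF that] by (intro borel_measurable_times borel_measurable_sum) auto
  have Ub: "\<bar>U k x \<omega>\<bar> \<le> real k" for k x \<omega>
  proof -
    have "\<bar>\<Sum>i=1..k. \<zeta> x (Z i \<omega>)\<bar> \<le> (\<Sum>i=1..k. b)" by (rule order_trans[OF sum_abs sum_mono]) (rule bd)
    then have "\<theta> * \<bar>\<Sum>i=1..k. \<zeta> x (Z i \<omega>)\<bar> \<le> \<theta> * (real k * b)" using \<theta> by (intro mult_left_mono) auto
    also have "\<dots> = real k * (\<theta> * b)" by simp
    also have "\<dots> \<le> real k * 1" using \<theta> by (intro mult_left_mono) auto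
    finally show ?thesis unfolding U_def using \<theta> by (simp add: abs_mult)
  qed
  have sb: "\<bar>s * \<theta>\<bar> * b \<le> 1" if "s \<in> {1, -1}" for s using that \<theta> by auto
  have step: "expectation (\<lambda>\<omega>. exp (s * U n x \<omega>) * g (R n \<omega>)) \<le> expectation (\<lambda>\<omega>. exp (s * U (Suc n) x \<omega>) * g (R n \<omega>))"
             "expectation (\<lambda>\<omega>. exp (s * U (Suc n) x \<omega>) * g (R n \<omega>)) \<le> expectation (\<lambda>\<omega>. exp (s * U n x \<omega>) * g (R n \<omega>)) * exp (\<theta>\<^sup>2 * \<sigma>)"
             "integrable M (\<lambda>\<omega>. exp (s * U n x \<omega>) * g (R n \<omega>))"
    if x: "x \<in> space \<mu>" and s: "s \<in> {1, -1}" and g: "g \<in> borel_measurable (PiM {1..n} (\<lambda>_. S))" "\<And>z. 0 \<le> g z" "\<And>z. g z \<le> 1"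
    for n x s and g :: "(nat \<Rightarrow> 'z) \<Rightarrow> real"
  proof -
    define f where "f z = exp (s * (\<theta> * (\<Sum>i=1..n. \<zeta> x (z i)))) * g z" for z
    have fm: "f \<in> borel_measurable (PiM {1..n} (\<lambda>_. S))"
    proof -
      have "(\<lambda>z. \<Sum>i=1..n. \<zeta> x (z i)) \<in> borel_measurable (PiM {1..n} (\<lambda>_. S))"
      proof (rule borel_measurable_sum)
        fix i assume "i \<in> {1..n}"
        then show "(\<lambda>z. \<zeta> x (z i)) \<in> borel_measurable (PiM {1..n} (\<lambda>_. S))"
          using measurable_compose[where f="\<lambda>z. z i" and N=S, OF _ \<zeta>x[OF x]] measurable_component_singleton[of i "{1..n}" "\<lambda>_. S"] by blast
      qed
      then show ?thesis unfolding f_def[abs_def] using g(1) by measurable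
    qed
    have fR: "f (R n \<omega>) = exp (s * U n x \<omega>) * g (R n \<omega>)" for \<omega>
      unfolding f_def U_def using sumR[of n n x \<omega>] by simp
    have fi: "integrable M (\<lambda>\<omega>. f (R n \<omega>))"
    proof (rule integrable_const_bound[where B="exp (real n)"])
      show "(\<lambda>\<omega>. f (R n \<omega>)) \<in> borel_measurable M" using measurable_compose[OF Rm fm] .
      have "norm (f (R n \<omega>)) \<le> exp (real n)" for \<omega>
      proof -
        have "s * U n x \<omega> \<le> real n" using Ub[of n x \<omega>] s by auto
        then have "exp (s * U n x \<omega>) * g (R n \<omega>) \<le> exp (real n) * 1" using g by (intro mult_mono) auto
        then show ?thesis unfolding fR using g by simp
      qed
      then show "AE \<omega> in M. norm (f (R n \<omega>)) \<le> exp (real n)" by simp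
    qed
    then show "integrable M (\<lambda>\<omega>. exp (s * U n x \<omega>) * g (R n \<omega>))" unfolding fR .
    have s2: "(s * \<theta>)\<^sup>2 = \<theta>\<^sup>2" using s by auto
    have pre: "(\<lambda>\<omega>. \<zeta> x (Z (Suc n) \<omega>)) \<in> borel_measurable M" "expectation (\<lambda>\<omega>. \<zeta> x (Z (Suc n) \<omega>)) = 0"
      "expectation (\<lambda>\<omega>. (\<zeta> x (Z (Suc n) \<omega>))\<^sup>2) \<le> \<sigma>"
      using Zx[OF x] mean[OF _ x] var[OF _ x] by auto
    note em = exp_moment_bounds[OF pre(1) bd sb[OF s] pre(2,3)]
    have hm: "(\<lambda>z. exp (s * \<theta> * \<zeta> x z)) \<in> borel_measurable S" using \<zeta>x[OF x] by measurable
    have prod: "expectation (\<lambda>\<omega>. exp (s * U (Suc n) x \<omega>) * g (R n \<omega>)) =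
       expectation (\<lambda>\<omega>. f (R n \<omega>)) * expectation (\<lambda>\<omega>. exp (s * \<theta> * \<zeta> x (Z (Suc n) \<omega>)))"
    proof -
      have "exp (s * U (Suc n) x \<omega>) * g (R n \<omega>) = f (R n \<omega>) * exp (s * \<theta> * \<zeta> x (Z (Suc n) \<omega>))" for \<omega>
        unfolding fR by (simp add: U_def algebra_simps exp_add)
      then show ?thesis
        using expectation_mult_next(1)[OF ind fm hm fi[unfolded R_def], folded R_def] em(3) by simp
    qed
    have f0: "0 \<le> expectation (\<lambda>\<omega>. f (R n \<omega>))" by (rule Bochner_Integration.integral_nonneg) (simp add: fR g)
    show "expectation (\<lambda>\<omega>. exp (s * U n x \<omega>) * g (R n \<omega>)) \<le> expectation (\<lambda>\<omega>. exp (s * U (Suc n) x \<omega>) * g (R n \<omega>))"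
      unfolding prod unfolding fR[symmetric] using f0 em(1) mult_left_mono[OF em(1) f0] by simp
    show "expectation (\<lambda>\<omega>. exp (s * U (Suc n) x \<omega>) * g (R n \<omega>)) \<le> expectation (\<lambda>\<omega>. exp (s * U n x \<omega>) * g (R n \<omega>)) * exp (\<theta>\<^sup>2 * \<sigma>)"
      unfolding prod unfolding fR[symmetric] using f0 em(2) unfolding s2 by (intro mult_left_mono) auto
  qed
  have expi: "integrable M (\<lambda>\<omega>. exp (s * U n x \<omega>) * h \<omega>)"
    if x: "x \<in> space \<mu>" and s: "s \<in> {1, -1}" and h: "h \<in> borel_measurable M" "\<And>\<omega>. 0 \<le> h \<omega>" "\<And>\<omega>. h \<omega> \<le> 1" for s n x and h :: "'a \<Rightarrow> real"
  proof (rule integrable_const_bound[where B="exp (real n)"])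
    show "(\<lambda>\<omega>. exp (s * U n x \<omega>) * h \<omega>) \<in> borel_measurable M" using Um[OF x] h by measurable
    have "norm (exp (s * U n x \<omega>) * h \<omega>) \<le> exp (real n)" for \<omega>
    proof -
      have "s * U n x \<omega> \<le> real n" using Ub[of n x \<omega>] s by auto
      then have "exp (s * U n x \<omega>) * h \<omega> \<le> exp (real n) * 1" using h by (intro mult_mono) auto
      then show ?thesis using h by simp
    qed
    then show "AE \<omega> in M. norm (exp (s * U n x \<omega>) * h \<omega>) \<le> exp (real n)" by simp
  qed
  have coshE: "cosh (U n x \<omega>) * h = (exp (1 * U n x \<omega>) * h + exp ((-1) * U n x \<omega>) * h) / 2" for n x \<omega> and h :: real
    unfolding cosh_def by (simp add: algebra_simps)
  have coshint: "(\<integral>\<^sup>+\<omega>. ennreal (cosh (U n x \<omega>) * h \<omega>) \<partial>M) =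
      ennreal ((expectation (\<lambda>\<omega>. exp (1 * U n x \<omega>) * h \<omega>) + expectation (\<lambda>\<omega>. exp ((-1) * U n x \<omega>) * h \<omega>)) / 2)"
    if x: "x \<in> space \<mu>" and h: "h \<in> borel_measurable M" "\<And>\<omega>. 0 \<le> h \<omega>" "\<And>\<omega>. h \<omega> \<le> 1" for n x and h :: "'a \<Rightarrow> real"
  proof -
    have i: "integrable M (\<lambda>\<omega>. exp (1 * U n x \<omega>) * h \<omega>)" "integrable M (\<lambda>\<omega>. exp ((-1) * U n x \<omega>) * h \<omega>)"
      by (rule expi[OF x _ h], simp)+
    have "(\<integral>\<^sup>+\<omega>. ennreal (cosh (U n x \<omega>) * h \<omega>) \<partial>M) = ennreal (expectation (\<lambda>\<omega>. (exp (1 * U n x \<omega>) * h \<omega> + exp ((-1) * U n x \<omega>) * h \<omega>) / 2))"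
      unfolding coshE using i h by (intro nn_integral_eq_integral) auto
    then show ?thesis using i by simp
  qed
  \<comment> \<open>The submartingale inequality on an event of the past; \<open>cosh\<close> is the
    mean of two exponentials, to which the one-step bound applies with either sign.\<close>
  have mono: "(\<integral>\<^sup>+\<omega>. ennreal (cosh (U n x \<omega>) * I n \<omega>) \<partial>M) \<le> (\<integral>\<^sup>+\<omega>. ennreal (cosh (U (Suc n) x \<omega>) * I n \<omega>) \<partial>M)" if x: "x \<in> space \<mu>" for n x
    unfolding coshint[OF x Im I01]
    using step(1)[OF x, of 1 "\<lambda>z. indicator {z. B n z} z" n] step(1)[OF x, of "-1" "\<lambda>z. indicator {z. B n z} z" n] Bm[of n]
    unfolding I_def by (intro ennreal_leI divide_right_mono add_mono) auto
  have last: "(\<integral>\<^sup>+\<omega>. ennreal (cosh (U n x \<omega>) * 1) \<partial>M) \<le> ennreal (exp (real n * (\<theta>\<^sup>2 * \<sigma>)))" if x: "x \<in> space \<mu>" for n x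
  proof -
    have e: "expectation (\<lambda>\<omega>. exp (s * U n x \<omega>) * 1) \<le> exp (real n * (\<theta>\<^sup>2 * \<sigma>))" if s: "s \<in> {1, -1}" for s
    proof (induction n)
      case 0 show ?case by (simp add: U_def prob_space)
    next
      case (Suc n)
      have "expectation (\<lambda>\<omega>. exp (s * U (Suc n) x \<omega>) * 1) \<le> expectation (\<lambda>\<omega>. exp (s * U n x \<omega>) * 1) * exp (\<theta>\<^sup>2 * \<sigma>)"
        using step(2)[OF x s, of "\<lambda>_. 1" n] by simp
      also have "\<dots> \<le> exp (real n * (\<theta>\<^sup>2 * \<sigma>)) * exp (\<theta>\<^sup>2 * \<sigma>)" using Suc by (intro mult_right_mono) auto
      also have "\<dots> = exp (real (Suc n) * (\<theta>\<^sup>2 * \<sigma>))" by (simp add: exp_add[symmetric] algebra_simps)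
      finally show ?case .
    qed
    have "(\<integral>\<^sup>+\<omega>. ennreal (cosh (U n x \<omega>) * 1) \<partial>M) =
      ennreal ((expectation (\<lambda>\<omega>. exp (1 * U n x \<omega>) * 1) + expectation (\<lambda>\<omega>. exp ((-1) * U n x \<omega>) * 1)) / 2)"
      by (rule coshint[OF x, of "\<lambda>_. 1"]) auto
    also have "\<dots> \<le> ennreal (exp (real n * (\<theta>\<^sup>2 * \<sigma>)))" using e[of 1] e[of "-1"] by (intro ennreal_leI) simp
    finally show ?thesis .
  qed
  have joint: "(\<lambda>(x, \<omega>). ennreal (cosh (U n x \<omega>) * h \<omega>)) \<in> borel_measurable (\<mu> \<Otimes>\<^sub>M M)" if h: "h \<in> borel_measurable M" for n and h :: "'a \<Rightarrow> real"
  proof -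
    have [measurable]: "(\<lambda>p. \<zeta> (fst p) (Z i (snd p))) \<in> borel_measurable (\<mu> \<Otimes>\<^sub>M M)" if "i \<in> {1..n}" for i
    proof -
      have "(\<lambda>p. (fst p, Z i (snd p))) \<in> measurable (\<mu> \<Otimes>\<^sub>M M) (\<mu> \<Otimes>\<^sub>M S)"
        using that by (intro measurable_Pair measurable_fst measurable_compose[OF measurable_snd Z]) auto
      from measurable_compose[OF this \<zeta>] show ?thesis by simp
    qed
    have "(\<lambda>p. \<Sum>i=1..n. \<zeta> (fst p) (Z i (snd p))) \<in> borel_measurable (\<mu> \<Otimes>\<^sub>M M)" by (intro borel_measurable_sum) auto
    then have "(\<lambda>p. ennreal (cosh (U n (fst p) (snd p)) * h (snd p))) \<in> borel_measurable (\<mu> \<Otimes>\<^sub>M M)"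
      unfolding U_def cosh_def using h by measurable
    then show ?thesis by (simp add: case_prod_beta)
  qed
  have Fh: "(\<integral>\<^sup>+\<omega>. F n \<omega> * ennreal (h \<omega>) \<partial>M) = (\<integral>\<^sup>+x. (\<integral>\<^sup>+\<omega>. ennreal (cosh (U n x \<omega>) * h \<omega>) \<partial>M) \<partial>\<mu>)"
    if h: "h \<in> borel_measurable M" "\<And>\<omega>. 0 \<le> h \<omega>" for n and h :: "'a \<Rightarrow> real"
  proof -
    have "(\<integral>\<^sup>+\<omega>. (\<integral>\<^sup>+x. ennreal (cosh (U n x \<omega>) * h \<omega>) \<partial>\<mu>) \<partial>M) = (\<integral>\<^sup>+x. (\<integral>\<^sup>+\<omega>. ennreal (cosh (U n x \<omega>) * h \<omega>) \<partial>M) \<partial>\<mu>)"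
      by (rule Fubini'[OF joint[OF h(1)]])
    moreover have "(\<integral>\<^sup>+x. ennreal (cosh (U n x \<omega>) * h \<omega>) \<partial>\<mu>) = F n \<omega> * ennreal (h \<omega>)" if "\<omega> \<in> space M" for \<omega>
    proof -
      have "(\<lambda>x. ennreal (cosh (U n x \<omega>) * 1)) \<in> borel_measurable \<mu>"
        using measurable_compose[OF measurable_Pair2'[OF that] joint[of "\<lambda>_. 1" n]] by simp
      then show ?thesis unfolding F_def using h by (simp add: ennreal_mult nn_integral_multc)
    qed
    ultimately show ?thesis by (simp cong: nn_integral_cong)
  qed
  \<comment> \<open>Doob's argument by induction over time: where the level was reached earlier,
    \<open>mono\<close> passes from \<open>F n\<close> to \<open>F (Suc n)\<close>; on the
    first-hitting part \<open>J\<close> the value \<open>F (Suc n)\<close> itself is at least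
    \<open>K\<close>.\<close>
  have main: "ennreal K * (\<integral>\<^sup>+\<omega>. ennreal (I n \<omega>) \<partial>M) \<le> (\<integral>\<^sup>+\<omega>. F n \<omega> * ennreal (I n \<omega>) \<partial>M)" for n
  proof (induction n)
    case 0
    have "(\<integral>\<^sup>+\<omega>. ennreal K * ennreal (I 0 \<omega>) \<partial>M) \<le> (\<integral>\<^sup>+\<omega>. F 0 \<omega> * ennreal (I 0 \<omega>) \<partial>M)"
      by (intro nn_integral_mono) (auto simp: Ieq)
    then show ?case by (simp add: nn_integral_cmult)
  next
    case (Suc n)
    define J where "J \<omega> = I (Suc n) \<omega> - I n \<omega>" for \<omega>
    have Jm[measurable]: "J \<in> borel_measurable M" unfolding J_def[abs_def] by measurable
    have Jeq: "J \<omega> = (if ennreal K \<le> F (Suc n) \<omega> \<and> \<not> (\<exists>k\<le>n. ennreal K \<le> F k \<omega>) then 1 else 0)" for \<omega>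
      unfolding J_def Ieq by (auto simp: le_Suc_eq)
    have Isplit: "ennreal (I (Suc n) \<omega>) = ennreal (I n \<omega>) + ennreal (J \<omega>)" for \<omega>
    proof -
      have "0 \<le> J \<omega>" using Jeq[of \<omega>] by simp
      moreover have "I (Suc n) \<omega> = I n \<omega> + J \<omega>" unfolding J_def by simp
      ultimately show ?thesis using ennreal_plus[OF I01(1)[of n \<omega>], of "J \<omega>"] by metis
    qed
    have "ennreal K * (\<integral>\<^sup>+\<omega>. ennreal (I (Suc n) \<omega>) \<partial>M) = ennreal K * (\<integral>\<^sup>+\<omega>. ennreal (I n \<omega>) \<partial>M) + (\<integral>\<^sup>+\<omega>. ennreal K * ennreal (J \<omega>) \<partial>M)"
      unfolding Isplit by (simp add: nn_integral_add nn_integral_cmult distrib_left)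
    also have "\<dots> \<le> (\<integral>\<^sup>+\<omega>. F n \<omega> * ennreal (I n \<omega>) \<partial>M) + (\<integral>\<^sup>+\<omega>. F (Suc n) \<omega> * ennreal (J \<omega>) \<partial>M)"
      by (intro add_mono Suc nn_integral_mono) (auto simp: Jeq)
    also have "\<dots> \<le> (\<integral>\<^sup>+\<omega>. F (Suc n) \<omega> * ennreal (I n \<omega>) \<partial>M) + (\<integral>\<^sup>+\<omega>. F (Suc n) \<omega> * ennreal (J \<omega>) \<partial>M)"
      unfolding Fh[OF Im I01(1)] by (intro add_mono nn_integral_mono mono order_refl)
    also have "\<dots> = (\<integral>\<^sup>+\<omega>. F (Suc n) \<omega> * ennreal (I (Suc n) \<omega>) \<partial>M)"
      unfolding Isplit by (simp add: nn_integral_add distrib_left)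
    finally show ?case .
  qed
  have "(\<integral>\<^sup>+\<omega>. F n \<omega> * ennreal (I n \<omega>) \<partial>M) \<le> (\<integral>\<^sup>+\<omega>. F n \<omega> * ennreal 1 \<partial>M)"
    using I01 by (intro nn_integral_mono mult_left_mono ennreal_leI) auto
  also have "\<dots> \<le> (\<integral>\<^sup>+x. ennreal (exp (real n * (\<theta>\<^sup>2 * \<sigma>))) \<partial>\<mu>)"
  proof -
    have "(\<integral>\<^sup>+\<omega>. F n \<omega> * ennreal 1 \<partial>M) = (\<integral>\<^sup>+x. (\<integral>\<^sup>+\<omega>. ennreal (cosh (U n x \<omega>) * 1) \<partial>M) \<partial>\<mu>)"
      by (rule Fh[of "\<lambda>_. 1"]) auto
    also have "\<dots> \<le> (\<integral>\<^sup>+x. ennreal (exp (real n * (\<theta>\<^sup>2 * \<sigma>))) \<partial>\<mu>)" by (intro nn_integral_mono last)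
    finally show ?thesis .
  qed
  also have "\<dots> = ennreal (exp (real n * (\<theta>\<^sup>2 * \<sigma>)))" by (simp add: \<mu>.emeasure_space_1)
  finally have fin: "ennreal K * (\<integral>\<^sup>+\<omega>. ennreal (I n \<omega>) \<partial>M) \<le> ennreal (exp (real n * (\<theta>\<^sup>2 * \<sigma>)))"
    using main[of n] by (rule order_trans[rotated])
  have "(\<integral>\<^sup>+\<omega>. ennreal (I n \<omega>) \<partial>M) = (\<integral>\<^sup>+\<omega>. indicator {\<omega>\<in>space M. \<exists>k\<le>n. ennreal K \<le> F k \<omega>} \<omega> \<partial>M)"
    by (intro nn_integral_cong) (auto simp: Ieq indicator_def)
  also have "\<dots> = emeasure M {\<omega>\<in>space M. \<exists>k\<le>n. ennreal K \<le> F k \<omega>}"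
    by (rule nn_integral_indicator) measurable
  finally show ?thesis using fin unfolding F_def U_def by simp
qed


section \<open>Fluctuations on one cell within one block of sample sizes\<close>

lemma expectation_same_law:
  fixes g :: "'z \<Rightarrow> real"
  assumes "Z \<in> measurable M S" "Z' \<in> measurable M S" "distr M S Z = distr M S Z'" "g \<in> borel_measurable S"
  shows "expectation (\<lambda>\<omega>. g (Z \<omega>)) = expectation (\<lambda>\<omega>. g (Z' \<omega>))"
  using integral_distr[OF assms(1,4)] integral_distr[OF assms(2,4)] assms(3) by simp

text \<open>The maximal inequality is applied twice to truncated and centred marks: with the point
  mass at \<open>b\<close> it controls the cell total, with the uniform measure on [a,b] the mean
  square of the running sums. While the first \<open>N\<close> marks do not exceed \<tau>,
  truncation changes nothing. The local moment bounds the variance, since the square of a mark is at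
  most 1 plus its \<kappa>-th absolute power.\<close>

lemma mark_sum_block_exceptional_set:
  fixes X D :: "nat \<Rightarrow> 'a \<Rightarrow> real"
  assumes ind: "indep_vars (\<lambda>_. borel) (\<lambda>i \<omega>. (X i \<omega>, D i \<omega>)) {1..}"
    and law: "\<And>i. i \<ge> 1 \<Longrightarrow> distr M borel (\<lambda>\<omega>. (X i \<omega>, D i \<omega>)) = distr M borel (\<lambda>\<omega>. (X 1 \<omega>, D 1 \<omega>))"
    and \<kappa>: "2 \<le> \<kappa>" and mom: "integrable M (\<lambda>\<omega>. \<bar>D 1 \<omega>\<bar> powr \<kappa>)"
    and loc: "expectation (\<lambda>\<omega>. (1 + \<bar>D 1 \<omega>\<bar> powr \<kappa>) * (if a < X 1 \<omega> \<and> X 1 \<omega> \<le> b then 1 else 0)) \<le> B * (b - a)"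
    and ab: "0 \<le> a" "a < b" "b \<le> 1" and \<theta>: "\<theta> > 0" "\<theta> * (2 * \<tau>) \<le> 1" and \<tau>: "\<tau> > 0" and \<alpha>: "\<alpha> \<ge> 0"
    and c: "\<And>x. c x = expectation (\<lambda>\<omega>. (if \<bar>D 1 \<omega>\<bar> \<le> \<tau> then D 1 \<omega> else 0) * (if a < X 1 \<omega> \<and> X 1 \<omega> \<le> x then 1 else 0))"
  shows "\<exists>E\<in>events. prob E \<le> 2 * exp (real N * (\<theta>\<^sup>2 * (B * (b - a))) - \<alpha>) \<and>
    (\<forall>\<omega>\<in>space M - E. (\<forall>i\<in>{1..N}. \<bar>D i \<omega>\<bar> \<le> \<tau>) \<longrightarrow> (\<forall>n\<le>N.
       \<theta>\<^sup>2 * (mark_sum (\<lambda>i. X i \<omega>) (\<lambda>i. D i \<omega>) n a b - real n * c b)\<^sup>2 \<le> 4 * \<alpha>\<^sup>2 + 16 \<and>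
       \<theta>\<^sup>2 * integral {a..b} (\<lambda>x. (mark_sum (\<lambda>i. X i \<omega>) (\<lambda>i. D i \<omega>) n a x - real n * c x)\<^sup>2) \<le> (b - a) * (4 * \<alpha>\<^sup>2 + 16)))"
proof -
  define Z where "Z i \<omega> = (X i \<omega>, D i \<omega>)" for i \<omega>
  have Zm: "Z i \<in> borel_measurable M" if "i \<ge> 1" for i
    using ind that unfolding indep_vars_def Z_def[abs_def] by auto
  have Zm2: "Z i \<in> measurable M (borel \<Otimes>\<^sub>M borel)" if "i \<ge> 1" for i using Zm[OF that] by (simp add: borel_prod)
  have XD[measurable]: "X 1 \<in> borel_measurable M" "D 1 \<in> borel_measurable M"
    using measurable_compose[OF Zm2[of 1] measurable_fst] measurable_compose[OF Zm2[of 1] measurable_snd] unfolding Z_def by auto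
  define tr where "tr y = (if \<bar>y\<bar> \<le> \<tau> then y else 0)" for y :: real
  have [measurable]: "tr \<in> borel_measurable borel" unfolding tr_def[abs_def] by measurable
  have tr: "\<bar>tr y\<bar> \<le> \<tau>" for y using \<tau> by (simp add: tr_def)
  \<comment> \<open>The minimum with \<open>b\<close> keeps the variance bound of the cell valid for
    every real \<open>x\<close>, as the maximal inequality asks for all points of the parameter
    space.\<close>
  define J where "J x y = (if a < y \<and> y \<le> min x b then 1 else 0 :: real)" for x y
  define \<xi> where "\<xi> x z = tr (snd z) * J x (fst z)" for x and z :: "real \<times> real"
  have \<xi>b: "\<bar>\<xi> x z\<bar> \<le> \<tau>" for x z unfolding \<xi>_def J_def using tr[of "snd z"] \<tau> by auto
  have \<xi>m[measurable]: "(\<lambda>p. \<xi> (fst p) (snd p)) \<in> borel_measurable (borel \<Otimes>\<^sub>M (borel \<Otimes>\<^sub>M borel))"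
    unfolding \<xi>_def J_def by measurable
  define e where "e x = expectation (\<lambda>\<omega>. \<xi> x (Z 1 \<omega>))" for x
  have em[measurable]: "e \<in> borel_measurable borel"
    unfolding e_def[abs_def]
  proof (rule borel_measurable_lebesgue_integral)
    have "(\<lambda>p. (fst p, Z 1 (snd p))) \<in> measurable (borel \<Otimes>\<^sub>M M) (borel \<Otimes>\<^sub>M (borel \<Otimes>\<^sub>M borel))"
      by (intro measurable_Pair measurable_fst measurable_compose[OF measurable_snd Zm2]) simp
    from measurable_compose[OF this \<xi>m] show "(\<lambda>(x, \<omega>). \<xi> x (Z 1 \<omega>)) \<in> borel_measurable (borel \<Otimes>\<^sub>M M)"
      by (simp add: case_prod_beta)
  qed
  have \<xi>x: "\<xi> x \<in> borel_measurable (borel \<Otimes>\<^sub>M borel)" for x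
    unfolding \<xi>_def[abs_def] J_def by measurable
  have \<xi>xb: "\<xi> x \<in> borel_measurable borel" for x using \<xi>x[of x] by (simp add: borel_prod)
  have \<xi>i: "integrable M (\<lambda>\<omega>. \<xi> x (Z i \<omega>))" if "i \<ge> 1" for x i
    by (rule integrable_const_bound[where B=\<tau>]) (use \<xi>b measurable_compose[OF Zm2[OF that] \<xi>x] in auto)
  have same: "expectation (\<lambda>\<omega>. g (Z i \<omega>)) = expectation (\<lambda>\<omega>. g (Z 1 \<omega>))" if "i \<ge> 1" "g \<in> borel_measurable borel" for i and g :: "real \<times> real \<Rightarrow> real"
    using law[OF that(1)] that by (intro expectation_same_law[where S=borel] Zm) (auto simp: Z_def[abs_def])
  have eb: "\<bar>e x\<bar> \<le> \<tau>" for x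
  proof -
    have "\<bar>e x\<bar> \<le> expectation (\<lambda>\<omega>. \<bar>\<xi> x (Z 1 \<omega>)\<bar>)" unfolding e_def by (rule integral_abs_bound)
    also have "\<dots> \<le> expectation (\<lambda>\<omega>. \<tau>)" using \<xi>b \<xi>i[of 1 x] by (intro integral_mono) auto
    finally show ?thesis by (simp add: prob_space)
  qed
  define \<zeta> where "\<zeta> x z = \<xi> x z - e x" for x z
  have \<zeta>b: "\<bar>\<zeta> x z\<bar> \<le> 2 * \<tau>" for x z unfolding \<zeta>_def using \<xi>b[of x z] eb[of x] by linarith
  have mean: "expectation (\<lambda>\<omega>. \<zeta> x (Z i \<omega>)) = 0" if "i \<ge> 1" for x i
    unfolding \<zeta>_def using \<xi>i[OF that] same[OF that \<xi>xb[of x]] by (simp add: prob_space e_def)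
  have var: "expectation (\<lambda>\<omega>. (\<zeta> x (Z i \<omega>))\<^sup>2) \<le> B * (b - a)" if i: "i \<ge> 1" for x i
  proof -
    have sqi: "integrable M (\<lambda>\<omega>. (\<xi> x (Z i \<omega>))\<^sup>2)" if "i \<ge> 1" for i
    proof (rule integrable_const_bound[where B="\<tau>\<^sup>2"])
      have "(\<xi> x z)\<^sup>2 \<le> \<tau>\<^sup>2" for z using \<xi>b[of x z] \<tau> by (simp add: abs_le_square_iff[symmetric])
      then show "AE \<omega> in M. norm ((\<xi> x (Z i \<omega>))\<^sup>2) \<le> \<tau>\<^sup>2" by simp
      show "(\<lambda>\<omega>. (\<xi> x (Z i \<omega>))\<^sup>2) \<in> borel_measurable M" using measurable_compose[OF Zm2[OF that] \<xi>x] by (rule borel_measurable_power)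
    qed
    have "expectation (\<lambda>\<omega>. (\<zeta> x (Z i \<omega>))\<^sup>2) = expectation (\<lambda>\<omega>. (\<xi> x (Z i \<omega>))\<^sup>2 - 2 * e x * \<xi> x (Z i \<omega>) + (e x)\<^sup>2)"
      unfolding \<zeta>_def by (simp add: power2_diff algebra_simps)
    also have "\<dots> = expectation (\<lambda>\<omega>. (\<xi> x (Z i \<omega>))\<^sup>2) - 2 * e x * expectation (\<lambda>\<omega>. \<xi> x (Z i \<omega>)) + (e x)\<^sup>2"
      using sqi[OF i] \<xi>i[OF i] by (simp add: prob_space)
    also have "\<dots> \<le> expectation (\<lambda>\<omega>. (\<xi> x (Z i \<omega>))\<^sup>2)"
      using same[OF i \<xi>xb[of x]] unfolding e_def by (simp add: power2_eq_square)
    also have "\<dots> = expectation (\<lambda>\<omega>. (\<xi> x (Z 1 \<omega>))\<^sup>2)"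
      using \<xi>xb[of x] by (intro same[OF i, of "\<lambda>z. (\<xi> x z)\<^sup>2"] borel_measurable_power)
    also have "\<dots> \<le> expectation (\<lambda>\<omega>. (1 + \<bar>D 1 \<omega>\<bar> powr \<kappa>) * (if a < X 1 \<omega> \<and> X 1 \<omega> \<le> b then 1 else 0))"
    proof (rule integral_mono)
      show "integrable M (\<lambda>\<omega>. (1 + \<bar>D 1 \<omega>\<bar> powr \<kappa>) * (if a < X 1 \<omega> \<and> X 1 \<omega> \<le> b then 1 else 0))"
      proof (rule Bochner_Integration.integrable_bound[where f="\<lambda>\<omega>. 1 + \<bar>D 1 \<omega>\<bar> powr \<kappa>"])
        show "integrable M (\<lambda>\<omega>. 1 + \<bar>D 1 \<omega>\<bar> powr \<kappa>)" using mom by (intro Bochner_Integration.integrable_add integrable_const)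
        show "(\<lambda>\<omega>. (1 + \<bar>D 1 \<omega>\<bar> powr \<kappa>) * (if a < X 1 \<omega> \<and> X 1 \<omega> \<le> b then 1 else 0)) \<in> borel_measurable M" by measurable
      qed auto
      fix \<omega>
      show "(\<xi> x (Z 1 \<omega>))\<^sup>2 \<le> (1 + \<bar>D 1 \<omega>\<bar> powr \<kappa>) * (if a < X 1 \<omega> \<and> X 1 \<omega> \<le> b then 1 else 0)"
      proof -
        have "(D 1 \<omega>)\<^sup>2 \<le> 1 + \<bar>D 1 \<omega>\<bar> powr \<kappa>"
        proof (cases "\<bar>D 1 \<omega>\<bar> \<le> 1")
          case True
          then have "(D 1 \<omega>)\<^sup>2 \<le> 1" by (simp add: abs_square_le_1)
          then show ?thesis by (simp add: add_increasing2)
        next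
          case False
          then have "\<bar>D 1 \<omega>\<bar> powr 2 \<le> \<bar>D 1 \<omega>\<bar> powr \<kappa>" using \<kappa> by (intro powr_mono) auto
          then show ?thesis using False by (simp add: powr_numeral)
        qed
        then show ?thesis unfolding \<xi>_def Z_def J_def tr_def by (auto simp: power_mult_distrib)
      qed
    qed (rule sqi, simp)
    also have "\<dots> \<le> B * (b - a)" by (rule loc)
    finally show ?thesis .
  qed
  have \<zeta>m: "case_prod \<zeta> \<in> borel_measurable (borel \<Otimes>\<^sub>M borel)"
  proof -
    have "(\<lambda>p. \<xi> (fst p) (snd p) - e (fst p)) \<in> borel_measurable (borel \<Otimes>\<^sub>M (borel \<Otimes>\<^sub>M borel))" by measurable
    then show ?thesis unfolding \<zeta>_def by (simp add: case_prod_beta' borel_prod)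
  qed
  have indZ: "indep_vars (\<lambda>_. borel) Z {1..}" using ind unfolding Z_def[abs_def] .
  define Su where "Su n x \<omega> = (\<Sum>i=1..n. \<zeta> x (Z i \<omega>))" for n x \<omega>
  \<comment> \<open>With this level Markov's bound contributes \<open>exp (- \<alpha>)\<close>, and
    the term \<open>16 * exp (- \<alpha>) * K\<close> arising from \<open>square_le_cosh\<close>
    becomes 16.\<close>
  define K where "K = exp \<alpha>"
  define Ev where "Ev \<mu> = {\<omega>\<in>space M. \<exists>k\<le>N. ennreal K \<le> (\<integral>\<^sup>+x. ennreal (cosh (\<theta> * Su k x \<omega>)) \<partial>\<mu>)}" for \<mu> :: "real measure"
  have Sum: "(\<lambda>p. Su n (fst p) (snd p)) \<in> borel_measurable (borel \<Otimes>\<^sub>M M)" for n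
  proof -
    have "(\<lambda>p. \<zeta> (fst p) (Z i (snd p))) \<in> borel_measurable (borel \<Otimes>\<^sub>M M)" if "i \<in> {1..n}" for i
    proof -
      have "(\<lambda>p. (fst p, Z i (snd p))) \<in> measurable (borel \<Otimes>\<^sub>M M) (borel \<Otimes>\<^sub>M borel)"
        using that by (intro measurable_Pair measurable_fst measurable_compose[OF measurable_snd Zm]) auto
      from measurable_compose[OF this \<zeta>m] show ?thesis by simp
    qed
    then show ?thesis unfolding Su_def by (intro borel_measurable_sum)
  qed
  have Sux: "(\<lambda>x. Su n x \<omega>) \<in> borel_measurable borel" if "\<omega> \<in> space M" for n \<omega>
    using measurable_compose[OF measurable_Pair2'[OF that] Sum[of n]] by simp
  have ev: "Ev \<mu> \<in> events \<and> prob (Ev \<mu>) \<le> exp (real N * (\<theta>\<^sup>2 * (B * (b - a))) - \<alpha>)"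
    if \<mu>: "prob_space \<mu>" "sets \<mu> = sets borel" for \<mu>
  proof
    interpret \<mu>: prob_space \<mu> by fact
    have sp: "space \<mu> = UNIV" using sets_eq_imp_space_eq[OF \<mu>(2)] by simp
    have [measurable_cong]: "sets \<mu> = sets borel" by fact
    have mm: "(\<lambda>\<omega>. \<integral>\<^sup>+x. ennreal (cosh (\<theta> * Su k x \<omega>)) \<partial>\<mu>) \<in> borel_measurable M" for k
    proof (rule \<mu>.borel_measurable_nn_integral)
      have "(\<lambda>p. (snd p, fst p)) \<in> measurable (M \<Otimes>\<^sub>M \<mu>) (borel \<Otimes>\<^sub>M M)" by measurable
      from measurable_compose[OF this Sum[of k]] have [measurable]: "(\<lambda>p. Su k (snd p) (fst p)) \<in> borel_measurable (M \<Otimes>\<^sub>M \<mu>)" by simp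
      have "(\<lambda>p. ennreal (cosh (\<theta> * Su k (snd p) (fst p)))) \<in> borel_measurable (M \<Otimes>\<^sub>M \<mu>)"
        unfolding cosh_def by measurable
      then show "(\<lambda>(\<omega>, x). ennreal (cosh (\<theta> * Su k x \<omega>))) \<in> borel_measurable (M \<Otimes>\<^sub>M \<mu>)" by (simp add: case_prod_beta)
    qed
    have "Ev \<mu> = (\<Union>k\<in>{..N}. {\<omega>\<in>space M. ennreal K \<le> (\<integral>\<^sup>+x. ennreal (cosh (\<theta> * Su k x \<omega>)) \<partial>\<mu>)})"
      unfolding Ev_def by auto
    also have "\<dots> \<in> events" using mm by (intro sets.finite_UN) (auto intro!: borel_measurable_le)
    finally show "Ev \<mu> \<in> events" .
    have "ennreal K * emeasure M (Ev \<mu>) \<le> ennreal (exp (real N * (\<theta>\<^sup>2 * (B * (b - a)))))"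
      unfolding Ev_def Su_def
    proof (rule cosh_average_maximal_inequality[OF indZ \<mu>(1) _ \<zeta>b _ _ _ \<theta>(2)])
      show "case_prod \<zeta> \<in> borel_measurable (\<mu> \<Otimes>\<^sub>M borel)" using \<zeta>m by measurable
    qed (use mean var \<theta> in auto)
    then have "K * prob (Ev \<mu>) \<le> exp (real N * (\<theta>\<^sup>2 * (B * (b - a))))"
      unfolding emeasure_eq_measure K_def by (simp add: ennreal_mult[symmetric])
    then show "prob (Ev \<mu>) \<le> exp (real N * (\<theta>\<^sup>2 * (B * (b - a))) - \<alpha>)"
      unfolding K_def exp_diff by (simp add: field_simps)
  qed
  have off: "(\<integral>\<^sup>+x. ennreal ((\<theta> * Su n x \<omega>)\<^sup>2) \<partial>\<mu>) \<le> ennreal (4 * \<alpha>\<^sup>2 + 16)"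
    if \<mu>: "prob_space \<mu>" "sets \<mu> = sets borel" and \<omega>: "\<omega> \<in> space M - Ev \<mu>" and n: "n \<le> N" for \<mu> \<omega> n
  proof -
    interpret \<mu>: prob_space \<mu> by fact
    have [measurable_cong]: "sets \<mu> = sets borel" by fact
    have [measurable]: "(\<lambda>x. Su n x \<omega>) \<in> borel_measurable borel" using Sux \<omega> by simp
    have lt: "(\<integral>\<^sup>+x. ennreal (cosh (\<theta> * Su n x \<omega>)) \<partial>\<mu>) \<le> ennreal K"
    proof (rule ccontr)
      assume "\<not> ?thesis"
      then have "ennreal K \<le> (\<integral>\<^sup>+x. ennreal (cosh (\<theta> * Su n x \<omega>)) \<partial>\<mu>)" by simp
      then show False using \<omega> n unfolding Ev_def by blast
    qed
    have "(\<integral>\<^sup>+x. ennreal ((\<theta> * Su n x \<omega>)\<^sup>2) \<partial>\<mu>) \<le> (\<integral>\<^sup>+x. ennreal (4 * \<alpha>\<^sup>2) + ennreal (16 * exp (- \<alpha>)) * ennreal (cosh (\<theta> * Su n x \<omega>)) \<partial>\<mu>)"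
    proof (intro nn_integral_mono)
      fix x
      have "ennreal ((\<theta> * Su n x \<omega>)\<^sup>2) \<le> ennreal (4 * \<alpha>\<^sup>2 + 16 * exp (- \<alpha>) * cosh (\<theta> * Su n x \<omega>))"
        by (intro ennreal_leI square_le_cosh \<alpha>)
      also have "\<dots> = ennreal (4 * \<alpha>\<^sup>2) + ennreal (16 * exp (- \<alpha>)) * ennreal (cosh (\<theta> * Su n x \<omega>))"
        by (simp add: ennreal_mult[symmetric] ennreal_plus[symmetric] del: ennreal_plus)
      finally show "ennreal ((\<theta> * Su n x \<omega>)\<^sup>2) \<le> ennreal (4 * \<alpha>\<^sup>2) + ennreal (16 * exp (- \<alpha>)) * ennreal (cosh (\<theta> * Su n x \<omega>))" .
    qed
    also have "\<dots> = ennreal (4 * \<alpha>\<^sup>2) + ennreal (16 * exp (- \<alpha>)) * (\<integral>\<^sup>+x. ennreal (cosh (\<theta> * Su n x \<omega>)) \<partial>\<mu>)"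
    proof -
      have [measurable]: "(\<lambda>x. ennreal (cosh (\<theta> * Su n x \<omega>))) \<in> borel_measurable \<mu>" unfolding cosh_def by measurable
      have "(\<integral>\<^sup>+x. ennreal (16 * exp (- \<alpha>)) * ennreal (cosh (\<theta> * Su n x \<omega>)) \<partial>\<mu>) = ennreal (16 * exp (- \<alpha>)) * (\<integral>\<^sup>+x. ennreal (cosh (\<theta> * Su n x \<omega>)) \<partial>\<mu>)"
        by (rule nn_integral_cmult) measurable
      then show ?thesis by (subst nn_integral_add) (auto simp: \<mu>.emeasure_space_1)
    qed
    also have "\<dots> \<le> ennreal (4 * \<alpha>\<^sup>2) + ennreal (16 * exp (- \<alpha>)) * ennreal K"
      by (intro add_left_mono mult_left_mono lt) auto
    also have "\<dots> = ennreal (4 * \<alpha>\<^sup>2 + 16)"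
      unfolding K_def by (simp add: ennreal_mult[symmetric] ennreal_plus[symmetric] exp_minus del: ennreal_plus)
    finally show ?thesis .
  qed
  define \<mu>1 where "\<mu>1 = return borel b"
  define \<mu>2 where "\<mu>2 = uniform_measure lborel {a..b}"
  have p1: "prob_space \<mu>1" "sets \<mu>1 = sets borel" unfolding \<mu>1_def by (auto intro: prob_space_return)
  have p2: "prob_space \<mu>2" "sets \<mu>2 = sets borel" unfolding \<mu>2_def using ab by (auto intro!: prob_space_uniform_measure)
  show ?thesis
  proof (intro bexI[of _ "Ev \<mu>1 \<union> Ev \<mu>2"] conjI ballI impI allI)
    show "Ev \<mu>1 \<union> Ev \<mu>2 \<in> events" using ev[OF p1] ev[OF p2] by auto
    have "prob (Ev \<mu>1 \<union> Ev \<mu>2) \<le> prob (Ev \<mu>1) + prob (Ev \<mu>2)" using ev[OF p1] ev[OF p2] by (intro measure_Un_le) auto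
    then show "prob (Ev \<mu>1 \<union> Ev \<mu>2) \<le> 2 * exp (real N * (\<theta>\<^sup>2 * (B * (b - a))) - \<alpha>)"
      using ev[OF p1] ev[OF p2] by linarith
    fix \<omega> n assume \<omega>: "\<omega> \<in> space M - (Ev \<mu>1 \<union> Ev \<mu>2)" and D: "\<forall>i\<in>{1..N}. \<bar>D i \<omega>\<bar> \<le> \<tau>" and n: "n \<le> N"
    have [measurable]: "(\<lambda>x. Su n x \<omega>) \<in> borel_measurable borel" using Sux \<omega> by simp
    have SuE: "Su n x \<omega> = mark_sum (\<lambda>i. X i \<omega>) (\<lambda>i. D i \<omega>) n a x - real n * c x" if "x \<le> b" for x
    proof -
      have "\<xi> x (Z i \<omega>) = (if \<bar>D i \<omega>\<bar> \<le> \<tau> then D i \<omega> else 0) * (if a < X i \<omega> \<and> X i \<omega> \<le> x then 1 else 0)" for i \<omega>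
        unfolding \<xi>_def Z_def J_def tr_def using that by (simp add: min_def)
      then have "e x = c x" unfolding e_def c by (simp only:)
      moreover have "(\<Sum>i=1..n. \<xi> x (Z i \<omega>)) = mark_sum (\<lambda>i. X i \<omega>) (\<lambda>i. D i \<omega>) n a x"
        unfolding mark_sum_def
      proof (rule sum.cong[OF refl])
        fix i assume "i \<in> {1..n}"
        then have "\<bar>D i \<omega>\<bar> \<le> \<tau>" using D n by auto
        then show "\<xi> x (Z i \<omega>) = (if a < X i \<omega> \<and> X i \<omega> \<le> x then D i \<omega> else 0)"
          using that unfolding \<xi>_def Z_def J_def tr_def by (auto simp: min_def)
      qed
      ultimately show ?thesis unfolding Su_def \<zeta>_def by (simp add: sum_subtractf)
    qed
    have "(\<integral>\<^sup>+x. ennreal ((\<theta> * Su n x \<omega>)\<^sup>2) \<partial>\<mu>1) = ennreal ((\<theta> * Su n b \<omega>)\<^sup>2)"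
      unfolding \<mu>1_def by (rule nn_integral_return) auto
    then have "(\<theta> * Su n b \<omega>)\<^sup>2 \<le> 4 * \<alpha>\<^sup>2 + 16"
      using off[OF p1 _ n, of \<omega>] \<omega> by (simp del: ennreal_plus)
    then show "\<theta>\<^sup>2 * (mark_sum (\<lambda>i. X i \<omega>) (\<lambda>i. D i \<omega>) n a b - real n * c b)\<^sup>2 \<le> 4 * \<alpha>\<^sup>2 + 16"
      by (simp add: SuE power_mult_distrib)
    define I where "I = integral {a..b} (\<lambda>x. (\<theta> * Su n x \<omega>)\<^sup>2)"
    have Sb: "\<bar>\<theta> * Su n x \<omega>\<bar> \<le> \<theta> * (real n * (2 * \<tau>))" for x
    proof -
      have "\<bar>Su n x \<omega>\<bar> \<le> (\<Sum>i=1..n. 2 * \<tau>)" unfolding Su_def by (rule order_trans[OF sum_abs sum_mono]) (rule \<zeta>b)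
      then show ?thesis using \<theta> by (simp add: abs_mult)
    qed
    have "L2_01 (\<lambda>x. \<theta> * Su n x \<omega>)" by (rule L2_01_bounded_borel[OF _ Sb]) measurable
    then have "(\<lambda>x. (\<theta> * Su n x \<omega>)\<^sup>2) integrable_on {a..b}"
      unfolding L2_01_def by (intro integrable_on_sub01[OF conjunct2 ab(1,3)])
    then have hI: "((\<lambda>x. (\<theta> * Su n x \<omega>)\<^sup>2) has_integral I) {a..b}" unfolding I_def by (rule integrable_integral)
    have nnI: "(\<integral>\<^sup>+x. ennreal ((\<theta> * Su n x \<omega>)\<^sup>2) * indicator {a..b} x \<partial>lborel) = ennreal I"
    proof -
      have "(\<integral>\<^sup>+x. ennreal ((\<theta> * Su n x \<omega>)\<^sup>2) * indicator {a..b} x \<partial>lborel) = (\<integral>\<^sup>+x. ennreal (indicator {a..b} x * (\<theta> * Su n x \<omega>)\<^sup>2) \<partial>lborel)"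
        by (intro nn_integral_cong) (auto simp: indicator_def)
      also have "\<dots> = ennreal I" by (rule nn_integral_has_integral_lebesgue[OF _ hI]) simp
      finally show ?thesis .
    qed
    have "(\<integral>\<^sup>+x. ennreal ((\<theta> * Su n x \<omega>)\<^sup>2) \<partial>\<mu>2) = ennreal I / ennreal (b - a)"
      unfolding \<mu>2_def using ab nnI by (subst nn_integral_uniform_measure) auto
    then have "ennreal I / ennreal (b - a) \<le> ennreal (4 * \<alpha>\<^sup>2 + 16)"
      using off[OF p2 _ n, of \<omega>] \<omega> by (simp del: ennreal_plus)
    moreover have I0: "0 \<le> I" using hI by (rule has_integral_nonneg) simp
    ultimately have "I / (b - a) \<le> 4 * \<alpha>\<^sup>2 + 16" using ab by (simp add: divide_ennreal del: ennreal_plus)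
    then have "I \<le> (b - a) * (4 * \<alpha>\<^sup>2 + 16)" using ab by (simp add: field_simps)
    moreover have "I = \<theta>\<^sup>2 * integral {a..b} (\<lambda>x. (mark_sum (\<lambda>i. X i \<omega>) (\<lambda>i. D i \<omega>) n a x - real n * c x)\<^sup>2)"
    proof -
      have "I = integral {a..b} (\<lambda>x. \<theta>\<^sup>2 * (mark_sum (\<lambda>i. X i \<omega>) (\<lambda>i. D i \<omega>) n a x - real n * c x)\<^sup>2)"
        unfolding I_def by (rule integral_cong) (simp add: SuE power_mult_distrib)
      then show ?thesis by simp
    qed
    ultimately show "\<theta>\<^sup>2 * integral {a..b} (\<lambda>x. (mark_sum (\<lambda>i. X i \<omega>) (\<lambda>i. D i \<omega>) n a x - real n * c x)\<^sup>2) \<le> (b - a) * (4 * \<alpha>\<^sup>2 + 16)"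
      by simp
  qed
qed

end

section \<open>Almost sure fluctuations of mark sums\<close>

context prob_space
begin

section \<open>Controlling the truncation\<close>

lemma expectation_cut_L2:
  assumes [measurable]: "X \<in> borel_measurable M" and g: "integrable M g"
  shows "L2_01 (\<lambda>x. expectation (\<lambda>\<omega>. g \<omega> * (if a < X \<omega> \<and> X \<omega> \<le> x then 1 else 0)))"
proof (rule L2_01_bounded_borel)
  have [measurable]: "g \<in> borel_measurable M" using g by simp
  show "(\<lambda>x. expectation (\<lambda>\<omega>. g \<omega> * (if a < X \<omega> \<and> X \<omega> \<le> x then 1 else 0))) \<in> borel_measurable borel"
  proof (rule borel_measurable_lebesgue_integral)
    show "(\<lambda>(x, \<omega>). g \<omega> * (if a < X \<omega> \<and> X \<omega> \<le> x then 1 else 0)) \<in> borel_measurable (borel \<Otimes>\<^sub>M M)" by measurable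
  qed
  fix x
  have "integrable M (\<lambda>\<omega>. g \<omega> * (if a < X \<omega> \<and> X \<omega> \<le> x then 1 else 0))"
    by (rule Bochner_Integration.integrable_bound[OF g]) auto
  have "\<bar>expectation (\<lambda>\<omega>. g \<omega> * (if a < X \<omega> \<and> X \<omega> \<le> x then 1 else 0))\<bar> \<le> expectation (\<lambda>\<omega>. \<bar>g \<omega> * (if a < X \<omega> \<and> X \<omega> \<le> x then 1 else 0)\<bar>)"
    by (rule integral_abs_bound)
  also have "\<dots> \<le> expectation (\<lambda>\<omega>. \<bar>g \<omega>\<bar>)"
    using g \<open>integrable M (\<lambda>\<omega>. g \<omega> * (if a < X \<omega> \<and> X \<omega> \<le> x then 1 else 0))\<close> by (intro integral_mono) auto
  finally show "\<bar>expectation (\<lambda>\<omega>. g \<omega> * (if a < X \<omega> \<and> X \<omega> \<le> x then 1 else 0))\<bar> \<le> expectation (\<lambda>\<omega>. \<bar>g \<omega>\<bar>)" .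
qed

text \<open>Where \<bar>D\<bar> > \<tau>, the factor
  \<open>(\<bar>D\<bar> / \<tau>) powr (\<kappa> - 1)\<close> is at least 1, so the discarded part
  is dominated by the \<kappa>-th moment.\<close>

lemma truncation_bias:
  fixes D X :: "'a \<Rightarrow> real"
  assumes [measurable]: "D \<in> borel_measurable M" "X \<in> borel_measurable M" and \<kappa>: "1 \<le> \<kappa>" and mom: "integrable M (\<lambda>\<omega>. \<bar>D \<omega>\<bar> powr \<kappa>)"
    and B: "expectation (\<lambda>\<omega>. \<bar>D \<omega>\<bar> powr \<kappa>) \<le> B" and \<tau>: "\<tau> > 0" and D: "integrable M D"
  shows "\<bar>expectation (\<lambda>\<omega>. (if \<bar>D \<omega>\<bar> \<le> \<tau> then D \<omega> else 0) * (if a < X \<omega> \<and> X \<omega> \<le> x then 1 else 0)) -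
     expectation (\<lambda>\<omega>. D \<omega> * (if a < X \<omega> \<and> X \<omega> \<le> x then 1 else 0))\<bar> \<le> \<tau> powr (1 - \<kappa>) * B"
proof -
  let ?J = "\<lambda>\<omega>. if a < X \<omega> \<and> X \<omega> \<le> x then 1 else 0 :: real"
  have i1: "integrable M (\<lambda>\<omega>. (if \<bar>D \<omega>\<bar> \<le> \<tau> then D \<omega> else 0) * ?J \<omega>)"
  proof (rule Bochner_Integration.integrable_bound[OF D])
    show "(\<lambda>\<omega>. (if \<bar>D \<omega>\<bar> \<le> \<tau> then D \<omega> else 0) * ?J \<omega>) \<in> borel_measurable M" by measurable
  qed auto
  have i2: "integrable M (\<lambda>\<omega>. D \<omega> * ?J \<omega>)"
  proof (rule Bochner_Integration.integrable_bound[OF D])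
    show "(\<lambda>\<omega>. D \<omega> * ?J \<omega>) \<in> borel_measurable M" by measurable
  qed auto
  have "\<bar>expectation (\<lambda>\<omega>. (if \<bar>D \<omega>\<bar> \<le> \<tau> then D \<omega> else 0) * ?J \<omega>) - expectation (\<lambda>\<omega>. D \<omega> * ?J \<omega>)\<bar> =
     \<bar>expectation (\<lambda>\<omega>. (if \<bar>D \<omega>\<bar> \<le> \<tau> then D \<omega> else 0) * ?J \<omega> - D \<omega> * ?J \<omega>)\<bar>"
    by (subst Bochner_Integration.integral_diff[OF i1 i2]) simp
  also have "\<dots> \<le> expectation (\<lambda>\<omega>. \<bar>(if \<bar>D \<omega>\<bar> \<le> \<tau> then D \<omega> else 0) * ?J \<omega> - D \<omega> * ?J \<omega>\<bar>)" by (rule integral_abs_bound)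
  also have "\<dots> \<le> expectation (\<lambda>\<omega>. \<tau> powr (1 - \<kappa>) * (\<bar>D \<omega>\<bar> powr \<kappa>))"
  proof (rule integral_mono)
    show "integrable M (\<lambda>\<omega>. \<bar>(if \<bar>D \<omega>\<bar> \<le> \<tau> then D \<omega> else 0) * ?J \<omega> - D \<omega> * ?J \<omega>\<bar>)"
      using i1 i2 by (intro Bochner_Integration.integrable_abs Bochner_Integration.integrable_diff)
    show "integrable M (\<lambda>\<omega>. \<tau> powr (1 - \<kappa>) * (\<bar>D \<omega>\<bar> powr \<kappa>))" using mom by simp
    fix \<omega>
    have "\<bar>D \<omega>\<bar> \<le> \<tau> powr (1 - \<kappa>) * (\<bar>D \<omega>\<bar> powr \<kappa>)" if "\<tau> < \<bar>D \<omega>\<bar>"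
    proof -
      have D0: "\<bar>D \<omega>\<bar> > 0" using that \<tau> by linarith
      have "\<bar>D \<omega>\<bar> powr (1 - \<kappa>) \<le> \<tau> powr (1 - \<kappa>)" using that \<tau> \<kappa> by (intro powr_mono2') auto
      then have "\<bar>D \<omega>\<bar> powr (1 - \<kappa>) * \<bar>D \<omega>\<bar> powr \<kappa> \<le> \<tau> powr (1 - \<kappa>) * \<bar>D \<omega>\<bar> powr \<kappa>" by (intro mult_right_mono) auto
      moreover have "\<bar>D \<omega>\<bar> powr (1 - \<kappa>) * \<bar>D \<omega>\<bar> powr \<kappa> = \<bar>D \<omega>\<bar>" using D0 by (simp add: powr_add[symmetric])
      ultimately show ?thesis by simp
    qed
    then show "\<bar>(if \<bar>D \<omega>\<bar> \<le> \<tau> then D \<omega> else 0) * ?J \<omega> - D \<omega> * ?J \<omega>\<bar> \<le> \<tau> powr (1 - \<kappa>) * (\<bar>D \<omega>\<bar> powr \<kappa>)"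
      by auto
  qed
  also have "\<dots> = \<tau> powr (1 - \<kappa>) * expectation (\<lambda>\<omega>. \<bar>D \<omega>\<bar> powr \<kappa>)" by simp
  also have "\<dots> \<le> \<tau> powr (1 - \<kappa>) * B" using B by (intro mult_left_mono) auto
  finally show ?thesis .
qed

text \<open>By Markov's inequality the i-th mark exceeds \<open>(i / 2) powr \<rho>\<close> with a
  probability of order \<open>i powr (- (\<rho> * \<kappa>))\<close>, which is summable. The halving
  fits the blocks: for \<open>i \<le> 2 ^ Suc k\<close> this threshold is at most
  \<open>2 powr (k * \<rho>)\<close>. The finitely many exceptional marks are overtaken by the
  growing threshold.\<close>

lemma marks_eventually_bounded:
  fixes D :: "nat \<Rightarrow> 'a \<Rightarrow> real"
  assumes D[measurable]: "\<And>i. i \<ge> 1 \<Longrightarrow> D i \<in> borel_measurable M"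
    and law: "\<And>i. i \<ge> 1 \<Longrightarrow> distr M borel (D i) = distr M borel (D 1)"
    and mom: "integrable M (\<lambda>\<omega>. \<bar>D 1 \<omega>\<bar> powr \<kappa>)" and \<rho>: "\<rho> > 0" "\<rho> * \<kappa> > 1" "\<kappa> > 0"
  shows "AE \<omega> in M. \<forall>\<^sub>F k in sequentially. \<forall>i\<in>{1..2 ^ Suc k}. \<bar>D i \<omega>\<bar> \<le> 2 powr (real k * \<rho>)"
proof -
  define A where "A i = {\<omega>\<in>space M. (real (Suc i) / 2) powr \<rho> < \<bar>D (Suc i) \<omega>\<bar>}" for i
  have Am[measurable]: "A i \<in> events" for i
  proof -
    have [measurable]: "D (Suc i) \<in> borel_measurable M" by (rule D) simp
    show ?thesis unfolding A_def by measurable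
  qed
  define m where "m = expectation (\<lambda>\<omega>. \<bar>D 1 \<omega>\<bar> powr \<kappa>)"
  have pA: "prob (A i) \<le> m * (1/2) powr (- (\<rho> * \<kappa>)) * real (Suc i) powr (- (\<rho> * \<kappa>))" for i
  proof -
    define t where "t = real (Suc i) / 2"
    have t: "t > 0" unfolding t_def by simp
    have D1[measurable]: "D 1 \<in> borel_measurable M" by (rule D) simp
    have DS[measurable]: "D (Suc i) \<in> borel_measurable M" by (rule D) simp
    have S: "{y::real. t powr \<rho> < \<bar>y\<bar>} \<in> sets borel" by measurable
    have "prob (A i) = measure (distr M borel (D (Suc i))) {y. t powr \<rho> < \<bar>y\<bar>}"
      unfolding A_def t_def[symmetric] by (subst measure_distr[OF DS S]) (auto intro!: arg_cong[where f=prob])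
    also have "\<dots> = measure (distr M borel (D 1)) {y. t powr \<rho> < \<bar>y\<bar>}" using law[of "Suc i"] by simp
    also have "\<dots> = prob {\<omega>\<in>space M. t powr \<rho> < \<bar>D 1 \<omega>\<bar>}"
      by (subst measure_distr[OF D1 S]) (auto intro!: arg_cong[where f=prob])
    also have "\<dots> = expectation (indicator {\<omega>\<in>space M. t powr \<rho> < \<bar>D 1 \<omega>\<bar>})" by simp
    also have "\<dots> \<le> expectation (\<lambda>\<omega>. t powr (- (\<rho> * \<kappa>)) * (\<bar>D 1 \<omega>\<bar> powr \<kappa>))"
    proof (rule integral_mono)
      show "integrable M (\<lambda>\<omega>. t powr (- (\<rho> * \<kappa>)) * (\<bar>D 1 \<omega>\<bar> powr \<kappa>))" using mom by simp
      show "integrable M (indicator {\<omega>\<in>space M. t powr \<rho> < \<bar>D 1 \<omega>\<bar>} :: 'a \<Rightarrow> real)"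
        by (rule integrable_const_bound[where B=1]) auto
      fix \<omega>
      have "1 \<le> t powr (- (\<rho> * \<kappa>)) * (\<bar>D 1 \<omega>\<bar> powr \<kappa>)" if "t powr \<rho> < \<bar>D 1 \<omega>\<bar>"
      proof -
        have "(t powr \<rho>) powr \<kappa> \<le> \<bar>D 1 \<omega>\<bar> powr \<kappa>" using that \<rho> by (intro powr_mono2) auto
        then have "t powr (- (\<rho> * \<kappa>)) * (t powr (\<rho> * \<kappa>)) \<le> t powr (- (\<rho> * \<kappa>)) * (\<bar>D 1 \<omega>\<bar> powr \<kappa>)"
          by (intro mult_left_mono) (auto simp: powr_powr)
        then show ?thesis using t by (simp add: powr_add[symmetric])
      qed
      then show "indicator {\<omega>\<in>space M. t powr \<rho> < \<bar>D 1 \<omega>\<bar>} \<omega> \<le> t powr (- (\<rho> * \<kappa>)) * (\<bar>D 1 \<omega>\<bar> powr \<kappa>)"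
        by (auto simp: indicator_def)
    qed
    also have "\<dots> = t powr (- (\<rho> * \<kappa>)) * m" unfolding m_def by simp
    also have "t powr (- (\<rho> * \<kappa>)) = (1/2) powr (- (\<rho> * \<kappa>)) * real (Suc i) powr (- (\<rho> * \<kappa>))"
      unfolding t_def by (subst powr_mult[symmetric]) auto
    finally show ?thesis by (simp add: mult_ac)
  qed
  have sA: "summable (\<lambda>i. prob (A i))"
  proof (rule summable_comparison_test')
    have "summable (\<lambda>i. real i powr (- (\<rho> * \<kappa>)))" using \<rho> by (simp add: summable_real_powr_iff)
    then have "summable (\<lambda>i. real (Suc i) powr (- (\<rho> * \<kappa>)))" by (subst summable_Suc_iff)
    then show "summable (\<lambda>i. m * (1/2) powr (- (\<rho> * \<kappa>)) * real (Suc i) powr (- (\<rho> * \<kappa>)))" by (rule summable_mult)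
    show "norm (prob (A i)) \<le> m * (1/2) powr (- (\<rho> * \<kappa>)) * real (Suc i) powr (- (\<rho> * \<kappa>))" if "i \<ge> 0" for i
      using pA[of i] by simp
  qed
  have "AE \<omega> in M. eventually (\<lambda>n. \<omega> \<in> space M - A n) sequentially"
    by (rule borel_cantelli_AE1[OF Am _ sA]) (simp add: emeasure_eq_measure)
  then show ?thesis
  proof eventually_elim
    case (elim \<omega>)
    then obtain i0 where i0: "\<And>i. i \<ge> i0 \<Longrightarrow> \<omega> \<in> space M - A i" by (auto simp: eventually_sequentially)
    define m0 where "m0 = (\<Sum>i\<le>i0. \<bar>D i \<omega>\<bar>)"
    have "filterlim (\<lambda>k. 2 powr (real k * \<rho>)) at_top sequentially" using \<rho>(1) by real_asymp
    then have "\<forall>\<^sub>F k in sequentially. m0 \<le> 2 powr (real k * \<rho>)" by (simp add: filterlim_at_top)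
    then show ?case
    proof eventually_elim
      case (elim k)
      show ?case
      proof
        fix i :: nat assume i: "i \<in> {1..2 ^ Suc k}"
        show "\<bar>D i \<omega>\<bar> \<le> 2 powr (real k * \<rho>)"
        proof (cases "i \<le> i0")
          case True
          have "\<bar>D i \<omega>\<bar> \<le> m0" unfolding m0_def using True by (intro member_le_sum) auto
          then show ?thesis using elim by simp
        next
          case False
          obtain i' where i': "i = Suc i'" using i by (cases i) auto
          have "\<omega> \<in> space M - A i'" using False i' by (intro i0) simp
          then have "\<bar>D i \<omega>\<bar> \<le> (real i / 2) powr \<rho>" unfolding A_def i' by auto
          also have "\<dots> \<le> (2 ^ k) powr \<rho>"
          proof (rule powr_mono2)
            have "real i \<le> real (2 ^ Suc k)" using i by (simp only: of_nat_le_iff atLeastAtMost_iff)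
            then show "real i / 2 \<le> 2 ^ k" by simp
          qed (use \<rho> in auto)
          also have "(2 ^ k) powr \<rho> = 2 powr (real k * \<rho>)" by (simp add: powr_realpow[symmetric] powr_powr)
          finally show ?thesis .
        qed
      qed
    qed
  qed
qed


lemma integral_square_add_le:
  assumes u: "L2_01 u" and v: "L2_01 v" and ab: "0 \<le> a" "a \<le> b" "b \<le> 1" and bd: "\<And>x. x \<in> {a..b} \<Longrightarrow> (v x)\<^sup>2 \<le> V"
  shows "integral {a..b} (\<lambda>x. (u x + v x)\<^sup>2) \<le> 2 * integral {a..b} (\<lambda>x. (u x)\<^sup>2) + 2 * V * (b - a)"
proof -
  have i: "(\<lambda>x. (u x)\<^sup>2) integrable_on {a..b}" "(\<lambda>x. (u x + v x)\<^sup>2) integrable_on {a..b}"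
    using u L2_01_add[OF u v] unfolding L2_01_def by (auto intro: integrable_on_sub01[OF conjunct2 ab(1,3)])
  have "integral {a..b} (\<lambda>x. (u x + v x)\<^sup>2) \<le> integral {a..b} (\<lambda>x. 2 * (u x)\<^sup>2 + 2 * V)"
  proof (rule integral_le)
    show "(\<lambda>x. 2 * (u x)\<^sup>2 + 2 * V) integrable_on {a..b}" by (intro integrable_add integrable_on_mult_right i integrable_const_ivl)
    show "(u x + v x)\<^sup>2 \<le> 2 * (u x)\<^sup>2 + 2 * V" if "x \<in> {a..b}" for x
      using square_sum_le[of "u x" "v x"] bd[OF that] by linarith
  qed (rule i)
  also have "\<dots> = integral {a..b} (\<lambda>x. 2 * (u x)\<^sup>2) + integral {a..b} (\<lambda>x. 2 * V)"
    by (intro Henstock_Kurzweil_Integration.integral_add integrable_on_mult_right i integrable_const_ivl)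
  also have "\<dots> = 2 * integral {a..b} (\<lambda>x. (u x)\<^sup>2) + 2 * V * (b - a)" using ab by simp
  finally show ?thesis .
qed

text \<open>Borel-Cantelli over blocks, block \<open>k\<close> holding the \<open>n\<close> with
  \<open>2 ^ k \<le> n < 2 ^ Suc k\<close>, after a union bound over the cells of all relevant
  levels. The marks need not be centred, so the result serves noise and counts alike; the truncated
  mean is exchanged for \<open>c\<close> at the end, at the cost of a bias.\<close>

theorem mark_sum_oscillation:
  fixes X D :: "nat \<Rightarrow> 'a \<Rightarrow> real"
  assumes ind: "indep_vars (\<lambda>_. borel) (\<lambda>i \<omega>. (X i \<omega>, D i \<omega>)) {1..}"
    and law: "\<And>i. i \<ge> 1 \<Longrightarrow> distr M borel (\<lambda>\<omega>. (X i \<omega>, D i \<omega>)) = distr M borel (\<lambda>\<omega>. (X 1 \<omega>, D 1 \<omega>))"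
    and lam: "2 < lam" "lam < \<kappa>" and mom: "integrable M (\<lambda>\<omega>. \<bar>D 1 \<omega>\<bar> powr \<kappa>)"
    and momB: "expectation (\<lambda>\<omega>. \<bar>D 1 \<omega>\<bar> powr \<kappa>) \<le> B" and B: "B \<ge> 0"
    and loc: "\<And>a b. 0 \<le> a \<Longrightarrow> a \<le> b \<Longrightarrow> b \<le> 1 \<Longrightarrow>
      expectation (\<lambda>\<omega>. (1 + \<bar>D 1 \<omega>\<bar> powr \<kappa>) * (if a < X 1 \<omega> \<and> X 1 \<omega> \<le> b then 1 else 0)) \<le> B * (b - a)"
    and c: "\<And>a x. c a x = expectation (\<lambda>\<omega>. D 1 \<omega> * (if a < X 1 \<omega> \<and> X 1 \<omega> \<le> x then 1 else 0))"
  shows "\<exists>C\<ge>0. AE \<omega> in M. \<forall>\<^sub>F n in sequentially. \<forall>j. real n powr (- (1 - 2 / lam)) \<le> 1 / 2 ^ j \<longrightarrow> (\<forall>k<2 ^ j.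
     (mark_sum (\<lambda>i. X i \<omega>) (\<lambda>i. D i \<omega>) n (real k / 2 ^ j) (real (Suc k) / 2 ^ j) - real n * c (real k / 2 ^ j) (real (Suc k) / 2 ^ j))\<^sup>2
       \<le> C * (real n * (1 / 2 ^ j) * (1 + real j + ln (ln (real n)))) \<and>
     integral {real k / 2 ^ j..real (Suc k) / 2 ^ j} (\<lambda>x. (mark_sum (\<lambda>i. X i \<omega>) (\<lambda>i. D i \<omega>) n (real k / 2 ^ j) x - real n * c (real k / 2 ^ j) x)\<^sup>2)
       \<le> 1 / 2 ^ j * (C * (real n * (1 / 2 ^ j) * (1 + real j + ln (ln (real n))))))"
proof -
  have Zm: "(\<lambda>\<omega>. (X i \<omega>, D i \<omega>)) \<in> measurable M (borel \<Otimes>\<^sub>M borel)" if "i \<ge> 1" for i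
    using ind that unfolding indep_vars_def by (auto simp: borel_prod)
  have XD: "X i \<in> borel_measurable M" "D i \<in> borel_measurable M" if "i \<ge> 1" for i
    using measurable_compose[OF Zm[OF that] measurable_fst] measurable_compose[OF Zm[OF that] measurable_snd] by auto
  note XD1[measurable] = XD[OF order_refl]
  have Di: "integrable M (D 1)"
  proof (rule Bochner_Integration.integrable_bound[where f="\<lambda>\<omega>. 1 + \<bar>D 1 \<omega>\<bar> powr \<kappa>"])
    show "integrable M (\<lambda>\<omega>. 1 + \<bar>D 1 \<omega>\<bar> powr \<kappa>)" using mom by (intro Bochner_Integration.integrable_add integrable_const)
    have "\<bar>y\<bar> \<le> 1 + \<bar>y\<bar> powr \<kappa>" for y :: real
    proof (cases "\<bar>y\<bar> \<le> 1")
      case False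
      then have "\<bar>y\<bar> powr 1 \<le> \<bar>y\<bar> powr \<kappa>" using lam by (intro powr_mono) auto
      then show ?thesis using False by simp
    qed (simp add: add_increasing2)
    then show "AE \<omega> in M. norm (D 1 \<omega>) \<le> norm (1 + \<bar>D 1 \<omega>\<bar> powr \<kappa>)"
      by (intro AE_I2) (simp add: order_trans[OF _ abs_ge_self])
  qed (rule XD1(2))
  define \<beta> where "\<beta> = 1 - 2 / lam"
  have \<beta>: "0 < \<beta>" "\<beta> < 1" unfolding \<beta>_def using lam by (auto simp: field_simps)
  \<comment> \<open>Strictly between \<open>1 / \<kappa>\<close> and \<open>1 / lam\<close>: the
    first makes \<open>\<tau> k\<close> eventually exceed all marks of the block, the second keeps
    \<open>\<theta> k j * (2 * \<tau> k)\<close> below 1.\<close>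
  define \<rho> where "\<rho> = (1 / \<kappa> + 1 / lam) / 2"
  have kl: "1 / \<kappa> < 1 / lam" using lam by (simp add: frac_less2)
  have "x < (x + y) / 2 \<and> (x + y) / 2 < y" if "x < y" for x y :: real using that by simp
  from this[OF kl] have \<rho>: "1 / \<kappa> < \<rho>" "\<rho> < 1 / lam" unfolding \<rho>_def by blast+
  have \<rho>\<kappa>: "\<rho> * \<kappa> > 1" using \<rho>(1) lam by (simp add: field_simps)
  have \<rho>0: "\<rho> > 0" using \<rho>(1) lam by (meson divide_pos_pos less_trans zero_less_one zero_less_numeral)
  define \<epsilon> where "\<epsilon> = 2 / lam - 2 * \<rho>"
  have \<epsilon>: "\<epsilon> > 0" unfolding \<epsilon>_def using \<rho>(2) by simp
  define \<tau> where "\<tau> k = 2 powr (real k * \<rho>)" for k :: nat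
  have \<tau>: "\<tau> k > 0" for k unfolding \<tau>_def by simp
  \<comment> \<open>The logarithmic factor of the rate; \<open>ln (real k + 1)\<close> stands for
    the iterated logarithm of \<open>n\<close>, from which it differs by a bounded amount on late
    blocks.\<close>
  define q where "q k j = 1 + real j + ln (real k + 1)" for k j :: nat
  have q1: "1 \<le> q k j" for k j unfolding q_def by simp
  define N :: "nat \<Rightarrow> nat" where "N k = 2 ^ Suc k" for k
  \<comment> \<open>Chosen so that the Bernstein exponent
    \<open>N * \<theta>\<^sup>2 * B / 2 ^ j\<close> equals \<open>B * q\<close>. With \<alpha> equal
    to \<open>(B + 2) * q\<close> the exceptional probability is at most
    \<open>2 * exp (- 2 * q)\<close>, of order 4^-j / (k + 1)^2: enough for the 2^j cells of each
    level and for the sum over blocks.\<close>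
  define \<theta> where "\<theta> k j = sqrt (q k j * 2 ^ j / real (N k))" for k j
  have \<theta>2: "(\<theta> k j)\<^sup>2 = q k j * 2 ^ j / real (N k)" for k j unfolding \<theta>_def using q1[of k j] by (simp add: N_def)
  have \<theta>: "\<theta> k j > 0" for k j unfolding \<theta>_def using q1[of k j] by (simp add: N_def)
  define \<alpha> where "\<alpha> k j = (B + 2) * q k j" for k j
  have \<alpha>: "\<alpha> k j \<ge> 0" for k j unfolding \<alpha>_def using B q1[of k j] by simp
  define ct where "ct k a x = expectation (\<lambda>\<omega>. (if \<bar>D 1 \<omega>\<bar> \<le> \<tau> k then D 1 \<omega> else 0) * (if a < X 1 \<omega> \<and> X 1 \<omega> \<le> x then 1 else 0))" for k a x
  define lo hi where "lo j l = real l / 2 ^ j" and "hi j l = real (Suc l) / 2 ^ j" for j l :: nat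
  have lohi: "0 \<le> lo j l" "lo j l < hi j l" "hi j l \<le> 1" "hi j l - lo j l = 1 / 2 ^ j" if "l < 2 ^ j" for j l
    using piece_bounds[OF that] unfolding lo_def hi_def by auto
  define ms where "ms \<omega> n a x = mark_sum (\<lambda>i. X i \<omega>) (\<lambda>i. D i \<omega>) n a x" for \<omega> n a x
  define Good where "Good k j l \<omega> \<longleftrightarrow> ((\<forall>i\<in>{1..N k}. \<bar>D i \<omega>\<bar> \<le> \<tau> k) \<longrightarrow> (\<forall>n\<le>N k.
       (\<theta> k j)\<^sup>2 * (ms \<omega> n (lo j l) (hi j l) - real n * ct k (lo j l) (hi j l))\<^sup>2 \<le> 4 * (\<alpha> k j)\<^sup>2 + 16 \<and>
       (\<theta> k j)\<^sup>2 * integral {lo j l..hi j l} (\<lambda>x. (ms \<omega> n (lo j l) x - real n * ct k (lo j l) x)\<^sup>2) \<le> (hi j l - lo j l) * (4 * (\<alpha> k j)\<^sup>2 + 16)))" for k j l \<omega>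
  define cond where "cond k j \<longleftrightarrow> \<theta> k j * (2 * \<tau> k) \<le> 1" for k j
  \<comment> \<open>If \<open>cond\<close> fails nothing is claimed and the empty set serves; for
    the relevant levels of late blocks \<open>cond\<close> is verified below.\<close>
  define Q where "Q k j l E \<longleftrightarrow> E \<in> events \<and> prob E \<le> 2 * exp (- 2 * q k j) \<and> (cond k j \<longrightarrow> (\<forall>\<omega>\<in>space M - E. Good k j l \<omega>))" for k j l E
  have exQ: "\<exists>E. l < 2 ^ j \<longrightarrow> Q k j l E" for k j l
  proof (cases "l < 2 ^ j \<and> cond k j")
    case True
    then have l: "l < 2 ^ j" and cnd: "\<theta> k j * (2 * \<tau> k) \<le> 1" unfolding cond_def by auto
    have lc: "expectation (\<lambda>\<omega>. (1 + \<bar>D 1 \<omega>\<bar> powr \<kappa>) * (if lo j l < X 1 \<omega> \<and> X 1 \<omega> \<le> hi j l then 1 else 0)) \<le> B * (hi j l - lo j l)"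
      using lohi[OF l] by (intro loc) auto
    have \<kappa>2: "2 \<le> \<kappa>" using lam by simp
    have ctd: "\<And>x. ct k (lo j l) x = expectation (\<lambda>\<omega>. (if \<bar>D 1 \<omega>\<bar> \<le> \<tau> k then D 1 \<omega> else 0) * (if lo j l < X 1 \<omega> \<and> X 1 \<omega> \<le> x then 1 else 0))"
      unfolding ct_def ..
    have "\<exists>E\<in>events. prob E \<le> 2 * exp (real (N k) * ((\<theta> k j)\<^sup>2 * (B * (hi j l - lo j l))) - \<alpha> k j) \<and> (\<forall>\<omega>\<in>space M - E. Good k j l \<omega>)"
      unfolding Good_def ms_def
      by (rule mark_sum_block_exceptional_set[OF ind law \<kappa>2 mom lc lohi(1-3)[OF l] \<theta> cnd \<tau> \<alpha> ctd])
    then obtain E where E: "E \<in> events" "prob E \<le> 2 * exp (real (N k) * ((\<theta> k j)\<^sup>2 * (B * (hi j l - lo j l))) - \<alpha> k j)"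
      "\<forall>\<omega>\<in>space M - E. Good k j l \<omega>" by blast
    have "real (N k) * ((\<theta> k j)\<^sup>2 * (B * (hi j l - lo j l))) - \<alpha> k j = - 2 * q k j"
      unfolding \<theta>2 lohi(4)[OF l] \<alpha>_def by (simp add: N_def algebra_simps)
    then show ?thesis using E unfolding Q_def by (intro exI[of _ E]) simp
  next
    case False
    then show ?thesis unfolding Q_def by (intro exI[of _ "{}"]) auto
  qed
  define Ef where "Ef k j l = (SOME E. l < 2 ^ j \<longrightarrow> Q k j l E)" for k j l
  have Ef: "Q k j l (Ef k j l)" if "l < 2 ^ j" for k j l
    using someI_ex[OF exQ[of l j k]] that unfolding Ef_def by (rule mp)
  \<comment> \<open>Levels up to \<open>Suc k\<close> suffice: at a relevant level
    \<open>2 ^ j\<close> is at most \<open>n powr \<beta>\<close>, and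
    \<open>n < 2 ^ Suc k\<close>.\<close>
  define EE where "EE k = (\<Union>j\<in>{..Suc k}. \<Union>l\<in>{..<2 ^ j}. Ef k j l)" for k
  have Efm: "Ef k j l \<in> events" if "l < 2 ^ j" for k j l using Ef[OF that] unfolding Q_def by blast
  have EEm: "EE k \<in> events" for k unfolding EE_def using Efm by (intro sets.finite_UN) auto
  have EEp: "prob (EE k) \<le> 4 / (real k + 1)\<^sup>2" for k
  proof -
    have e2: "exp (-2::real) \<le> 1 / 4"
    proof -
      have "(2::real) \<le> exp 1" using exp_ge_add_one_self[of 1] by simp
      then have "2 * 2 \<le> exp 1 * exp (1::real)" by (intro mult_mono) auto
      then show ?thesis by (simp add: exp_minus exp_add[symmetric] field_simps)
    qed
    have eq: "exp (- 2 * q k j) \<le> (1/4) ^ j / (real k + 1)\<^sup>2" for j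
    proof -
      have "exp (- 2 * q k j) = exp (-2) * exp (- 2) ^ j * exp (- 2 * ln (real k + 1))"
        unfolding q_def by (simp add: exp_add[symmetric] exp_of_nat_mult[symmetric] algebra_simps)
      also have "exp (- 2 * ln (real k + 1)) = 1 / (real k + 1)\<^sup>2"
        by (simp add: exp_minus exp_double field_simps)
      also have "exp (-2) * exp (- 2) ^ j * (1 / (real k + 1)\<^sup>2) \<le> 1 * (1/4) ^ j * (1 / (real k + 1)\<^sup>2)"
        using e2 by (intro mult_right_mono mult_mono power_mono) auto
      finally show ?thesis by simp
    qed
    have "prob (EE k) \<le> (\<Sum>j\<le>Suc k. prob (\<Union>l\<in>{..<2 ^ j}. Ef k j l))"
      unfolding EE_def using Efm by (intro finite_measure_subadditive_finite) (auto intro!: sets.finite_UN)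
    also have "\<dots> \<le> (\<Sum>j\<le>Suc k. \<Sum>l<2 ^ j. prob (Ef k j l))"
      using Efm by (intro sum_mono finite_measure_subadditive_finite) auto
    also have "\<dots> \<le> (\<Sum>j\<le>Suc k. \<Sum>l<(2::nat) ^ j. 2 * ((1/4) ^ j / (real k + 1)\<^sup>2))"
    proof (intro sum_mono)
      fix j l assume "l \<in> {..<(2::nat) ^ j}"
      then have "prob (Ef k j l) \<le> 2 * exp (- 2 * q k j)" using Ef[of l j k] unfolding Q_def by simp
      then show "prob (Ef k j l) \<le> 2 * ((1/4) ^ j / (real k + 1)\<^sup>2)" using eq[of j] by linarith
    qed
    also have "\<dots> = 2 / (real k + 1)\<^sup>2 * (\<Sum>j\<le>Suc k. (1/2) ^ j)"
      unfolding sum_distrib_left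
    proof (rule sum.cong[OF refl])
      fix j
      have "(2::real) ^ j * (1/4) ^ j = (1/2) ^ j" by (simp add: power_mult_distrib[symmetric])
      then show "(\<Sum>l<(2::nat) ^ j. 2 * ((1/4) ^ j / (real k + 1)\<^sup>2)) = 2 / (real k + 1)\<^sup>2 * (1/2) ^ j"
        by (simp add: field_simps)
    qed
    also have "\<dots> \<le> 2 / (real k + 1)\<^sup>2 * 2"
    proof (intro mult_left_mono)
      have "(\<Sum>j\<le>Suc k. (1/2::real) ^ j) \<le> (\<Sum>j. (1/2) ^ j)" by (intro sum_le_suminf summable_geometric) auto
      then show "(\<Sum>j\<le>Suc k. (1/2::real) ^ j) \<le> 2" by (simp add: suminf_geometric)
    qed auto
    finally show ?thesis by simp
  qed
  have "summable (\<lambda>k. prob (EE k))"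
  proof (rule summable_comparison_test')
    have "summable (\<lambda>k. 1 / (real k + 1)\<^sup>2)"
      using inverse_squares_sums by (auto simp: sums_iff add.commute)
    then have "summable (\<lambda>k. 4 * (1 / (real k + 1)\<^sup>2))" by (rule summable_mult)
    then show "summable (\<lambda>k. 4 / (real k + 1)\<^sup>2)" by simp
    show "norm (prob (EE k)) \<le> 4 / (real k + 1)\<^sup>2" if "k \<ge> 0" for k using EEp[of k] by simp
  qed
  then have ae1: "AE \<omega> in M. eventually (\<lambda>k. \<omega> \<in> space M - EE k) sequentially"
    by (intro borel_cantelli_AE1[OF EEm]) (simp_all add: emeasure_eq_measure)
  have Dlaw: "distr M borel (D i) = distr M borel (D 1)" if "i \<ge> 1" for i
  proof -
    have sm: "(snd :: real \<times> real \<Rightarrow> real) \<in> borel_measurable borel"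
      by (intro borel_measurable_continuous_onI continuous_on_snd continuous_on_id)
    have "distr M borel (D j) = distr (distr M borel (\<lambda>\<omega>. (X j \<omega>, D j \<omega>))) borel snd" if "j \<ge> 1" for j
      using Zm[OF that] sm by (subst distr_distr) (auto simp: o_def borel_prod)
    then show ?thesis using law[OF that] that by simp
  qed
  have ae2: "AE \<omega> in M. \<forall>\<^sub>F k in sequentially. \<forall>i\<in>{1..N k}. \<bar>D i \<omega>\<bar> \<le> \<tau> k"
    unfolding N_def \<tau>_def
  proof (rule marks_eventually_bounded[where D=D and \<kappa>=\<kappa> and \<rho>=\<rho>, OF _ _ mom \<rho>0 \<rho>\<kappa>])
    show "D i \<in> borel_measurable M" if "1 \<le> i" for i by (rule XD(2)[OF that])
    show "distr M borel (D i) = distr M borel (D 1)" if "1 \<le> i" for i by (rule Dlaw[OF that])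
    show "0 < \<kappa>" using lam by simp
  qed
  \<comment> \<open>The 16 is absorbed because \<open>q\<close> is at least 1. In \<open>C\<close>
    below, fluctuation and bias are both doubled by squaring their sum.\<close>
  define K0 where "K0 = 4 * (B + 2)\<^sup>2 + 16"
  have K0: "K0 \<ge> 0" unfolding K0_def by simp
  define C where "C = 8 * K0 + 8 * B\<^sup>2"
  have C: "C \<ge> 0" unfolding C_def using K0 by simp
  \<comment> \<open>For late blocks this yields \<open>cond\<close>, as the square of
    \<open>\<theta> k j * (2 * \<tau> k)\<close> is at most
    \<open>4 * (2 * k + 3) * 2 powr (- (k * \<epsilon>))\<close>.\<close>
  have ev1: "\<forall>\<^sub>F k in sequentially. 4 * (2 * real k + 3) \<le> 2 powr (real k * \<epsilon>)" using \<epsilon> by real_asymp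
  show ?thesis
  proof (intro exI[of _ C] conjI C)
    show "AE \<omega> in M. \<forall>\<^sub>F n in sequentially. \<forall>j. real n powr (- (1 - 2 / lam)) \<le> 1 / 2 ^ j \<longrightarrow> (\<forall>k<2 ^ j.
     (mark_sum (\<lambda>i. X i \<omega>) (\<lambda>i. D i \<omega>) n (real k / 2 ^ j) (real (Suc k) / 2 ^ j) - real n * c (real k / 2 ^ j) (real (Suc k) / 2 ^ j))\<^sup>2
       \<le> C * (real n * (1 / 2 ^ j) * (1 + real j + ln (ln (real n)))) \<and>
     integral {real k / 2 ^ j..real (Suc k) / 2 ^ j} (\<lambda>x. (mark_sum (\<lambda>i. X i \<omega>) (\<lambda>i. D i \<omega>) n (real k / 2 ^ j) x - real n * c (real k / 2 ^ j) x)\<^sup>2)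
       \<le> 1 / 2 ^ j * (C * (real n * (1 / 2 ^ j) * (1 + real j + ln (ln (real n))))))"
      using ae1 ae2
    proof eventually_elim
      case (elim \<omega>)
      then have "\<forall>\<^sub>F k in sequentially. \<omega> \<in> space M - EE k \<and> (\<forall>i\<in>{1..N k}. \<bar>D i \<omega>\<bar> \<le> \<tau> k) \<and> 4 * (2 * real k + 3) \<le> 2 powr (real k * \<epsilon>)"
        using ev1 by (simp add: eventually_conj_iff)
      then obtain k0 where k0: "\<And>k. k \<ge> k0 \<Longrightarrow> \<omega> \<in> space M - EE k \<and> (\<forall>i\<in>{1..N k}. \<bar>D i \<omega>\<bar> \<le> \<tau> k) \<and> 4 * (2 * real k + 3) \<le> 2 powr (real k * \<epsilon>)"
        by (auto simp: eventually_sequentially)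
      \<comment> \<open>This gives \<open>k + 1 \<le> exp 1 * ln n\<close>, so that
        \<open>ln (k + 1)\<close> is at most 1 plus the iterated logarithm of
        \<open>n\<close>.\<close>
      have ev2: "\<forall>\<^sub>F n in sequentially. ln (real n) / ln 2 + 1 \<le> exp 1 * ln (real n) \<and> 1 \<le> ln (real n)"
      proof (rule eventually_conj)
        have "exp 1 * ln 2 > (1::real)" using ln2_ge_two_thirds exp_ge_add_one_self[of 1] mult_mono[of 2 "exp 1" "2/3" "ln 2 :: real"] by simp
        then have "exp 1 - 1 / ln 2 > (0::real)" by (simp add: field_simps)
        moreover have "\<forall>\<^sub>F n in sequentially. 1 \<le> a * ln (real n)" if "a > 0" for a :: real
          using that by real_asymp
        ultimately have "\<forall>\<^sub>F n in sequentially. 1 \<le> (exp 1 - 1 / ln 2) * ln (real n)" by blast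
        then show "\<forall>\<^sub>F n in sequentially. ln (real n) / ln 2 + 1 \<le> exp 1 * ln (real n)"
          by eventually_elim (simp add: algebra_simps)
        show "\<forall>\<^sub>F n in sequentially. 1 \<le> ln (real n)" by real_asymp
      qed
      have ev3: "\<forall>\<^sub>F n in sequentially. n \<ge> 2 ^ k0" by (rule eventually_ge_at_top)
      from ev2 ev3 show ?case
      proof eventually_elim
        case (elim n)
        have n1: "n \<ge> 1" using elim(2) by (metis one_le_numeral one_le_power order_trans)
        obtain k where k: "2 ^ k \<le> n" "n < 2 ^ Suc k" using ex_power_ivl1[of 2 n] n1 by auto
        have kk0: "k \<ge> k0"
        proof (rule ccontr)
          assume "\<not> k \<ge> k0"
          then have "(2::nat) ^ Suc k \<le> 2 ^ k0" by (intro power_increasing) auto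
          then show False using k(2) elim(2) by linarith
        qed
        note K = k0[OF kk0]
        have nN: "n \<le> N k" "real (N k) \<le> 2 * real n"
        proof -
          show "n \<le> N k" using k unfolding N_def by simp
          have "real (2 ^ k) \<le> real n" using k(1) by (simp only: of_nat_le_iff)
          then show "real (N k) \<le> 2 * real n" unfolding N_def by simp
        qed
        have rn: "real n > 0" using n1 by simp
        have lnq: "ln (real k + 1) \<le> 1 + ln (ln (real n))"
        proof -
          have "real (2 ^ k) \<le> real n" using k(1) by (simp only: of_nat_le_iff)
          then have "ln (2 ^ k) \<le> ln (real n)" using rn by (subst ln_le_cancel_iff) auto
          then have "real k * ln 2 \<le> ln (real n)" by (simp add: ln_realpow)
          then have "real k + 1 \<le> ln (real n) / ln 2 + 1" by (simp add: pos_le_divide_eq)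
          also have "\<dots> \<le> exp 1 * ln (real n)" using elim(1) by simp
          finally have "ln (real k + 1) \<le> ln (exp 1 * ln (real n))" using elim(1) by (subst ln_le_cancel_iff) auto
          also have "\<dots> = 1 + ln (ln (real n))" using elim(1) by (subst ln_mult) auto
          finally show ?thesis .
        qed
        have lln: "0 \<le> ln (ln (real n))" using elim(1) by simp
        show ?case
        proof (intro allI impI)
          fix j l :: nat assume j: "real n powr (- (1 - 2 / lam)) \<le> 1 / 2 ^ j" and l: "l < 2 ^ j"
          define L where "L = 1 + real j + ln (ln (real n))"
          have L1: "1 \<le> L" unfolding L_def using lln by simp
          have qL: "q k j \<le> 2 * L" unfolding q_def L_def using lnq lln by simp
          have jn: "2 ^ j \<le> real n powr \<beta>"
          proof -
            have "1 / real n powr \<beta> \<le> 1 / 2 ^ j" using j unfolding \<beta>_def[symmetric] by (simp add: powr_minus_divide)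
            then show ?thesis using rn by (simp add: field_simps)
          qed
          have nk: "real n \<le> 2 powr (real k + 1)"
          proof -
            have "real n \<le> real (2 ^ Suc k)" using k(2) by (simp only: of_nat_le_iff)
            then show ?thesis by (simp add: powr_add powr_realpow)
          qed
          have j2: "2 ^ j \<le> 2 powr ((real k + 1) * \<beta>)"
          proof -
            have "real n powr \<beta> \<le> (2 powr (real k + 1)) powr \<beta>" using nk \<beta> rn by (intro powr_mono2) auto
            then show ?thesis using jn by (simp add: powr_powr)
          qed
          have jk: "j \<le> Suc k"
          proof -
            have "(2::real) powr real j \<le> 2 powr ((real k + 1) * \<beta>)" using j2 by (simp add: powr_realpow)
            then have "real j \<le> (real k + 1) * \<beta>" by simp
            also have "\<dots> \<le> (real k + 1) * 1" using \<beta> by (intro mult_left_mono) auto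
            finally show ?thesis by simp
          qed
          have cnd: "cond k j"
          proof -
            have lnk: "ln (real k + 1) \<le> real k" using ln_add_one_self_le_self[of "real k"] by (simp add: add.commute)
            have qk: "q k j \<le> 2 * real k + 3" unfolding q_def using jk lnk by simp
            have NN: "real (N k) = 2 powr (real k + 1)" unfolding N_def by (simp add: powr_add powr_realpow)
            have "(\<theta> k j * (2 * \<tau> k))\<^sup>2 = 4 * q k j * (2 ^ j / real (N k)) * (\<tau> k)\<^sup>2"
              by (simp add: power_mult_distrib \<theta>2)
            also have "\<dots> \<le> 4 * (2 * real k + 3) * 2 powr (real k * (\<beta> - 1)) * (\<tau> k)\<^sup>2"
            proof (intro mult_right_mono mult_mono)
              have "2 ^ j / real (N k) \<le> 2 powr ((real k + 1) * \<beta>) / 2 powr (real k + 1)"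
                unfolding NN using j2 by (intro divide_right_mono) auto
              also have "\<dots> = 2 powr ((real k + 1) * (\<beta> - 1))" by (simp add: powr_diff[symmetric] algebra_simps)
              also have "\<dots> \<le> 2 powr (real k * (\<beta> - 1))"
              proof -
                have "(real k + 1) * (\<beta> - 1) \<le> real k * (\<beta> - 1)" using \<beta> by (intro mult_right_mono_neg) auto
                then show ?thesis by simp
              qed
              finally show "2 ^ j / real (N k) \<le> 2 powr (real k * (\<beta> - 1))" .
            qed (use qk q1[of k j] in auto)
            also have "\<dots> = 4 * (2 * real k + 3) * 2 powr (- (real k * \<epsilon>))"
            proof -
              have "2 powr (real k * (\<beta> - 1)) * (\<tau> k)\<^sup>2 = 2 powr (real k * (\<beta> - 1) + (real k * \<rho> + real k * \<rho>))"
                unfolding \<tau>_def power2_eq_square powr_add ..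
              also have "real k * (\<beta> - 1) + (real k * \<rho> + real k * \<rho>) = - (real k * \<epsilon>)"
                unfolding \<beta>_def \<epsilon>_def by (simp add: algebra_simps)
              finally show ?thesis by simp
            qed
            also have "\<dots> \<le> 1" using K by (simp add: powr_minus_divide)
            finally have "(\<theta> k j * (2 * \<tau> k))\<^sup>2 \<le> 1" .
            then show ?thesis unfolding cond_def using abs_square_le_1 abs_le_D1 by blast
          qed
          have "\<omega> \<in> space M - Ef k j l" using K jk l unfolding EE_def by auto
          then have "Good k j l \<omega>" using Ef[OF l, of k] cnd unfolding Q_def by blast
          then have G: "(\<theta> k j)\<^sup>2 * (ms \<omega> n (lo j l) (hi j l) - real n * ct k (lo j l) (hi j l))\<^sup>2 \<le> 4 * (\<alpha> k j)\<^sup>2 + 16"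
             "(\<theta> k j)\<^sup>2 * integral {lo j l..hi j l} (\<lambda>x. (ms \<omega> n (lo j l) x - real n * ct k (lo j l) x)\<^sup>2) \<le> (1 / 2 ^ j) * (4 * (\<alpha> k j)\<^sup>2 + 16)"
            using K nN lohi(4)[OF l] unfolding Good_def by auto
          define V where "V = real n * (1 / 2 ^ j) * L"
          have V0: "0 \<le> V" unfolding V_def using L1 by simp
          \<comment> \<open>Divides out the square of \<theta>: one of the two factors
            \<open>q\<close> cancels, the other is at most \<open>2 * L\<close>, and
            \<open>N k\<close> is at most \<open>2 * n\<close>; hence the 4.\<close>
          have red: "y \<le> s * (4 * K0 * V)" if y: "(\<theta> k j)\<^sup>2 * y \<le> s * (4 * (\<alpha> k j)\<^sup>2 + 16)" and s: "0 \<le> s" for y s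
          proof -
            have qp: "q k j > 0" using q1[of k j] by simp
            have "4 * (\<alpha> k j)\<^sup>2 + 16 \<le> K0 * (q k j)\<^sup>2"
            proof -
              have "16 * 1 \<le> 16 * (q k j)\<^sup>2" using q1[of k j] by (intro mult_left_mono one_le_power) auto
              then show ?thesis unfolding \<alpha>_def K0_def power_mult_distrib by (simp add: distrib_right)
            qed
            then have "(\<theta> k j)\<^sup>2 * y \<le> s * (K0 * (q k j)\<^sup>2)" using y s by (meson mult_left_mono order_trans)
            then have "q k j * (2 ^ j * y) \<le> q k j * (s * K0 * q k j * real (N k))"
              unfolding \<theta>2 by (simp add: N_def field_simps power2_eq_square)
            then have "2 ^ j * y \<le> s * K0 * (q k j * real (N k))" using qp by (simp add: mult.assoc)
            also have "\<dots> \<le> s * K0 * ((2 * L) * (2 * real n))"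
              using s K0 qL nN(2) L1 by (intro mult_left_mono mult_mono) auto
            finally show ?thesis unfolding V_def by (simp add: field_simps)
          qed
          have G1: "(ms \<omega> n (lo j l) (hi j l) - real n * ct k (lo j l) (hi j l))\<^sup>2 \<le> 4 * K0 * V"
            using red[of _ 1] G(1) by simp
          have G2: "integral {lo j l..hi j l} (\<lambda>x. (ms \<omega> n (lo j l) x - real n * ct k (lo j l) x)\<^sup>2) \<le> (1 / 2 ^ j) * (4 * K0 * V)"
            by (rule red[OF G(2)]) simp
          \<comment> \<open>Multiplied by \<open>2 ^ j / n\<close>, the squared bias
            \<open>n\<^sup>2 * (\<tau> k) powr (2 - 2 * \<kappa>)\<close> is bounded: the
            coefficient of \<open>k\<close> in the exponent is
            \<open>2 * (\<rho> - 1 / lam) + 2 * (1 - \<rho> * \<kappa>)\<close>, negative by both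
            constraints on \<rho>. The left-over exponent \<open>1 + \<beta> \<le> 2\<close> gives
            the 4.\<close>
          have bias: "(real n * (ct k (lo j l) x - c (lo j l) x))\<^sup>2 \<le> 4 * B\<^sup>2 * V" for x
          proof -
            have \<kappa>1: "1 \<le> \<kappa>" using lam by simp
            have "\<bar>ct k (lo j l) x - c (lo j l) x\<bar> \<le> \<tau> k powr (1 - \<kappa>) * B"
              unfolding ct_def c by (rule truncation_bias[OF XD1(2,1) \<kappa>1 mom momB \<tau> Di])
            then have "(ct k (lo j l) x - c (lo j l) x)\<^sup>2 \<le> (\<tau> k powr (1 - \<kappa>) * B)\<^sup>2"
              using B abs_le_square_iff[of "ct k (lo j l) x - c (lo j l) x" "\<tau> k powr (1 - \<kappa>) * B"] by simp
            then have "(real n * (ct k (lo j l) x - c (lo j l) x))\<^sup>2 \<le> (real n)\<^sup>2 * ((\<tau> k powr (1 - \<kappa>))\<^sup>2 * B\<^sup>2)"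
              unfolding power_mult_distrib by (intro mult_left_mono) auto
            also have "\<dots> = (real n * (1 / 2 ^ j)) * B\<^sup>2 * (real n * (\<tau> k powr (1 - \<kappa>))\<^sup>2 * 2 ^ j)"
              by (simp add: power2_eq_square)
            also have "\<dots> \<le> (real n * (1 / 2 ^ j)) * B\<^sup>2 * 4"
            proof (intro mult_left_mono)
              have t: "(\<tau> k powr (1 - \<kappa>))\<^sup>2 = 2 powr (real k * \<rho> * (2 - 2 * \<kappa>))"
                unfolding \<tau>_def powr_powr by (simp add: power2_eq_square powr_add[symmetric] algebra_simps)
              have "real n * (\<tau> k powr (1 - \<kappa>))\<^sup>2 * 2 ^ j \<le> 2 powr (real k + 1) * 2 powr (real k * \<rho> * (2 - 2 * \<kappa>)) * 2 powr ((real k + 1) * \<beta>)"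
                unfolding t using nk j2 by (intro mult_mono) auto
              also have "\<dots> = 2 powr (real k * (1 + \<beta> + \<rho> * (2 - 2 * \<kappa>)) + (1 + \<beta>))"
                by (simp add: powr_add[symmetric] algebra_simps)
              also have "\<dots> \<le> 2 powr 2"
              proof -
                have "1 + \<beta> + \<rho> * (2 - 2 * \<kappa>) = 2 * (\<rho> - 1 / lam) + 2 * (1 - \<rho> * \<kappa>)" unfolding \<beta>_def by (simp add: algebra_simps)
                also have "\<dots> \<le> 0"
                proof -
                  have "2 * (x - y) + 2 * (1 - z) \<le> 0" if "x < y" "1 < z" for x y z :: real using that by simp
                  from this[OF \<rho>(2) \<rho>\<kappa>] show ?thesis .
                qed
                finally have "real k * (1 + \<beta> + \<rho> * (2 - 2 * \<kappa>)) \<le> 0" by (simp add: mult_nonneg_nonpos)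
                then show ?thesis using \<beta> by (intro powr_mono) linarith+
              qed
              finally show "real n * (\<tau> k powr (1 - \<kappa>))\<^sup>2 * 2 ^ j \<le> 4" by simp
            qed auto
            also have "\<dots> \<le> (real n * (1 / 2 ^ j)) * B\<^sup>2 * 4 * L" 
            proof -
              have "0 \<le> (real n * (1 / 2 ^ j)) * B\<^sup>2 * 4" by simp
              from mult_left_mono[OF L1 this] show ?thesis by simp
            qed
            finally show ?thesis unfolding V_def by (simp add: mult_ac)
          qed
          have dec: "ms \<omega> n a x - real n * c a x = (ms \<omega> n a x - real n * ct k a x) + real n * (ct k a x - c a x)" for a x
            by (simp add: algebra_simps)
          have F1: "(ms \<omega> n (lo j l) (hi j l) - real n * c (lo j l) (hi j l))\<^sup>2 \<le> C * V"
          proof -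
            have "(ms \<omega> n (lo j l) (hi j l) - real n * c (lo j l) (hi j l))\<^sup>2 \<le> 2 * (4 * K0 * V) + 2 * (4 * B\<^sup>2 * V)"
              unfolding dec[of "lo j l" "hi j l"] by (rule order_trans[OF square_sum_le]) (intro add_mono mult_left_mono G1 bias; simp)
            then show ?thesis unfolding C_def by (simp add: algebra_simps)
          qed
          have F2: "integral {lo j l..hi j l} (\<lambda>x. (ms \<omega> n (lo j l) x - real n * c (lo j l) x)\<^sup>2) \<le> 1 / 2 ^ j * (C * V)"
          proof -
            have tri: "integrable M (\<lambda>\<omega>. if \<bar>D 1 \<omega>\<bar> \<le> \<tau> k then D 1 \<omega> else 0)"
            proof (rule Bochner_Integration.integrable_bound[OF Di])
              show "(\<lambda>\<omega>. if \<bar>D 1 \<omega>\<bar> \<le> \<tau> k then D 1 \<omega> else 0) \<in> borel_measurable M" by measurable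
            qed auto
            have Lc: "L2_01 (c (lo j l))" unfolding c[abs_def] by (rule expectation_cut_L2[OF XD1(1) Di])
            have Lct: "L2_01 (ct k (lo j l))" unfolding ct_def[abs_def] by (rule expectation_cut_L2[OF XD1(1) tri])
            have "integral {lo j l..hi j l} (\<lambda>x. (ms \<omega> n (lo j l) x - real n * c (lo j l) x)\<^sup>2) \<le>
              2 * integral {lo j l..hi j l} (\<lambda>x. (ms \<omega> n (lo j l) x - real n * ct k (lo j l) x)\<^sup>2) + 2 * (4 * B\<^sup>2 * V) * (hi j l - lo j l)"
              unfolding dec[of "lo j l"]
            proof (rule integral_square_add_le)
              show "L2_01 (\<lambda>x. ms \<omega> n (lo j l) x - real n * ct k (lo j l) x)"
                unfolding ms_def by (rule L2_01_diff[OF mark_sum_L2 L2_01_cmult[OF Lct]])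
              show "L2_01 (\<lambda>x. real n * (ct k (lo j l) x - c (lo j l) x))"
                by (rule L2_01_cmult[OF L2_01_diff[OF Lct Lc]])
              show "0 \<le> lo j l" "lo j l \<le> hi j l" "hi j l \<le> 1" using lohi[OF l] by simp_all
            qed (rule bias)
            also have "\<dots> \<le> 2 * ((1 / 2 ^ j) * (4 * K0 * V)) + 2 * (4 * B\<^sup>2 * V) * (1 / 2 ^ j)"
              using G2 lohi(4)[OF l] by simp
            finally show ?thesis unfolding C_def by (simp add: algebra_simps)
          qed
          show "(mark_sum (\<lambda>i. X i \<omega>) (\<lambda>i. D i \<omega>) n (real l / 2 ^ j) (real (Suc l) / 2 ^ j) - real n * c (real l / 2 ^ j) (real (Suc l) / 2 ^ j))\<^sup>2
             \<le> C * (real n * (1 / 2 ^ j) * (1 + real j + ln (ln (real n)))) \<and>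
           integral {real l / 2 ^ j..real (Suc l) / 2 ^ j} (\<lambda>x. (mark_sum (\<lambda>i. X i \<omega>) (\<lambda>i. D i \<omega>) n (real l / 2 ^ j) x - real n * c (real l / 2 ^ j) x)\<^sup>2)
             \<le> 1 / 2 ^ j * (C * (real n * (1 / 2 ^ j) * (1 + real j + ln (ln (real n)))))"
            using F1 F2 unfolding V_def L_def lo_def hi_def ms_def by (rule conjI)
        qed
      qed
    qed
  qed
qed

end

section \<open>Localized energy estimate for the spline\<close>

text \<open>The i-th derivative of 1 / cosh is this polynomial in tanh, divided by cosh. The
  recursion uses that tanh has derivative 1 - tanh^2, encoded by \<open>[:1, 0, -1:]\<close>, and 1
  / cosh has derivative - tanh / cosh.\<close>

primrec sech_poly :: "nat \<Rightarrow> real poly" where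
  "sech_poly 0 = 1"
| "sech_poly (Suc i) = [:1, 0, -1:] * pderiv (sech_poly i) - [:0, 1:] * sech_poly i"

text \<open>The \<open>i\<close>-th derivative of \<open>1 / cosh (c (x - t) / \<delta>)\<close>.\<close>

definition sech_weight :: "real \<Rightarrow> real \<Rightarrow> real \<Rightarrow> nat \<Rightarrow> real \<Rightarrow> real" where
  "sech_weight c t \<delta> i x = (c / \<delta>) ^ i * (poly (sech_poly i) (tanh (c * (x - t) / \<delta>)) / cosh (c * (x - t) / \<delta>))"

lemma sech_weight_0: "sech_weight c t \<delta> 0 x = 1 / cosh (c * (x - t) / \<delta>)"
  by (simp add: sech_weight_def)

lemma sech_poly_deriv:
  "((\<lambda>u. poly (sech_poly i) (tanh u) / cosh u) has_real_derivative poly (sech_poly (Suc i)) (tanh u) / cosh u) (at u)"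
proof -
  have c: "cosh u \<noteq> 0" by simp
  have p: "((\<lambda>u. poly (sech_poly i) (tanh u)) has_real_derivative poly (pderiv (sech_poly i)) (tanh u) * (1 - (tanh u)\<^sup>2)) (at u)"
    by (rule DERIV_chain2[OF poly_DERIV]) (auto intro!: derivative_eq_intros)
  have "((\<lambda>u. poly (sech_poly i) (tanh u) / cosh u) has_real_derivative
     (poly (pderiv (sech_poly i)) (tanh u) * (1 - (tanh u)\<^sup>2) * cosh u - poly (sech_poly i) (tanh u) * sinh u) / (cosh u * cosh u)) (at u)"
  proof (rule DERIV_divide)
    show "(cosh has_real_derivative sinh u) (at u)" by (auto intro!: derivative_eq_intros)
  qed (rule p c)+
  also have "(poly (pderiv (sech_poly i)) (tanh u) * (1 - (tanh u)\<^sup>2) * cosh u - poly (sech_poly i) (tanh u) * sinh u) / (cosh u * cosh u) =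
     poly (sech_poly (Suc i)) (tanh u) / cosh u"
  proof -
    have "sinh u = tanh u * cosh u" unfolding tanh_def by simp
    then have num: "poly (pderiv (sech_poly i)) (tanh u) * (1 - (tanh u)\<^sup>2) * cosh u - poly (sech_poly i) (tanh u) * sinh u =
      (poly (pderiv (sech_poly i)) (tanh u) * (1 - (tanh u)\<^sup>2) - poly (sech_poly i) (tanh u) * tanh u) * cosh u"
      by (simp add: algebra_simps)
    have suc: "poly (sech_poly (Suc i)) (tanh u) = poly (pderiv (sech_poly i)) (tanh u) * (1 - (tanh u)\<^sup>2) - poly (sech_poly i) (tanh u) * tanh u"
      by (simp add: algebra_simps power2_eq_square)
    show ?thesis unfolding num suc using c by simp
  qed
  finally show ?thesis .
qed

lemma sech_weight_deriv:
  "(sech_weight c t \<delta> i has_real_derivative sech_weight c t \<delta> (Suc i) x) (at x)"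
proof -
  have a: "((\<lambda>x. c * (x - t) / \<delta>) has_real_derivative c / \<delta>) (at x)"
    by (auto intro!: derivative_eq_intros simp: divide_inverse)
  have "((\<lambda>x. (c / \<delta>) ^ i * (poly (sech_poly i) (tanh (c * (x - t) / \<delta>)) / cosh (c * (x - t) / \<delta>))) has_real_derivative
     (c / \<delta>) ^ i * (poly (sech_poly (Suc i)) (tanh (c * (x - t) / \<delta>)) / cosh (c * (x - t) / \<delta>) * (c / \<delta>))) (at x)"
    by (intro DERIV_cmult DERIV_chain2[OF sech_poly_deriv a])
  then show ?thesis unfolding sech_weight_def[abs_def] by (simp add: mult_ac del: sech_poly.simps)
qed

text \<open>\<open>tanh\<close> stays in [-1,1], where the finitely many polynomials involved are
  bounded. By Gronwall's inequality no nonzero bump of compact support satisfies such a bound, which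
  is the reason for choosing sech.\<close>

lemma abs_sech_weight_le:
  "\<exists>A\<ge>1. \<forall>i\<le>m. \<forall>c t \<delta> x. 0 < c \<longrightarrow> 0 < \<delta> \<longrightarrow> \<bar>sech_weight c t \<delta> i x\<bar> \<le> sech_weight c t \<delta> 0 x * A * (c / \<delta>) ^ i"
proof -
  have "\<exists>B. \<forall>y\<in>{-1..1}. \<bar>poly (sech_poly i) y\<bar> \<le> B" for i
  proof -
    have "continuous_on {-1..1} (poly (sech_poly i))" by (intro continuous_intros)
    from compact_continuous_image[OF this compact_Icc, THEN compact_imp_bounded] show ?thesis
      unfolding bounded_iff by auto
  qed
  then obtain B where B: "\<And>i. \<forall>y\<in>{-1..1}. \<bar>poly (sech_poly i) y\<bar> \<le> B i" by metis
  define A where "A = 1 + (\<Sum>i\<le>m. \<bar>B i\<bar>)"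
  show ?thesis
  proof (intro exI[of _ A] conjI allI impI)
    show "1 \<le> A" unfolding A_def by (simp add: sum_nonneg)
    fix i and c t \<delta> x :: real assume i: "i \<le> m" and c: "0 < c" "0 < \<delta>"
    define u where "u = c * (x - t) / \<delta>"
    have "tanh u \<in> {-1..1}" using tanh_real_bounds[of u] by auto
    then have "\<bar>poly (sech_poly i) (tanh u)\<bar> \<le> B i" using B by blast
    also have "\<dots> \<le> \<bar>B i\<bar>" by simp
    also have "\<dots> \<le> (\<Sum>i\<le>m. \<bar>B i\<bar>)" using i by (intro member_le_sum) auto
    finally have "\<bar>poly (sech_poly i) (tanh u)\<bar> \<le> A" unfolding A_def by simp
    then have "(c / \<delta>) ^ i * (\<bar>poly (sech_poly i) (tanh u)\<bar> / cosh u) \<le> (c / \<delta>) ^ i * (A / cosh u)"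
      using c by (intro mult_left_mono divide_right_mono) auto
    moreover have "\<bar>(c / \<delta>) ^ i * (poly (sech_poly i) (tanh u) / cosh u)\<bar> = (c / \<delta>) ^ i * (\<bar>poly (sech_poly i) (tanh u)\<bar> / cosh u)"
      using c by (simp add: abs_mult)
    ultimately show "\<bar>sech_weight c t \<delta> i x\<bar> \<le> sech_weight c t \<delta> 0 x * A * (c / \<delta>) ^ i"
      unfolding sech_weight_0 unfolding sech_weight_def u_def[symmetric] by (simp add: mult_ac)
  qed
qed

lemma cosh_le_exp_mult: "cosh v \<le> exp \<bar>v - u\<bar> * cosh (u::real)"
proof -
  have "exp v = exp (v - u) * exp u" by (simp add: exp_diff)
  also have "\<dots> \<le> exp \<bar>v - u\<bar> * exp u" by (intro mult_right_mono) auto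
  finally have 1: "exp v \<le> exp \<bar>v - u\<bar> * exp u" .
  have "exp (-v) = exp (u - v) * exp (-u)" by (simp add: exp_add[symmetric])
  also have "\<dots> \<le> exp \<bar>v - u\<bar> * exp (-u)" by (intro mult_right_mono) auto
  finally have 2: "exp (-v) \<le> exp \<bar>v - u\<bar> * exp (-u)" .
  show ?thesis using 1 2 unfolding cosh_def by (simp add: field_simps)
qed

text \<open>Moving by at most \<delta> changes the argument of cosh by at most
  \<open>c \<le> 1\<close>, hence cosh by at most a factor e, which is below 3.\<close>

lemma slow_weight_sech:
  assumes "0 < c" "c \<le> 1" "0 < \<delta>"
  shows "slow_weight \<delta> (sech_weight c t \<delta> 0)"
  unfolding slow_weight_def
proof (intro conjI ballI impI)
  show "continuous_on {0..1} (sech_weight c t \<delta> 0)"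
    by (intro continuous_at_imp_continuous_on ballI DERIV_isCont[OF sech_weight_deriv])
  show "0 \<le> sech_weight c t \<delta> 0 x" for x by (simp add: sech_weight_0)
  fix x y :: real assume xy: "\<bar>x - y\<bar> \<le> \<delta>"
  define u v where "u = c * (x - t) / \<delta>" and "v = c * (y - t) / \<delta>"
  have "v - u = c * ((y - x) / \<delta>)" 
    unfolding u_def v_def diff_divide_distrib[symmetric] by (simp add: algebra_simps)
  then have "\<bar>v - u\<bar> = c * (\<bar>y - x\<bar> / \<delta>)" using assms by (simp add: abs_mult)
  also have "\<dots> \<le> 1 * 1" using assms xy by (intro mult_mono) (auto simp: abs_minus_commute)
  finally have "exp \<bar>v - u\<bar> \<le> exp 1" by simp
  then have "exp \<bar>v - u\<bar> \<le> 3" using exp_le by linarith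
  then have "exp \<bar>v - u\<bar> * cosh u \<le> 3 * cosh u" by (rule mult_right_mono) simp
  then have "cosh v \<le> 3 * cosh u" using cosh_le_exp_mult[of v u] by linarith
  then show "sech_weight c t \<delta> 0 x \<le> 3 * sech_weight c t \<delta> 0 y"
    unfolding sech_weight_0 u_def[symmetric] v_def[symmetric] by (simp add: field_simps)
qed

text \<open>\<open>arctan (sinh u)\<close> is a primitive of \<open>1 / cosh u\<close> and increases
  by at most \<pi> in total, rounded up to 4. The bound is uniform in the centre
  \<open>t\<close>.\<close>

lemma integral_sech_weight_le:
  assumes "0 < c" "0 < \<delta>"
  shows "integral {0..1} (sech_weight c t \<delta> 0) \<le> 4 / c * \<delta>"
proof -
  define F where "F x = \<delta> / c * arctan (sinh (c * (x - t) / \<delta>))" for x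
  have d: "(F has_real_derivative sech_weight c t \<delta> 0 x) (at x)" for x
  proof -
    have "(F has_real_derivative \<delta> / c * (inverse (1 + (sinh (c * (x - t) / \<delta>))\<^sup>2) * (cosh (c * (x - t) / \<delta>) * (c / \<delta>)))) (at x)"
      unfolding F_def by (auto intro!: derivative_eq_intros simp: divide_inverse)
    also have "\<delta> / c * (inverse (1 + (sinh (c * (x - t) / \<delta>))\<^sup>2) * (cosh (c * (x - t) / \<delta>) * (c / \<delta>))) = sech_weight c t \<delta> 0 x"
      using assms unfolding sech_weight_0 cosh_square_eq[of "c * (x - t) / \<delta>", symmetric, simplified add.commute]
      by (simp add: field_simps power2_eq_square)
    finally show ?thesis .
  qed
  have "(sech_weight c t \<delta> 0 has_integral F 1 - F 0) {0..1}"
  proof (rule fundamental_theorem_of_calculus)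
    show "(F has_vector_derivative sech_weight c t \<delta> 0 x) (at x within {0..1})" for x
      by (rule has_vector_derivative_at_within[OF d[unfolded has_real_derivative_iff_has_vector_derivative]])
  qed simp
  then have "integral {0..1} (sech_weight c t \<delta> 0) = F 1 - F 0" by (rule integral_unique)
  also have "\<dots> = \<delta> / c * (arctan (sinh (c * (1 - t) / \<delta>)) - arctan (sinh (c * (0 - t) / \<delta>)))"
    unfolding F_def by (simp add: algebra_simps)
  also have "\<dots> \<le> \<delta> / c * 4"
  proof (rule mult_left_mono)
    show "arctan (sinh (c * (1 - t) / \<delta>)) - arctan (sinh (c * (0 - t) / \<delta>)) \<le> 4"
      using arctan_bounded[of "sinh (c * (1 - t) / \<delta>)"] arctan_bounded[of "sinh (c * (0 - t) / \<delta>)"] pi_less_4 by linarith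
  qed (use assms in auto)
  finally show ?thesis by (simp add: mult_ac)
qed

section \<open>The variational equation of the spline\<close>

lemma linear_coeff_zero_of_quadratic_nonneg:
  assumes "\<And>s::real. 0 \<le> 2 * L * s + Q * s\<^sup>2"
  shows "L = 0"
proof (rule ccontr)
  assume L: "L \<noteq> 0"
  define q where "q = 1 + \<bar>Q\<bar>"
  have q: "q > 0" "Q \<le> q" unfolding q_def by auto
  define s where "s = - L / q"
  have "Q * s\<^sup>2 \<le> q * s\<^sup>2" by (intro mult_right_mono q) auto
  also have "\<dots> = L\<^sup>2 / q" unfolding s_def using q by (simp add: power_divide power2_eq_square)
  finally have "0 \<le> 2 * L * s + L\<^sup>2 / q" using assms[of s] by simp
  also have "\<dots> = - (L\<^sup>2 / q)" unfolding s_def by (simp add: power2_eq_square)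
  finally show False using L q by (simp add: zero_le_divide_iff divide_le_0_iff)
qed

text \<open>Adding \<open>s\<close> times \<open>G 0\<close> to \<open>f\<close> gives an admissible
  competitor, and along this line the objective is a quadratic polynomial in \<open>s\<close> that
  is minimal at 0; its linear coefficient vanishes.\<close>

lemma spline_euler_lagrange:
  assumes f: "is_smoothing_spline m n h x y f" and m: "m \<ge> 1" and G: "sobolev_jet m G"
    and x: "\<And>i. i \<in> {1..n} \<Longrightarrow> x i \<in> {0..1}"
  shows "1 / real n * (\<Sum>i=1..n. (f (x i) - y i) * G 0 (x i)) + h ^ (2 * m) * integral {0..1} (\<lambda>t. nderiv m f t * G m t) = 0"
proof -
  have fs: "f \<in> sobolev m 2" using f unfolding is_smoothing_spline_def by simp
  note jf = sobolev_imp_jet[OF fs m]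
  have Lf: "L2_01 (nderiv m f)" and LG: "L2_01 (G m)" using sobolev_jet_L2[OF jf, of m] sobolev_jet_L2[OF G, of m] by auto
  have i1: "(\<lambda>t. (nderiv m f t)\<^sup>2) integrable_on {0..1}" and i2: "(\<lambda>t. nderiv m f t * G m t) integrable_on {0..1}"
    and i3: "(\<lambda>t. (G m t)\<^sup>2) integrable_on {0..1}"
    using Lf LG L2_01_prod_integrable[OF Lf LG] unfolding L2_01_def by auto
  define S1 where "S1 = (\<Sum>i=1..n. (f (x i) - y i) * G 0 (x i))"
  define S2 where "S2 = (\<Sum>i=1..n. (G 0 (x i))\<^sup>2)"
  define I1 where "I1 = integral {0..1} (\<lambda>t. nderiv m f t * G m t)"
  define I2 where "I2 = integral {0..1} (\<lambda>t. (G m t)\<^sup>2)"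
  have "0 \<le> 2 * (1 / real n * S1 + h ^ (2 * m) * I1) * s + (1 / real n * S2 + h ^ (2 * m) * I2) * s\<^sup>2" for s
  proof -
    define F where "F t = f t + s * G 0 t" for t
    have jF: "sobolev_jet m (\<lambda>j t. nderiv j f t + s * G j t)" by (rule sobolev_jet_lincomb[OF jf G])
    have F: "F \<in> sobolev m 2" "(L2_norm (nderiv m F))\<^sup>2 = integral {0..1} (\<lambda>t. (nderiv m f t + s * G m t)\<^sup>2)"
      by (rule jet_imp_sobolev[OF jF m], simp add: F_def)+
    have nf: "(L2_norm (nderiv m f))\<^sup>2 = integral {0..1} (\<lambda>t. (nderiv m f t)\<^sup>2)"
      by (rule jet_imp_sobolev(2)[OF jf m]) simp
    have "((\<lambda>t. ((nderiv m f t)\<^sup>2 + (2 * s) * (nderiv m f t * G m t)) + s\<^sup>2 * (G m t)\<^sup>2) has_integral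
       ((integral {0..1} (\<lambda>t. (nderiv m f t)\<^sup>2) + (2 * s) * I1) + s\<^sup>2 * I2)) {0..1}"
      unfolding I1_def I2_def by (intro has_integral_add has_integral_mult_right integrable_integral i1 i2 i3)
    then have "((\<lambda>t. (nderiv m f t + s * G m t)\<^sup>2) has_integral
       ((integral {0..1} (\<lambda>t. (nderiv m f t)\<^sup>2) + (2 * s) * I1) + s\<^sup>2 * I2)) {0..1}"
      by (rule has_integral_eq[rotated]) (simp add: power2_sum power_mult_distrib algebra_simps)
    then have NF: "(L2_norm (nderiv m F))\<^sup>2 = (L2_norm (nderiv m f))\<^sup>2 + 2 * s * I1 + s\<^sup>2 * I2"
      unfolding F(2) nf by (simp add: integral_unique)
    have SF: "(\<Sum>i=1..n. \<bar>F (x i) - y i\<bar>\<^sup>2) = (\<Sum>i=1..n. \<bar>f (x i) - y i\<bar>\<^sup>2) + 2 * s * S1 + s\<^sup>2 * S2"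
      unfolding S1_def S2_def sum_distrib_left sum.distrib[symmetric]
      by (intro sum.cong refl) (simp add: F_def power2_eq_square algebra_simps)
    have "spline_objective m n h x y f \<le> spline_objective m n h x y F"
      using f F(1) unfolding is_smoothing_spline_def by blast
    then show ?thesis unfolding spline_objective_def NF SF by (simp add: algebra_simps)
  qed
  then show ?thesis unfolding S1_def I1_def by (rule linear_coeff_zero_of_quadratic_nonneg)
qed


text \<open>Multiplication by \<open>\<delta> ^ m\<close> turns
  \<open>(c / \<delta>) ^ (m - j)\<close> into \<open>c ^ (m - j) * \<delta> ^ j\<close>. For
  \<open>j < m\<close> at least one factor \<open>c\<close> survives, and this is the smallness of
  the commutator.\<close>

lemma leibniz_remainder_bound:
  assumes P: "\<And>i. i \<le> m \<Longrightarrow> \<bar>p i x\<bar> \<le> p 0 x * A * (c / \<delta>) ^ i" and p0: "0 \<le> p 0 x" and A: "1 \<le> A" and c: "0 < c" "c \<le> 1" and \<delta>: "0 < \<delta>"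
  shows "\<delta> ^ m * \<bar>leibniz m p d x - p 0 x * d m x\<bar> \<le> p 0 x * A * 2 ^ m * c * (\<Sum>j<m. \<delta> ^ j * \<bar>d j x\<bar>)"
    and "\<delta> ^ m * \<bar>leibniz m p d x\<bar> \<le> p 0 x * A * 2 ^ m * (\<Sum>j\<le>m. \<delta> ^ j * \<bar>d j x\<bar>)"
proof -
  have pA: "0 \<le> p 0 x * A" using p0 A by simp
  have cd: "0 \<le> c / \<delta>" using c \<delta> by simp
  have sc: "\<delta> ^ m * (c / \<delta>) ^ (m - j) = c ^ (m - j) * \<delta> ^ j" if "j \<le> m" for j
  proof -
    have "\<delta> ^ m = \<delta> ^ (m - j) * \<delta> ^ j" using that by (simp add: power_add[symmetric])
    then show ?thesis using \<delta> by (simp add: power_divide)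
  qed
  have "\<delta> ^ m * \<bar>leibniz m p d x - p 0 x * d m x\<bar> \<le> \<delta> ^ m * (p 0 x * A * 2 ^ m * (\<Sum>j<m. (c / \<delta>) ^ (m - j) * \<bar>d j x\<bar>))"
    using \<delta> by (intro mult_left_mono abs_leibniz_diff_le P pA cd) auto
  also have "\<dots> = p 0 x * A * 2 ^ m * (\<Sum>j<m. (\<delta> ^ m * (c / \<delta>) ^ (m - j)) * \<bar>d j x\<bar>)"
    by (simp add: sum_distrib_left mult_ac)
  also have "(\<Sum>j<m. (\<delta> ^ m * (c / \<delta>) ^ (m - j)) * \<bar>d j x\<bar>) = (\<Sum>j<m. c ^ (m - j) * (\<delta> ^ j * \<bar>d j x\<bar>))"
    by (rule sum.cong[OF refl]) (use sc in auto)
  also have "p 0 x * A * 2 ^ m * (\<Sum>j<m. c ^ (m - j) * (\<delta> ^ j * \<bar>d j x\<bar>)) \<le> p 0 x * A * 2 ^ m * (\<Sum>j<m. c * (\<delta> ^ j * \<bar>d j x\<bar>))"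
  proof (intro mult_left_mono sum_mono mult_right_mono)
    fix j assume "j \<in> {..<m}"
    then have "c ^ (m - j) \<le> c ^ 1" using c by (intro power_decreasing) auto
    then show "c ^ (m - j) \<le> c" by simp
  qed (use pA \<delta> in auto)
  also have "\<dots> = p 0 x * A * 2 ^ m * c * (\<Sum>j<m. \<delta> ^ j * \<bar>d j x\<bar>)" by (simp add: sum_distrib_left mult_ac)
  finally show "\<delta> ^ m * \<bar>leibniz m p d x - p 0 x * d m x\<bar> \<le> p 0 x * A * 2 ^ m * c * (\<Sum>j<m. \<delta> ^ j * \<bar>d j x\<bar>)" .
  have "\<delta> ^ m * \<bar>leibniz m p d x\<bar> \<le> \<delta> ^ m * (p 0 x * A * 2 ^ m * (\<Sum>j\<le>m. (c / \<delta>) ^ (m - j) * \<bar>d j x\<bar>))"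
    using \<delta> by (intro mult_left_mono abs_leibniz_le P pA cd) auto
  also have "\<dots> = p 0 x * A * 2 ^ m * (\<Sum>j\<le>m. (\<delta> ^ m * (c / \<delta>) ^ (m - j)) * \<bar>d j x\<bar>)"
    by (simp add: sum_distrib_left mult_ac)
  also have "(\<Sum>j\<le>m. (\<delta> ^ m * (c / \<delta>) ^ (m - j)) * \<bar>d j x\<bar>) = (\<Sum>j\<le>m. c ^ (m - j) * (\<delta> ^ j * \<bar>d j x\<bar>))"
    by (rule sum.cong[OF refl]) (use sc in auto)
  also have "p 0 x * A * 2 ^ m * (\<Sum>j\<le>m. c ^ (m - j) * (\<delta> ^ j * \<bar>d j x\<bar>)) \<le> p 0 x * A * 2 ^ m * (\<Sum>j\<le>m. 1 * (\<delta> ^ j * \<bar>d j x\<bar>))"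
    using pA \<delta> c by (intro mult_left_mono sum_mono mult_right_mono power_le_one) auto
  finally show "\<delta> ^ m * \<bar>leibniz m p d x\<bar> \<le> p 0 x * A * 2 ^ m * (\<Sum>j\<le>m. \<delta> ^ j * \<bar>d j x\<bar>)" by simp
qed

text \<open>The deterministic core: \<open>C\<close> and \<open>r\<close> are fixed before the
  sample, \<open>h\<close> and \<open>t\<close>. Testing the variational equation with the bump
  times \<open>f - fo\<close> balances design and penalty against noise and bias. The former
  dominate \<open>c1 * E\<close> up to errors; the gradient, the commutator and the Young terms are
  each arranged to cost at most \<open>c1 / 8 * E\<close>. \<open>R\<close> measures the squared
  oscillation of the averaged noise.\<close>

theorem spline_sup_bound:
  assumes m: "m \<ge> 1" and c0: "c0 > 0" and B: "B \<ge> 0"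
  shows "\<exists>C\<ge>0. \<exists>r. \<forall>J n h (x::nat \<Rightarrow> real) y f fo R t Z.
    is_smoothing_spline m n h x y f \<longrightarrow> fo \<in> sobolev m 2 \<longrightarrow>
    negligible Z \<longrightarrow> (\<forall>t\<in>{0..1} - Z. \<bar>nderiv m fo t\<bar> \<le> B) \<longrightarrow>
    0 < n \<longrightarrow> 1 / 2 ^ J \<le> h \<longrightarrow> h \<le> 2 / 2 ^ J \<longrightarrow> (\<forall>i\<in>{1..n}. 0 < x i \<and> x i \<le> 1) \<longrightarrow>
    (\<forall>k<2 ^ (J + r). c0 * real n / 2 ^ (J + r) \<le> mark_sum x (\<lambda>_. 1) n (real k / 2 ^ (J + r)) (real (Suc k) / 2 ^ (J + r))) \<longrightarrow>
    0 \<le> R \<longrightarrow>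
    (\<forall>k<2 ^ J. (mark_sum x (\<lambda>i. y i - fo (x i)) n (real k / 2 ^ J) (real (Suc k) / 2 ^ J))\<^sup>2 \<le> R * (real n)\<^sup>2) \<longrightarrow>
    (\<forall>k<2 ^ J. integral {real k / 2 ^ J..real (Suc k) / 2 ^ J} (\<lambda>t. (mark_sum x (\<lambda>i. y i - fo (x i)) n (real k / 2 ^ J) t)\<^sup>2) \<le> 1 / 2 ^ J * R * (real n)\<^sup>2) \<longrightarrow>
    t \<in> {0..1} \<longrightarrow>
    (f t - fo t)\<^sup>2 \<le> C * (R * (2 ^ J)\<^sup>2 + (1 / 2 ^ J) ^ (2 * m))"
proof -
  obtain Ci where Ci: "Ci \<ge> 0" "\<forall>d \<phi> J. sobolev_jet m d \<longrightarrow> slow_weight (1 / 2 ^ J) \<phi> \<longrightarrow>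
     (\<forall>j\<le>m. (1 / 2 ^ J) ^ (2 * j) * integral {0..1} (\<lambda>t. \<phi> t * (d j t)\<^sup>2) \<le>
       Ci * (integral {0..1} (\<lambda>t. \<phi> t * (d 0 t)\<^sup>2) + (1 / 2 ^ J) ^ (2 * m) * integral {0..1} (\<lambda>t. \<phi> t * (d m t)\<^sup>2)))"
    using weighted_interpolation[of m] by blast
  obtain A where A: "A \<ge> 1" "\<forall>i\<le>m. \<forall>c t \<delta> x. 0 < c \<longrightarrow> 0 < \<delta> \<longrightarrow> \<bar>sech_weight c t \<delta> i x\<bar> \<le> sech_weight c t \<delta> 0 x * A * (c / \<delta>) ^ i"
    using abs_sech_weight_le[of m] by blast
  \<comment> \<open>The design controls the weighted square of \<open>f - fo\<close> with constant
    \<open>c0 / 18\<close>, the penalty that of the m-th derivative with constant 1.\<close>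
  define c1 where "c1 = min (c0 / 18) 1"
  have c1: "c1 > 0" "c1 \<le> c0 / 18" "c1 \<le> 1" unfolding c1_def using c0 by auto
  \<comment> \<open>Refining the cells by \<open>2 ^ r\<close> divides the gradient term of the
    design bound by \<open>4 ^ r\<close>, which brings it below \<open>c1 / 8 * E\<close>.\<close>
  obtain r :: nat where r: "c0 * Ci * 8 / c1 < 4 ^ r" using real_arch_pow[of 4 "c0 * Ci * 8 / c1"] by auto
  define K1 where "K1 = 8 ^ m * A * real m * Ci"
  have K1: "K1 \<ge> 0" unfolding K1_def using A Ci by simp
  \<comment> \<open>The inverse width of the bump relative to \<delta>; \<open>K1 * c\<close> bounds
    the commutator relative to \<open>E\<close>.\<close>
  define c where "c = min 1 (c1 / (8 * (K1 + 1)))"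
  have c: "0 < c" "c \<le> 1" unfolding c_def using c1 K1 by auto
  have cK: "K1 * c \<le> c1 / 8"
  proof -
    define k where "k = K1 + 1"
    have k: "k > 0" "K1 \<le> k" unfolding k_def using K1 by auto
    have "K1 * c \<le> k * (c1 / (8 * k))" using k K1 c c1 unfolding c_def k_def[symmetric] by (intro mult_mono) auto
    also have "\<dots> = c1 / 8" using k by simp
    finally show ?thesis .
  qed
  define K2 where "K2 = 8 ^ m * A * B * (real m + 1)"
  have K2: "K2 \<ge> 0" unfolding K2_def using A B by simp
  define Q where "Q = 7 * (1 + Ci) + K2 * Ci + 1"
  have Q: "Q > 0" unfolding Q_def using Ci(1) K2 by (intro add_nonneg_pos add_nonneg_nonneg mult_nonneg_nonneg) auto
  \<comment> \<open>Young's parameter for noise and bias; \<open>Q\<close> dominates the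
    coefficients with which their energy parts enter.\<close>
  define \<nu> where "\<nu> = c1 / (8 * Q)"
  have \<nu>: "\<nu> > 0" unfolding \<nu>_def using c1 Q by simp
  have \<nu>K: "\<nu> * (7 * (1 + Ci) + K2 * Ci) \<le> c1 / 8"
  proof -
    have "\<nu> * (7 * (1 + Ci) + K2 * Ci) \<le> \<nu> * Q" unfolding Q_def using \<nu> by (intro mult_left_mono) auto
    also have "\<dots> = c1 / 8" unfolding \<nu>_def using Q by simp
    finally show ?thesis .
  qed
  define S where "S = 4 / c"
  have S: "S > 0" unfolding S_def using c by simp
  define K3 where "K3 = 3 * S * (1 + A\<^sup>2) / \<nu> + K2 * S / (4 * \<nu>)"
  have K3: "K3 \<ge> 0" unfolding K3_def using S \<nu> K2 by simp
  define C where "C = 6 * (1 + Ci) * (2 * K3 / c1)"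
  have C0: "C \<ge> 0" unfolding C_def using Ci K3 c1 by simp
  show ?thesis
  proof (intro exI[of _ C] exI[of _ r] conjI allI impI)
    show "0 \<le> C" by fact
    fix J n :: nat and h :: real and x y :: "nat \<Rightarrow> real" and f fo :: "real \<Rightarrow> real" and R t :: real and Z :: "real set"
    assume f: "is_smoothing_spline m n h x y f" and fo: "fo \<in> sobolev m 2"
      and Z: "negligible Z" and oB: "\<forall>t\<in>{0..1} - Z. \<bar>nderiv m fo t\<bar> \<le> B"
      and n: "0 < n" and h: "1 / 2 ^ J \<le> h" "h \<le> 2 / 2 ^ J" and x: "\<forall>i\<in>{1..n}. 0 < x i \<and> x i \<le> 1"
      and cnt: "\<forall>k<2 ^ (J + r). c0 * real n / 2 ^ (J + r) \<le> mark_sum x (\<lambda>_. 1) n (real k / 2 ^ (J + r)) (real (Suc k) / 2 ^ (J + r))"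
      and R: "0 \<le> R"
      and R1: "\<forall>k<2 ^ J. (mark_sum x (\<lambda>i. y i - fo (x i)) n (real k / 2 ^ J) (real (Suc k) / 2 ^ J))\<^sup>2 \<le> R * (real n)\<^sup>2"
      and R2: "\<forall>k<2 ^ J. integral {real k / 2 ^ J..real (Suc k) / 2 ^ J} (\<lambda>t. (mark_sum x (\<lambda>i. y i - fo (x i)) n (real k / 2 ^ J) t)\<^sup>2) \<le> 1 / 2 ^ J * R * (real n)\<^sup>2"
      and t: "t \<in> {0..1}"
    define \<delta> :: real where "\<delta> = 1 / 2 ^ J"
    define N :: nat where "N = 2 ^ J"
    define N' :: nat where "N' = 2 ^ (J + r)"
    have \<delta>: "\<delta> > 0" unfolding \<delta>_def by simp
    have N: "N > 0" "\<delta> = 1 / real N" unfolding N_def \<delta>_def by auto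
    have N': "N' > 0" "1 / real N' = \<delta> / 2 ^ r" unfolding N'_def \<delta>_def by (auto simp: power_add)
    have N'd: "1 / real N' \<le> \<delta>" unfolding N'(2) using \<delta> by (simp add: field_simps mult_left_mono)
    define H where "H = h ^ (2 * m)"
    have H: "\<delta> ^ (2 * m) \<le> H" "H \<le> 4 ^ m * \<delta> ^ (2 * m)"
    proof -
      show "\<delta> ^ (2 * m) \<le> H" unfolding H_def using h \<delta> unfolding \<delta>_def by (intro power_mono) auto
      have "H \<le> (2 * \<delta>) ^ (2 * m)" unfolding H_def using h \<delta> unfolding \<delta>_def
        by (intro power_mono) (auto intro: order_trans[of 0 "1 / 2 ^ J"])
      then show "H \<le> 4 ^ m * \<delta> ^ (2 * m)" by (simp add: power_mult_distrib power_mult)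
    qed
    have H0: "H \<ge> 0" using H(1) \<delta> by (meson order_trans zero_le_power less_imp_le)
    have fs: "f \<in> sobolev m 2" using f unfolding is_smoothing_spline_def by simp
    note jf = sobolev_imp_jet[OF fs m] and jo = sobolev_imp_jet[OF fo m]
    define d where "d j s = nderiv j f s + (-1) * nderiv j fo s" for j s
    have d: "sobolev_jet m d" unfolding d_def[abs_def] by (rule sobolev_jet_lincomb[OF jf jo])
    define p where "p = sech_weight c t \<delta>"
    define \<phi> where "\<phi> = p 0"
    have \<phi>: "slow_weight \<delta> \<phi>" unfolding \<phi>_def p_def by (rule slow_weight_sech[OF c \<delta>])
    have p0: "0 \<le> p 0 s" for s unfolding p_def by (simp add: sech_weight_0)
    have pd: "(p i has_real_derivative p (Suc i) s) (at s)" for i s unfolding p_def by (rule sech_weight_deriv)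
    have pA: "\<bar>p i s\<bar> \<le> p 0 s * A * (c / \<delta>) ^ i" if "i \<le> m" for i s unfolding p_def using A(2) c \<delta> that by blast
    define G where "G k = leibniz k p d" for k
    have G: "sobolev_jet m G" unfolding G_def[abs_def] by (rule sobolev_jet_leibniz[of p, OF pd d])
    have G0: "G 0 s = \<phi> s * d 0 s" for s unfolding G_def \<phi>_def by simp
    define \<alpha> where "\<alpha> j = integral {0..1} (\<lambda>s. \<phi> s * (d j s)\<^sup>2)" for j
    have L: "L2_01 (d j)" if "j \<le> m" for j by (rule sobolev_jet_L2[OF d that])
    have wi: "(\<lambda>s. \<phi> s * (d j s)\<^sup>2) integrable_on {0..1}" if "j \<le> m" for j by (rule weighted_square_integrable[OF \<phi> L[OF that]])
    have \<alpha>0: "0 \<le> \<alpha> j" if "j \<le> m" for j unfolding \<alpha>_def by (rule weighted_square_integral_nonneg[OF \<phi> L[OF that]]) auto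
    define E where "E = \<alpha> 0 + \<delta> ^ (2 * m) * \<alpha> m"
    have E0: "0 \<le> E" unfolding E_def using \<alpha>0 \<delta> by simp
    have int: "\<delta> ^ (2 * j) * \<alpha> j \<le> Ci * E" if "j \<le> m" for j
      using Ci(2)[rule_format, OF d, of J \<phi> j] \<phi> that unfolding \<alpha>_def E_def \<delta>_def by simp
    have \<phi>S: "integral {0..1} \<phi> \<le> S * \<delta>" unfolding \<phi>_def p_def S_def by (rule integral_sech_weight_le[OF c(1) \<delta>])
    have \<phi>i: "\<phi> integrable_on {0..1}" by (intro integrable_continuous_real slow_weightD(1)[OF \<phi>])
    define D where "D i = y i - fo (x i)" for i
    define noise where "noise = 1 / real n * (\<Sum>i=1..n. D i * G 0 (x i))"
    define design where "design = 1 / real n * (\<Sum>i=1..n. \<phi> (x i) * (d 0 (x i))\<^sup>2)"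
    have LG: "L2_01 (G m)" and Lo: "L2_01 (nderiv m fo)" using sobolev_jet_L2[OF G, of m] sobolev_jet_L2[OF jo, of m] by auto
    define IG where "IG = integral {0..1} (\<lambda>s. d m s * G m s)"
    define IB where "IB = integral {0..1} (\<lambda>s. nderiv m fo s * G m s)"
    \<comment> \<open>Writing \<open>f\<close> as \<open>f - fo\<close> plus \<open>fo\<close>
      separates the penalty of the error, \<open>IG\<close>, from the bias term
      \<open>IB\<close>.\<close>
    have EL: "design - noise + H * (IG + IB) = 0"
    proof -
      have "1 / real n * (\<Sum>i=1..n. (f (x i) - y i) * G 0 (x i)) + h ^ (2 * m) * integral {0..1} (\<lambda>t. nderiv m f t * G m t) = 0"
      proof (rule spline_euler_lagrange[OF f m G])
        show "x i \<in> {0..1}" if "i \<in> {1..n}" for i using bspec[OF x that] by simp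
      qed
      moreover have "(\<Sum>i=1..n. (f (x i) - y i) * G 0 (x i)) = (\<Sum>i=1..n. \<phi> (x i) * (d 0 (x i))\<^sup>2) - (\<Sum>i=1..n. D i * G 0 (x i))"
        unfolding sum_subtractf[symmetric] by (intro sum.cong refl) (simp add: G0 D_def d_def power2_eq_square algebra_simps)
      moreover have "integral {0..1} (\<lambda>t. nderiv m f t * G m t) = IG + IB"
      proof -
        have "integral {0..1} (\<lambda>s. d m s * G m s + nderiv m fo s * G m s) = IG + IB"
          unfolding IG_def IB_def
          by (rule Henstock_Kurzweil_Integration.integral_add[OF L2_01_prod_integrable[OF L[OF order_refl] LG] L2_01_prod_integrable[OF Lo LG]])
        moreover have "(\<lambda>s. d m s * G m s + nderiv m fo s * G m s) = (\<lambda>t. nderiv m f t * G m t)"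
          by (rule ext) (simp add: d_def algebra_simps)
        ultimately show ?thesis by simp
      qed
      ultimately show ?thesis unfolding design_def noise_def H_def by (simp add: diff_divide_distrib)
    qed
    have des: "c0 / 18 * \<alpha> 0 - c1 / 8 * E \<le> design"
    proof -
      have "c0 / 18 * \<alpha> 0 - c0 * (1 / real N')\<^sup>2 * \<alpha> 1 \<le> design"
        unfolding \<alpha>_def design_def
        by (rule design_bound[OF d _ N'(1) N'd n \<phi>]) (use m x c0 cnt in \<open>auto simp: N'_def\<close>)
      moreover have "c0 * (1 / real N')\<^sup>2 * \<alpha> 1 \<le> c1 / 8 * E"
      proof -
        have "(1 / real N')\<^sup>2 = \<delta>\<^sup>2 / 4 ^ r"
          unfolding N'(2) power_divide by (simp add: power_mult[symmetric] mult.commute[of r] power_mult)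
        then have "c0 * (1 / real N')\<^sup>2 * \<alpha> 1 = c0 / 4 ^ r * (\<delta> ^ (2 * 1) * \<alpha> 1)" by simp
        also have "\<dots> \<le> c0 / 4 ^ r * (Ci * E)" using c0 m by (intro mult_left_mono int) auto
        also have "\<dots> = (c0 * Ci / 4 ^ r) * E" by simp
        also have "\<dots> \<le> c1 / 8 * E"
          using r c1 E0 by (intro mult_right_mono) (auto simp: field_simps)
        finally show ?thesis .
      qed
      ultimately show ?thesis by linarith
    qed
    have noi: "noise \<le> 7 * \<nu> * (1 + Ci) * E + 3 * S * (1 + A\<^sup>2) * R / (\<nu> * \<delta>)"
    proof -
      have "noise \<le> 7 * \<nu> * (\<alpha> 0 + \<delta>\<^sup>2 * \<alpha> 1) + 3 * S * (1 + A\<^sup>2) * R / (\<nu> * \<delta>)"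
        unfolding noise_def \<alpha>_def
      proof (rule noise_bound[OF d _ G N n \<phi>])
        show "\<bar>G 0 s\<bar> \<le> \<phi> s * \<bar>d 0 s\<bar>" for s using p0 unfolding G0 \<phi>_def by (simp add: abs_mult)
        show "\<bar>G 1 s\<bar> \<le> \<phi> s * (\<bar>d 1 s\<bar> + A / \<delta> * \<bar>d 0 s\<bar>)" for s
        proof -
          have "\<bar>p 1 s\<bar> \<le> p 0 s * A * (c / \<delta>) ^ 1" using m by (intro pA) auto
          also have "\<dots> \<le> p 0 s * A * (1 / \<delta>)" using p0[of s] A c \<delta> by (intro mult_left_mono) (auto simp: divide_right_mono)
          finally have "\<bar>p 1 s\<bar> * \<bar>d 0 s\<bar> \<le> p 0 s * (A / \<delta>) * \<bar>d 0 s\<bar>" by (intro mult_right_mono) auto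
          moreover have "\<bar>G 1 s\<bar> \<le> \<bar>p 1 s\<bar> * \<bar>d 0 s\<bar> + p 0 s * \<bar>d 1 s\<bar>"
            unfolding G_def using abs_triangle_ineq[of "p 1 s * d 0 s" "p 0 s * d 1 s"] p0[of s] by (simp add: abs_mult)
          ultimately show ?thesis unfolding \<phi>_def by (simp add: algebra_simps)
        qed
        show "integral {0..1} \<phi> \<le> S * \<delta>" by (rule \<phi>S)
        show "0 < x i \<and> x i \<le> 1" if "i \<in> {1..n}" for i using x that by blast
        show "(mark_sum x D n (real k / real N) (real (Suc k) / real N))\<^sup>2 \<le> R * (real n)\<^sup>2" if "k < N" for k
          using R1[rule_format, of k] that unfolding N_def D_def[abs_def] by simp
        show "integral {real k / real N..real (Suc k) / real N} (\<lambda>t. (mark_sum x D n (real k / real N) t)\<^sup>2) \<le> \<delta> * R * (real n)\<^sup>2" if "k < N" for k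
          using R2[rule_format, of k] that unfolding N_def D_def[abs_def] \<delta>_def by simp
      qed (use m A \<nu> R in auto)
      moreover have "\<delta>\<^sup>2 * \<alpha> 1 \<le> Ci * E" using int[of 1] m by simp
      moreover have "\<alpha> 0 \<le> E" unfolding E_def using \<alpha>0[of m] \<delta> by simp
      ultimately have "noise \<le> 7 * \<nu> * (E + Ci * E) + 3 * S * (1 + A\<^sup>2) * R / (\<nu> * \<delta>)"
        using \<nu> by (smt (verit) mult_left_mono)
      then show ?thesis by (simp add: algebra_simps)
    qed
    have HP: "H * \<bar>a\<bar> * \<bar>b\<bar> \<le> 4 ^ m * ((\<delta> ^ m * \<bar>a\<bar>) * (\<delta> ^ m * \<bar>b\<bar>))" for a b
    proof -
      have "H * (\<bar>a\<bar> * \<bar>b\<bar>) \<le> (4 ^ m * \<delta> ^ (2 * m)) * (\<bar>a\<bar> * \<bar>b\<bar>)" by (intro mult_right_mono H) auto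
      then show ?thesis by (simp add: power_mult power2_eq_square power_mult_distrib mult_ac)
    qed
    have sq: "(\<delta> ^ k * \<bar>z\<bar>)\<^sup>2 = \<delta> ^ (2 * k) * z\<^sup>2" for k z
      by (simp add: power_mult_distrib power_even_eq)
    have idn1: "q * (p * ((1/2) * (D1 * u) + (D2 * v) / (4 * (1/2)))) = q / 2 * (D1 * (p * u) + D2 * (p * v))" for q p D1 u D2 v :: real
      by (simp add: field_simps)
    have idn2: "p * (\<nu> * (D1 * u) + D2 / q) = \<nu> * D1 * (p * u) + D2 / q * p" for q p D1 u D2 :: real
      by (simp add: algebra_simps)
    \<comment> \<open>\<open>4 ^ m\<close> stems from \<open>h \<le> 2 * \<delta>\<close> and
      \<open>2 ^ m\<close> from the Leibniz rule.\<close>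
    have e48: "(4::real) ^ m * 2 ^ m = 8 ^ m" by (simp add: power_mult_distrib[symmetric])
    have pen: "H * \<alpha> m - c1 / 8 * E \<le> H * IG"
    proof -
      \<comment> \<open>Bounds the commutator \<open>G m - p 0 * d m\<close> against
        \<open>d m\<close>, split by Young's inequality with parameter 1/2; interpolation then
        compares its integral with \<open>E\<close>.\<close>
      define W where "W s = 8 ^ m * A * c / 2 * (\<Sum>j<m. \<delta> ^ (2 * m) * (\<phi> s * (d m s)\<^sup>2) + \<delta> ^ (2 * j) * (\<phi> s * (d j s)\<^sup>2))" for s
      have Wi: "W integrable_on {0..1}"
        unfolding W_def[abs_def] by (intro integrable_on_mult_right integrable_sum integrable_add wi) auto
      have "integral {0..1} (\<lambda>s. H * (\<phi> s * (d m s)\<^sup>2) - W s) \<le> integral {0..1} (\<lambda>s. H * (d m s * G m s))"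
      proof (rule integral_le)
        show "(\<lambda>s. H * (\<phi> s * (d m s)\<^sup>2) - W s) integrable_on {0..1}"
          by (intro integrable_diff integrable_on_mult_right wi Wi) auto
        show "(\<lambda>s. H * (d m s * G m s)) integrable_on {0..1}"
          by (intro integrable_on_mult_right L2_01_prod_integrable L LG) auto
        fix s
        have "H * \<bar>d m s\<bar> * \<bar>G m s - p 0 s * d m s\<bar> \<le> 4 ^ m * ((\<delta> ^ m * \<bar>d m s\<bar>) * (\<delta> ^ m * \<bar>G m s - p 0 s * d m s\<bar>))" by (rule HP)
        also have "\<dots> \<le> 4 ^ m * ((\<delta> ^ m * \<bar>d m s\<bar>) * (p 0 s * A * 2 ^ m * c * (\<Sum>j<m. \<delta> ^ j * \<bar>d j s\<bar>)))"
          unfolding G_def using \<delta> leibniz_remainder_bound(1)[of m p s A c \<delta> d, OF pA p0 A(1) c \<delta>]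
          by (intro mult_left_mono) auto
        also have "\<dots> = 8 ^ m * A * c * (\<Sum>j<m. p 0 s * ((\<delta> ^ m * \<bar>d m s\<bar>) * (\<delta> ^ j * \<bar>d j s\<bar>)))"
          unfolding e48[symmetric] by (simp add: sum_distrib_left mult_ac)
        also have "\<dots> \<le> 8 ^ m * A * c * (\<Sum>j<m. p 0 s * ((1/2) * (\<delta> ^ m * \<bar>d m s\<bar>)\<^sup>2 + (\<delta> ^ j * \<bar>d j s\<bar>)\<^sup>2 / (4 * (1/2))))"
          using A c p0 by (intro mult_left_mono sum_mono weighted_young) auto
        also have "\<dots> = W s" unfolding W_def \<phi>_def sum_distrib_left
          by (intro sum.cong refl) (simp only: sq idn1)
        finally have "\<bar>H * d m s * (G m s - p 0 s * d m s)\<bar> \<le> W s" using H0 by (simp add: abs_mult)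
        moreover have "H * (d m s * G m s) = H * (\<phi> s * (d m s)\<^sup>2) + H * d m s * (G m s - p 0 s * d m s)"
          unfolding \<phi>_def by (simp add: power2_eq_square algebra_simps)
        ultimately show "H * (\<phi> s * (d m s)\<^sup>2) - W s \<le> H * (d m s * G m s)" by linarith
      qed
      also have "\<dots> = H * IG" unfolding IG_def by simp
      also have "integral {0..1} (\<lambda>s. H * (\<phi> s * (d m s)\<^sup>2) - W s) = H * \<alpha> m - integral {0..1} W"
        unfolding \<alpha>_def by (subst Henstock_Kurzweil_Integration.integral_diff) (auto intro!: integrable_on_mult_right wi Wi)
      finally have *: "H * \<alpha> m - integral {0..1} W \<le> H * IG" .
      have "integral {0..1} W = 8 ^ m * A * c / 2 * (\<Sum>j<m. \<delta> ^ (2 * m) * \<alpha> m + \<delta> ^ (2 * j) * \<alpha> j)"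
      proof (rule integral_unique)
        show "(W has_integral 8 ^ m * A * c / 2 * (\<Sum>j<m. \<delta> ^ (2 * m) * \<alpha> m + \<delta> ^ (2 * j) * \<alpha> j)) {0..1}"
          unfolding W_def[abs_def] \<alpha>_def
          by (intro has_integral_mult_right has_integral_sum has_integral_add integrable_integral wi) auto
      qed
      also have "\<dots> \<le> 8 ^ m * A * c / 2 * (\<Sum>j<m. Ci * E + Ci * E)"
        using A c by (intro mult_left_mono sum_mono add_mono int) auto
      also have "\<dots> = K1 * c * E" unfolding K1_def by simp
      also have "\<dots> \<le> c1 / 8 * E" using cK E0 by (intro mult_right_mono) auto
      finally show ?thesis using * by linarith
    qed
    \<comment> \<open>The m-th derivative of \<open>fo\<close> is bounded, so Young's inequality
      leaves \<open>\<delta> ^ (2 * m)\<close> times the integral of \<phi>. That integral supplies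
      the extra factor \<delta>, which the evaluation at \<open>t\<close> divides out again.\<close>
    have bias: "- (H * IB) \<le> \<nu> * K2 * Ci * E + K2 * S / (4 * \<nu>) * \<delta> ^ (2 * m) * \<delta>"
    proof -
      define W where "W s = 8 ^ m * A * B * (\<Sum>j\<le>m. \<nu> * \<delta> ^ (2 * j) * (\<phi> s * (d j s)\<^sup>2) + \<delta> ^ (2 * m) / (4 * \<nu>) * \<phi> s)" for s
      have Wi: "W integrable_on {0..1}"
        unfolding W_def[abs_def] by (intro integrable_on_mult_right integrable_sum integrable_add wi \<phi>i) auto
      \<comment> \<open>Resets the m-th derivative of \<open>fo\<close> to 0 on the exceptional null
        set, so that the bound \<open>B\<close> holds at every point of [0,1].\<close>
      define q where "q s = (if s \<in> Z then 0 else nderiv m fo s)" for s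
      have IBq: "IB = integral {0..1} (\<lambda>s. q s * G m s)"
        unfolding IB_def by (rule integral_spike[OF Z]) (auto simp: q_def)
      have qi: "(\<lambda>s. q s * G m s) integrable_on {0..1}"
        by (rule integrable_spike[OF L2_01_prod_integrable[OF Lo LG] Z]) (auto simp: q_def)
      have "norm (integral {0..1} (\<lambda>s. H * (q s * G m s))) \<le> integral {0..1} W"
      proof (rule integral_norm_bound_integral)
        show "(\<lambda>s. H * (q s * G m s)) integrable_on {0..1}" by (intro integrable_on_mult_right qi)
        fix s :: real assume s: "s \<in> {0..1}"
        have q: "\<bar>q s\<bar> \<le> B" using oB s B unfolding q_def by auto
        have "norm (H * (q s * G m s)) = H * \<bar>q s\<bar> * \<bar>G m s\<bar>" using H0 by (simp add: abs_mult)
        also have "\<dots> \<le> 4 ^ m * ((\<delta> ^ m * \<bar>q s\<bar>) * (\<delta> ^ m * \<bar>G m s\<bar>))" by (rule HP)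
        also have "\<dots> \<le> 4 ^ m * ((\<delta> ^ m * B) * (p 0 s * A * 2 ^ m * (\<Sum>j\<le>m. \<delta> ^ j * \<bar>d j s\<bar>)))"
        proof (rule mult_left_mono, rule mult_mono)
          show "\<delta> ^ m * \<bar>q s\<bar> \<le> \<delta> ^ m * B" using \<delta> q by (intro mult_left_mono) auto
          show "\<delta> ^ m * \<bar>G m s\<bar> \<le> p 0 s * A * 2 ^ m * (\<Sum>j\<le>m. \<delta> ^ j * \<bar>d j s\<bar>)"
            unfolding G_def by (rule leibniz_remainder_bound(2)[of m p s A c \<delta> d, OF pA p0 A(1) c \<delta>])
        qed (use \<delta> B in auto)
        also have "\<dots> = 8 ^ m * A * B * (\<Sum>j\<le>m. p 0 s * ((\<delta> ^ j * \<bar>d j s\<bar>) * \<delta> ^ m))"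
          unfolding e48[symmetric] by (simp add: sum_distrib_left mult_ac)
        also have "\<dots> \<le> 8 ^ m * A * B * (\<Sum>j\<le>m. p 0 s * (\<nu> * (\<delta> ^ j * \<bar>d j s\<bar>)\<^sup>2 + (\<delta> ^ m)\<^sup>2 / (4 * \<nu>)))"
          using A B p0 \<nu> by (intro mult_left_mono sum_mono weighted_young) auto
        also have "\<dots> = W s" unfolding W_def \<phi>_def
          by (intro arg_cong2[where f="(*)"] sum.cong refl) (simp only: sq power_even_eq[symmetric] idn2)
        finally show "norm (H * (q s * G m s)) \<le> W s" .
      qed (rule Wi)
      then have "- (H * IB) \<le> integral {0..1} W" unfolding IBq by (simp add: abs_le_iff)
      also have "integral {0..1} W = 8 ^ m * A * B * (\<Sum>j\<le>m. \<nu> * \<delta> ^ (2 * j) * \<alpha> j + \<delta> ^ (2 * m) / (4 * \<nu>) * integral {0..1} \<phi>)"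
      proof (rule integral_unique)
        show "(W has_integral 8 ^ m * A * B * (\<Sum>j\<le>m. \<nu> * \<delta> ^ (2 * j) * \<alpha> j + \<delta> ^ (2 * m) / (4 * \<nu>) * integral {0..1} \<phi>)) {0..1}"
          unfolding W_def[abs_def] \<alpha>_def
          by (intro has_integral_mult_right has_integral_sum has_integral_add integrable_integral wi \<phi>i) auto
      qed
      also have "\<dots> \<le> 8 ^ m * A * B * (\<Sum>j\<le>m. \<nu> * (Ci * E) + \<delta> ^ (2 * m) / (4 * \<nu>) * (S * \<delta>))"
        unfolding mult.assoc[of \<nu>] using A B \<nu> \<delta> \<phi>S by (intro mult_left_mono sum_mono add_mono int) auto
      also have "\<dots> = \<nu> * K2 * Ci * E + K2 * S / (4 * \<nu>) * \<delta> ^ (2 * m) * \<delta>" unfolding K2_def by (simp add: algebra_simps)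
      finally show ?thesis .
    qed
    have main: "c1 / 2 * E \<le> K3 * (R / \<delta> + \<delta> ^ (2 * m) * \<delta>)"
    proof -
      have "c1 * E \<le> c0 / 18 * \<alpha> 0 + H * \<alpha> m"
      proof -
        have "c1 * \<alpha> 0 \<le> c0 / 18 * \<alpha> 0" using c1 \<alpha>0 by (intro mult_right_mono) auto
        moreover have "c1 * (\<delta> ^ (2 * m) * \<alpha> m) \<le> 1 * (H * \<alpha> m)" using c1 \<alpha>0 H \<delta> H0 by (intro mult_mono) auto
        ultimately show ?thesis unfolding E_def by (simp add: distrib_left)
      qed
      also have "\<dots> \<le> (design + c1 / 8 * E) + (H * IG + c1 / 8 * E)" using des pen by linarith
      also have "\<dots> = noise + (- (H * IB)) + c1 / 4 * E" using EL by (simp add: algebra_simps)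
      also have "\<dots> \<le> (7 * \<nu> * (1 + Ci) * E + 3 * S * (1 + A\<^sup>2) * R / (\<nu> * \<delta>)) + (\<nu> * K2 * Ci * E + K2 * S / (4 * \<nu>) * \<delta> ^ (2 * m) * \<delta>) + c1 / 4 * E"
        using noi bias by linarith
      also have "\<dots> = \<nu> * (7 * (1 + Ci) + K2 * Ci) * E + c1 / 4 * E + (3 * S * (1 + A\<^sup>2) / \<nu> * (R / \<delta>) + K2 * S / (4 * \<nu>) * (\<delta> ^ (2 * m) * \<delta>))"
        by (simp add: algebra_simps add_divide_distrib)
      also have "\<dots> \<le> c1 / 8 * E + c1 / 4 * E + (K3 * (R / \<delta>) + K3 * (\<delta> ^ (2 * m) * \<delta>))"
      proof (intro add_mono mult_right_mono \<nu>K order_refl)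
        show "3 * S * (1 + A\<^sup>2) / \<nu> \<le> K3" "K2 * S / (4 * \<nu>) \<le> K3" unfolding K3_def using S \<nu> K2 by auto
      qed (use E0 R \<delta> in auto)
      finally have X: "c1 * E \<le> c1 / 8 * E + c1 / 4 * E + K3 * (R / \<delta> + \<delta> ^ (2 * m) * \<delta>)" by (simp only: distrib_left)
      define z where "z = c1 * E"
      have z: "c1 / 8 * E = z / 8" "c1 / 4 * E = z / 4" "c1 / 2 * E = z / 2" "0 \<le> z" unfolding z_def using c1 E0 by auto
      show ?thesis using X z(4) unfolding z(1-3) z_def[symmetric] by linarith
    qed
    \<comment> \<open>The bump equals 1 at \<open>t\<close>, so on the cell of \<open>t\<close> the
      weighted integrals control the unweighted ones, and the sup bound applies.\<close>
    have pt: "(d 0 t)\<^sup>2 \<le> 6 / \<delta> * (1 + Ci) * E"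
    proof -
      have "\<exists>k<N. t \<in> {real k / real N..real (Suc k) / real N}"
      proof (cases "t = 0")
        case True then show ?thesis using N(1) by (intro exI[of _ 0]) auto
      next
        case False
        then have "(\<Sum>k<N. if real k / real N < t \<and> t \<le> real (Suc k) / real N then 1 else 0) = (1::real)"
          using t N(1) by (intro sum_indicator_pieces) auto
        moreover have "(\<Sum>k<N. if real k / real N < t \<and> t \<le> real (Suc k) / real N then 1 else 0) = (0::real)"
          if "\<not> ?thesis"
        proof (intro sum.neutral ballI)
          fix k assume "k \<in> {..<N}"
          then have "t \<notin> {real k / real N..real (Suc k) / real N}" using that by blast
          then show "(if real k / real N < t \<and> t \<le> real (Suc k) / real N then 1 else 0) = (0::real)" by auto
        qed
        ultimately show ?thesis by (metis zero_neq_one)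
      qed
      then obtain k where k: "k < N" "t \<in> {real k / real N..real (Suc k) / real N}" by blast
      define a b where "a = real k / real N" and "b = real (Suc k) / real N"
      have ab: "0 \<le> a" "a < b" "b \<le> 1" "b - a = \<delta>" "b - a \<le> \<delta>" "t \<in> {a..b}"
        using piece_bounds[OF k(1)] N k(2) unfolding a_def b_def by auto
      have ab': "a \<le> b" and m0: "0 < m" using ab m by auto
      have \<phi>t: "\<phi> t = 1" unfolding \<phi>_def p_def by (simp add: sech_weight_0)
      note W = slow_weight_integral_bounds(2)[OF \<phi> L ab(1) ab' ab(3,5,6), unfolded \<phi>t]
      have sub: "integral {a..b} (\<lambda>s. \<phi> s * (d j s)\<^sup>2) \<le> \<alpha> j" if "j \<le> m" for j
        unfolding \<alpha>_def
      proof (rule integral_subset_le)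
        show "(\<lambda>s. \<phi> s * (d j s)\<^sup>2) integrable_on {a..b}" by (rule integrable_on_sub01[OF wi[OF that] ab(1,3)])
        show "\<forall>s\<in>{0..1}. 0 \<le> \<phi> s * (d j s)\<^sup>2" unfolding \<phi>_def using p0 by simp
      qed (use ab wi[OF that] in auto)
      have "(d 0 t)\<^sup>2 \<le> 2 / \<delta> * integral {a..b} (\<lambda>s. (d 0 s)\<^sup>2) + 2 * \<delta> * integral {a..b} (\<lambda>s. (d 1 s)\<^sup>2)"
        using jet_sup_le[OF d m0 ab(1-3,6)] unfolding ab(4) by simp
      also have "\<dots> \<le> 2 / \<delta> * (3 * \<alpha> 0) + 2 * \<delta> * (3 * \<alpha> 1)"
        using \<delta> W[of 0] W[of 1] sub[of 0] sub[of 1] m by (intro add_mono mult_left_mono) auto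
      also have "\<dots> = 6 / \<delta> * (\<alpha> 0 + \<delta> ^ (2 * 1) * \<alpha> 1)" using \<delta> by (simp add: field_simps power2_eq_square)
      also have "\<dots> \<le> 6 / \<delta> * (E + Ci * E)"
        using \<delta> \<alpha>0[of m] m by (intro mult_left_mono add_mono int) (auto simp: E_def)
      finally show ?thesis by (simp add: algebra_simps)
    qed
    have "E \<le> 2 * K3 / c1 * (R / \<delta> + \<delta> ^ (2 * m) * \<delta>)"
      using main c1 by (simp add: field_simps)
    then have "6 / \<delta> * (1 + Ci) * E \<le> 6 / \<delta> * (1 + Ci) * (2 * K3 / c1 * (R / \<delta> + \<delta> ^ (2 * m) * \<delta>))"
      using \<delta> Ci by (intro mult_left_mono) auto
    also have "\<dots> = C * ((R / \<delta> + \<delta> ^ (2 * m) * \<delta>) / \<delta>)" 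
    proof -
      have "6 / \<delta> * (1 + Ci) * (2 * K3 / c1 * u) = C * (u / \<delta>)" for u
        unfolding C_def using \<delta> c1 by (simp add: field_simps)
      then show ?thesis .
    qed
    also have "(R / \<delta> + \<delta> ^ (2 * m) * \<delta>) / \<delta> = R * (1 / \<delta>)\<^sup>2 + \<delta> ^ (2 * m)"
      using \<delta> by (simp add: field_simps power2_eq_square)
    also have "1 / \<delta> = 2 ^ J" unfolding \<delta>_def by simp
    finally have "(d 0 t)\<^sup>2 \<le> C * (R * (2 ^ J)\<^sup>2 + \<delta> ^ (2 * m))" using pt by linarith
    then show "(f t - fo t)\<^sup>2 \<le> C * (R * (2 ^ J)\<^sup>2 + (1 / 2 ^ J) ^ (2 * m))"
      unfolding d_def \<delta>_def by simp
  qed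
qed

section \<open>The uniform rate\<close>

lemma sobolev_continuous:
  assumes "f \<in> sobolev m 2" "m \<ge> 1"
  shows "continuous_on {0..1} f"
  using sobolev_jet_continuous[OF sobolev_imp_jet[OF assms], of 0] assms(2) by simp

lemma Linf_norm_le:
  assumes g: "continuous_on {0..1} g" and K: "\<And>t. t \<in> {0..1} \<Longrightarrow> \<bar>g t\<bar> \<le> K"
  shows "Linf_norm g \<le> ereal K"
  unfolding Linf_norm_def
proof (rule esssup_I)
  have "continuous_on {0<..<1} g" using g by (rule continuous_on_subset) auto
  then have "g \<in> borel_measurable (lebesgue_on {0<..<1})"
    by (rule continuous_imp_measurable_on_sets_lebesgue) simp
  then show "(\<lambda>x. ereal \<bar>g x\<bar>) \<in> borel_measurable (lebesgue_on {0<..<1})" by measurable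
  show "AE x in lebesgue_on {0<..<1}. ereal \<bar>g x\<bar> \<le> ereal K"
    using K by (intro AE_I2) auto
qed

text \<open>\<open>J\<close> is the least level whose cells are not longer than \<open>h\<close>,
  hence \<open>h\<close> is at most two cells. Since \<open>h \<le> 1 / 2\<close>,
  \<open>ln (1 / h)\<close> is at least \<open>ln 2\<close> and absorbs the constants; 9/2 is 3
  divided by the lower bound 2/3 for \<open>ln 2\<close>.\<close>

lemma dyadic_scale:
  fixes h :: real
  assumes h: "0 < h" "h \<le> 1 / 2"
  obtains J :: nat where "1 / 2 ^ J \<le> h" "h \<le> 2 / 2 ^ J" "1 + real J \<le> 9 / 2 * ln (1 / h)"
proof -
  define J where "J = (LEAST j::nat. 1 / 2 ^ j \<le> h)"
  obtain j0 :: nat where "(1 / 2) ^ j0 < h" using real_arch_pow_inv[of h "1/2"] h by auto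
  then have ex: "1 / 2 ^ j0 \<le> h" by (simp add: power_one_over)
  have 1: "1 / 2 ^ J \<le> h" unfolding J_def by (rule LeastI[of "\<lambda>j. 1 / 2 ^ j \<le> h", OF ex])
  have J0: "J \<noteq> 0"
  proof
    assume "J = 0"
    then show False using 1 h by simp
  qed
  then have "\<not> 1 / 2 ^ (J - 1) \<le> h"
    using not_less_Least[of "J - 1" "\<lambda>j. 1 / 2 ^ j \<le> h"] unfolding J_def[symmetric] by simp
  moreover have "(2::real) ^ J = 2 * 2 ^ (J - 1)" using J0 by (simp add: power_eq_if)
  ultimately have 2: "h \<le> 2 / 2 ^ J" by (simp add: field_simps)
  have "2 ^ J \<le> 2 * (1 / h)" using 2 h by (simp add: field_simps)
  then have "ln (2 ^ J) \<le> ln (2 * (1 / h))" using h by (subst ln_le_cancel_iff) auto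
  also have "ln (2 * (1 / h)) = ln 2 + ln (1 / h)" using h by (subst ln_mult) auto
  finally have a: "real J * ln 2 \<le> ln 2 + ln (1 / h)" by (simp add: ln_realpow)
  have b: "ln 2 \<le> ln (1 / h)" using h by (subst ln_le_cancel_iff) (auto simp: field_simps)
  have c: "(2/3::real) \<le> ln 2" by (rule ln2_ge_two_thirds)
  have "(1 + real J) * (2 / 3) \<le> (1 + real J) * ln 2" using c by (intro mult_left_mono) auto
  also have "\<dots> = ln 2 + real J * ln 2" by (simp add: algebra_simps)
  also have "\<dots> \<le> 3 * ln (1 / h)" using a b by linarith
  finally have "(1 + real J) * (2 / 3) \<le> 3 * ln (1 / h)" .
  moreover have "u \<le> 9 / 2 * v" if "u * (2 / 3) \<le> 3 * v" for u v :: real using that by linarith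
  ultimately have 3: "1 + real J \<le> 9 / 2 * ln (1 / h)" by blast
  show ?thesis using that 1 2 3 .
qed

text \<open>The expected count in a cell, of order \<open>n / 2 ^ j\<close>, must dominate its
  fluctuation; squared and rearranged, this requirement is the inequality. It holds since
  \<open>2 ^ j\<close> is at most \<open>n powr \<beta>\<close> with \<beta> < 1 and the other
  factors are logarithmic.\<close>

lemma eventually_dyadic_cells_large:
  assumes \<beta>: "0 < \<beta>" "\<beta> < 1" and c: "c > 0" and C: "C \<ge> 0"
  shows "\<forall>\<^sub>F n in sequentially. \<forall>j. real n powr (- \<beta>) \<le> 1 / 2 ^ j \<longrightarrow> C * 2 ^ j * (1 + real j + ln (ln (real n))) \<le> c * real n"
proof -
  \<comment> \<open>\<open>C + 1\<close> in place of \<open>C\<close> keeps the leading coefficient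
    positive in the asymptotic comparison.\<close>
  have "C + 1 > 0" using C by simp
  then have "\<forall>\<^sub>F n in sequentially. (C + 1) * (real n powr \<beta>) * (1 + 2 * ln (real n) + ln (ln (real n))) \<le> c * real n"
    using \<beta> c by real_asymp
  moreover have "\<forall>\<^sub>F n in sequentially. 1 \<le> ln (real n)" by real_asymp
  moreover have "\<forall>\<^sub>F n in sequentially. n > (0::nat)" by (rule eventually_gt_at_top)
  ultimately show ?thesis
  proof eventually_elim
    case (elim n)
    show ?case
    proof (intro allI impI)
      fix j :: nat assume j: "real n powr (- \<beta>) \<le> 1 / 2 ^ j"
      have rn: "real n > 0" using elim by simp
      have p: "2 ^ j \<le> real n powr \<beta>"
      proof -
        have "1 / real n powr \<beta> \<le> 1 / 2 ^ j" using j by (simp add: powr_minus_divide)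
        then show ?thesis using rn by (simp add: field_simps)
      qed
      then have "ln (2 ^ j) \<le> ln (real n powr \<beta>)" using rn by (subst ln_le_cancel_iff) auto
      then have "real j * ln 2 \<le> \<beta> * ln (real n)" using rn by (simp add: ln_realpow ln_powr)
      also have "\<dots> \<le> 1 * ln (real n)" using \<beta> elim by (intro mult_right_mono) auto
      finally have "real j * ln 2 \<le> ln (real n)" by simp
      moreover have "real j * (1 / 2) \<le> real j * ln 2" using ln2_ge_two_thirds by (intro mult_left_mono) auto
      ultimately have jl: "real j \<le> 2 * ln (real n)" by linarith
      have ll: "0 \<le> ln (ln (real n))" using elim by simp
      have "C * 2 ^ j * (1 + real j + ln (ln (real n))) \<le> (C + 1) * (real n powr \<beta>) * (1 + 2 * ln (real n) + ln (ln (real n)))"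
        using p jl ll C by (intro mult_mono) auto
      then show "C * 2 ^ j * (1 + real j + ln (ln (real n))) \<le> c * real n" using elim by linarith
    qed
  qed
qed

text \<open>The power of \<open>ln n\<close> in the smallest bandwidth outgrows every fixed factor;
  it pays for \<gamma> and for the passage to finer cells.\<close>

lemma eventually_bandwidth_lower:
  assumes "0 < \<beta>" "a > 0"
  shows "\<forall>\<^sub>F n in sequentially. real n powr (- \<beta>) \<le> a * (ln (real n) / real n) powr \<beta>"
  using assms by real_asymp

text \<open>On a fixed path the two fluctuation bounds feed \<open>spline_sup_bound\<close>: the
  noise bound at level \<open>J\<close>, the design bound at level \<open>J + r\<close>, where it
  turns into a lower bound for the counts.\<close>

lemma spline_rate_pathwise:
  fixes x y :: "nat \<Rightarrow> real" and f :: "nat \<Rightarrow> real \<Rightarrow> real \<Rightarrow> real" and p :: "real \<Rightarrow> real \<Rightarrow> real"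
  assumes m: "m \<ge> 1" and lam: "2 < lam" and \<gamma>: "\<gamma> > 0" and w: "w > 0" and C1: "C1 \<ge> 0" and C2: "C2 \<ge> 0"
    and fo: "fo \<in> sobolev m \<infinity>" and x: "\<And>i. i \<ge> 1 \<Longrightarrow> 0 < x i \<and> x i \<le> 1"
    and p: "\<And>a b. 0 \<le> a \<Longrightarrow> a \<le> b \<Longrightarrow> b \<le> 1 \<Longrightarrow> w * (b - a) \<le> p a b"
    and noise: "\<forall>\<^sub>F n in sequentially. \<forall>j. real n powr (- (1 - 2 / lam)) \<le> 1 / 2 ^ j \<longrightarrow> (\<forall>k<2 ^ j.
      (mark_sum x (\<lambda>i. y i - fo (x i)) n (real k / 2 ^ j) (real (Suc k) / 2 ^ j))\<^sup>2
         \<le> C1 * (real n * (1 / 2 ^ j) * (1 + real j + ln (ln (real n)))) \<and>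
      integral {real k / 2 ^ j..real (Suc k) / 2 ^ j} (\<lambda>t. (mark_sum x (\<lambda>i. y i - fo (x i)) n (real k / 2 ^ j) t)\<^sup>2)
         \<le> 1 / 2 ^ j * (C1 * (real n * (1 / 2 ^ j) * (1 + real j + ln (ln (real n))))))"
    and design: "\<forall>\<^sub>F n in sequentially. \<forall>j. real n powr (- (1 - 2 / lam)) \<le> 1 / 2 ^ j \<longrightarrow> (\<forall>k<2 ^ j.
      (mark_sum x (\<lambda>_. 1) n (real k / 2 ^ j) (real (Suc k) / 2 ^ j) - real n * p (real k / 2 ^ j) (real (Suc k) / 2 ^ j))\<^sup>2
         \<le> C2 * (real n * (1 / 2 ^ j) * (1 + real j + ln (ln (real n)))))"
    and spline: "\<And>n h. n \<ge> m \<Longrightarrow> h > 0 \<Longrightarrow> is_smoothing_spline m n h x y (f n h)"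
  shows "limsup (\<lambda>n. SUP h\<in>bandwidths lam \<gamma> n. Linf_norm (\<lambda>t. f n h t - fo t) /
      ereal (sqrt (h ^ (2 * m) + 1 / (real n * h) * max (ln (1 / h)) (ln (ln (real n)))))) < \<infinity>"
proof -
  define \<beta> where "\<beta> = 1 - 2 / lam"
  have \<beta>: "0 < \<beta>" "\<beta> < 1" unfolding \<beta>_def using lam by (auto simp: field_simps)
  note fo2 = sobolev_infinity(1)[OF fo]
  obtain B0 Z where Z: "negligible Z" and B0: "\<forall>t\<in>{0..1} - Z. \<bar>nderiv m fo t\<bar> \<le> B0"
    using sobolev_infinity(2)[OF fo] by blast
  define B where "B = max 0 B0"
  have B: "B \<ge> 0" "\<forall>t\<in>{0..1} - Z. \<bar>nderiv m fo t\<bar> \<le> B" unfolding B_def using B0 by (simp, meson max.coboundedI2)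
  have w2: "w / 2 > 0" using w by simp
  obtain C r where C: "C \<ge> 0" and bound: "\<forall>J n h (x::nat \<Rightarrow> real) y f fo R t Z.
    is_smoothing_spline m n h x y f \<longrightarrow> fo \<in> sobolev m 2 \<longrightarrow>
    negligible Z \<longrightarrow> (\<forall>t\<in>{0..1} - Z. \<bar>nderiv m fo t\<bar> \<le> B) \<longrightarrow>
    0 < n \<longrightarrow> 1 / 2 ^ J \<le> h \<longrightarrow> h \<le> 2 / 2 ^ J \<longrightarrow> (\<forall>i\<in>{1..n}. 0 < x i \<and> x i \<le> 1) \<longrightarrow>
    (\<forall>k<2 ^ (J + r). w / 2 * real n / 2 ^ (J + r) \<le> mark_sum x (\<lambda>_. 1) n (real k / 2 ^ (J + r)) (real (Suc k) / 2 ^ (J + r))) \<longrightarrow>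
    0 \<le> R \<longrightarrow>
    (\<forall>k<2 ^ J. (mark_sum x (\<lambda>i. y i - fo (x i)) n (real k / 2 ^ J) (real (Suc k) / 2 ^ J))\<^sup>2 \<le> R * (real n)\<^sup>2) \<longrightarrow>
    (\<forall>k<2 ^ J. integral {real k / 2 ^ J..real (Suc k) / 2 ^ J} (\<lambda>t. (mark_sum x (\<lambda>i. y i - fo (x i)) n (real k / 2 ^ J) t)\<^sup>2) \<le> 1 / 2 ^ J * R * (real n)\<^sup>2) \<longrightarrow>
    t \<in> {0..1} \<longrightarrow>
    (f t - fo t)\<^sup>2 \<le> C * (R * (2 ^ J)\<^sup>2 + (1 / 2 ^ J) ^ (2 * m))"
    using spline_sup_bound[OF m w2 B(1)] by (elim exE conjE)
  \<comment> \<open>12 = 6 * 2, from \<open>L \<le> 6 * mx\<close> and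
    \<open>2 ^ J \<le> 2 / h\<close>; the additional 1 is for \<open>h ^ (2 * m)\<close>.\<close>
  define K where "K = C * (12 * C1 + 1)"
  have K: "K \<ge> 0" unfolding K_def using C C1 by simp
  have g2: "\<gamma> / 2 ^ (r + 1) > 0" using \<gamma> by simp
  have w4: "w\<^sup>2 / 4 > 0" using w by simp
  have "\<forall>\<^sub>F n in sequentially. (SUP h\<in>bandwidths lam \<gamma> n. Linf_norm (\<lambda>t. f n h t - fo t) /
      ereal (sqrt (h ^ (2 * m) + 1 / (real n * h) * max (ln (1 / h)) (ln (ln (real n)))))) \<le> ereal (sqrt K)"
    using noise design eventually_dyadic_cells_large[OF \<beta> w4 C2] eventually_bandwidth_lower[OF \<beta>(1) g2]
      eventually_ge_at_top[of m] eventually_ge_at_top[of "3::nat"]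
  proof eventually_elim
    case (elim n)
    note noise_n = elim(1)[rule_format, folded \<beta>_def] and design_n = elim(2)[rule_format, folded \<beta>_def]
      and cell_n = elim(3)[rule_format] and low_n = elim(4)
    have n3: "real n \<ge> 3" "n > 0" using elim(6) by auto
    have lnn: "1 \<le> ln (real n)"
    proof -
      have "exp 1 \<le> real n" using exp_le n3 by linarith
      then show ?thesis using n3 by (simp add: ln_ge_iff)
    qed
    then have lln: "0 \<le> ln (ln (real n))" by simp
    show ?case
    proof (rule SUP_least)
      fix h assume "h \<in> bandwidths lam \<gamma> n"
      then have h: "\<gamma> * (ln (real n) / real n) powr \<beta> \<le> h" "h \<le> 1 / 2" unfolding bandwidths_def \<beta>_def by auto
      have "0 < \<gamma> * (ln (real n) / real n) powr \<beta>" using \<gamma> lnn n3 by simp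
      then have h0: "h > 0" using h by linarith
      obtain J where J: "1 / 2 ^ J \<le> h" "h \<le> 2 / 2 ^ J" "1 + real J \<le> 9 / 2 * ln (1 / h)"
        using dyadic_scale[OF h0 h(2)] .
      \<comment> \<open>The finer level must still be admissible for the fluctuation bounds: the
        smallest bandwidth eventually exceeds \<open>2 ^ (r + 1)\<close> times
        \<open>n powr (- \<beta>)\<close>.\<close>
      have Jr: "real n powr (- \<beta>) \<le> 1 / 2 ^ (J + r)"
      proof -
        have "real n powr (- \<beta>) \<le> h / 2 ^ (r + 1)"
          using low_n h(1) by (simp add: field_simps)
        also have "\<dots> \<le> (2 / 2 ^ J) / 2 ^ (r + 1)" using J(2) by (intro divide_right_mono) auto
        also have "\<dots> = 1 / 2 ^ (J + r)" by (simp add: power_add)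
        finally show ?thesis .
      qed
      have "(1::real) / 2 ^ (J + r) \<le> 1 / 2 ^ J" by (intro divide_left_mono power_increasing) auto
      then have J0: "real n powr (- \<beta>) \<le> 1 / 2 ^ J" using Jr by linarith
      define L where "L = 1 + real J + ln (ln (real n))"
      \<comment> \<open>The noise bound divided by the square of \<open>n\<close>; \<open>R\<close>
        times the square of \<open>2 ^ J\<close> then has the order \<open>L * 2 ^ J / n\<close> of
        the variance term of the rate.\<close>
      define R where "R = C1 * ((1 / 2 ^ J) * L) / real n"
      have L: "L \<ge> 0" unfolding L_def using lln by simp
      have R0: "R \<ge> 0" unfolding R_def using C1 L by simp
      have Rn: "C1 * (real n * (1 / 2 ^ J) * L) = R * (real n)\<^sup>2"
        unfolding R_def using n3 by (simp add: field_simps power2_eq_square)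
      define mx where "mx = max (ln (1 / h)) (ln (ln (real n)))"
      \<comment> \<open>9/2 from the dyadic level plus 1 from the iterated logarithm, rounded up to
        6.\<close>
      have L6: "L \<le> 6 * mx"
      proof -
        have "ln (1 / h) \<le> mx" "ln (ln (real n)) \<le> mx" unfolding mx_def by auto
        moreover have "0 \<le> mx" unfolding mx_def using lln by simp
        ultimately show ?thesis unfolding L_def using J(3) by linarith
      qed
      have count: "w / 2 * real n / 2 ^ (J + r) \<le> mark_sum x (\<lambda>_. 1) n (real k / 2 ^ (J + r)) (real (Suc k) / 2 ^ (J + r))"
        if k: "k < 2 ^ (J + r)" for k
      proof -
        define D where "D = (2::real) ^ (J + r)"
        have D: "D > 0" unfolding D_def by simp
        define T where "T = mark_sum x (\<lambda>_. 1) n (real k / D) (real (Suc k) / D)"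
        define q where "q = p (real k / D) (real (Suc k) / D)"
        define L' where "L' = 1 + real (J + r) + ln (ln (real n))"
        have "(T - real n * q)\<^sup>2 \<le> C2 * (real n * (1 / D) * L')"
          using design_n[OF Jr k] unfolding T_def q_def L'_def D_def .
        also have "\<dots> = (C2 * D * L') * (real n / D\<^sup>2)" using D by (simp add: field_simps power2_eq_square)
        \<comment> \<open>The fluctuation is at most half of the guaranteed mean count
          \<open>w * n / D\<close>, so the other half remains.\<close>
        also have "\<dots> \<le> (w\<^sup>2 / 4 * real n) * (real n / D\<^sup>2)"
          using cell_n[OF Jr] n3 unfolding L'_def D_def by (intro mult_right_mono) auto
        also have "\<dots> = (w / 2 * real n / D)\<^sup>2" by (simp add: power2_eq_square)
        finally have "\<bar>T - real n * q\<bar> \<le> \<bar>w / 2 * real n / D\<bar>" by (simp only: abs_le_square_iff)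
        moreover have "w / 2 * real n / D \<ge> 0" using w D by simp
        ultimately have T: "real n * q - w / 2 * real n / D \<le> T" by linarith
        have "w * (1 / D) \<le> q"
        proof -
          have pb: "0 \<le> real k / D" "real k / D < real (Suc k) / D" "real (Suc k) / D \<le> 1" "real (Suc k) / D - real k / D = 1 / D"
            using piece_bounds[OF k] unfolding D_def by auto
          show ?thesis using p[OF pb(1) less_imp_le[OF pb(2)] pb(3)] unfolding pb(4) q_def .
        qed
        then have "real n * (w * (1 / D)) \<le> real n * q" by (intro mult_left_mono) auto
        moreover have "real n * (w * (1 / D)) - w / 2 * real n / D = w / 2 * real n / D" by (simp add: field_simps)
        ultimately have "w / 2 * real n / D \<le> T" using T by linarith
        then show ?thesis unfolding T_def D_def .
      qed
      define S where "S = h ^ (2 * m) + 1 / (real n * h) * mx"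
      have mx0: "0 < mx"
      proof -
        have "0 < ln (1 / h)" using h h0 by (simp add: ln_gt_zero_iff)
        then show ?thesis unfolding mx_def by simp
      qed
      have S: "S > 0" unfolding S_def using h0 n3 mx0 by (intro add_pos_pos) auto
      have pt: "(f n h t - fo t)\<^sup>2 \<le> K * S" if t: "t \<in> {0..1}" for t
      proof -
        have n1: "\<forall>k<2 ^ J. (mark_sum x (\<lambda>i. y i - fo (x i)) n (real k / 2 ^ J) (real (Suc k) / 2 ^ J))\<^sup>2 \<le> R * (real n)\<^sup>2"
        proof (intro allI impI)
          fix k :: nat assume k: "k < 2 ^ J"
          show "(mark_sum x (\<lambda>i. y i - fo (x i)) n (real k / 2 ^ J) (real (Suc k) / 2 ^ J))\<^sup>2 \<le> R * (real n)\<^sup>2"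
            using conjunct1[OF noise_n[OF J0 k]] unfolding L_def[symmetric] Rn .
        qed
        have n2: "\<forall>k<2 ^ J. integral {real k / 2 ^ J..real (Suc k) / 2 ^ J} (\<lambda>t. (mark_sum x (\<lambda>i. y i - fo (x i)) n (real k / 2 ^ J) t)\<^sup>2) \<le> 1 / 2 ^ J * R * (real n)\<^sup>2"
        proof (intro allI impI)
          fix k :: nat assume k: "k < 2 ^ J"
          show "integral {real k / 2 ^ J..real (Suc k) / 2 ^ J} (\<lambda>t. (mark_sum x (\<lambda>i. y i - fo (x i)) n (real k / 2 ^ J) t)\<^sup>2) \<le> 1 / 2 ^ J * R * (real n)\<^sup>2"
            using conjunct2[OF noise_n[OF J0 k]] unfolding L_def[symmetric] Rn by (simp only: mult.assoc)
        qed
        have xs: "\<forall>i\<in>{1..n}. 0 < x i \<and> x i \<le> 1" using x by simp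
        have "(f n h t - fo t)\<^sup>2 \<le> C * (R * (2 ^ J)\<^sup>2 + (1 / 2 ^ J) ^ (2 * m))"
          by (rule bound[rule_format, OF spline[OF elim(5) h0] fo2 Z _ n3(2) J(1,2) _ count R0 _ _ t])
            (use B(2) xs n1 n2 in blast)+
        also have "\<dots> \<le> C * ((12 * C1 + 1) * S)"
        proof (intro mult_left_mono C)
          have e: "2 ^ J \<le> 2 / h" using J(2) h0 by (simp add: field_simps)
          have "R * (2 ^ J)\<^sup>2 = C1 * (L * 2 ^ J) / real n"
            unfolding R_def by (simp add: field_simps power2_eq_square)
          also have "\<dots> \<le> C1 * ((6 * mx) * (2 / h)) / real n"
            using C1 L6 e L mx0 by (intro divide_right_mono mult_left_mono mult_mono) auto
          also have "\<dots> = 12 * C1 * (1 / (real n * h) * mx)" by (simp add: field_simps)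
          finally have 1: "R * (2 ^ J)\<^sup>2 \<le> 12 * C1 * (1 / (real n * h) * mx)" .
          have 2: "(1 / 2 ^ J) ^ (2 * m) \<le> h ^ (2 * m)" using J(1) by (intro power_mono) auto
          have 3: "0 \<le> 12 * C1 * h ^ (2 * m)" "0 \<le> 1 / (real n * h) * mx" using C1 h0 mx0 by auto
          have "(12 * C1 + 1) * S = 12 * C1 * h ^ (2 * m) + 12 * C1 * (1 / (real n * h) * mx) + (h ^ (2 * m) + 1 / (real n * h) * mx)"
            unfolding S_def by (simp only: distrib_left distrib_right mult_1)
          then show "R * (2 ^ J)\<^sup>2 + (1 / 2 ^ J) ^ (2 * m) \<le> (12 * C1 + 1) * S" using 1 2 3 by linarith
        qed
        finally show ?thesis unfolding K_def by (simp only: mult.assoc)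
      qed
      have "Linf_norm (\<lambda>t. f n h t - fo t) \<le> ereal (sqrt (K * S))"
      proof (rule Linf_norm_le)
        have "f n h \<in> sobolev m 2" using spline[OF elim(5) h0] unfolding is_smoothing_spline_def by blast
        then show "continuous_on {0..1} (\<lambda>t. f n h t - fo t)"
          using m fo2 by (intro continuous_on_diff sobolev_continuous)
        show "\<bar>f n h t - fo t\<bar> \<le> sqrt (K * S)" if "t \<in> {0..1}" for t
          using pt[OF that] by (metis real_sqrt_abs real_sqrt_le_mono)
      qed
      then have "Linf_norm (\<lambda>t. f n h t - fo t) \<le> ereal (sqrt S) * ereal (sqrt K)"
        by (simp add: real_sqrt_mult mult.commute)
      then have "Linf_norm (\<lambda>t. f n h t - fo t) / ereal (sqrt S) \<le> ereal (sqrt K)"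
        using S by (subst ereal_divide_le_pos) auto
      then show "Linf_norm (\<lambda>t. f n h t - fo t) / ereal (sqrt (h ^ (2 * m) + 1 / (real n * h) * max (ln (1 / h)) (ln (ln (real n))))) \<le> ereal (sqrt K)"
        unfolding S_def mx_def .
    qed
  qed
  then have "limsup (\<lambda>n. SUP h\<in>bandwidths lam \<gamma> n. Linf_norm (\<lambda>t. f n h t - fo t) /
      ereal (sqrt (h ^ (2 * m) + 1 / (real n * h) * max (ln (1 / h)) (ln (ln (real n)))))) \<le> ereal (sqrt K)"
    by (rule Limsup_bounded)
  then show ?thesis by (rule order_le_less_trans) simp
qed

text \<open>The observations enter through a mark \<open>\<phi> (x, y)\<close>: the residual for the
  noise, the constant 1 for the counts. All hypotheses are moved to the generic pair by equality of
  laws.\<close>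

lemma (in prob_space) iid_mark_sum_oscillation:
  fixes X Y :: "'a \<Rightarrow> real" and Xs Ys :: "nat \<Rightarrow> 'a \<Rightarrow> real" and \<phi> :: "real \<times> real \<Rightarrow> real"
  assumes iid: "iid_copies M (\<lambda>i \<omega>. (Xs i \<omega>, Ys i \<omega>)) (\<lambda>\<omega>. (X \<omega>, Y \<omega>))"
    and \<phi>[measurable]: "\<phi> \<in> borel_measurable borel" and lam: "2 < lam" "lam < \<kappa>"
    and mom: "integrable M (\<lambda>\<omega>. \<bar>\<phi> (X \<omega>, Y \<omega>)\<bar> powr \<kappa>)"
    and momB: "expectation (\<lambda>\<omega>. \<bar>\<phi> (X \<omega>, Y \<omega>)\<bar> powr \<kappa>) \<le> B" and B: "B \<ge> 0"
    and loc: "\<And>a b. 0 \<le> a \<Longrightarrow> a \<le> b \<Longrightarrow> b \<le> 1 \<Longrightarrow>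
      expectation (\<lambda>\<omega>. (1 + \<bar>\<phi> (X \<omega>, Y \<omega>)\<bar> powr \<kappa>) * (if a < X \<omega> \<and> X \<omega> \<le> b then 1 else 0)) \<le> B * (b - a)"
    and c: "\<And>a x. c a x = expectation (\<lambda>\<omega>. \<phi> (X \<omega>, Y \<omega>) * (if a < X \<omega> \<and> X \<omega> \<le> x then 1 else 0))"
  shows "\<exists>C\<ge>0. AE \<omega> in M. \<forall>\<^sub>F n in sequentially. \<forall>j. real n powr (- (1 - 2 / lam)) \<le> 1 / 2 ^ j \<longrightarrow> (\<forall>k<2 ^ j.
     (mark_sum (\<lambda>i. Xs i \<omega>) (\<lambda>i. \<phi> (Xs i \<omega>, Ys i \<omega>)) n (real k / 2 ^ j) (real (Suc k) / 2 ^ j) - real n * c (real k / 2 ^ j) (real (Suc k) / 2 ^ j))\<^sup>2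
       \<le> C * (real n * (1 / 2 ^ j) * (1 + real j + ln (ln (real n)))) \<and>
     integral {real k / 2 ^ j..real (Suc k) / 2 ^ j} (\<lambda>x. (mark_sum (\<lambda>i. Xs i \<omega>) (\<lambda>i. \<phi> (Xs i \<omega>, Ys i \<omega>)) n (real k / 2 ^ j) x - real n * c (real k / 2 ^ j) x)\<^sup>2)
       \<le> 1 / 2 ^ j * (C * (real n * (1 / 2 ^ j) * (1 + real j + ln (ln (real n))))))"
proof -
  have ind: "indep_vars (\<lambda>_. borel) (\<lambda>i \<omega>. (Xs i \<omega>, Ys i \<omega>)) {1..}"
    and Zm: "(\<lambda>\<omega>. (X \<omega>, Y \<omega>)) \<in> borel_measurable M"
    and law: "\<And>i. i \<ge> 1 \<Longrightarrow> distr M borel (\<lambda>\<omega>. (Xs i \<omega>, Ys i \<omega>)) = distr M borel (\<lambda>\<omega>. (X \<omega>, Y \<omega>))"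
    using iid unfolding iid_copies_def by auto
  have Zsm: "(\<lambda>\<omega>. (Xs i \<omega>, Ys i \<omega>)) \<in> borel_measurable M" if "i \<ge> 1" for i
    using ind that unfolding indep_vars_def by auto
  have Tm: "(\<lambda>z. (fst z, \<phi> z)) \<in> measurable borel (borel :: (real \<times> real) measure)"
    by (intro borel_measurable_Pair \<phi> borel_measurable_continuous_onI continuous_on_fst continuous_on_id)
  have fm[measurable]: "(fst :: real \<times> real \<Rightarrow> real) \<in> borel_measurable borel"
    by (intro borel_measurable_continuous_onI continuous_on_fst continuous_on_id)
  have ind': "indep_vars (\<lambda>_. borel) (\<lambda>i \<omega>. (Xs i \<omega>, \<phi> (Xs i \<omega>, Ys i \<omega>))) {1..}"
    using indep_vars_compose2[OF ind, of "\<lambda>_ z. (fst z, \<phi> z)" "\<lambda>_. borel"] Tm by simp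
  have distr_T: "distr M borel (\<lambda>\<omega>. (Xs i \<omega>, \<phi> (Xs i \<omega>, Ys i \<omega>))) = distr (distr M borel (\<lambda>\<omega>. (X \<omega>, Y \<omega>))) borel (\<lambda>z. (fst z, \<phi> z))"
    if "i \<ge> 1" for i
    unfolding law[OF that, symmetric] using distr_distr[OF Tm Zsm[OF that]] by (simp add: o_def)
  have law': "distr M borel (\<lambda>\<omega>. (Xs i \<omega>, \<phi> (Xs i \<omega>, Ys i \<omega>))) = distr M borel (\<lambda>\<omega>. (Xs 1 \<omega>, \<phi> (Xs 1 \<omega>, Ys 1 \<omega>)))"
    if "i \<ge> 1" for i
    unfolding distr_T[OF that] distr_T[OF order_refl] ..
  have E: "expectation (\<lambda>\<omega>. g (Xs 1 \<omega>, Ys 1 \<omega>)) = expectation (\<lambda>\<omega>. g (X \<omega>, Y \<omega>))"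
    if "g \<in> borel_measurable borel" for g :: "real \<times> real \<Rightarrow> real"
    by (rule expectation_same_law[OF Zsm[OF order_refl] Zm law[OF order_refl] that])
  have pm: "(\<lambda>z. \<bar>\<phi> z\<bar> powr \<kappa>) \<in> borel_measurable borel" by measurable
  have im[measurable]: "(\<lambda>z::real \<times> real. if a < fst z \<and> fst z \<le> x then 1 else 0 :: real) \<in> borel_measurable borel" for a x
    by measurable
  show ?thesis
  proof (rule mark_sum_oscillation[where X=Xs and D="\<lambda>i \<omega>. \<phi> (Xs i \<omega>, Ys i \<omega>)" and \<kappa>=\<kappa> and B=B and lam=lam and c=c, OF ind' _ lam _ _ B])
    show "distr M borel (\<lambda>\<omega>. (Xs i \<omega>, \<phi> (Xs i \<omega>, Ys i \<omega>))) = distr M borel (\<lambda>\<omega>. (Xs 1 \<omega>, \<phi> (Xs 1 \<omega>, Ys 1 \<omega>)))"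
      if "1 \<le> i" for i by (rule law'[OF that])
    show "integrable M (\<lambda>\<omega>. \<bar>\<phi> (Xs 1 \<omega>, Ys 1 \<omega>)\<bar> powr \<kappa>)"
      using mom integrable_distr_eq[OF Zm pm] integrable_distr_eq[OF Zsm[OF order_refl] pm] law[OF order_refl] by simp
    show "expectation (\<lambda>\<omega>. \<bar>\<phi> (Xs 1 \<omega>, Ys 1 \<omega>)\<bar> powr \<kappa>) \<le> B"
      using E[OF pm] momB by simp
    show "expectation (\<lambda>\<omega>. (1 + \<bar>\<phi> (Xs 1 \<omega>, Ys 1 \<omega>)\<bar> powr \<kappa>) * (if a < Xs 1 \<omega> \<and> Xs 1 \<omega> \<le> b then 1 else 0)) \<le> B * (b - a)"
      if "0 \<le> a" "a \<le> b" "b \<le> 1" for a b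
    proof -
      have "(\<lambda>z. (1 + \<bar>\<phi> z\<bar> powr \<kappa>) * (if a < fst z \<and> fst z \<le> b then 1 else 0)) \<in> borel_measurable borel" by measurable
      from E[OF this] show ?thesis using loc[OF that] by simp
    qed
    show "c a x = expectation (\<lambda>\<omega>. \<phi> (Xs 1 \<omega>, Ys 1 \<omega>) * (if a < Xs 1 \<omega> \<and> Xs 1 \<omega> \<le> x then 1 else 0))" for a x
    proof -
      have "(\<lambda>z. \<phi> z * (if a < fst z \<and> fst z \<le> x then 1 else 0)) \<in> borel_measurable borel" by measurable
      from E[OF this] show ?thesis unfolding c by simp
    qed
  qed
qed

text \<open>The defining property of conditional expectation, tested on events that \<open>X\<close>
  lies in \<open>A\<close>. With \<open>A\<close> a cell it centres the noise and localizes the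
  conditional moment bound.\<close>

lemma (in prob_space) cond_exp_given_integral:
  fixes X Z :: "'a \<Rightarrow> real"
  assumes g: "is_cond_exp_given M X Z g" and A[measurable]: "A \<in> sets borel"
  shows "integrable M (\<lambda>\<omega>. g (X \<omega>) * indicator A (X \<omega>))"
    and "expectation (\<lambda>\<omega>. Z \<omega> * indicator A (X \<omega>)) = expectation (\<lambda>\<omega>. g (X \<omega>) * indicator A (X \<omega>))"
proof -
  define F where "F = vimage_algebra (space M) X borel"
  have X[measurable]: "X \<in> borel_measurable M" and Z: "integrable M Z" and gm[measurable]: "g \<in> borel_measurable borel"
    and ae: "AE \<omega> in M. real_cond_exp M F Z \<omega> = g (X \<omega>)"
    using g unfolding is_cond_exp_given_def F_def by auto
  have [measurable]: "Z \<in> borel_measurable M" using Z by simp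
  have sub: "subalgebra M F"
    unfolding subalgebra_def F_def by (auto simp: sets_vimage_algebra2 intro!: measurable_sets[OF X])
  interpret finite_measure_subalgebra M F by unfold_locales (rule sub)
  have XF: "X \<in> borel_measurable F" unfolding F_def by (rule measurable_vimage_algebra1) simp
  have fm: "(\<lambda>\<omega>. indicator A (X \<omega>) :: real) \<in> borel_measurable F"
    by (rule measurable_compose[OF XF]) simp
  have i: "integrable M (\<lambda>\<omega>. indicator A (X \<omega>) * Z \<omega>)"
    by (rule Bochner_Integration.integrable_bound[OF Z]) (auto simp: indicator_def)
  have r: "integrable M (\<lambda>\<omega>. indicator A (X \<omega>) * real_cond_exp M F Z \<omega>)"
     "(\<integral>\<omega>. indicator A (X \<omega>) * real_cond_exp M F Z \<omega> \<partial>M) = (\<integral>\<omega>. indicator A (X \<omega>) * Z \<omega> \<partial>M)"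
    by (rule real_cond_exp_intg[OF i fm]; measurable)+
  have m1: "(\<lambda>\<omega>. indicator A (X \<omega>) * real_cond_exp M F Z \<omega>) \<in> borel_measurable M" using r(1) by simp
  have m2: "(\<lambda>\<omega>. g (X \<omega>) * indicator A (X \<omega>)) \<in> borel_measurable M" by measurable
  have ae': "AE \<omega> in M. indicator A (X \<omega>) * real_cond_exp M F Z \<omega> = g (X \<omega>) * indicator A (X \<omega>)"
    using ae by eventually_elim simp
  show "integrable M (\<lambda>\<omega>. g (X \<omega>) * indicator A (X \<omega>))"
    using integrable_cong_AE[OF m1 m2 ae'] r(1) by simp
  show "expectation (\<lambda>\<omega>. Z \<omega> * indicator A (X \<omega>)) = expectation (\<lambda>\<omega>. g (X \<omega>) * indicator A (X \<omega>))"
    using integral_cong_AE[OF m1 m2 ae'] r(2) by (simp add: mult.commute)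
qed

lemma (in prob_space) bounded_density_interval_prob:
  fixes X :: "'a \<Rightarrow> real"
  assumes X: "distributed M lborel X (\<lambda>t. ennreal (w t * indicator {0<..<1} t))"
    and w: "0 < w1" "0 < w2" "\<forall>t\<in>{0..1}. w1 \<le> w t \<and> w t \<le> w2" and ab: "0 \<le> a" "a \<le> b" "b \<le> 1"
  shows "w1 * (b - a) \<le> expectation (\<lambda>\<omega>. indicator {a<..b} (X \<omega>))"
    and "expectation (\<lambda>\<omega>. indicator {a<..b} (X \<omega>)) \<le> w2 * (b - a)"
proof -
  have Xm[measurable]: "X \<in> borel_measurable M" using distributed_measurable[OF X] by simp
  have set: "X -` {a<..b} \<inter> space M \<in> sets M" by measurable
  have "expectation (\<lambda>\<omega>. indicator {a<..b} (X \<omega>)) = expectation (indicator (X -` {a<..b} \<inter> space M))"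
    by (intro Bochner_Integration.integral_cong) (auto simp: indicator_def)
  also have "\<dots> = prob (X -` {a<..b} \<inter> space M)" using set by simp
  finally have e: "expectation (\<lambda>\<omega>. indicator {a<..b} (X \<omega>)) = prob (X -` {a<..b} \<inter> space M)" .
  have d: "ennreal (prob (X -` {a<..b} \<inter> space M)) = (\<integral>\<^sup>+ t. ennreal (w t * indicator {0<..<1} t) * indicator {a<..b} t \<partial>lborel)"
    using distributed_emeasure[OF X, of "{a<..b}"] by (simp add: emeasure_eq_measure)
  have "ennreal (w1 * (b - a)) = (\<integral>\<^sup>+ t. ennreal w1 * indicator {a<..<b} t \<partial>lborel)"
    using w ab by (simp add: nn_integral_cmult_indicator ennreal_mult)
  also have "\<dots> \<le> ennreal (prob (X -` {a<..b} \<inter> space M))"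
    unfolding d using w ab by (intro nn_integral_mono) (auto simp: indicator_def intro!: ennreal_leI)
  finally show "w1 * (b - a) \<le> expectation (\<lambda>\<omega>. indicator {a<..b} (X \<omega>))" unfolding e by simp
  have "ennreal (prob (X -` {a<..b} \<inter> space M)) \<le> (\<integral>\<^sup>+ t. ennreal w2 * indicator {a<..b} t \<partial>lborel)"
    unfolding d using w ab by (intro nn_integral_mono) (auto simp: indicator_def intro!: ennreal_leI)
  also have "\<dots> = ennreal (w2 * (b - a))" using w ab by (simp add: nn_integral_cmult_indicator ennreal_mult)
  finally show "expectation (\<lambda>\<omega>. indicator {a<..b} (X \<omega>)) \<le> w2 * (b - a)"
    unfolding e using w ab by (subst (asm) ennreal_le_iff) auto
qed

lemma AE_same_law:
  assumes "Z \<in> measurable M S" "Z' \<in> measurable M S" "distr M S Z = distr M S Z'"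
    and "{z \<in> space S. P z} \<in> sets S" and "AE \<omega> in M. P (Z' \<omega>)"
  shows "AE \<omega> in M. P (Z \<omega>)"
proof -
  have "AE z in distr M S Z'. P z" using AE_distr_iff[OF assms(2,4)] assms(5) by simp
  then have "AE z in distr M S Z. P z" unfolding assms(3) .
  then show ?thesis using AE_distr_iff[OF assms(1,4)] by simp
qed

text \<open>The half-open cells leave out 0, and the design points must lie in their union.\<close>

lemma (in prob_space) AE_density_support:
  fixes X :: "'a \<Rightarrow> real"
  assumes X: "distributed M lborel X (\<lambda>t. ennreal (w t * indicator {0<..<1} t))"
  shows "AE \<omega> in M. 0 < X \<omega> \<and> X \<omega> \<le> 1"
proof -
  have Xm[measurable]: "X \<in> borel_measurable M" using distributed_measurable[OF X] by simp
  have "emeasure M (X -` (- {0<..1}) \<inter> space M) = (\<integral>\<^sup>+ t. ennreal (w t * indicator {0<..<1} t) * indicator (- {0<..1}) t \<partial>lborel)"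
    by (rule distributed_emeasure[OF X]) simp
  also have "\<dots> = (\<integral>\<^sup>+ t. 0 \<partial>(lborel :: real measure))"
    by (intro nn_integral_cong) (auto simp: indicator_def)
  finally have 0: "emeasure M (X -` (- {0<..1}) \<inter> space M) = 0" by simp
  show ?thesis
  proof (rule AE_I[OF _ 0])
    show "X -` (- {0<..1}) \<inter> space M \<in> sets M" by measurable
  qed auto
qed

theorem mainTheorem2:
  fixes M :: "'a measure"
    and X Y :: "'a \<Rightarrow> real"
    and Xs Ys :: "nat \<Rightarrow> 'a \<Rightarrow> real"
    and f\<^sub>o w :: "real \<Rightarrow> real"
    and m :: nat
    and w\<^sub>1 w\<^sub>2 \<kappa> lam \<gamma> :: real
    and f :: "nat \<Rightarrow> real \<Rightarrow> 'a \<Rightarrow> real \<Rightarrow> real"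
  assumes "prob_space M"
    and sample: "iid_copies M (\<lambda>i \<omega>. (Xs i \<omega>, Ys i \<omega>)) (\<lambda>\<omega>. (X \<omega>, Y \<omega>))"
    and range: "AE \<omega> in M. X \<omega> \<in> {0..1}"
    and regression: "is_cond_exp_given M X Y f\<^sub>o"
    and "m \<ge> 1"
    and i: "f\<^sub>o \<in> sobolev m \<infinity>"
    and ii: "distributed M lborel X (\<lambda>t. ennreal (w t * indicator {0<..<1} t))"
    and iii: "w\<^sub>1 > 0" "w\<^sub>2 > 0" "\<forall>t\<in>{0..1}. w\<^sub>1 \<le> w t \<and> w t \<le> w\<^sub>2"
    and iv: "\<kappa> > 2"
      "\<exists>v. is_cond_exp_given M X (\<lambda>\<omega>. \<bar>Y \<omega> - f\<^sub>o (X \<omega>)\<bar> powr \<kappa>) v \<and> bdd_above (v ` {0..1})"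
    and "2 < lam" "lam < min \<kappa> 4"
    and "\<gamma> > 0"
    and estimator: "AE \<omega> in M. \<forall>n\<ge>m. \<forall>h>0.
      is_smoothing_spline m n h (\<lambda>i. Xs i \<omega>) (\<lambda>i. Ys i \<omega>) (f n h \<omega>)"
  shows "AE \<omega> in M.
    limsup (\<lambda>n. SUP h\<in>bandwidths lam \<gamma> n.
      Linf_norm (\<lambda>x. f n h \<omega> x - f\<^sub>o x) /
      ereal (sqrt (h ^ (2 * m) + 1 / (real n * h) * max (ln (1 / h)) (ln (ln (real n))))))
    < \<infinity>"
proof -
  interpret prob_space M by fact
  have Zsm: "(\<lambda>\<omega>. (Xs i \<omega>, Ys i \<omega>)) \<in> borel_measurable M" if "i \<ge> 1" for i
    using sample that unfolding iid_copies_def indep_vars_def by auto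
  have Zm: "(\<lambda>\<omega>. (X \<omega>, Y \<omega>)) \<in> borel_measurable M"
    and law: "\<And>i. i \<ge> 1 \<Longrightarrow> distr M borel (\<lambda>\<omega>. (Xs i \<omega>, Ys i \<omega>)) = distr M borel (\<lambda>\<omega>. (X \<omega>, Y \<omega>))"
    using sample unfolding iid_copies_def by auto
  have Xm[measurable]: "X \<in> borel_measurable M" and Yi: "integrable M Y" and fom[measurable]: "f\<^sub>o \<in> borel_measurable borel"
    using regression unfolding is_cond_exp_given_def by auto
  have Ym[measurable]: "Y \<in> borel_measurable M" using Yi by simp
  obtain v Vb where v: "is_cond_exp_given M X (\<lambda>\<omega>. \<bar>Y \<omega> - f\<^sub>o (X \<omega>)\<bar> powr \<kappa>) v" and Vb: "\<forall>t\<in>{0..1}. v t \<le> Vb"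
    using iv(2) unfolding bdd_above_def by auto
  define V where "V = max 0 Vb"
  have V0: "V \<ge> 0" and vV: "t \<in> {0..1} \<Longrightarrow> v t \<le> V" for t unfolding V_def using Vb by (auto simp: max.coboundedI2)
  have mom: "integrable M (\<lambda>\<omega>. \<bar>Y \<omega> - f\<^sub>o (X \<omega>)\<bar> powr \<kappa>)" using v unfolding is_cond_exp_given_def by auto
  let ?I = "\<lambda>a b \<omega>. if a < X \<omega> \<and> X \<omega> \<le> b then 1 else 0 :: real"
  have I: "?I a b \<omega> = indicator {a<..b} (X \<omega>)" for a b \<omega> by (simp add: indicator_def)
  note P = bounded_density_interval_prob[OF ii iii]
  have momA: "expectation (\<lambda>\<omega>. \<bar>Y \<omega> - f\<^sub>o (X \<omega>)\<bar> powr \<kappa> * indicator A (X \<omega>)) \<le> V * expectation (\<lambda>\<omega>. indicator A (X \<omega>))"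
    if A[measurable]: "A \<in> sets borel" for A
  proof -
    have iA: "integrable M (\<lambda>\<omega>. indicator A (X \<omega>) :: real)"
      by (rule integrable_const_bound[where B=1]) (auto simp: indicator_def)
    have "expectation (\<lambda>\<omega>. v (X \<omega>) * indicator A (X \<omega>)) \<le> expectation (\<lambda>\<omega>. V * indicator A (X \<omega>))"
    proof (rule integral_mono_AE[OF cond_exp_given_integral(1)[OF v A] integrable_mult_right[OF iA]])
      show "AE \<omega> in M. v (X \<omega>) * indicator A (X \<omega>) \<le> V * indicator A (X \<omega>)"
        using range by eventually_elim (auto intro!: mult_right_mono vV)
    qed
    then show ?thesis unfolding cond_exp_given_integral(2)[OF v A] by simp
  qed
  define \<phi> where "\<phi> z = snd z - f\<^sub>o (fst z)" for z :: "real \<times> real"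
  have \<phi>: "\<phi> \<in> borel_measurable borel"
    unfolding \<phi>_def[abs_def]
    by (intro borel_measurable_diff measurable_compose[OF _ fom] borel_measurable_continuous_onI
        continuous_on_fst continuous_on_snd continuous_on_id)
  \<comment> \<open>Large enough for the total moment, at most \<open>V\<close>, and for the local
    one, at most \<open>(1 + V) * w\<^sub>2\<close> times the cell length.\<close>
  define B where "B = (1 + V) * (1 + w\<^sub>2)"
  have B: "B \<ge> 0" "V \<le> B" "(1 + V) * w\<^sub>2 \<le> B"
    unfolding B_def using V0 iii(2) by (auto simp: algebra_simps)
  have lamk: "2 < lam" "lam < \<kappa>" using \<open>2 < lam\<close> \<open>lam < min \<kappa> 4\<close> by auto
  \<comment> \<open>The residuals have mean 0 on every cell by the definition of the regression
    function, so the centring function is 0.\<close>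
  have "\<exists>C\<ge>0. AE \<omega> in M. \<forall>\<^sub>F n in sequentially. \<forall>j. real n powr (- (1 - 2 / lam)) \<le> 1 / 2 ^ j \<longrightarrow> (\<forall>k<2 ^ j.
     (mark_sum (\<lambda>i. Xs i \<omega>) (\<lambda>i. \<phi> (Xs i \<omega>, Ys i \<omega>)) n (real k / 2 ^ j) (real (Suc k) / 2 ^ j) - real n * (\<lambda>_ _. 0) (real k / 2 ^ j) (real (Suc k) / 2 ^ j))\<^sup>2
       \<le> C * (real n * (1 / 2 ^ j) * (1 + real j + ln (ln (real n)))) \<and>
     integral {real k / 2 ^ j..real (Suc k) / 2 ^ j} (\<lambda>x. (mark_sum (\<lambda>i. Xs i \<omega>) (\<lambda>i. \<phi> (Xs i \<omega>, Ys i \<omega>)) n (real k / 2 ^ j) x - real n * (\<lambda>_ _. 0) (real k / 2 ^ j) x)\<^sup>2)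
       \<le> 1 / 2 ^ j * (C * (real n * (1 / 2 ^ j) * (1 + real j + ln (ln (real n))))))"
  proof (rule iid_mark_sum_oscillation[OF sample \<phi> lamk _ _ B(1)])
    show "integrable M (\<lambda>\<omega>. \<bar>\<phi> (X \<omega>, Y \<omega>)\<bar> powr \<kappa>)" unfolding \<phi>_def using mom by simp
    show "expectation (\<lambda>\<omega>. \<bar>\<phi> (X \<omega>, Y \<omega>)\<bar> powr \<kappa>) \<le> B"
      unfolding \<phi>_def using momA[of UNIV] B(2) by (simp add: prob_space)
    show "expectation (\<lambda>\<omega>. (1 + \<bar>\<phi> (X \<omega>, Y \<omega>)\<bar> powr \<kappa>) * ?I a b \<omega>) \<le> B * (b - a)"
      if ab: "0 \<le> a" "a \<le> b" "b \<le> 1" for a b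
    proof -
      have i1: "integrable M (\<lambda>\<omega>. indicator {a<..b} (X \<omega>) :: real)"
        by (rule integrable_const_bound[where B=1]) (auto simp: indicator_def)
      have i2: "integrable M (\<lambda>\<omega>. \<bar>Y \<omega> - f\<^sub>o (X \<omega>)\<bar> powr \<kappa> * indicator {a<..b} (X \<omega>))"
        by (rule Bochner_Integration.integrable_bound[OF mom]) (auto simp: indicator_def)
      have "expectation (\<lambda>\<omega>. (1 + \<bar>\<phi> (X \<omega>, Y \<omega>)\<bar> powr \<kappa>) * ?I a b \<omega>) =
        expectation (\<lambda>\<omega>. indicator {a<..b} (X \<omega>) + \<bar>Y \<omega> - f\<^sub>o (X \<omega>)\<bar> powr \<kappa> * indicator {a<..b} (X \<omega>))"
        unfolding I \<phi>_def by (simp add: distrib_right)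
      also have "\<dots> = expectation (\<lambda>\<omega>. indicator {a<..b} (X \<omega>)) + expectation (\<lambda>\<omega>. \<bar>Y \<omega> - f\<^sub>o (X \<omega>)\<bar> powr \<kappa> * indicator {a<..b} (X \<omega>))"
        by (rule Bochner_Integration.integral_add[OF i1 i2])
      also have "\<dots> \<le> (1 + V) * expectation (\<lambda>\<omega>. indicator {a<..b} (X \<omega>))"
        using momA[of "{a<..b}"] by (simp add: distrib_right)
      also have "\<dots> \<le> (1 + V) * (w\<^sub>2 * (b - a))" using P(2)[OF ab] V0 by (intro mult_left_mono) auto
      also have "\<dots> \<le> B * (b - a)" using mult_right_mono[OF B(3), of "b - a"] ab by (simp add: mult.assoc)
      finally show ?thesis .
    qed
    show "0 = expectation (\<lambda>\<omega>. \<phi> (X \<omega>, Y \<omega>) * ?I a x \<omega>)" for a x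
    proof -
      have A: "{a<..x} \<in> sets borel" by simp
      have i1: "integrable M (\<lambda>\<omega>. Y \<omega> * indicator {a<..x} (X \<omega>))"
        by (rule Bochner_Integration.integrable_bound[OF Yi]) (auto simp: indicator_def)
      have "expectation (\<lambda>\<omega>. \<phi> (X \<omega>, Y \<omega>) * ?I a x \<omega>) =
        expectation (\<lambda>\<omega>. Y \<omega> * indicator {a<..x} (X \<omega>) - f\<^sub>o (X \<omega>) * indicator {a<..x} (X \<omega>))"
        unfolding I \<phi>_def by (simp add: left_diff_distrib)
      also have "\<dots> = 0"
        using Bochner_Integration.integral_diff[OF i1 cond_exp_given_integral(1)[OF regression A]]
          cond_exp_given_integral(2)[OF regression A] by simp
      finally show ?thesis by simp
    qed
  qed
  then obtain C1 where C1: "C1 \<ge> 0" and noise: "AE \<omega> in M. \<forall>\<^sub>F n in sequentially. \<forall>j. real n powr (- (1 - 2 / lam)) \<le> 1 / 2 ^ j \<longrightarrow> (\<forall>k<2 ^ j.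
     (mark_sum (\<lambda>i. Xs i \<omega>) (\<lambda>i. Ys i \<omega> - f\<^sub>o (Xs i \<omega>)) n (real k / 2 ^ j) (real (Suc k) / 2 ^ j))\<^sup>2
       \<le> C1 * (real n * (1 / 2 ^ j) * (1 + real j + ln (ln (real n)))) \<and>
     integral {real k / 2 ^ j..real (Suc k) / 2 ^ j} (\<lambda>x. (mark_sum (\<lambda>i. Xs i \<omega>) (\<lambda>i. Ys i \<omega> - f\<^sub>o (Xs i \<omega>)) n (real k / 2 ^ j) x)\<^sup>2)
       \<le> 1 / 2 ^ j * (C1 * (real n * (1 / 2 ^ j) * (1 + real j + ln (ln (real n))))))"
    unfolding \<phi>_def fst_conv snd_conv mult_zero_right diff_zero by (elim exE conjE)
  define p where "p a b = expectation (\<lambda>\<omega>. 1 * ?I a b \<omega>)" for a b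
  have one: "(\<lambda>_. 1) \<in> borel_measurable (borel :: (real \<times> real) measure)" by simp
  \<comment> \<open>With mark 1 the local moment is twice the cell probability, hence
    \<open>2 * w\<^sub>2\<close>; the added 1 covers the total moment, which equals 1.\<close>
  have B2: "2 * w\<^sub>2 + 1 \<ge> 0" using iii(2) by simp
  have "\<exists>C\<ge>0. AE \<omega> in M. \<forall>\<^sub>F n in sequentially. \<forall>j. real n powr (- (1 - 2 / lam)) \<le> 1 / 2 ^ j \<longrightarrow> (\<forall>k<2 ^ j.
     (mark_sum (\<lambda>i. Xs i \<omega>) (\<lambda>i. 1) n (real k / 2 ^ j) (real (Suc k) / 2 ^ j) - real n * p (real k / 2 ^ j) (real (Suc k) / 2 ^ j))\<^sup>2
       \<le> C * (real n * (1 / 2 ^ j) * (1 + real j + ln (ln (real n)))) \<and>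
     integral {real k / 2 ^ j..real (Suc k) / 2 ^ j} (\<lambda>x. (mark_sum (\<lambda>i. Xs i \<omega>) (\<lambda>i. 1) n (real k / 2 ^ j) x - real n * p (real k / 2 ^ j) x)\<^sup>2)
       \<le> 1 / 2 ^ j * (C * (real n * (1 / 2 ^ j) * (1 + real j + ln (ln (real n))))))"
  proof (rule iid_mark_sum_oscillation[OF sample one lamk _ _ B2])
    show "expectation (\<lambda>\<omega>. (1 + \<bar>1\<bar> powr \<kappa>) * ?I a b \<omega>) \<le> (2 * w\<^sub>2 + 1) * (b - a)"
      if ab: "0 \<le> a" "a \<le> b" "b \<le> 1" for a b
    proof -
      have "expectation (\<lambda>\<omega>. (1 + \<bar>1\<bar> powr \<kappa>) * ?I a b \<omega>) = 2 * expectation (\<lambda>\<omega>. indicator {a<..b} (X \<omega>))"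
        unfolding I by simp
      also have "\<dots> \<le> 2 * (w\<^sub>2 * (b - a))" using P(2)[OF ab] by simp
      also have "\<dots> \<le> (2 * w\<^sub>2 + 1) * (b - a)" using ab by (simp add: distrib_right)
      finally show ?thesis .
    qed
    show "p a x = expectation (\<lambda>\<omega>. 1 * ?I a x \<omega>)" for a x by (simp only: p_def)
    show "integrable M (\<lambda>\<omega>. \<bar>1::real\<bar> powr \<kappa>)" by simp
    show "expectation (\<lambda>\<omega>. \<bar>1\<bar> powr \<kappa>) \<le> 2 * w\<^sub>2 + 1" using iii(2) by (simp add: prob_space)
  qed
  then obtain C2 where C2: "C2 \<ge> 0" and design: "AE \<omega> in M. \<forall>\<^sub>F n in sequentially. \<forall>j. real n powr (- (1 - 2 / lam)) \<le> 1 / 2 ^ j \<longrightarrow> (\<forall>k<2 ^ j.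
     (mark_sum (\<lambda>i. Xs i \<omega>) (\<lambda>i. 1) n (real k / 2 ^ j) (real (Suc k) / 2 ^ j) - real n * p (real k / 2 ^ j) (real (Suc k) / 2 ^ j))\<^sup>2
       \<le> C2 * (real n * (1 / 2 ^ j) * (1 + real j + ln (ln (real n)))) \<and>
     integral {real k / 2 ^ j..real (Suc k) / 2 ^ j} (\<lambda>x. (mark_sum (\<lambda>i. Xs i \<omega>) (\<lambda>i. 1) n (real k / 2 ^ j) x - real n * p (real k / 2 ^ j) x)\<^sup>2)
       \<le> 1 / 2 ^ j * (C2 * (real n * (1 / 2 ^ j) * (1 + real j + ln (ln (real n))))))"
    by (elim exE conjE)
  have p: "w\<^sub>1 * (b - a) \<le> p a b" if "0 \<le> a" "a \<le> b" "b \<le> 1" for a b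
    using P(1)[OF that] unfolding p_def I by simp
  have supp: "AE \<omega> in M. \<forall>i\<in>{1..}. 0 < Xs i \<omega> \<and> Xs i \<omega> \<le> 1"
  proof (rule AE_ball_countable')
    fix i :: nat assume "i \<in> {1..}"
    then have i: "i \<ge> 1" by simp
    have fm: "(fst :: real \<times> real \<Rightarrow> real) \<in> borel_measurable borel"
      by (intro borel_measurable_continuous_onI continuous_on_fst continuous_on_id)
    have "{z \<in> space (borel :: (real \<times> real) measure). 0 < fst z \<and> fst z \<le> 1} \<in> sets borel"
      using measurable_sets[OF fm, of "{0<..1}"] by (simp add: vimage_def)
    from AE_same_law[OF Zsm[OF i] Zm law[OF i] this] AE_density_support[OF ii]
    show "AE \<omega> in M. 0 < Xs i \<omega> \<and> Xs i \<omega> \<le> 1" by simp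
  qed simp
  show ?thesis
    using estimator noise design supp
  proof eventually_elim
    case (elim \<omega>)
    have x: "0 < Xs i \<omega> \<and> Xs i \<omega> \<le> 1" if "i \<ge> 1" for i using elim(4) that by simp
    have sp: "is_smoothing_spline m n h (\<lambda>i. Xs i \<omega>) (\<lambda>i. Ys i \<omega>) (f n h \<omega>)" if "n \<ge> m" "h > 0" for n h
      using elim(1) that by simp
    have d: "\<forall>\<^sub>F n in sequentially. \<forall>j. real n powr (- (1 - 2 / lam)) \<le> 1 / 2 ^ j \<longrightarrow> (\<forall>k<2 ^ j.
      (mark_sum (\<lambda>i. Xs i \<omega>) (\<lambda>_. 1) n (real k / 2 ^ j) (real (Suc k) / 2 ^ j) - real n * p (real k / 2 ^ j) (real (Suc k) / 2 ^ j))\<^sup>2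
         \<le> C2 * (real n * (1 / 2 ^ j) * (1 + real j + ln (ln (real n)))))"
      using elim(3) by (rule eventually_mono) simp
    show ?case
      by (rule spline_rate_pathwise[where x="\<lambda>i. Xs i \<omega>" and y="\<lambda>i. Ys i \<omega>" and f="\<lambda>n h. f n h \<omega>" and p=p,
            OF \<open>m \<ge> 1\<close> \<open>2 < lam\<close> \<open>\<gamma> > 0\<close> iii(1) C1 C2 i x p elim(2) d sp])
  qed
qed

end
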